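(* Let $\omega_1\in\mathscr P_Q^0(\mathbf C^d)$, $\omega_2\in\mathscr P_Q(\mathbf C^d)$ and let $\mathscr B$ be a mixed quasi-norm space on $\mathbf C^d$. Then the following is true: (1) $M(\omega_1,\mathscr B)$ and $A(\omega_2,\mathscr B)$ are quasi-Banach spaces; (2) if in addition $\nu_1(\mathscr B)\ge 1$, then $M(\omega_1,\mathscr B)$ and $A(\omega_2,\mathscr B)$ are Banach spaces.
   Context: Identify $\mathbf R^{2d}\simeq\mathbf C^d$ via $(x,\xi)\leftrightarrow x+i\xi$. Weights. A weight on $\mathbf R^n$ is a positive function $\omega\in L^\infty_{loc}(\mathbf R^n)$ bounded below by a positive constant on each compact set. $\mathscr P_Q(\mathbf R^n)$ is the set of weights $\omega$ such that (i) there are $c,C>0$ with $C^{-1}\omega(x)^2\le\omega(x+y)\omega(x-y)\le C\omega(x)^2$ whenever $|x|\ge 2c$ and $|y|\le c/|x|$; (ii) there are $c,C>0$ with $C^{-1}e^{-c|x|^2}\le\omega(x)\le Ce^{c|x|^2}$ for all $x$. $\mathscr P_Q^0(\mathbf R^n)$ is the subset of those $\omega$ for which, for every $c>0$, there is $C>0$ such that the inequality in (ii) holds. $\mathscr P_Q(\mathbf C^d)=\mathscr P_Q(\mathbf R^{2d})$, and similarly for $\mathscr P_Q^0$. Mixed quasi-norm spaces. A mixed quasi-norm space on $\mathbf R^n$ is $\mathscr B=L^p(V)$, where $V=(V_1,\dots,V_m)$ are vector subspaces with $V_1\oplus\cdots\oplus V_m=\mathbf R^n$ and $p=(p_1,\dots,p_m)\in(0,\infty]^m$;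 $\|f\|_{\mathscr B}$ is obtained by writing $f=f(x_1,\dots,x_m)$, $x_j\in V_j$, and taking successively the $L^{p_1}(V_1)$ quasi-norm in $x_1$, ..., and finally the $L^{p_m}(V_m)$ quasi-norm in $x_m$. $\nu_1(\mathscr B)=\min_jp_j$. Gelfand-Shilov spaces. $\mathcal S_{1/2}(\mathbf R^d)=\bigcup_{h>0}\mathcal S_{1/2,h}(\mathbf R^d)$ (inductive limit), where $\mathcal S_{s,h}$ is the Banach space of $f\in C^\infty(\mathbf R^d)$ with $\sup_{\alpha,\beta,x}|x^\beta\partial^\alpha f(x)|/(h^{|\alpha|+|\beta|}(\alpha!\beta!)^s)<\infty$; $\mathcal S_{1/2}'(\mathbf R^d)$ is its dual. Modulation spaces. Let $\phi(x)=\pi^{-d/4}e^{-|x|^2/2}$ and, for $f\in\mathcal S'_{1/2}(\mathbf R^d)$, $V_\phi f(x,\xi)=(2\pi)^{-d/2}\langle f,\phi(\cdot-x)e^{-i\langle\cdot,\xi\rangle}\rangle$. $M(\omega,\mathscr B)$ is the set of $f\in\mathcal S'_{1/2}(\mathbf R^d)$ with $\|f\|_{M(\omega,\mathscr B)}=\|V_\phi f\cdot\omega\|_{\mathscr B}<\infty$. Spaces of analytic functions. For measurable $F$ on $\mathbf C^d$, $\|F\|_{B(\omega,\mathscr B)}=\|G\,\omega\|_{\mathscr B}$, where $G(x,\xi)=(2\pi)^{-d/2}e^{-(|x|^2+|\xi|^2)/4}e^{-i\langle x,\xi\rangle/2}F(2^{-1/2}x-i2^{-1/2}\xi)$. $A(\omega,\mathscr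 B)$ is the space of entire functions $F$ on $\mathbf C^d$ with $\|F\|_{A(\omega,\mathscr B)}=\|F\|_{B(\omega,\mathscr B)}<\infty$. *)

theory Defs
  imports "HOL-Probability.Essential_Supremum"
begin

section \<open>Quasi-Banach and Banach spaces of functions\<close>

text \<open>
  All spaces below are sets of complex-valued functions on some type, with the pointwise complex
  vector space operations. Norms take values in \<^typ>\<open>ennreal\<close>; finiteness on the carrier is part
  of \<open>quasi_norm_on\<close>.
\<close>

definition complex_function_space :: "('x \<Rightarrow> complex) set \<Rightarrow> bool" where
  "complex_function_space X \<longleftrightarrow>
     (\<lambda>x. 0) \<in> X \<and>
     (\<forall>f\<in>X. \<forall>g\<in>X. (\<lambda>x. f x + g x) \<in> X) \<and>
     (\<forall>c. \<forall>f\<in>X. (\<lambda>x. c * f x) \<in> X)"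

definition quasi_norm_on :: "real \<Rightarrow> ('x \<Rightarrow> complex) set \<Rightarrow> (('x \<Rightarrow> complex) \<Rightarrow> ennreal) \<Rightarrow> bool" where
  "quasi_norm_on K X N \<longleftrightarrow>
     (\<forall>f\<in>X. N f < top) \<and>
     (\<forall>f\<in>X. N f = 0 \<longleftrightarrow> f = (\<lambda>x. 0)) \<and>
     (\<forall>c. \<forall>f\<in>X. N (\<lambda>x. c * f x) = ennreal (norm c) * N f) \<and>
     (\<forall>f\<in>X. \<forall>g\<in>X. N (\<lambda>x. f x + g x) \<le> ennreal K * (N f + N g))"

definition complete_wrt :: "('x \<Rightarrow> complex) set \<Rightarrow> (('x \<Rightarrow> complex) \<Rightarrow> ennreal) \<Rightarrow> bool" where
  "complete_wrt X N \<longleftrightarrow>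
     (\<forall>u::nat \<Rightarrow> 'x \<Rightarrow> complex.
        (\<forall>n. u n \<in> X) \<and>
        (\<forall>e>0. \<exists>n0. \<forall>m\<ge>n0. \<forall>n\<ge>n0. N (\<lambda>x. u m x - u n x) < e)
        \<longrightarrow> (\<exists>f\<in>X. (\<lambda>n. N (\<lambda>x. u n x - f x)) \<longlonglongrightarrow> 0))"

definition quasi_Banach_space :: "('x \<Rightarrow> complex) set \<Rightarrow> (('x \<Rightarrow> complex) \<Rightarrow> ennreal) \<Rightarrow> bool" where
  "quasi_Banach_space X N \<longleftrightarrow>
     complex_function_space X \<and> (\<exists>K\<ge>1. quasi_norm_on K X N) \<and> complete_wrt X N"

definition Banach_space :: "('x \<Rightarrow> complex) set \<Rightarrow> (('x \<Rightarrow> complex) \<Rightarrow> ennreal) \<Rightarrow> bool" where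
  "Banach_space X N \<longleftrightarrow>
     complex_function_space X \<and> quasi_norm_on 1 X N \<and> complete_wrt X N"


section \<open>Weights\<close>

text \<open>Membership in local \<open>L\<^sup>\<infinity>\<close> is Lebesgue measurability plus essential boundedness on compact sets.\<close>

definition weight :: "('a::euclidean_space \<Rightarrow> real) \<Rightarrow> bool" where
  "weight \<omega> \<longleftrightarrow>
     (\<forall>x. 0 < \<omega> x) \<and>
     \<omega> \<in> borel_measurable lebesgue \<and>
     (\<forall>K. compact K \<longrightarrow> (\<exists>C. AE x in lebesgue. x \<in> K \<longrightarrow> \<omega> x \<le> C)) \<and>
     (\<forall>K. compact K \<longrightarrow> (\<exists>c>0. \<forall>x\<in>K. c \<le> \<omega> x))"

definition gaussian_bounds :: "real \<Rightarrow> real \<Rightarrow> ('a::euclidean_space \<Rightarrow> real) \<Rightarrow> bool" where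
  "gaussian_bounds c C \<omega> \<longleftrightarrow>
     (\<forall>x. inverse C * exp (- c * (norm x)\<^sup>2) \<le> \<omega> x \<and> \<omega> x \<le> C * exp (c * (norm x)\<^sup>2))"

definition P_Q :: "('a::euclidean_space \<Rightarrow> real) set" where
  "P_Q = {\<omega>. weight \<omega> \<and>
     (\<exists>c>0. \<exists>C>0. \<forall>x y. norm x \<ge> 2 * c \<and> norm y \<le> c / norm x \<longrightarrow>
        inverse C * (\<omega> x)\<^sup>2 \<le> \<omega> (x + y) * \<omega> (x - y) \<and>
        \<omega> (x + y) * \<omega> (x - y) \<le> C * (\<omega> x)\<^sup>2) \<and>
     (\<exists>c>0. \<exists>C>0. gaussian_bounds c C \<omega>)}"

definition P_Q0 :: "('a::euclidean_space \<Rightarrow> real) set" where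
  "P_Q0 = {\<omega> \<in> P_Q. \<forall>c>0. \<exists>C>0. gaussian_bounds c C \<omega>}"


section \<open>Mixed quasi-norm spaces\<close>

definition is_orthonormal_basis :: "'a::euclidean_space set \<Rightarrow> 'a set \<Rightarrow> bool" where
  "is_orthonormal_basis V E \<longleftrightarrow>
     E \<subseteq> V \<and> pairwise orthogonal E \<and> (\<forall>e\<in>E. norm e = 1) \<and> span E = V"

text \<open>
  Lebesgue measure on a linear subspace \<open>V\<close>: the image of Lebesgue measure under the coordinate map
  of an orthonormal basis (it does not depend on the basis). It is completed since weights, and
  hence the functions to be integrated, are only Lebesgue measurable.
\<close>

definition subspace_lebesgue :: "'a::euclidean_space set \<Rightarrow> 'a measure" where
  "subspace_lebesgue V =
     (let E = (SOME E. is_orthonormal_basis V E) in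
        completion (distr (\<Pi>\<^sub>M e\<in>E. (lborel :: real measure)) (restrict_space borel V)
          (\<lambda>t. \<Sum>e\<in>E. t e *\<^sub>R e)))"

definition epowr :: "ennreal \<Rightarrow> real \<Rightarrow> ennreal" where
  "epowr a r = (if a = top then top else ennreal (enn2real a powr r))"

definition Lp_quasi_norm :: "'a measure \<Rightarrow> ennreal \<Rightarrow> ('a \<Rightarrow> ennreal) \<Rightarrow> ennreal" where
  "Lp_quasi_norm M p f =
     (if p = top then esssup M f
      else epowr (\<integral>\<^sup>+ x. epowr (f x) (enn2real p) \<partial>M) (1 / enn2real p))"

text \<open>
  The space \<open>L\<^sup>p(V)\<close> with \<open>V = (V\<^sub>1, \<dots>, V\<^sub>m)\<close> and \<open>p = (p\<^sub>1, \<dots>, p\<^sub>m)\<close> is given by the list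
  \<open>[(V\<^sub>1, p\<^sub>1), \<dots>, (V\<^sub>m, p\<^sub>m)]\<close>, with exponents in \<^typ>\<open>ennreal\<close>. Writing \<open>x = x\<^sub>1 + \<dots> + x\<^sub>m\<close>, the
  quasi-norm in \<open>x\<^sub>1 \<in> V\<^sub>1\<close> is taken first, as a function of the remaining sum
  \<open>y = x\<^sub>2 + \<dots> + x\<^sub>m\<close>.
\<close>

type_synonym 'a mixed_space = "('a set \<times> ennreal) list"

definition direct_sum_decomposition :: "'a::euclidean_space set list \<Rightarrow> bool" where
  "direct_sum_decomposition Vs \<longleftrightarrow>
     (\<forall>V\<in>set Vs. subspace V) \<and>
     (\<forall>x. \<exists>!xs. list_all2 (\<in>) xs Vs \<and> sum_list xs = x)"

definition mixed_quasi_norm_space :: "'a::euclidean_space mixed_space \<Rightarrow> bool" where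
  "mixed_quasi_norm_space B \<longleftrightarrow>
     direct_sum_decomposition (map fst B) \<and> (\<forall>p\<in>set (map snd B). 0 < p)"

fun mixed_ennnorm :: "'a::euclidean_space mixed_space \<Rightarrow> ('a \<Rightarrow> ennreal) \<Rightarrow> ennreal" where
  "mixed_ennnorm [] f = f 0"
| "mixed_ennnorm ((V, p) # B) f =
     mixed_ennnorm B (\<lambda>y. Lp_quasi_norm (subspace_lebesgue V) p (\<lambda>x. f (x + y)))"

definition mixed_norm :: "'a::euclidean_space mixed_space \<Rightarrow> ('a \<Rightarrow> complex) \<Rightarrow> ennreal" where
  "mixed_norm B f = mixed_ennnorm B (\<lambda>x. ennreal (norm (f x)))"

definition nu1 :: "'a mixed_space \<Rightarrow> ennreal" where
  "nu1 B = Min (set (map snd B))"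


section \<open>Gelfand-Shilov spaces and their duals\<close>

definition partial_deriv :: "'d \<Rightarrow> (real ^ 'd \<Rightarrow> complex) \<Rightarrow> real ^ 'd \<Rightarrow> complex" where
  "partial_deriv i f = (\<lambda>x. frechet_derivative f (at x) (axis i 1))"

definition smooth :: "(real ^ 'd \<Rightarrow> complex) \<Rightarrow> bool" where
  "smooth f \<longleftrightarrow> (\<forall>is x. foldr partial_deriv is f differentiable (at x))"

text \<open>
  The multi-index derivative is formed in a fixed but arbitrary order of the coordinates; for
  smooth functions the order is immaterial.
\<close>

definition multi_deriv :: "('d::finite \<Rightarrow> nat) \<Rightarrow> (real ^ 'd \<Rightarrow> complex) \<Rightarrow> real ^ 'd \<Rightarrow> complex" where
  "multi_deriv \<alpha> f =
     foldr (\<lambda>i. partial_deriv i ^^ \<alpha> i) (SOME is. distinct is \<and> set is = (UNIV :: 'd set)) f"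

definition mabs :: "('d::finite \<Rightarrow> nat) \<Rightarrow> nat" where
  "mabs \<alpha> = (\<Sum>i\<in>UNIV. \<alpha> i)"

definition mfact :: "('d::finite \<Rightarrow> nat) \<Rightarrow> real" where
  "mfact \<alpha> = (\<Prod>i\<in>UNIV. fact (\<alpha> i))"

definition mpower :: "real ^ 'd \<Rightarrow> ('d::finite \<Rightarrow> nat) \<Rightarrow> real" where
  "mpower x \<alpha> = (\<Prod>i\<in>UNIV. (x $ i) ^ \<alpha> i)"

definition GS_norm :: "real \<Rightarrow> real \<Rightarrow> (real ^ 'd \<Rightarrow> complex) \<Rightarrow> ennreal" where
  "GS_norm s h f =
     (SUP \<alpha>. SUP \<beta>. SUP x. ennreal
        (norm (of_real (mpower x \<beta>) * multi_deriv \<alpha> f x) /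
          (h ^ (mabs \<alpha> + mabs \<beta>) * (mfact \<alpha> * mfact \<beta>) powr s)))"

definition GS_step :: "real \<Rightarrow> real \<Rightarrow> (real ^ 'd \<Rightarrow> complex) set" where
  "GS_step s h = {f. smooth f \<and> GS_norm s h f < top}"

definition GS :: "real \<Rightarrow> (real ^ 'd \<Rightarrow> complex) set" where
  "GS s = (\<Union>h\<in>{0<..}. GS_step s h)"

text \<open>
  The inductive limit topology is the finest locally convex one making all inclusions of the steps
  continuous: a base of neighbourhoods of zero consists of the absolutely convex sets whose trace
  on every step is a neighbourhood of zero there.
\<close>

definition GS_zero_nbhd :: "real \<Rightarrow> (real ^ 'd \<Rightarrow> complex) set \<Rightarrow> bool" where
  "GS_zero_nbhd s W \<longleftrightarrow>
     W \<subseteq> GS s \<and>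
     (\<forall>f\<in>W. \<forall>g\<in>W. \<forall>a b. norm a + norm b \<le> 1 \<longrightarrow> (\<lambda>x. a * f x + b * g x) \<in> W) \<and>
     (\<forall>h>0. \<exists>e>0. \<forall>f\<in>GS_step s h. GS_norm s h f < e \<longrightarrow> f \<in> W)"

definition GS_open :: "real \<Rightarrow> (real ^ 'd \<Rightarrow> complex) set \<Rightarrow> bool" where
  "GS_open s U \<longleftrightarrow>
     U \<subseteq> GS s \<and> (\<forall>f\<in>U. \<exists>W. GS_zero_nbhd s W \<and> (\<forall>g\<in>W. (\<lambda>x. f x + g x) \<in> U))"

definition GS_topology :: "real \<Rightarrow> (real ^ 'd \<Rightarrow> complex) topology" where
  "GS_topology s = topology (GS_open s)"

lemma GS_zero_nbhd_Int:
  assumes "GS_zero_nbhd s W" "GS_zero_nbhd s W'"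
  shows "GS_zero_nbhd s (W \<inter> W')"
  unfolding GS_zero_nbhd_def
proof (intro conjI allI impI)
  show "W \<inter> W' \<subseteq> GS s" using assms by (auto simp: GS_zero_nbhd_def)
  show "\<forall>f\<in>W \<inter> W'. \<forall>g\<in>W \<inter> W'. \<forall>a b. norm a + norm b \<le> 1 \<longrightarrow>
      (\<lambda>x. a * f x + b * g x) \<in> W \<inter> W'"
    using assms by (auto simp: GS_zero_nbhd_def)
  fix h :: real assume "h > 0"
  obtain e where e: "e > 0" "\<forall>f\<in>GS_step s h. GS_norm s h f < e \<longrightarrow> f \<in> W"
    using assms(1) \<open>h > 0\<close> unfolding GS_zero_nbhd_def by blast
  obtain e' where e': "e' > 0" "\<forall>f\<in>GS_step s h. GS_norm s h f < e' \<longrightarrow> f \<in> W'"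
    using assms(2) \<open>h > 0\<close> unfolding GS_zero_nbhd_def by blast
  show "\<exists>e>0. \<forall>f\<in>GS_step s h. GS_norm s h f < e \<longrightarrow> f \<in> W \<inter> W'"
    using e e' by (intro exI[of _ "min e e'"]) simp
qed

lemma istopology_GS_open: "istopology (GS_open s)"
  unfolding istopology_def
proof (intro conjI allI impI)
  fix S T :: "(real ^ 'd \<Rightarrow> complex) set"
  assume S: "GS_open s S" and T: "GS_open s T"
  show "GS_open s (S \<inter> T)"
    unfolding GS_open_def
  proof (intro conjI ballI)
    show "S \<inter> T \<subseteq> GS s" using S by (auto simp: GS_open_def)
    fix f assume "f \<in> S \<inter> T"
    then have f: "f \<in> S" "f \<in> T" by auto
    obtain W where W: "GS_zero_nbhd s W" "\<forall>g\<in>W. (\<lambda>x. f x + g x) \<in> S"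
      using S f(1) unfolding GS_open_def by blast
    obtain W' where W': "GS_zero_nbhd s W'" "\<forall>g\<in>W'. (\<lambda>x. f x + g x) \<in> T"
      using T f(2) unfolding GS_open_def by blast
    show "\<exists>W. GS_zero_nbhd s W \<and> (\<forall>g\<in>W. (\<lambda>x. f x + g x) \<in> S \<inter> T)"
      using W W' by (intro exI[of _ "W \<inter> W'"]) (simp add: GS_zero_nbhd_Int)
  qed
next
  fix \<K> :: "(real ^ 'd \<Rightarrow> complex) set set"
  assume K: "\<forall>K\<in>\<K>. GS_open s K"
  show "GS_open s (\<Union>\<K>)"
    unfolding GS_open_def
  proof (intro conjI ballI)
    show "\<Union>\<K> \<subseteq> GS s" using K unfolding GS_open_def by blast
    fix f assume "f \<in> \<Union>\<K>"
    then obtain U where U: "U \<in> \<K>" "f \<in> U" by blast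
    then obtain W where "GS_zero_nbhd s W" "\<forall>g\<in>W. (\<lambda>x. f x + g x) \<in> U"
      using K unfolding GS_open_def by blast
    then show "\<exists>W. GS_zero_nbhd s W \<and> (\<forall>g\<in>W. (\<lambda>x. f x + g x) \<in> \<Union>\<K>)"
      using U(1) by blast
  qed
qed

lemma openin_GS_topology: "openin (GS_topology s) = GS_open s"
  unfolding GS_topology_def by (rule topology_inverse'[OF istopology_GS_open])

text \<open>
  Elements of the dual are functionals on the test function space; they are set to zero outside of
  it, so that two of them are equal iff they agree on all test functions.
\<close>

definition GS_dual :: "real \<Rightarrow> ((real ^ 'd \<Rightarrow> complex) \<Rightarrow> complex) set" where
  "GS_dual s = {u.
     (\<forall>f\<in>GS s. \<forall>g\<in>GS s. \<forall>a b. u (\<lambda>x. a * f x + b * g x) = a * u f + b * u g) \<and>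
     continuous_map (GS_topology s) euclidean u \<and>
     (\<forall>f. f \<notin> GS s \<longrightarrow> u f = 0)}"


section \<open>Modulation spaces\<close>

text \<open>\<open>\<complex>\<^sup>d\<close> is identified with \<open>\<real>\<^sup>2\<^sup>d\<close>, rendered as the type of pairs \<open>(x, \<xi>)\<close>.\<close>

type_synonym 'd phase_space = "(real ^ 'd) \<times> (real ^ 'd)"

definition gauss :: "real ^ 'd \<Rightarrow> real" where
  "gauss x = pi powr (- real CARD('d) / 4) * exp (- (norm x)\<^sup>2 / 2)"

definition stft :: "((real ^ 'd \<Rightarrow> complex) \<Rightarrow> complex) \<Rightarrow> 'd phase_space \<Rightarrow> complex" where
  "stft f = (\<lambda>(x, \<xi>). of_real ((2 * pi) powr (- real CARD('d) / 2)) *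
     f (\<lambda>y. of_real (gauss (y - x)) * exp (- (\<i> * of_real (y \<bullet> \<xi>)))))"

definition M_norm :: "('d phase_space \<Rightarrow> real) \<Rightarrow> 'd::finite phase_space mixed_space \<Rightarrow>
    ((real ^ 'd \<Rightarrow> complex) \<Rightarrow> complex) \<Rightarrow> ennreal" where
  "M_norm \<omega> B f = mixed_norm B (\<lambda>z. stft f z * of_real (\<omega> z))"

definition M_space :: "('d phase_space \<Rightarrow> real) \<Rightarrow> 'd::finite phase_space mixed_space \<Rightarrow>
    ((real ^ 'd \<Rightarrow> complex) \<Rightarrow> complex) set" where
  "M_space \<omega> B = {f \<in> GS_dual (1/2). M_norm \<omega> B f < top}"


section \<open>Spaces of entire functions\<close>

text \<open>Entire: complex differentiable, i.e. differentiable with complex linear derivative, everywhere.\<close>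

definition entire :: "(complex ^ 'd \<Rightarrow> complex) \<Rightarrow> bool" where
  "entire F \<longleftrightarrow> (\<forall>z. \<exists>D. (F has_derivative D) (at z) \<and> (\<forall>c v. D (c *s v) = c * D v))"

definition B_transform :: "(complex ^ 'd \<Rightarrow> complex) \<Rightarrow> 'd phase_space \<Rightarrow> complex" where
  "B_transform F = (\<lambda>(x, \<xi>).
     of_real ((2 * pi) powr (- real CARD('d) / 2)) *
     of_real (exp (- ((norm x)\<^sup>2 + (norm \<xi>)\<^sup>2) / 4)) *
     exp (- (\<i> * of_real (x \<bullet> \<xi>) / 2)) *
     F (\<chi> j. Complex (x $ j / sqrt 2) (- (\<xi> $ j) / sqrt 2)))"

definition B_norm :: "('d phase_space \<Rightarrow> real) \<Rightarrow> 'd::finite phase_space mixed_space \<Rightarrow>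
    (complex ^ 'd \<Rightarrow> complex) \<Rightarrow> ennreal" where
  "B_norm \<omega> B F = mixed_norm B (\<lambda>z. B_transform F z * of_real (\<omega> z))"

definition A_space :: "('d phase_space \<Rightarrow> real) \<Rightarrow> 'd::finite phase_space mixed_space \<Rightarrow>
    (complex ^ 'd \<Rightarrow> complex) set" where
  "A_space \<omega> B = {F. entire F \<and> B_norm \<omega> B F < top}"

end

theory Submission
  imports Defs "HOL-Probability.Probability" "HOL-Complex_Analysis.Complex_Analysis"
begin

text \<open>
  For an entire function, the sub-mean value property of \<open>\<bar>F\<bar>\<^sup>r\<close> with small \<open>r\<close>, the local
  embedding of \<open>L\<^sup>p(V)\<close> into \<open>L\<^sup>r\<close>, translation invariance and the lower Gaussian bound on the weight give the
  pointwise estimate \<open>\<bar>F(\<zeta>)\<bar> \<le> M(\<bar>\<zeta>\<bar>) \<parallel>F\<parallel>\<close>. Hence Cauchy sequences converge locally uniformly to an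
  entire function, and Fatou's lemma gives convergence in norm.

  The short-time Fourier transform of \<open>u\<close> is, up to a Gaussian factor, the entire function
  \<open>w \<mapsto> u(e\<^bsub>w\<^esub>)\<close>, where \<open>e\<^bsub>w\<^esub>(y) = exp(- y\<sqdot>y/2 + w\<sqdot>y)\<close>, so the modulation space embeds isometrically into the
  space of entire functions. The embedding is onto: by the subgaussian weight, an
  entire function \<open>H\<close> of finite norm grows slowly enough to be paired with the Gaussian transforms
  of test functions, and the resulting functional has \<open>u(e\<^bsub>w\<^esub>) = H(w)\<close> by the mean value property. It is injective
  since every test function is a superposition of wave packets \<open>e\<^bsub>w\<^esub>\<close> that converges in a space of
  entire functions with Gaussian bounds, on which \<open>u\<close> is continuous.
\<close>

section \<open>Powers and quasi-norms of extended nonnegative functions\<close>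

text \<open>Two obstacles shape the development. A weight is only Lebesgue measurable, while
  \<open>mixed_ennnorm\<close> integrates slice by slice over subspaces that need not be orthogonal,
  and slices of a Lebesgue measurable function need not be measurable. The weight is therefore
  replaced by a Borel function that agrees with it almost everywhere, and all estimates are made for
  the Borel quasi-norm \<open>borel_mixed\<close>; the comparison rests on the fact that Lebesgue
  measure is a constant multiple of the product of the measures on the subspaces. The second
  obstacle is surjectivity onto the entire functions of finite norm. The transform of a test
  function in \<open>GS_step (1/2) h\<close> beats the critical Gaussian only by exp(- \<delta>
  |w|^2) with a \<delta> that depends on h, so the entire function may exceed the critical growth by
  no fixed Gaussian factor; this is where \<open>P_Q0\<close> enters. For the spaces of entire
  functions only local estimates are made, and these follow from the Gaussian lower bound in
  \<open>P_Q\<close>. The quasi-norm constant is a product of one factor per subspace, each equal to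
  1 when the exponent is at least 1, so the Banach case comes out of the same argument.\<close>

lemma epowr_top [simp]: "epowr top r = top"
  by (simp add: epowr_def)

lemma epowr_ennreal: "0 \<le> a \<Longrightarrow> epowr (ennreal a) r = ennreal (a powr r)"
  by (simp add: epowr_def)

lemma epowr_0 [simp]: "epowr 0 r = 0"
  by (simp add: epowr_def)

lemma epowr_1 [simp]: "epowr a 1 = a"
  by (cases a) (auto simp: epowr_ennreal)

lemma epowr_one [simp]: "epowr 1 r = 1"
  using epowr_ennreal[of 1 r] by simp

lemma epowr_mono: "0 < r \<Longrightarrow> a \<le> b \<Longrightarrow> epowr a r \<le> epowr b r"
  by (cases a; cases b) (auto simp: epowr_ennreal powr_mono2 top_unique)

lemma epowr_mult: "0 < r \<Longrightarrow> epowr (a * b) r = epowr a r * epowr b r"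
  apply (cases a; cases b)
     apply (auto simp: epowr_ennreal powr_mult ennreal_mult[symmetric] ennreal_mult_top ennreal_top_mult)
  done

lemma epowr_epowr: "epowr (epowr a r) s = epowr a (r * s)"
  by (cases a) (auto simp: epowr_ennreal powr_powr)

lemma epowr_inverse: "r \<noteq> 0 \<Longrightarrow> epowr (epowr a r) (1 / r) = a" "r \<noteq> 0 \<Longrightarrow> epowr (epowr a (1 / r)) r = a"
  by (simp_all add: epowr_epowr)

lemma epowr_eq_0_iff [simp]: "epowr a r = 0 \<longleftrightarrow> a = 0"
  by (cases a) (auto simp: epowr_ennreal)

lemma epowr_eq_top_iff [simp]: "epowr a r = top \<longleftrightarrow> a = top"
  by (cases a) (auto simp: epowr_ennreal)

lemma epowr_mono_iff: "0 < r \<Longrightarrow> epowr a r \<le> epowr b r \<longleftrightarrow> a \<le> b"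
  using epowr_mono[of r a b] epowr_mono[of "1/r" "epowr a r" "epowr b r"] by (auto simp: epowr_inverse)

text \<open>A monotone map of a linear order onto an open range is continuous, and the power is onto
  because the exponent \<open>1 / r\<close> undoes it. The point \<open>top\<close> is included,
  which the later passage to the limes inferior needs.\<close>

lemma continuous_on_epowr: "0 < r \<Longrightarrow> continuous_on UNIV (\<lambda>a. epowr a r)"
proof (rule continuous_onI_mono)
  assume "0 < r"
  then have "range (\<lambda>a. epowr a r) = UNIV"
    by (metis epowr_inverse(2) less_numeral_extra(3) surj_def)
  then show "open (range (\<lambda>a. epowr a r))" by simp
qed (auto intro: epowr_mono)

lemma borel_measurable_epowr [measurable]:
  assumes [measurable]: "f \<in> borel_measurable M"
  shows "(\<lambda>x. epowr (f x) r) \<in> borel_measurable M"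
  unfolding epowr_def by measurable

lemma liminf_epowr: "0 < r \<Longrightarrow> liminf (\<lambda>n. epowr (f n) r) = epowr (liminf f) r"
  using Liminf_compose_continuous_mono[of "\<lambda>a. epowr a r" sequentially f] continuous_on_epowr[of r] epowr_mono[of r]
  by (simp add: mono_def)

text \<open>After division by \<open>s = a + b\<close> the claim compares each fraction in [0, 1]
  with its p-th power, which is at least as large for p \<le> 1; the two fractions add up to
  1.\<close>

lemma powr_add_le:
  fixes a b p :: real
  assumes "0 \<le> a" "0 \<le> b" "0 < p" "p \<le> 1"
  shows "(a + b) powr p \<le> a powr p + b powr p"
proof (cases "a + b = 0")
  case False
  define s where "s = a + b"
  have s: "s > 0" using False assms by (simp add: s_def)
  have *: "t / s \<le> (t / s) powr p" if "0 \<le> t" "t \<le> s" for t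
  proof -
    have "(t/s) powr 1 \<le> (t / s) powr p" using that s assms by (intro powr_mono') auto
    then show ?thesis using that s by simp
  qed
  have "1 = a / s + b / s" using s by (simp add: s_def field_simps add_divide_distrib[symmetric])
  also have "\<dots> \<le> (a / s) powr p + (b / s) powr p" using *[of a] *[of b] assms by (simp add: s_def)
  also have "\<dots> = (a powr p + b powr p) / s powr p" using assms s by (simp add: powr_divide add_divide_distrib)
  finally show ?thesis using s by (simp add: field_simps s_def)
qed (use assms in auto)

lemma epowr_add_le: "0 < p \<Longrightarrow> p \<le> 1 \<Longrightarrow> epowr (a + b) p \<le> epowr a p + epowr b p"
  by (cases a; cases b) (auto simp: epowr_ennreal ennreal_plus[symmetric] powr_add_le simp del: ennreal_plus)

text \<open>Lowering an exponent costs an additive 1, which is integrable over sets of finite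
  measure; this takes the place of Hoelder's inequality in \<open>Lp_local\<close>.\<close>

lemma epowr_le_1_plus: "0 < r \<Longrightarrow> r \<le> p \<Longrightarrow> epowr a r \<le> 1 + epowr a p"
proof (cases a)
  case (real x)
  assume *: "0 < r" "r \<le> p"
  have "x powr r \<le> 1 + x powr p"
  proof (cases "x \<le> 1")
    case True
    have "x powr r \<le> 1 powr r" using True real * by (intro powr_mono2) auto
    then show ?thesis by (simp add: add_increasing2)
  next
    case False
    then have "x powr r \<le> x powr p" using * by (intro powr_mono) auto
    then show ?thesis by simp
  qed
  then show ?thesis using real
    by (metis add.commute ennreal_1 ennreal_leI ennreal_plus epowr_ennreal powr_ge_zero zero_le_one)
qed auto

text \<open>For positive arguments this is \<open>powr_convex\<close>; where one argument vanishes,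
  \<open>t powr p \<le> t\<close> for t in [0, 1] takes its place.\<close>

lemma powr_convex_comb:
  fixes a b l p :: real
  assumes "0 \<le> a" "0 \<le> b" "0 \<le> l" "l \<le> 1" "1 \<le> p"
  shows "(l * a + (1 - l) * b) powr p \<le> l * a powr p + (1 - l) * b powr p"
proof -
  have le: "(t * x) powr p \<le> t * x powr p" if "0 \<le> t" "t \<le> 1" "0 \<le> x" for t x :: real
  proof -
    have "t powr p \<le> t" using powr_mono'[of 1 p t] that assms by simp
    then show ?thesis using that by (simp add: powr_mult mult_right_mono)
  qed
  show ?thesis
  proof (cases "a = 0 \<or> b = 0")
    case True
    then show ?thesis using le[of l a] le[of "1 - l" b] assms by auto
  next
    case False
    then show ?thesis using convex_onD[OF powr_convex[OF assms(5)], of "1 - l" a b] assms by simp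
  qed
qed

lemma epowr_convex_comb:
  assumes "0 \<le> l" "l \<le> 1" "1 \<le> p"
  shows "epowr (ennreal l * a + ennreal (1 - l) * b) p \<le> ennreal l * epowr a p + ennreal (1 - l) * epowr b p"
proof (cases "l = 0 \<or> l = 1")
  case True then show ?thesis by auto
next
  case False
  then have l: "0 < l" "l < 1" using assms by auto
  show ?thesis
  proof (cases "a = top \<or> b = top")
    case True
    then show ?thesis using l by (auto simp: ennreal_mult_top)
  next
    case False
    then obtain x y where [simp]: "a = ennreal x" "b = ennreal y" "0 \<le> x" "0 \<le> y"
      by (metis ennreal_cases)
    show ?thesis using powr_convex_comb[of x y l p] assms l
      by (simp add: epowr_ennreal ennreal_mult[symmetric] ennreal_plus[symmetric] del: ennreal_plus)
  qed
qed

text \<open>For p < 1 the factor comes from bounding a sum of two integrals by twice the larger one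
  before the p-th root is taken. For p \<ge> 1 it has to be exactly 1, since this later turns the
  quasi-norm into a norm.\<close>

definition Lp_const :: "ennreal \<Rightarrow> real" where
  "Lp_const p = (if p \<ge> 1 then 1 else 2 powr (1 / enn2real p))"

lemma Lp_const_ge_1: "1 \<le> Lp_const p"
  by (auto simp: Lp_const_def intro!: ge_one_powr_ge_zero)

lemma Lp_mono:
  assumes "0 < p" "f \<in> borel_measurable M" "g \<in> borel_measurable M" "AE x in M. f x \<le> g x"
  shows "Lp_quasi_norm M p f \<le> Lp_quasi_norm M p g"
proof (cases "p = top")
  case True
  then show ?thesis using assms by (auto simp: Lp_quasi_norm_def intro: esssup_AE_mono)
next
  case False
  then have p: "0 < enn2real p" using assms(1) by (simp add: enn2real_positive_iff less_top)
  have "(\<integral>\<^sup>+ x. epowr (f x) (enn2real p) \<partial>M) \<le> (\<integral>\<^sup>+ x. epowr (g x) (enn2real p) \<partial>M)"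
    using assms(4) by (intro nn_integral_mono_AE) (auto intro: epowr_mono[OF p])
  then show ?thesis using False p by (auto simp: Lp_quasi_norm_def intro!: epowr_mono)
qed

lemma Lp_AE_cong:
  assumes "f \<in> borel_measurable M" "g \<in> borel_measurable M" "AE x in M. f x = g x"
  shows "Lp_quasi_norm M p f = Lp_quasi_norm M p g"
proof (cases "p = top")
  case True
  then show ?thesis using assms esssup_AE_cong by (auto simp: Lp_quasi_norm_def)
next
  case False
  have "(\<integral>\<^sup>+ x. epowr (f x) (enn2real p) \<partial>M) = (\<integral>\<^sup>+ x. epowr (g x) (enn2real p) \<partial>M)"
    using assms(3) by (intro nn_integral_cong_AE) auto
  then show ?thesis using False by (simp add: Lp_quasi_norm_def)
qed

lemma Lp_cmult_le:
  assumes "0 < p" "f \<in> borel_measurable M" "c \<noteq> top"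
  shows "Lp_quasi_norm M p (\<lambda>x. c * f x) \<le> c * Lp_quasi_norm M p f"
proof (cases "p = top")
  case True
  have "AE x in M. c * f x \<le> c * esssup M f" using esssup_AE[of f M] by eventually_elim (auto intro: mult_left_mono)
  then show ?thesis using assms True by (auto simp: Lp_quasi_norm_def)
next
  case False
  then have p: "0 < enn2real p" using assms(1) by (simp add: enn2real_positive_iff less_top)
  have "(\<integral>\<^sup>+ x. epowr (c * f x) (enn2real p) \<partial>M) = epowr c (enn2real p) * (\<integral>\<^sup>+ x. epowr (f x) (enn2real p) \<partial>M)"
    using assms(2) by (simp add: epowr_mult[OF p] nn_integral_cmult)
  then show ?thesis using False p by (simp add: Lp_quasi_norm_def epowr_mult epowr_inverse)
qed

text \<open>The missing inequality is \<open>Lp_cmult_le\<close> with the finite factor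
  \<open>inverse c\<close>, applied to \<open>c * f\<close>.\<close>

lemma Lp_cmult:
  assumes "0 < p" "f \<in> borel_measurable M" "c \<noteq> top"
  shows "Lp_quasi_norm M p (\<lambda>x. c * f x) = c * Lp_quasi_norm M p f"
proof (cases "c = 0")
  case True
  then show ?thesis using Lp_cmult_le[OF assms] by simp
next
  case False
  have [measurable]: "f \<in> borel_measurable M" by fact
  have i: "inverse c \<noteq> top" "c * inverse c = 1" "inverse c * c = 1"
    using False assms(3) by (cases c; auto simp: inverse_ennreal ennreal_mult[symmetric] less_le)+
  have "Lp_quasi_norm M p (\<lambda>x. inverse c * (c * f x)) \<le> inverse c * Lp_quasi_norm M p (\<lambda>x. c * f x)"
    using assms i by (intro Lp_cmult_le) auto
  then have "c * Lp_quasi_norm M p f \<le> c * (inverse c * Lp_quasi_norm M p (\<lambda>x. c * f x))"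
    by (intro mult_left_mono) (auto simp: mult.assoc[symmetric] i)
  then show ?thesis using Lp_cmult_le[OF assms] by (simp add: mult.assoc[symmetric] i)
qed

lemma Lp_eq_0_AE:
  assumes "0 < p" "f \<in> borel_measurable M" "Lp_quasi_norm M p f = 0"
  shows "AE x in M. f x = 0"
proof (cases "p = top")
  case True
  then show ?thesis using esssup_AE[of f M] assms(3) by (auto simp: Lp_quasi_norm_def)
next
  case False
  then show ?thesis using assms
    by (auto simp: Lp_quasi_norm_def nn_integral_0_iff_AE elim!: eventually_mono)
qed

lemma Lp_add_null:
  assumes "0 < p" and [measurable]: "f \<in> borel_measurable M" "g \<in> borel_measurable M" and "Lp_quasi_norm M p f = 0"
  shows "Lp_quasi_norm M p (\<lambda>x. f x + g x) = Lp_quasi_norm M p g"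
  using Lp_eq_0_AE[OF assms(1,2,4)] by (intro Lp_AE_cong) auto

lemma Lp_unit:
  assumes "p \<noteq> top" "0 < enn2real p" "Lp_quasi_norm M p f = N"
  shows "(\<integral>\<^sup>+ x. epowr (f x) (enn2real p) \<partial>M) = epowr N (enn2real p)"
  using assms by (auto simp: Lp_quasi_norm_def epowr_inverse)

text \<open>Both functions are normalized to norm 1, and \<open>f + g\<close> becomes a multiple of
  a convex combination of them; convexity of the q-th power then suffices, without duality. A
  function of norm 0 cannot be normalized, but it vanishes almost everywhere.\<close>

lemma Lp_Minkowski:
  assumes p: "1 \<le> p" and [measurable]: "f \<in> borel_measurable M" "g \<in> borel_measurable M"
  shows "Lp_quasi_norm M p (\<lambda>x. f x + g x) \<le> Lp_quasi_norm M p f + Lp_quasi_norm M p g" (is "?L \<le> ?A + ?B")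
proof -
  have p0: "0 < p" using p by (metis less_le_trans zero_less_one)
  consider "?A = 0" | "?B = 0" | "?A = top \<or> ?B = top" | "?A \<noteq> 0" "?B \<noteq> 0" "?A \<noteq> top" "?B \<noteq> top" by blast
  then show ?thesis
  proof cases
    case 1 then show ?thesis using Lp_add_null[OF p0 assms(2,3) 1] by simp
  next
    case 2 then show ?thesis using Lp_add_null[OF p0 assms(3,2) 2] by (simp add: add.commute)
  next
    case 3 then show ?thesis by auto
  next
    case 4
    show ?thesis
    proof (cases "p = top")
      case True
      have "AE x in M. f x + g x \<le> esssup M f + esssup M g"
        using esssup_AE[of f M] esssup_AE[of g M] by eventually_elim (rule add_mono)
      then show ?thesis using True by (auto simp: Lp_quasi_norm_def)
    next
      case False
      define q where "q = enn2real p"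
      have q: "1 \<le> q" using p False unfolding q_def
        by (metis enn2real_mono enn2real_1 less_top)
      obtain a b where ab: "?A = ennreal a" "?B = ennreal b" "0 < a" "0 < b"
        using 4 by (cases "?A"; cases "?B") (auto simp: less_le)
      \<comment> \<open>With these weights \<open>l * F + (1 - l) * G\<close> equals
        \<open>f + g\<close> divided by \<open>a + b\<close>.\<close>
      define l where "l = a / (a + b)"
      have l: "0 \<le> l" "l \<le> 1" "1 - l = b / (a + b)" using ab by (auto simp: l_def field_simps)
      define F where "F = (\<lambda>x. ennreal (1/a) * f x)"
      define G where "G = (\<lambda>x. ennreal (1/b) * g x)"
      have [measurable]: "F \<in> borel_measurable M" "G \<in> borel_measurable M" by (auto simp: F_def G_def)
      have NF: "Lp_quasi_norm M p F = 1" "Lp_quasi_norm M p G = 1" unfolding F_def G_def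
        using ab p0 by (auto simp: Lp_cmult ennreal_mult[symmetric])
      have IF: "(\<integral>\<^sup>+ x. epowr (F x) q \<partial>M) = 1" "(\<integral>\<^sup>+ x. epowr (G x) q \<partial>M) = 1"
        using Lp_unit[OF False _ NF(1)] Lp_unit[OF False _ NF(2)] q by (auto simp: q_def)
      have "(\<integral>\<^sup>+ x. epowr (ennreal l * F x + ennreal (1 - l) * G x) q \<partial>M)
         \<le> (\<integral>\<^sup>+ x. ennreal l * epowr (F x) q + ennreal (1 - l) * epowr (G x) q \<partial>M)"
        by (intro nn_integral_mono epowr_convex_comb l q)
      also have "\<dots> = ennreal l + ennreal (1 - l)"
        using l by (simp add: nn_integral_add nn_integral_cmult IF)
      also have "\<dots> = 1" using l(1,2) by (subst ennreal_plus[symmetric]) auto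
      finally have "Lp_quasi_norm M p (\<lambda>x. ennreal l * F x + ennreal (1 - l) * G x) \<le> epowr 1 (1/q)"
        using False q by (auto simp: Lp_quasi_norm_def q_def intro!: epowr_mono simp del: epowr_one)
      also have "(\<lambda>x. ennreal l * F x + ennreal (1 - l) * G x) = (\<lambda>x. ennreal (1 / (a + b)) * (f x + g x))"
      proof
        fix x
        have "ennreal l * ennreal (1/a) = ennreal (1/(a+b))" "ennreal (1-l) * ennreal (1/b) = ennreal (1/(a+b))"
          unfolding l(3) using ab by (simp_all add: l_def ennreal_mult[symmetric] del: ennreal_plus)
        then show "ennreal l * F x + ennreal (1 - l) * G x = ennreal (1 / (a + b)) * (f x + g x)"
          unfolding F_def G_def mult.assoc[symmetric] by (simp add: distrib_left)
      qed
      finally have *: "ennreal (1 / (a + b)) * ?L \<le> 1" using p0 by (simp add: Lp_cmult)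
      have "?L = ennreal (a + b) * (ennreal (1 / (a + b)) * ?L)"
        unfolding mult.assoc[symmetric] using ab by (simp add: ennreal_mult[symmetric] del: ennreal_plus)
      also have "\<dots> \<le> ennreal (a + b) * 1" using * by (intro mult_left_mono) auto
      finally show ?thesis using ab by simp
    qed
  qed
qed

text \<open>For p < 1 the p-th powers are subadditive, so the integrals add. Replacing the sum by
  twice the maximum lets the root be taken factor by factor, and the maximum of the two norms is at
  most their sum.\<close>

lemma Lp_triangle:
  assumes p: "0 < p" and [measurable]: "f \<in> borel_measurable M" "g \<in> borel_measurable M"
  shows "Lp_quasi_norm M p (\<lambda>x. f x + g x) \<le> ennreal (Lp_const p) * (Lp_quasi_norm M p f + Lp_quasi_norm M p g)"
proof (cases "1 \<le> p")
  case True
  then show ?thesis using Lp_Minkowski[OF True assms(2,3)] by (simp add: Lp_const_def)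
next
  case False
  then have pt: "p \<noteq> top" by auto
  define q where "q = enn2real p"
  have q: "0 < q" "q \<le> 1" using False p pt unfolding q_def
    by (auto simp: enn2real_positive_iff less_top enn2real_leI)
  let ?A = "\<integral>\<^sup>+ x. epowr (f x) q \<partial>M" and ?B = "\<integral>\<^sup>+ x. epowr (g x) q \<partial>M"
  have "(\<integral>\<^sup>+ x. epowr (f x + g x) q \<partial>M) \<le> (\<integral>\<^sup>+ x. epowr (f x) q + epowr (g x) q \<partial>M)"
    by (intro nn_integral_mono epowr_add_le q)
  also have "\<dots> = ?A + ?B" by (simp add: nn_integral_add)
  also have "\<dots> \<le> 2 * max ?A ?B" by (cases "?A \<le> ?B") (auto simp: mult_2 max_def intro: add_mono)
  finally have "Lp_quasi_norm M p (\<lambda>x. f x + g x) \<le> epowr (2 * max ?A ?B) (1/q)"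
    using pt q by (auto simp: Lp_quasi_norm_def q_def intro: epowr_mono)
  also have "\<dots> = ennreal (Lp_const p) * epowr (max ?A ?B) (1/q)"
    using q False epowr_ennreal[of 2 "1/q"] by (simp add: epowr_mult Lp_const_def q_def)
  also have "epowr (max ?A ?B) (1/q) \<le> epowr ?A (1/q) + epowr ?B (1/q)"
    by (auto simp: max_def add_increasing add_increasing2)
  finally show ?thesis using pt by (simp add: Lp_quasi_norm_def q_def mult_left_mono)
qed

text \<open>For finite p this is Fatou's lemma for the p-th powers, since a monotone continuous
  power commutes with the limes inferior. For p = \<open>top\<close> the countably many exceptional
  null sets are united.\<close>

lemma Lp_Fatou:
  assumes p: "0 < p" and [measurable]: "\<And>n. f n \<in> borel_measurable M"
  shows "Lp_quasi_norm M p (\<lambda>x. liminf (\<lambda>n. f n x)) \<le> liminf (\<lambda>n. Lp_quasi_norm M p (f n))"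
proof (cases "p = top")
  case True
  have "AE x in M. \<forall>n. f n x \<le> esssup M (f n)"
    by (subst AE_all_countable) (auto intro: esssup_AE)
  then have "AE x in M. liminf (\<lambda>n. f n x) \<le> liminf (\<lambda>n. esssup M (f n))"
    by eventually_elim (auto intro: Liminf_mono)
  then show ?thesis using True by (auto simp: Lp_quasi_norm_def)
next
  case False
  define q where "q = enn2real p"
  have q: "0 < q" using p False unfolding q_def by (auto simp: enn2real_positive_iff less_top)
  have "(\<integral>\<^sup>+ x. epowr (liminf (\<lambda>n. f n x)) q \<partial>M) = (\<integral>\<^sup>+ x. liminf (\<lambda>n. epowr (f n x) q) \<partial>M)"
    by (simp add: liminf_epowr q)
  also have "\<dots> \<le> liminf (\<lambda>n. \<integral>\<^sup>+ x. epowr (f n x) q \<partial>M)"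
    by (rule nn_integral_liminf) measurable
  finally have "epowr (\<integral>\<^sup>+ x. epowr (liminf (\<lambda>n. f n x)) q \<partial>M) (1/q) \<le> epowr (liminf (\<lambda>n. \<integral>\<^sup>+ x. epowr (f n x) q \<partial>M)) (1/q)"
    using q by (intro epowr_mono) auto
  then show ?thesis using False q by (simp add: Lp_quasi_norm_def q_def liminf_epowr)
qed

text \<open>Homogeneity reduces the claim to norm 1, where t^r \<le> 1 + t^p integrates to
  \<open>emeasure M K + 1\<close>; for p = \<open>top\<close> the integrand is bounded by a constant
  on K.\<close>

lemma Lp_local:
  assumes p: "0 < p" and r: "0 < r" "ennreal r \<le> p" and [measurable]: "f \<in> borel_measurable M" "K \<in> sets M"
  shows "(\<integral>\<^sup>+ x. indicator K x * epowr (f x) r \<partial>M) \<le> (emeasure M K + 1) * epowr (Lp_quasi_norm M p f) r"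
proof -
  let ?N = "Lp_quasi_norm M p f"
  consider "?N = 0" | "?N = top" | "?N \<noteq> 0" "?N \<noteq> top" by blast
  then show ?thesis
  proof cases
    case 1
    have "AE x in M. indicator K x * epowr (f x) r = 0" using Lp_eq_0_AE[OF p assms(4) 1] by eventually_elim simp
    then have "(\<integral>\<^sup>+ x. indicator K x * epowr (f x) r \<partial>M) = (\<integral>\<^sup>+ x. 0 \<partial>M)" by (rule nn_integral_cong_AE)
    then show ?thesis by simp
  next
    case 2 then show ?thesis by (simp add: ennreal_mult_top)
  next
    case 3
    show ?thesis
    proof (cases "p = top")
      case True
      have "AE x in M. indicator K x * epowr (f x) r \<le> indicator K x * epowr ?N r"
        using esssup_AE[of f M] r True by (auto simp: Lp_quasi_norm_def intro!: mult_left_mono epowr_mono)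
      then have "(\<integral>\<^sup>+ x. indicator K x * epowr (f x) r \<partial>M) \<le> (\<integral>\<^sup>+ x. indicator K x * epowr ?N r \<partial>M)"
        by (rule nn_integral_mono_AE)
      also have "\<dots> = emeasure M K * epowr ?N r" by (simp add: nn_integral_multc)
      also have "\<dots> \<le> (emeasure M K + 1) * epowr ?N r" by (intro mult_right_mono) auto
      finally show ?thesis .
    next
      case False
      define q where "q = enn2real p"
      have q: "0 < q" "r \<le> q" using p False r unfolding q_def
        by (auto simp: enn2real_positive_iff less_top) (metis enn2real_ennreal enn2real_mono less_imp_le less_top)
      obtain a where a: "?N = ennreal a" "0 < a" using 3 by (cases ?N) (auto simp: less_le)
      define F where "F = (\<lambda>x. ennreal (1/a) * f x)"
      have [measurable]: "F \<in> borel_measurable M" by (auto simp: F_def)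
      have NF: "Lp_quasi_norm M p F = 1" unfolding F_def using a p by (auto simp: Lp_cmult ennreal_mult[symmetric])
      then have IF: "(\<integral>\<^sup>+ x. epowr (F x) q \<partial>M) = 1" using Lp_unit[OF False _ NF] q by (auto simp: q_def)
      have f: "f x = ennreal a * F x" for x
        unfolding F_def mult.assoc[symmetric] using a by (simp add: ennreal_mult[symmetric])
      have "(\<integral>\<^sup>+ x. indicator K x * epowr (F x) r \<partial>M) \<le> (\<integral>\<^sup>+ x. indicator K x + epowr (F x) q \<partial>M)"
        using epowr_le_1_plus[OF r(1) q(2)] by (intro nn_integral_mono) (auto simp: indicator_def)
      also have "\<dots> = emeasure M K + 1" by (simp add: nn_integral_add IF)
      finally have *: "(\<integral>\<^sup>+ x. indicator K x * epowr (F x) r \<partial>M) \<le> emeasure M K + 1" .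
      have "(\<integral>\<^sup>+ x. indicator K x * epowr (f x) r \<partial>M) = (\<integral>\<^sup>+ x. (indicator K x * epowr (F x) r) * epowr ?N r \<partial>M)"
        using r a by (intro nn_integral_cong) (simp add: f epowr_mult ac_simps)
      also have "\<dots> = (\<integral>\<^sup>+ x. indicator K x * epowr (F x) r \<partial>M) * epowr ?N r" by (rule nn_integral_multc) measurable
      also have "\<dots> \<le> (emeasure M K + 1) * epowr ?N r" using * by (rule mult_right_mono) simp
      finally show ?thesis .
    qed
  qed
qed

text \<open>Only the essential supremum needs an argument: it is at most z iff the set of x with
  \<open>f y x > z\<close> is a null set, and the measure of such a slice depends measurably on y
  because M is \<sigma>-finite.\<close>

lemma Lp_measurable_param:
  assumes "sigma_finite_measure M" and f[measurable]: "(\<lambda>(y, x). f y x) \<in> borel_measurable (N \<Otimes>\<^sub>M M)"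
  shows "(\<lambda>y. Lp_quasi_norm M p (f y)) \<in> borel_measurable N"
proof (cases "p = top")
  case True
  interpret sigma_finite_measure M by fact
  show ?thesis unfolding Lp_quasi_norm_def if_P[OF True]
  proof (rule borel_measurableI_le)
    fix z :: ennreal
    have "{y \<in> space N. esssup M (f y) \<le> z} = {y \<in> space N. (\<integral>\<^sup>+ x. indicator {z<..} (f y x) \<partial>M) = 0}"
    proof (intro Collect_cong conj_cong refl)
      fix y assume y: "y \<in> space N"
      then have [measurable]: "f y \<in> borel_measurable M" by measurable
      have "esssup M (f y) \<le> z \<longleftrightarrow> (AE x in M. f y x \<le> z)"
      proof
        assume "esssup M (f y) \<le> z"
        then show "AE x in M. f y x \<le> z" using esssup_AE[of "f y" M] by (auto elim!: eventually_mono)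
      qed auto
      also have "\<dots> \<longleftrightarrow> (AE x in M. indicator {z<..} (f y x) = (0::ennreal))"
        by (intro AE_cong) (auto simp: indicator_def not_less)
      also have "\<dots> \<longleftrightarrow> (\<integral>\<^sup>+ x. indicator {z<..} (f y x) \<partial>M) = 0"
        by (subst nn_integral_0_iff_AE) auto
      finally show "esssup M (f y) \<le> z \<longleftrightarrow> (\<integral>\<^sup>+ x. indicator {z<..} (f y x) \<partial>M) = 0" .
    qed
    also have "\<dots> \<in> sets N" by measurable
    finally show "{y \<in> space N. esssup M (f y) \<le> z} \<in> sets N" .
  qed
next
  case False
  interpret sigma_finite_measure M by fact
  show ?thesis unfolding Lp_quasi_norm_def if_not_P[OF False] by measurable
qed

section \<open>Mixed quasi-norms\<close>

lemma Lp_distr: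
  assumes [measurable]: "T \<in> measurable M N" "f \<in> borel_measurable N"
  shows "Lp_quasi_norm (distr M N T) p f = Lp_quasi_norm M p (\<lambda>x. f (T x))"
proof (cases "p = top")
  case True
  have "(AE x in distr M N T. f x \<le> z) = (AE x in M. f (T x) \<le> z)" for z
    by (rule AE_distr_iff) measurable
  then have "esssup (distr M N T) f = esssup M (\<lambda>x. f (T x))"
    by (simp add: esssup_eq_AE)
  then show ?thesis using True by (simp add: Lp_quasi_norm_def)
next
  case False
  then show ?thesis by (simp add: Lp_quasi_norm_def nn_integral_distr)
qed

lemma Lp_completion:
  assumes f: "f \<in> borel_measurable M"
  shows "Lp_quasi_norm (completion M) p f = Lp_quasi_norm M p f"
proof -
  have "esssup (completion M) f = esssup M f"
    using f measurable_completion[OF f] by (simp add: esssup_eq_AE AE_completion_iff)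
  then show ?thesis by (simp add: Lp_quasi_norm_def nn_integral_completion)
qed

text \<open>The preimages under f and g differ only inside a null set, and the completion contains
  all subsets of it.\<close>

lemma measurable_completion_AE:
  assumes g: "g \<in> measurable M N" and "AE x in M. f x = g x" and sp: "\<And>x. x \<in> space M \<Longrightarrow> f x \<in> space N"
  shows "f \<in> measurable (completion M) N"
proof (rule measurableI)
  fix A assume A: "A \<in> sets N"
  obtain Z where Z: "Z \<in> null_sets M" "{x \<in> space M. f x \<noteq> g x} \<subseteq> Z"
    using assms(2) by (metis AE_E null_setsI)
  have "f -` A \<inter> space (completion M) = (g -` A \<inter> space M - Z) \<union> (f -` A \<inter> Z \<inter> space M)"
    using Z(2) by auto
  moreover have "g -` A \<inter> space M - Z \<in> sets (completion M)" using measurable_sets[OF g A] Z by auto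
  moreover have "f -` A \<inter> Z \<inter> space M \<in> sets (completion M)"
    by (rule null_sets_completion[OF Z(1)]) auto
  ultimately show "f -` A \<inter> space (completion M) \<in> sets (completion M)" by simp
qed (use sp in auto)

text \<open>
  The measure underlying \<^const>\<open>subspace_lebesgue\<close>, not completed and viewed as a Borel measure
  on the whole space.
\<close>

definition sub_lborel :: "'a::euclidean_space set \<Rightarrow> 'a measure" where
  "sub_lborel V = distr (\<Pi>\<^sub>M e\<in>(SOME E. is_orthonormal_basis V E). (lborel :: real measure)) borel
     (\<lambda>t. \<Sum>e\<in>(SOME E. is_orthonormal_basis V E). t e *\<^sub>R e)"

lemma sets_sub_lborel [simp, measurable_cong]: "sets (sub_lborel V) = sets borel"
  by (simp add: sub_lborel_def)

lemma space_sub_lborel [simp]: "space (sub_lborel V) = UNIV"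
  by (simp add: sub_lborel_def)

interpretation product_lborel: product_sigma_finite "\<lambda>_. lborel :: real measure"
  by standard

context
  fixes V E :: "'a::euclidean_space set"
  assumes V: "subspace V" and E_def: "E = (SOME E. is_orthonormal_basis V E)"
begin

lemma some_onb: "is_orthonormal_basis V E" "finite E" "E \<subseteq> V"
proof -
  have "\<exists>E. is_orthonormal_basis V E"
    using orthonormal_basis_subspace[OF V] unfolding is_orthonormal_basis_def by metis
  then show *: "is_orthonormal_basis V E" unfolding E_def by (rule someI_ex)
  then have "0 \<notin> E" by (auto simp: is_orthonormal_basis_def)
  then show "finite E" using * pairwise_orthogonal_independent[of E] independent_imp_finite
    by (auto simp: is_orthonormal_basis_def)
  show "E \<subseteq> V" using * by (simp add: is_orthonormal_basis_def)
qed

lemma onb_map_in: "(\<Sum>e\<in>E. t e *\<^sub>R e) \<in> V"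
  using some_onb V by (intro subspace_sum) (auto intro: subspace_scale)

lemma onb_inner: "e \<in> E \<Longrightarrow> (\<Sum>e\<in>E. t e *\<^sub>R e) \<bullet> e = t e"
proof -
  assume e: "e \<in> E"
  have "(t d *\<^sub>R d) \<bullet> e = (if d = e then t d else 0)" if "d \<in> E" for d
    using some_onb(1) e that by (auto simp: is_orthonormal_basis_def pairwise_def orthogonal_def dot_square_norm)
  then have "(\<Sum>e\<in>E. t e *\<^sub>R e) \<bullet> e = (\<Sum>d\<in>E. if d = e then t d else 0)" unfolding inner_sum_left by (intro sum.cong) auto
  then show ?thesis using e some_onb(2) by simp
qed

lemma onb_repr: "v \<in> V \<Longrightarrow> (\<Sum>e\<in>E. (v \<bullet> e) *\<^sub>R e) = v"
proof -
  assume "v \<in> V"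
  then have "v \<in> span E" using some_onb(1) by (simp add: is_orthonormal_basis_def)
  then obtain u where u: "v = (\<Sum>e\<in>E. u e *\<^sub>R e)" using some_onb(2) by (auto simp: span_finite)
  show ?thesis using u onb_inner[of _ u] by (auto intro!: sum.cong)
qed

lemma sub_lborel_alt: "sub_lborel V = distr (\<Pi>\<^sub>M e\<in>E. lborel) borel (\<lambda>t. \<Sum>e\<in>E. t e *\<^sub>R e)"
  by (simp add: sub_lborel_def E_def)

text \<open>The defined measure lives on V and is completed there, whereas
  \<open>sub_lborel V\<close> lives on the whole space. Both come from the same uncompleted measure
  M on V, which links their null sets and integrals.\<close>

lemma subspace_lebesgue_alt:
  "\<exists>M. subspace_lebesgue V = completion M \<and> sub_lborel V = distr M borel (\<lambda>x. x) \<and> (\<lambda>x. x) \<in> M \<rightarrow>\<^sub>M borel"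
proof (intro exI conjI)
  let ?T = "\<lambda>t. \<Sum>e\<in>E. t e *\<^sub>R e"
  let ?M = "distr (\<Pi>\<^sub>M e\<in>E. lborel) (restrict_space borel V) ?T"
  show "subspace_lebesgue V = completion ?M" by (simp add: subspace_lebesgue_def E_def Let_def)
  have [measurable]: "?T \<in> (\<Pi>\<^sub>M e\<in>E. lborel) \<rightarrow>\<^sub>M restrict_space borel V"
    by (rule measurable_restrict_space2) (auto intro: onb_map_in)
  have [measurable]: "(\<lambda>x. x) \<in> restrict_space borel V \<rightarrow>\<^sub>M borel"
    by (rule measurable_restrict_space1) simp
  show "(\<lambda>x. x) \<in> ?M \<rightarrow>\<^sub>M borel" by simp
  show "sub_lborel V = distr ?M borel (\<lambda>x. x)"
    by (subst distr_distr) (simp_all add: sub_lborel_alt comp_def)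
qed

text \<open>Orthonormal coordinates are bounded by the norm, so the preimage of a ball lies in a
  cube.\<close>

lemma emeasure_sub_lborel_bounded:
  assumes "bounded K" shows "emeasure (sub_lborel V) K < \<infinity>"
proof -
  obtain R where R: "\<And>x. x \<in> K \<Longrightarrow> norm x \<le> R" using assms by (auto simp: bounded_iff)
  have "emeasure (sub_lborel V) K \<le> emeasure (sub_lborel V) (cball 0 R)"
    using R by (intro emeasure_mono) (auto simp: dist_norm)
  also have "\<dots> = emeasure (\<Pi>\<^sub>M e\<in>E. lborel) ((\<lambda>t. \<Sum>e\<in>E. t e *\<^sub>R e) -` cball 0 R \<inter> space (\<Pi>\<^sub>M e\<in>E. lborel))"
    unfolding sub_lborel_alt by (rule emeasure_distr) auto
  also have "\<dots> \<le> emeasure (\<Pi>\<^sub>M e\<in>E. lborel) (\<Pi>\<^sub>E e\<in>E. {-R..R})"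
  proof (rule emeasure_mono)
    show "(\<lambda>t. \<Sum>e\<in>E. t e *\<^sub>R e) -` cball 0 R \<inter> space (\<Pi>\<^sub>M e\<in>E. lborel) \<subseteq> (\<Pi>\<^sub>E e\<in>E. {-R..R})"
    proof (clarsimp simp: space_PiM PiE_iff)
      fix t e assume t: "norm (\<Sum>e\<in>E. t e *\<^sub>R e) \<le> R" and e: "e \<in> E"
      have "\<bar>t e\<bar> = \<bar>(\<Sum>e\<in>E. t e *\<^sub>R e) \<bullet> e\<bar>" using onb_inner[OF e] by simp
      also have "\<dots> \<le> norm (\<Sum>e\<in>E. t e *\<^sub>R e) * norm e" by (rule Cauchy_Schwarz_ineq2)
      also have "\<dots> \<le> R" using t some_onb(1) e by (simp add: is_orthonormal_basis_def)
      finally show "- R \<le> t e \<and> t e \<le> R" by auto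
    qed
  qed (use some_onb(2) in \<open>auto intro!: sets_PiM_I_finite\<close>)
  also have "\<dots> = (\<Prod>e\<in>E. emeasure lborel {-R..R})" using some_onb(2) by (intro product_lborel.emeasure_PiM) auto
  also have "\<dots> < \<infinity>" by (cases "0 \<le> R") (simp_all add: ennreal_power less_top[symmetric] emeasure_lborel_Icc_eq power_0_left)
  finally show ?thesis .
qed

lemma emeasure_sub_lborel_UNIV: "emeasure (sub_lborel V) UNIV \<noteq> 0"
proof -
  have "emeasure (sub_lborel V) UNIV = emeasure (\<Pi>\<^sub>M e\<in>E. lborel :: real measure) (\<Pi>\<^sub>E e\<in>E. UNIV)"
    unfolding sub_lborel_alt by (subst emeasure_distr) (auto simp: space_PiM)
  also have "\<dots> = (\<Prod>e\<in>E. emeasure lborel (UNIV :: real set))" using some_onb(2) by (intro product_lborel.emeasure_PiM) auto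
  also have "\<dots> \<noteq> 0" using some_onb(2) by simp
  finally show ?thesis .
qed

lemma sub_lborel_AE_in: "AE x in sub_lborel V. x \<in> V"
proof -
  have "closed V" by (rule closed_subspace[OF V])
  then have [measurable]: "V \<in> sets borel" by simp
  show ?thesis unfolding sub_lborel_alt by (subst AE_distr_iff) (auto intro: onb_map_in)
qed

text \<open>In orthonormal coordinates the translation by v shifts the coordinate of e by
  \<open>v \<bullet> e\<close>; the product measure is determined by boxes, and on these every
  factor is invariant.\<close>

lemma sub_lborel_translate:
  assumes v: "v \<in> V" shows "distr (sub_lborel V) borel (\<lambda>x. x + v) = sub_lborel V"
proof -
  let ?P = "\<Pi>\<^sub>M e\<in>E. lborel :: real measure"
  let ?S = "\<lambda>t. \<lambda>e\<in>E. t e + v \<bullet> e"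
  have S[measurable]: "?S \<in> ?P \<rightarrow>\<^sub>M ?P" by measurable
  have tr: "emeasure lborel ((\<lambda>x. x + c) -` A) = emeasure lborel A" if "A \<in> sets borel" for c :: real and A
  proof -
    have "emeasure lborel ((+) c -` A) = emeasure lborel A"
      using that arg_cong[OF lborel_distr_plus[of c], of "\<lambda>M. emeasure M A"] by (simp add: emeasure_distr)
    moreover have "(+) c -` A = (\<lambda>x. x + c) -` A" by (auto simp: add.commute)
    ultimately show ?thesis by (simp only:)
  qed
  have "distr ?P ?P ?S = ?P"
  proof (rule product_lborel.PiM_eqI[OF some_onb(2)])
    fix A :: "'a \<Rightarrow> real set" assume A: "\<And>e. e \<in> E \<Longrightarrow> A e \<in> sets lborel"
    have "emeasure (distr ?P ?P ?S) (Pi\<^sub>E E A) = emeasure ?P (?S -` Pi\<^sub>E E A \<inter> space ?P)"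
      using A some_onb(2) by (intro emeasure_distr S sets_PiM_I_finite) auto
    also have "?S -` Pi\<^sub>E E A \<inter> space ?P = (\<Pi>\<^sub>E e\<in>E. (\<lambda>x. x + v \<bullet> e) -` A e)"
      by (auto simp: space_PiM PiE_iff restrict_def extensional_def)
    also have "emeasure ?P \<dots> = (\<Prod>e\<in>E. emeasure lborel ((\<lambda>x. x + v \<bullet> e) -` A e))"
    proof (rule product_lborel.emeasure_PiM[OF some_onb(2)])
      fix e assume "e \<in> E"
      then have [measurable]: "A e \<in> sets borel" using A by simp
      have "(\<lambda>x. x + v \<bullet> e) -` A e \<inter> space borel \<in> sets borel"
        by (rule measurable_sets[of _ borel borel]) auto
      then show "(\<lambda>x. x + v \<bullet> e) -` A e \<in> sets lborel" by simp
    qed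
    also have "\<dots> = (\<Prod>e\<in>E. emeasure lborel (A e))" using A tr by (intro prod.cong) auto
    finally show "emeasure (distr ?P ?P ?S) (Pi\<^sub>E E A) = (\<Prod>e\<in>E. emeasure lborel (A e))" .
  qed simp
  then have "sub_lborel V = distr (distr ?P ?P ?S) borel (\<lambda>t. \<Sum>e\<in>E. t e *\<^sub>R e)"
    by (simp add: sub_lborel_alt)
  also have "\<dots> = distr ?P borel (\<lambda>t. (\<Sum>e\<in>E. t e *\<^sub>R e) + v)"
  proof (subst distr_distr)
    have "(\<Sum>e\<in>E. ?S t e *\<^sub>R e) = (\<Sum>e\<in>E. t e *\<^sub>R e) + v" for t
      using onb_repr[OF v] by (simp add: scaleR_add_left sum.distrib cong: sum.cong)
    then show "distr ?P borel ((\<lambda>t. \<Sum>e\<in>E. t e *\<^sub>R e) \<circ> ?S) = distr ?P borel (\<lambda>t. (\<Sum>e\<in>E. t e *\<^sub>R e) + v)"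
      by (simp add: comp_def)
  qed auto
  also have "\<dots> = distr (sub_lborel V) borel (\<lambda>x. x + v)"
    unfolding sub_lborel_alt by (subst distr_distr) (auto simp: comp_def)
  finally show ?thesis by simp
qed

end

lemma sigma_finite_bounded:
  fixes M :: "'a::euclidean_space measure"
  assumes "sets M = sets borel" "\<And>K. bounded K \<Longrightarrow> emeasure M K < \<infinity>"
  shows "sigma_finite_measure M"
proof
  have sp: "space M = UNIV" using sets_eq_imp_space_eq[OF assms(1)] by simp
  show "\<exists>A. countable A \<and> A \<subseteq> sets M \<and> \<Union>A = space M \<and> (\<forall>a\<in>A. emeasure M a \<noteq> \<infinity>)"
  proof (intro exI conjI ballI)
    let ?A = "range (\<lambda>n::nat. cball (0::'a) (real n))"
    show "countable ?A" "?A \<subseteq> sets M" by (auto simp: assms(1))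
    show "\<Union>?A = space M" by (auto simp: sp dist_norm real_arch_simple)
    show "emeasure M a \<noteq> \<infinity>" if "a \<in> ?A" for a using that assms(2)[of a] by (auto simp: less_top)
  qed
qed

lemma sigma_finite_sub_lborel: "subspace V \<Longrightarrow> sigma_finite_measure (sub_lborel V)"
  by (rule sigma_finite_bounded) (auto intro: emeasure_sub_lborel_bounded[OF _ refl, simplified])

text \<open>Here f need not be Borel: agreement with g off a null set makes it measurable for the
  completion, and on Borel functions the completion does not change the quasi-norm.\<close>

lemma Lp_subspace_lebesgue:
  assumes V: "subspace V" and g[measurable]: "g \<in> borel_measurable borel" and ae: "AE x in sub_lborel V. f x = g x"
  shows "Lp_quasi_norm (subspace_lebesgue V) p f = Lp_quasi_norm (sub_lborel V) p g"
proof -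
  obtain M where M: "subspace_lebesgue V = completion M" "sub_lborel V = distr M borel (\<lambda>x. x)"
    and [measurable]: "(\<lambda>x. x) \<in> M \<rightarrow>\<^sub>M borel"
    using subspace_lebesgue_alt[OF V refl] by blast
  have gM[measurable]: "g \<in> borel_measurable M"
    using measurable_compose[OF \<open>(\<lambda>x. x) \<in> M \<rightarrow>\<^sub>M borel\<close> g] .
  have ae': "AE x in M. f x = g x" by (rule AE_distrD[of "\<lambda>x. x" M borel, OF _ ae[unfolded M(2)]]) fact
  have "Lp_quasi_norm (completion M) p f = Lp_quasi_norm (completion M) p g"
  proof (rule Lp_AE_cong)
    show "f \<in> borel_measurable (completion M)" by (rule measurable_completion_AE[OF gM ae']) simp
    show "AE x in completion M. f x = g x" by (rule AE_completion[OF ae'])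
  qed (rule measurable_completion[OF gM])
  also have "\<dots> = Lp_quasi_norm M p g" by (rule Lp_completion[OF gM])
  also have "\<dots> = Lp_quasi_norm (sub_lborel V) p g" unfolding M(2) by (subst Lp_distr) auto
  finally show ?thesis by (simp add: M(1))
qed

section \<open>Direct sums of subspaces and their product measure\<close>

fun list_sum_set :: "'a::euclidean_space set list \<Rightarrow> 'a set" where
  "list_sum_set [] = {0}"
| "list_sum_set (V # Vs) = {x + y | x y. x \<in> V \<and> y \<in> list_sum_set Vs}"

text \<open>The tail of a decomposition of the space no longer spans it, so inductions over the list
  of subspaces keep only the independence of the summands; \<open>list_sum_set\<close> records what
  they span.\<close>

fun indep_list :: "'a::euclidean_space set list \<Rightarrow> bool" where
  "indep_list [] = True"
| "indep_list (V # Vs) = (subspace V \<and> V \<inter> list_sum_set Vs = {0} \<and> indep_list Vs)"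

lemma list_sum_set_iff: "x \<in> list_sum_set Vs \<longleftrightarrow> (\<exists>xs. list_all2 (\<in>) xs Vs \<and> sum_list xs = x)"
proof (induction Vs arbitrary: x)
  case Nil show ?case by auto
next
  case (Cons V Vs)
  show ?case
  proof
    assume "x \<in> list_sum_set (V # Vs)"
    then obtain a y where "x = a + y" "a \<in> V" "y \<in> list_sum_set Vs" by auto
    then obtain ys where "list_all2 (\<in>) (a # ys) (V # Vs)" "sum_list (a # ys) = x" using Cons.IH[of y] by auto
    then show "\<exists>xs. list_all2 (\<in>) xs (V # Vs) \<and> sum_list xs = x" by blast
  next
    assume "\<exists>xs. list_all2 (\<in>) xs (V # Vs) \<and> sum_list xs = x"
    then obtain a ys where "a \<in> V" "list_all2 (\<in>) ys Vs" "a + sum_list ys = x" by (auto simp: list_all2_Cons2)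
    moreover have "sum_list ys \<in> list_sum_set Vs" using Cons.IH calculation by blast
    ultimately show "x \<in> list_sum_set (V # Vs)" by auto
  qed
qed

lemma subspace_list_sum_set: "\<forall>V\<in>set Vs. subspace V \<Longrightarrow> subspace (list_sum_set Vs)"
proof (induction Vs)
  case (Cons V Vs)
  then show ?case using subspace_sums[of V "list_sum_set Vs"] by simp
qed simp

lemma indep_list_subspace: "indep_list Vs \<Longrightarrow> \<forall>V\<in>set Vs. subspace V"
  by (induction Vs) auto

lemma indep_listI:
  assumes "\<forall>V\<in>set Vs. subspace V"
    and "\<And>xs ys. list_all2 (\<in>) xs Vs \<Longrightarrow> list_all2 (\<in>) ys Vs \<Longrightarrow> sum_list xs = sum_list ys \<Longrightarrow> xs = ys"
  shows "indep_list Vs"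
  using assms
proof (induction Vs)
  case (Cons V Vs)
  have V: "subspace V" "0 \<in> V" using Cons.prems(1) by (auto intro: subspace_0)
  have z: "list_all2 (\<in>) (map (\<lambda>_. 0) Vs) Vs" using Cons.prems(1)
    by (auto simp: list_all2_conv_all_nth intro: subspace_0)
  have "sum_list (map (\<lambda>_. 0::'a) Vs) = 0" by (induction Vs) auto
  have "v = 0" if v: "v \<in> V" "v \<in> list_sum_set Vs" for v
  proof -
    obtain ys where "list_all2 (\<in>) ys Vs" "sum_list ys = v" using v(2) list_sum_set_iff by blast
    then have "v # map (\<lambda>_. 0) Vs = 0 # ys" using v V z \<open>sum_list (map (\<lambda>_. 0::'a) Vs) = 0\<close>
      by (intro Cons.prems(2)) auto
    then show ?thesis by simp
  qed
  moreover have "0 \<in> list_sum_set Vs" using Cons.prems(1) subspace_list_sum_set[of Vs] by (auto intro: subspace_0)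
  moreover have "indep_list Vs"
  proof (rule Cons.IH)
    fix xs ys assume "list_all2 (\<in>) xs Vs" "list_all2 (\<in>) ys Vs" "sum_list xs = sum_list ys"
    then have "0 # xs = 0 # ys" using V by (intro Cons.prems(2)) auto
    then show "xs = ys" by simp
  qed (use Cons.prems in auto)
  ultimately show ?case using V by auto
qed auto

lemma direct_sum_decomposition_indep:
  assumes "direct_sum_decomposition Vs"
  shows "indep_list Vs" "list_sum_set Vs = UNIV"
proof -
  show "list_sum_set Vs = UNIV" using assms unfolding direct_sum_decomposition_def set_eq_iff list_sum_set_iff by blast
  show "indep_list Vs" using assms unfolding direct_sum_decomposition_def by (intro indep_listI) blast+
qed

text \<open>For independent subspaces this is, up to a constant factor, Lebesgue measure on their
  sum: the image of the product measure under addition. Over the empty list it is the point mass at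
  0, matching \<open>mixed_ennnorm [] f = f 0\<close>.\<close>

fun sum_lborel :: "'a::euclidean_space set list \<Rightarrow> 'a measure" where
  "sum_lborel [] = return borel 0"
| "sum_lborel (V # Vs) = distr (sub_lborel V \<Otimes>\<^sub>M sum_lborel Vs) borel (\<lambda>(x, y). x + y)"

lemma sets_sum_lborel [simp, measurable_cong]: "sets (sum_lborel Vs) = sets borel"
  by (cases Vs) auto

lemma space_sum_lborel [simp]: "space (sum_lborel Vs) = UNIV"
  by (cases Vs) auto

text \<open>The summands need not be orthogonal, so boundedness of the projections is obtained by
  compactness: the unit sphere of V has positive distance d from the closed set W, and scaling gives
  \<open>d * norm x \<le> norm (x + y)\<close>.\<close>

lemma bounded_direct_sum:
  fixes V W :: "'a::euclidean_space set"
  assumes "subspace V" "subspace W" "V \<inter> W = {0}"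
  obtains c where "c > 0" "\<And>x y. x \<in> V \<Longrightarrow> y \<in> W \<Longrightarrow> norm x \<le> c * norm (x + y) \<and> norm y \<le> c * norm (x + y)"
proof -
  have "\<exists>d>0. \<forall>x\<in>V \<inter> sphere 0 1. \<forall>y\<in>W. d \<le> dist x y"
  proof (rule separate_compact_closed)
    show "compact (V \<inter> sphere 0 1)" using closed_subspace[OF assms(1)] by (simp add: closed_Int_compact)
    show "closed W" by (rule closed_subspace[OF assms(2)])
    have "x = 0" if "x \<in> V" "x \<in> W" for x using that assms(3) by blast
    then show "V \<inter> sphere 0 1 \<inter> W = {}" by fastforce
  qed
  then obtain d where d: "d > 0" "\<And>x y. x \<in> V \<Longrightarrow> norm x = 1 \<Longrightarrow> y \<in> W \<Longrightarrow> d \<le> dist x y"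
    by (metis IntI mem_sphere_0)
  have *: "d * norm x \<le> norm (x + y)" if "x \<in> V" "y \<in> W" for x y
  proof (cases "x = 0")
    case False
    have "d \<le> dist ((1 / norm x) *\<^sub>R x) (- ((1 / norm x) *\<^sub>R y))"
      using that False assms by (intro d) (auto intro: subspace_scale subspace_neg)
    also have "\<dots> = norm ((1 / norm x) *\<^sub>R (x + y))" by (simp add: dist_norm scaleR_add_right)
    also have "\<dots> = norm (x + y) / norm x" by simp
    finally show ?thesis using False by (simp add: field_simps)
  qed simp
  show ?thesis
  proof
    show "1 / d + 1 > 0" using d by (simp add: add_pos_pos)
    fix x y assume xy: "x \<in> V" "y \<in> W"
    have 1: "norm x \<le> (1 / d) * norm (x + y)" using *[OF xy] d by (simp add: field_simps)
    moreover have "norm y \<le> norm (x + y) + norm x" by (metis add_diff_cancel_left' norm_triangle_ineq4)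
    ultimately show "norm x \<le> (1 / d + 1) * norm (x + y) \<and> norm y \<le> (1 / d + 1) * norm (x + y)"
      by (auto simp: distrib_right) (smt (verit) norm_ge_zero)
  qed
qed

lemma sum_lborel_Cons_aux:
  assumes "indep_list (V # Vs)" "sigma_finite_measure (sum_lborel Vs)" and [measurable]: "f \<in> borel_measurable borel"
  shows "(\<integral>\<^sup>+x. f x \<partial>sum_lborel (V # Vs)) = (\<integral>\<^sup>+y. \<integral>\<^sup>+x. f (x + y) \<partial>sub_lborel V \<partial>sum_lborel Vs)"
proof -
  interpret A: sigma_finite_measure "sub_lborel V" using assms by (intro sigma_finite_sub_lborel) auto
  interpret B: sigma_finite_measure "sum_lborel Vs" by fact
  interpret P: pair_sigma_finite "sub_lborel V" "sum_lborel Vs" by standard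
  have "(\<integral>\<^sup>+x. f x \<partial>sum_lborel (V # Vs)) = (\<integral>\<^sup>+z. f (fst z + snd z) \<partial>(sub_lborel V \<Otimes>\<^sub>M sum_lborel Vs))"
    by (simp add: nn_integral_distr case_prod_beta)
  also have "\<dots> = (\<integral>\<^sup>+y. \<integral>\<^sup>+x. f (x + y) \<partial>sub_lborel V \<partial>sum_lborel Vs)"
    by (subst P.nn_integral_snd[symmetric]) auto
  finally show ?thesis .
qed

text \<open>The facts are proved together because the induction step uses Fubini's theorem, hence
  \<sigma>-finiteness of the measure of the tail, which comes from its finiteness on bounded sets;
  it also needs that almost every y lies in the span of the tail.\<close>

lemma sum_lborel_bounded_AE:
  "indep_list Vs \<Longrightarrow> (\<forall>K. bounded K \<longrightarrow> emeasure (sum_lborel Vs) K < \<infinity>) \<and> (AE x in sum_lborel Vs. x \<in> list_sum_set Vs)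
     \<and> emeasure (sum_lborel Vs) UNIV \<noteq> 0"
proof (induction Vs)
  case Nil
  have "emeasure (return borel 0) K < \<infinity>" for K :: "'a set"
  proof -
    have "emeasure (return borel 0) K \<le> emeasure (return borel 0) (UNIV::'a set)" by (rule emeasure_mono) auto
    also have "\<dots> < \<infinity>" by simp
    finally show ?thesis .
  qed
  moreover have "AE x in return borel (0::'a). x = 0" by (subst AE_return) auto
  ultimately show ?case unfolding sum_lborel.simps list_sum_set.simps by auto
next
  case (Cons V Vs)
  then have V: "subspace V" and W: "subspace (list_sum_set Vs)" and VW: "V \<inter> list_sum_set Vs = {0}" and Vs: "indep_list Vs"
    using subspace_list_sum_set indep_list_subspace by auto
  have IH: "\<And>K. bounded K \<Longrightarrow> emeasure (sum_lborel Vs) K < \<infinity>" "AE x in sum_lborel Vs. x \<in> list_sum_set Vs"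
     "emeasure (sum_lborel Vs) UNIV \<noteq> 0"
    using Cons.IH[OF Vs] by auto
  have sf: "sigma_finite_measure (sum_lborel Vs)" using IH by (intro sigma_finite_bounded) auto
  interpret A: sigma_finite_measure "sub_lborel V" using V by (intro sigma_finite_sub_lborel) auto
  interpret B: sigma_finite_measure "sum_lborel Vs" by fact
  interpret P: pair_sigma_finite "sub_lborel V" "sum_lborel Vs" by standard
  obtain c where c: "c > 0" "\<And>x y. x \<in> V \<Longrightarrow> y \<in> list_sum_set Vs \<Longrightarrow> norm x \<le> c * norm (x + y) \<and> norm y \<le> c * norm (x + y)"
    using bounded_direct_sum[OF V W VW] by blast
  have "emeasure (sum_lborel (V # Vs)) K < \<infinity>" if K: "bounded K" for K
  proof -
    obtain R where R: "\<And>x. x \<in> K \<Longrightarrow> norm x \<le> R" using K by (auto simp: bounded_iff)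
    let ?D = "cball (0::'a) (c * R)"
    have [measurable]: "?D \<in> sets borel" by simp
    have "emeasure (sum_lborel (V # Vs)) K \<le> emeasure (sum_lborel (V # Vs)) (cball 0 R)"
      using R by (intro emeasure_mono) (auto simp: dist_norm)
    also have "\<dots> = (\<integral>\<^sup>+x. indicator (cball 0 R) x \<partial>sum_lborel (V # Vs))" by (subst nn_integral_indicator) auto
    also have "\<dots> = (\<integral>\<^sup>+y. \<integral>\<^sup>+x. indicator (cball 0 R) (x + y) \<partial>sub_lborel V \<partial>sum_lborel Vs)"
      by (rule sum_lborel_Cons_aux[OF Cons.prems sf], rule borel_measurable_indicator) simp
    \<comment> \<open>If x + y lies in the ball of radius R, both components lie in the ball of
      radius c R, so the set is dominated by a product of balls.\<close>
    also have "\<dots> \<le> (\<integral>\<^sup>+y. \<integral>\<^sup>+x. indicator ?D x * indicator ?D y \<partial>sub_lborel V \<partial>sum_lborel Vs)"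
    proof (rule nn_integral_mono_AE)
      show "AE y in sum_lborel Vs. (\<integral>\<^sup>+x. indicator (cball 0 R) (x + y) \<partial>sub_lborel V)
         \<le> (\<integral>\<^sup>+x. indicator ?D x * indicator ?D y \<partial>sub_lborel V)"
        using IH(2)
      proof eventually_elim
        fix y assume y: "y \<in> list_sum_set Vs"
        show "(\<integral>\<^sup>+x. indicator (cball 0 R) (x + y) \<partial>sub_lborel V)
         \<le> (\<integral>\<^sup>+x. indicator ?D x * indicator ?D y \<partial>sub_lborel V)"
        proof (rule nn_integral_mono_AE)
          show "AE x in sub_lborel V. indicator (cball 0 R) (x + y) \<le> (indicator ?D x * indicator ?D y :: ennreal)"
            using sub_lborel_AE_in[OF V refl]
          proof eventually_elim
            fix x assume x: "x \<in> V"
            have "norm (x + y) \<le> R \<Longrightarrow> norm x \<le> c * R \<and> norm y \<le> c * R"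
              using c(2)[OF x y] c(1) by (meson less_imp_le mult_left_mono order_trans)
            then show "indicator (cball 0 R) (x + y) \<le> (indicator ?D x * indicator ?D y :: ennreal)"
              by (auto simp: indicator_def)
          qed
        qed
      qed
    qed
    also have "\<dots> = (\<integral>\<^sup>+y. emeasure (sub_lborel V) ?D * indicator ?D y \<partial>sum_lborel Vs)"
      by (rule nn_integral_cong) (subst nn_integral_multc, auto)
    also have "\<dots> = emeasure (sub_lborel V) ?D * emeasure (sum_lborel Vs) ?D" by (subst nn_integral_cmult) auto
    also have "\<dots> < \<infinity>" using IH(1)[of ?D] emeasure_sub_lborel_bounded[OF V refl, of ?D]
      by (simp add: ennreal_mult_less_top)
    finally show ?thesis .
  qed
  moreover have "AE x in sum_lborel (V # Vs). x \<in> list_sum_set (V # Vs)"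
  proof -
    let ?S = "list_sum_set (V # Vs)"
    have "\<forall>V\<in>set (V # Vs). subspace V" using indep_list_subspace[OF Cons.prems] by simp
    then have "closed ?S" by (intro closed_subspace subspace_list_sum_set)
    then have [measurable]: "?S \<in> sets borel" by (rule borel_closed)
    have "AE x in sub_lborel V. AE y in sum_lborel Vs. x + y \<in> ?S"
      using sub_lborel_AE_in[OF V refl]
    proof eventually_elim
      fix x assume "x \<in> V"
      then show "AE y in sum_lborel Vs. x + y \<in> ?S" using IH(2) by (auto elim!: eventually_mono)
    qed
    then have "AE z in sub_lborel V \<Otimes>\<^sub>M sum_lborel Vs. fst z + snd z \<in> ?S"
    proof -
      assume ae: "AE x in sub_lborel V. AE y in sum_lborel Vs. x + y \<in> ?S"
      have "{z \<in> space (sub_lborel V \<Otimes>\<^sub>M sum_lborel Vs). fst z + snd z \<in> ?S} \<in> sets (sub_lborel V \<Otimes>\<^sub>M sum_lborel Vs)"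
        by measurable
      from P.AE_pair_measure[OF this] ae show ?thesis by (simp only: fst_conv snd_conv)
    qed
    then show ?thesis unfolding sum_lborel.simps by (subst AE_distr_iff) (auto simp: case_prod_beta simp del: list_sum_set.simps)
  qed
  moreover have "emeasure (sum_lborel (V # Vs)) UNIV \<noteq> 0"
  proof -
    have "emeasure (sum_lborel (V # Vs)) UNIV = emeasure (sub_lborel V \<Otimes>\<^sub>M sum_lborel Vs) (UNIV \<times> UNIV)"
      unfolding sum_lborel.simps by (subst emeasure_distr) (auto simp: space_pair_measure)
    also have "\<dots> = emeasure (sub_lborel V) UNIV * emeasure (sum_lborel Vs) UNIV"
      by (intro B.emeasure_pair_measure_Times) auto
    finally show ?thesis using IH(3) emeasure_sub_lborel_UNIV[OF V refl] by simp
  qed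
  ultimately show ?case by blast
qed

lemma sigma_finite_sum_lborel: "indep_list Vs \<Longrightarrow> sigma_finite_measure (sum_lborel Vs)"
  using sum_lborel_bounded_AE by (intro sigma_finite_bounded) auto

lemma nn_integral_sum_lborel_Cons:
  assumes "indep_list (V # Vs)" "f \<in> borel_measurable borel"
  shows "(\<integral>\<^sup>+x. f x \<partial>sum_lborel (V # Vs)) = (\<integral>\<^sup>+y. \<integral>\<^sup>+x. f (x + y) \<partial>sub_lborel V \<partial>sum_lborel Vs)"
  using assms sigma_finite_sum_lborel[of Vs] by (intro sum_lborel_Cons_aux) auto

section \<open>Mixed quasi-norms of Borel functions\<close>

text \<open>The mixed quasi-norm with uncompleted measures. On Borel functions every slice and every
  intermediate norm is Borel, so the lemmas on a single exponent can be applied level by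
  level.\<close>

fun borel_mixed :: "'a::euclidean_space mixed_space \<Rightarrow> ('a \<Rightarrow> ennreal) \<Rightarrow> ennreal" where
  "borel_mixed [] f = f 0"
| "borel_mixed ((V, p) # B) f = borel_mixed B (\<lambda>y. Lp_quasi_norm (sub_lborel V) p (\<lambda>x. f (x + y)))"

lemma Lp_slice_measurable [measurable]:
  assumes "subspace V" and [measurable]: "f \<in> borel_measurable borel"
  shows "(\<lambda>y. Lp_quasi_norm (sub_lborel V) p (\<lambda>x. f (x + y))) \<in> borel_measurable borel"
  by (rule Lp_measurable_param[OF sigma_finite_sub_lborel[OF assms(1)]]) measurable

text \<open>By Fubini's theorem a null set of the product measure meets almost every slice in a null
  set, so the inner quasi-norms agree almost everywhere for the measure of the tail, which is the
  hypothesis one level further out.\<close>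

lemma mixed_ennnorm_eq_borel_mixed:
  assumes "indep_list (map fst B)" "g \<in> borel_measurable borel" "AE x in sum_lborel (map fst B). f x = g x"
  shows "mixed_ennnorm B f = borel_mixed B g"
  using assms
proof (induction B arbitrary: f g)
  case Nil
  \<comment> \<open>A null set of the point mass at 0 cannot contain 0, so
    \<open>f 0 = g 0\<close>.\<close>
  have "AE x in return borel (0::'a). f x = g x" using Nil.prems(3) unfolding list.map sum_lborel.simps .
  then obtain N where "{x \<in> space (return borel (0::'a)). f x \<noteq> g x} \<subseteq> N"
      "emeasure (return borel (0::'a)) N = 0" "N \<in> sets (return borel (0::'a))"
    by (rule AE_E)
  then show ?case by (cases "0 \<in> N") auto
next
  case (Cons b B)
  obtain V p where b: "b = (V, p)" by (cases b)
  let ?Vs = "map fst B"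
  have V: "subspace V" and Vs: "indep_list ?Vs" using Cons.prems b by auto
  have [measurable]: "g \<in> borel_measurable borel" by fact
  interpret A: sigma_finite_measure "sub_lborel V" using V by (rule sigma_finite_sub_lborel)
  interpret B: sigma_finite_measure "sum_lborel ?Vs" using Vs by (rule sigma_finite_sum_lborel)
  interpret P: pair_sigma_finite "sub_lborel V" "sum_lborel ?Vs" by standard
  have "AE x in sum_lborel (V # ?Vs). f x = g x" using Cons.prems(3) unfolding b list.map fst_conv .
  then obtain N where "{x \<in> space (sum_lborel (V # ?Vs)). f x \<noteq> g x} \<subseteq> N"
      "emeasure (sum_lborel (V # ?Vs)) N = 0" "N \<in> sets (sum_lborel (V # ?Vs))"
    by (rule AE_E)
  then have N: "{x. f x \<noteq> g x} \<subseteq> N" "N \<in> null_sets (sum_lborel (V # ?Vs))" by auto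
  then have [measurable]: "N \<in> sets borel" by auto
  have "AE x in sum_lborel (V # ?Vs). x \<notin> N" using N(2) by (rule AE_not_in)
  then have "AE z in sub_lborel V \<Otimes>\<^sub>M sum_lborel ?Vs. fst z + snd z \<notin> N"
    unfolding sum_lborel.simps by (subst (asm) AE_distr_iff) (auto simp: case_prod_beta)
  then have "AE y in sum_lborel ?Vs. AE x in sub_lborel V. x + y \<notin> N"
  proof -
    assume ae: "AE z in sub_lborel V \<Otimes>\<^sub>M sum_lborel ?Vs. fst z + snd z \<notin> N"
    have "{z \<in> space (sub_lborel V \<Otimes>\<^sub>M sum_lborel ?Vs). fst z + snd z \<notin> N} \<in> sets (sub_lborel V \<Otimes>\<^sub>M sum_lborel ?Vs)"
      by measurable
    then show ?thesis using P.AE_commute[of "\<lambda>x y. x + y \<notin> N"] P.AE_pair[OF ae] by simp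
  qed
  then have "AE y in sum_lborel ?Vs. Lp_quasi_norm (subspace_lebesgue V) p (\<lambda>x. f (x + y))
      = Lp_quasi_norm (sub_lborel V) p (\<lambda>x. g (x + y))"
  proof eventually_elim
    fix y assume "AE x in sub_lborel V. x + y \<notin> N"
    then have "AE x in sub_lborel V. f (x + y) = g (x + y)" using N(1) by (auto elim!: eventually_mono)
    then show "Lp_quasi_norm (subspace_lebesgue V) p (\<lambda>x. f (x + y))
      = Lp_quasi_norm (sub_lborel V) p (\<lambda>x. g (x + y))"
      by (intro Lp_subspace_lebesgue[OF V]) measurable
  qed
  then show ?case unfolding b mixed_ennnorm.simps borel_mixed.simps
    by (intro Cons.IH[OF Vs]) (use V in measurable)
qed

definition valid_mixed :: "'a::euclidean_space mixed_space \<Rightarrow> bool" where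
  "valid_mixed B \<longleftrightarrow> indep_list (map fst B) \<and> (\<forall>p\<in>set (map snd B). 0 < p)"

lemma valid_mixed_Cons [simp]: "valid_mixed ((V, p) # B) \<longleftrightarrow>
   subspace V \<and> V \<inter> list_sum_set (map fst B) = {0} \<and> 0 < p \<and> valid_mixed B"
  by (auto simp: valid_mixed_def)

lemma borel_mixed_mono:
  assumes "valid_mixed B" "f \<in> borel_measurable borel" "g \<in> borel_measurable borel" "\<And>x. f x \<le> g x"
  shows "borel_mixed B f \<le> borel_mixed B g"
  using assms
proof (induction B arbitrary: f g)
  case (Cons b B)
  obtain V p where b: "b = (V, p)" by (cases b)
  have V: "subspace V" "0 < p" and Vs: "valid_mixed B" using Cons.prems b by auto
  have [measurable]: "f \<in> borel_measurable borel" "g \<in> borel_measurable borel" by fact+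
  show ?case unfolding b borel_mixed.simps
    using Cons.prems(4) V by (intro Cons.IH[OF Vs] Lp_mono) (auto intro!: Lp_slice_measurable)
qed auto

lemma borel_mixed_cmult:
  assumes "valid_mixed B" "f \<in> borel_measurable borel" "c \<noteq> top"
  shows "borel_mixed B (\<lambda>x. c * f x) = c * borel_mixed B f"
  using assms
proof (induction B arbitrary: f)
  case (Cons b B)
  obtain V p where b: "b = (V, p)" by (cases b)
  have V: "subspace V" "0 < p" and Vs: "valid_mixed B" using Cons.prems b by auto
  have [measurable]: "f \<in> borel_measurable borel" by fact+
  have "(\<lambda>y. Lp_quasi_norm (sub_lborel V) p (\<lambda>x. c * f (x + y))) = (\<lambda>y. c * Lp_quasi_norm (sub_lborel V) p (\<lambda>x. f (x + y)))"
    using V assms(3) by (intro ext Lp_cmult) auto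
  then show ?case unfolding b borel_mixed.simps using Cons.IH[OF Vs _ assms(3)] Lp_slice_measurable[OF V(1)] by simp
qed auto

definition mixed_const :: "'a mixed_space \<Rightarrow> real" where
  "mixed_const B = prod_list (map (Lp_const \<circ> snd) B)"

lemma mixed_const_ge_1: "1 \<le> mixed_const B"
proof (induction B)
  case (Cons b B)
  have "1 * 1 \<le> Lp_const (snd b) * mixed_const B"
    using Cons Lp_const_ge_1[of "snd b"] by (intro mult_mono) auto
  then show ?case by (simp add: mixed_const_def)
qed (simp add: mixed_const_def)

lemma borel_mixed_triangle:
  assumes "valid_mixed B" "f \<in> borel_measurable borel" "g \<in> borel_measurable borel"
  shows "borel_mixed B (\<lambda>x. f x + g x) \<le> ennreal (mixed_const B) * (borel_mixed B f + borel_mixed B g)"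
  using assms
proof (induction B arbitrary: f g)
  case (Cons b B)
  obtain V p where b: "b = (V, p)" by (cases b)
  have V: "subspace V" "0 < p" and Vs: "valid_mixed B" using Cons.prems b by auto
  have [measurable]: "f \<in> borel_measurable borel" "g \<in> borel_measurable borel" by fact+
  let ?F = "\<lambda>y. Lp_quasi_norm (sub_lborel V) p (\<lambda>x. f (x + y))"
  let ?G = "\<lambda>y. Lp_quasi_norm (sub_lborel V) p (\<lambda>x. g (x + y))"
  have [measurable]: "?F \<in> borel_measurable borel" "?G \<in> borel_measurable borel"
     "(\<lambda>y. Lp_quasi_norm (sub_lborel V) p (\<lambda>x. f (x + y) + g (x + y))) \<in> borel_measurable borel"
    using V(1) Lp_slice_measurable[of V "\<lambda>x. f x + g x" p] by (auto intro!: Lp_slice_measurable)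
  have "borel_mixed (b # B) (\<lambda>x. f x + g x) \<le> borel_mixed B (\<lambda>y. ennreal (Lp_const p) * (?F y + ?G y))"
    unfolding b borel_mixed.simps using V by (intro borel_mixed_mono Vs Lp_triangle) auto
  also have "\<dots> = ennreal (Lp_const p) * borel_mixed B (\<lambda>y. ?F y + ?G y)" by (rule borel_mixed_cmult[OF Vs]) auto
  also have "\<dots> \<le> ennreal (Lp_const p) * (ennreal (mixed_const B) * (borel_mixed B ?F + borel_mixed B ?G))"
    by (intro mult_left_mono Cons.IH Vs) auto
  also have "\<dots> = ennreal (mixed_const (b # B)) * (borel_mixed (b # B) f + borel_mixed (b # B) g)"
    using Lp_const_ge_1[of p] mixed_const_ge_1[of B] by (simp add: b mixed_const_def ennreal_mult mult.assoc)
  finally show ?case .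
qed (simp add: mixed_const_def)

lemma borel_mixed_Fatou:
  assumes "valid_mixed B" "\<And>n. f n \<in> borel_measurable borel"
  shows "borel_mixed B (\<lambda>x. liminf (\<lambda>n. f n x)) \<le> liminf (\<lambda>n. borel_mixed B (f n))"
  using assms
proof (induction B arbitrary: f)
  case (Cons b B)
  obtain V p where b: "b = (V, p)" by (cases b)
  have V: "subspace V" "0 < p" and Vs: "valid_mixed B" using Cons.prems b by auto
  have [measurable]: "f n \<in> borel_measurable borel" for n by fact+
  let ?F = "\<lambda>n y. Lp_quasi_norm (sub_lborel V) p (\<lambda>x. f n (x + y))"
  have [measurable]: "?F n \<in> borel_measurable borel"
     "(\<lambda>y. Lp_quasi_norm (sub_lborel V) p (\<lambda>x. liminf (\<lambda>n. f n (x + y)))) \<in> borel_measurable borel" for n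
    using V(1) Lp_slice_measurable[of V "\<lambda>x. liminf (\<lambda>n. f n x)" p] by (auto intro!: Lp_slice_measurable)
  have "borel_mixed (b # B) (\<lambda>x. liminf (\<lambda>n. f n x)) \<le> borel_mixed B (\<lambda>y. liminf (\<lambda>n. ?F n y))"
    unfolding b borel_mixed.simps using V by (intro borel_mixed_mono Vs Lp_Fatou) auto
  also have "\<dots> \<le> liminf (\<lambda>n. borel_mixed B (?F n))" by (intro Cons.IH Vs) auto
  finally show ?case by (simp add: b)
qed simp

text \<open>The component of v in V is absorbed by the invariance of the measure on V; the component
  in the remaining subspaces merely translates the function that is passed on to the outer
  levels.\<close>

lemma borel_mixed_translate:
  assumes "valid_mixed B" "f \<in> borel_measurable borel" "v \<in> list_sum_set (map fst B)"
  shows "borel_mixed B (\<lambda>x. f (x + v)) = borel_mixed B f"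
  using assms
proof (induction B arbitrary: f v)
  case (Cons b B)
  obtain V p where b: "b = (V, p)" by (cases b)
  have V: "subspace V" "0 < p" and Vs: "valid_mixed B" using Cons.prems b by auto
  have [measurable]: "f \<in> borel_measurable borel" by fact+
  obtain a w where v: "v = a + w" "a \<in> V" "w \<in> list_sum_set (map fst B)" using Cons.prems(3) b by auto
  let ?F = "\<lambda>y. Lp_quasi_norm (sub_lborel V) p (\<lambda>x. f (x + y))"
  have "Lp_quasi_norm (sub_lborel V) p (\<lambda>x. f (x + y + v)) = ?F (y + w)" for y
  proof -
    have "?F (y + w) = Lp_quasi_norm (distr (sub_lborel V) borel (\<lambda>x. x + a)) p (\<lambda>x. f (x + (y + w)))"
      by (simp add: sub_lborel_translate[OF V(1) refl v(2)])
    also have "\<dots> = Lp_quasi_norm (sub_lborel V) p (\<lambda>x. f (x + a + (y + w)))" by (rule Lp_distr) auto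
    finally show ?thesis by (simp add: v(1) ac_simps)
  qed
  then have "borel_mixed (b # B) (\<lambda>x. f (x + v)) = borel_mixed B (\<lambda>y. ?F (y + w))" by (simp add: b)
  also have "\<dots> = borel_mixed B ?F" by (intro Cons.IH[OF Vs _ v(3)] Lp_slice_measurable V) auto
  finally show ?case by (simp add: b)
qed simp

text \<open>With all exponents equal to 1 the mixed quasi-norm is an iterated integral. Translation
  invariance of \<open>sum_lborel\<close> thus follows from that of the mixed quasi-norms.\<close>

lemma nn_integral_sum_lborel_eq:
  assumes "indep_list Vs" "f \<in> borel_measurable borel"
  shows "(\<integral>\<^sup>+x. f x \<partial>sum_lborel Vs) = borel_mixed (map (\<lambda>V. (V, 1)) Vs) f"
  using assms
proof (induction Vs arbitrary: f)
  case Nil then show ?case by (simp add: nn_integral_return)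
next
  case (Cons V Vs)
  have [measurable]: "f \<in> borel_measurable borel" by fact+
  interpret A: sigma_finite_measure "sub_lborel V" using Cons.prems by (intro sigma_finite_sub_lborel) auto
  have "(\<integral>\<^sup>+x. f x \<partial>sum_lborel (V # Vs)) = (\<integral>\<^sup>+y. \<integral>\<^sup>+x. f (x + y) \<partial>sub_lborel V \<partial>sum_lborel Vs)"
    by (rule nn_integral_sum_lborel_Cons) (use Cons.prems in auto)
  also have "\<dots> = borel_mixed (map (\<lambda>V. (V, 1)) Vs) (\<lambda>y. \<integral>\<^sup>+x. f (x + y) \<partial>sub_lborel V)"
    using Cons.prems by (intro Cons.IH) auto
  finally show ?case by (simp add: Lp_quasi_norm_def)
qed

lemma nn_integral_sum_lborel_translate:
  assumes "indep_list Vs" "list_sum_set Vs = UNIV" "f \<in> borel_measurable borel"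
  shows "(\<integral>\<^sup>+x. f (x + v) \<partial>sum_lborel Vs) = (\<integral>\<^sup>+x. f x \<partial>sum_lborel Vs)"
proof -
  have [measurable]: "f \<in> borel_measurable borel" by fact
  have "valid_mixed (map (\<lambda>V. (V, 1)) Vs)" using assms(1) by (auto simp: valid_mixed_def comp_def)
  from borel_mixed_translate[OF this assms(3), of v] show ?thesis using assms
    by (simp add: nn_integral_sum_lborel_eq comp_def)
qed

lemma nn_integral_lborel_translate:
  fixes f :: "'a::euclidean_space \<Rightarrow> ennreal"
  assumes [measurable]: "f \<in> borel_measurable borel"
  shows "(\<integral>\<^sup>+x. f (x + v) \<partial>lborel) = (\<integral>\<^sup>+x. f x \<partial>lborel)"
  by (subst lborel_distr_plus[of v, symmetric]) (simp add: nn_integral_distr add.commute)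

text \<open>Uniqueness of translation invariant measures, proved directly: the double integral of
  1_A(x + y) 1_D(y) is evaluated in both orders, with the unit ball D as test set. The purpose is
  that Lebesgue null sets become null sets for iterated integrals, and that local integrals can be
  moved from one measure to the other.\<close>

lemma lborel_eq_sum_lborel:
  fixes Vs :: "'a::euclidean_space set list"
  assumes Vs: "indep_list Vs" "list_sum_set Vs = UNIV"
  obtains c where "0 < c" "c < \<infinity>" "lborel = density (sum_lborel Vs) (\<lambda>_. c)"
proof -
  let ?\<mu> = "sum_lborel Vs"
  interpret M: sigma_finite_measure ?\<mu> by (rule sigma_finite_sum_lborel[OF Vs(1)])
  interpret P: pair_sigma_finite ?\<mu> "lborel :: 'a measure" by standard
  define D where "D = ball (0::'a) 1"
  have [measurable]: "D \<in> sets borel" by (simp add: D_def)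
  have key: "emeasure ?\<mu> A * emeasure lborel D = emeasure lborel A * emeasure ?\<mu> D" if A[measurable]: "A \<in> sets borel" for A
  proof -
    have "emeasure ?\<mu> A * emeasure lborel D = (\<integral>\<^sup>+y. (\<integral>\<^sup>+x. indicator A x \<partial>?\<mu>) * indicator D y \<partial>lborel)"
      by (subst nn_integral_cmult) auto
    also have "\<dots> = (\<integral>\<^sup>+y. (\<integral>\<^sup>+x. indicator A (x + y) \<partial>?\<mu>) * indicator D y \<partial>lborel)"
      by (subst nn_integral_sum_lborel_translate[OF Vs]) auto
    also have "\<dots> = (\<integral>\<^sup>+y. (\<integral>\<^sup>+x. indicator A (x + y) * indicator D y \<partial>?\<mu>) \<partial>lborel)"
      by (intro nn_integral_cong nn_integral_multc[symmetric]) auto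
    also have "\<dots> = (\<integral>\<^sup>+x. (\<integral>\<^sup>+y. indicator A (x + y) * indicator D y \<partial>lborel) \<partial>?\<mu>)"
      by (rule P.Fubini') measurable
    also have "\<dots> = (\<integral>\<^sup>+x. (\<integral>\<^sup>+y. indicator A y * indicator D (y - x) \<partial>lborel) \<partial>?\<mu>)"
    proof (rule nn_integral_cong)
      fix x
      show "(\<integral>\<^sup>+y. indicator A (x + y) * indicator D y \<partial>lborel) = (\<integral>\<^sup>+y. indicator A y * indicator D (y - x) \<partial>lborel)"
        using nn_integral_lborel_translate[of "\<lambda>y. indicator A y * indicator D (y - x)" x] by (simp add: add.commute)
    qed
    also have "\<dots> = (\<integral>\<^sup>+y. (\<integral>\<^sup>+x. indicator A y * indicator D (y - x) \<partial>?\<mu>) \<partial>lborel)"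
      by (rule P.Fubini'[symmetric]) measurable
    \<comment> \<open>The ball is symmetric, so y - x may be replaced by x - y, and then the
      translation in x can be removed.\<close>
    also have "\<dots> = (\<integral>\<^sup>+y. (\<integral>\<^sup>+x. indicator A y * indicator D (x - y) \<partial>?\<mu>) \<partial>lborel)"
      by (auto simp: D_def dist_norm norm_minus_commute indicator_def intro!: nn_integral_cong)
    also have "\<dots> = (\<integral>\<^sup>+y. indicator A y * (\<integral>\<^sup>+x. indicator D (x + (- y)) \<partial>?\<mu>) \<partial>lborel)"
      by (intro nn_integral_cong) (subst nn_integral_cmult, auto)
    also have "\<dots> = (\<integral>\<^sup>+y. indicator A y * emeasure ?\<mu> D \<partial>lborel)"
      by (subst nn_integral_sum_lborel_translate[OF Vs]) auto
    also have "\<dots> = emeasure lborel A * emeasure ?\<mu> D" by (subst nn_integral_multc) auto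
    finally show ?thesis .
  qed
  have muD: "emeasure ?\<mu> D < \<infinity>" using sum_lborel_bounded_AE[OF Vs(1)] by (auto simp: D_def)
  have lD: "emeasure lborel D < \<infinity>" unfolding D_def by (rule emeasure_lborel_ball_finite)
  \<comment> \<open>Otherwise \<open>key\<close> would make the whole space a null set. This keeps
    the quotient c below finite.\<close>
  have "emeasure ?\<mu> D \<noteq> 0"
  proof
    assume "emeasure ?\<mu> D = 0"
    moreover have "emeasure lborel D \<noteq> 0" unfolding D_def
      using content_ball_pos[of 1 "0::'a"] by (auto simp: measure_def)
    ultimately have "emeasure ?\<mu> UNIV = 0" using key[of UNIV] by simp
    then show False using sum_lborel_bounded_AE[OF Vs(1)] by auto
  qed
  define c where "c = emeasure lborel D / emeasure ?\<mu> D"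
  have lD0: "emeasure lborel D \<noteq> 0" unfolding D_def using content_ball_pos[of 1 "0::'a"] by (auto simp: measure_def)
  have c: "emeasure lborel A = c * emeasure ?\<mu> A" if "A \<in> sets borel" for A
  proof -
    have "emeasure lborel A = emeasure lborel A * emeasure ?\<mu> D / emeasure ?\<mu> D"
      using muD \<open>emeasure ?\<mu> D \<noteq> 0\<close> by (simp add: ennreal_mult_divide_eq)
    also have "\<dots> = emeasure ?\<mu> A * emeasure lborel D / emeasure ?\<mu> D" by (simp add: key[OF that])
    finally show ?thesis by (simp add: c_def ennreal_times_divide mult.commute)
  qed
  show ?thesis
  proof (rule that[of c])
    show "0 < c" using lD0 muD by (auto simp: c_def ennreal_zero_less_divide zero_less_iff_neq_zero)
    show "c < \<infinity>" using lD \<open>emeasure ?\<mu> D \<noteq> 0\<close>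
      unfolding c_def infinity_ennreal_def less_top[symmetric] by (simp add: ennreal_divide_eq_top_iff)
    show "lborel = density ?\<mu> (\<lambda>_. c)"
      by (rule measure_eqI) (auto simp: emeasure_density nn_integral_cmult c)
  qed
qed

text \<open>The local embedding \<open>Lp_local\<close> is applied in each subspace in turn: a
  bounded set is contained in a product of balls because the projections are bounded, and the
  constants of the levels multiply. A single r below all exponents lets the iterated integrals of
  r-th powers collapse to one integral over \<open>sum_lborel\<close>.\<close>

lemma borel_mixed_local:
  assumes "valid_mixed B" "0 < r" "\<forall>p\<in>set (map snd B). ennreal r \<le> p" "bounded K" "K \<in> sets borel"
  shows "\<exists>C<\<infinity>. \<forall>f\<in>borel_measurable borel.
    (\<integral>\<^sup>+x. indicator K x * epowr (f x) r \<partial>sum_lborel (map fst B)) \<le> C * epowr (borel_mixed B f) r"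
  using assms
proof (induction B arbitrary: K)
  case Nil
  have [measurable]: "K \<in> sets borel" by fact
  have "(\<integral>\<^sup>+x. indicator K x * epowr (f x) r \<partial>return borel 0) \<le> epowr (f 0) r"
    if [measurable]: "f \<in> borel_measurable borel" for f :: "'a \<Rightarrow> ennreal"
    by (subst nn_integral_return) (auto simp: indicator_def)
  then show ?case by (intro exI[of _ 1]) auto
next
  case (Cons b B)
  obtain V p where b: "b = (V, p)" by (cases b)
  let ?Vs = "map fst B"
  have V: "subspace V" "0 < p" and Vs: "valid_mixed B" and VW: "V \<inter> list_sum_set ?Vs = {0}" using Cons.prems b by auto
  have ind: "indep_list (V # ?Vs)" "indep_list ?Vs" using Cons.prems b by (auto simp: valid_mixed_def)
  have W: "subspace (list_sum_set ?Vs)" using ind subspace_list_sum_set indep_list_subspace by blast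
  obtain c where c: "c > 0" "\<And>x y. x \<in> V \<Longrightarrow> y \<in> list_sum_set ?Vs \<Longrightarrow> norm x \<le> c * norm (x + y) \<and> norm y \<le> c * norm (x + y)"
    using bounded_direct_sum[OF V(1) W VW] by blast
  obtain R where R: "\<And>x. x \<in> K \<Longrightarrow> norm x \<le> R" using Cons.prems by (auto simp: bounded_iff)
  let ?D = "cball (0::'a) (c * R)"
  obtain C where C: "C < \<infinity>" "\<And>f. f\<in>borel_measurable borel \<Longrightarrow>
    (\<integral>\<^sup>+x. indicator ?D x * epowr (f x) r \<partial>sum_lborel ?Vs) \<le> C * epowr (borel_mixed B f) r"
    using Cons.IH[OF Vs, of ?D] Cons.prems by auto
  define S where "S = emeasure (sub_lborel V) ?D + 1"
  have S: "S < \<infinity>" using emeasure_sub_lborel_bounded[OF V(1) refl, of ?D] by (simp add: S_def)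
  interpret A: sigma_finite_measure "sub_lborel V" using V by (intro sigma_finite_sub_lborel)
  have AEW: "AE x in sum_lborel ?Vs. x \<in> list_sum_set ?Vs" using sum_lborel_bounded_AE[OF ind(2)] by simp
  have "(\<integral>\<^sup>+x. indicator K x * epowr (f x) r \<partial>sum_lborel (map fst (b # B))) \<le> (S * C) * epowr (borel_mixed (b # B) f) r"
    if f[measurable]: "f \<in> borel_measurable borel" for f
  proof -
    let ?F = "\<lambda>y. Lp_quasi_norm (sub_lborel V) p (\<lambda>x. f (x + y))"
    have [measurable]: "?F \<in> borel_measurable borel" by (rule Lp_slice_measurable[OF V(1) f])
    have [measurable]: "K \<in> sets borel" by fact
    have [measurable]: "?D \<in> sets borel" by simp
    have "(\<integral>\<^sup>+x. indicator K x * epowr (f x) r \<partial>sum_lborel (map fst (b # B)))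
       = (\<integral>\<^sup>+y. \<integral>\<^sup>+x. indicator K (x + y) * epowr (f (x + y)) r \<partial>sub_lborel V \<partial>sum_lborel ?Vs)"
      using ind b by (simp only: list.map fst_conv, intro nn_integral_sum_lborel_Cons) measurable
    also have "\<dots> \<le> (\<integral>\<^sup>+y. S * (indicator ?D y * epowr (?F y) r) \<partial>sum_lborel ?Vs)"
    proof (rule nn_integral_mono_AE)
      show "AE y in sum_lborel ?Vs. (\<integral>\<^sup>+x. indicator K (x + y) * epowr (f (x + y)) r \<partial>sub_lborel V)
         \<le> S * (indicator ?D y * epowr (?F y) r)"
        using AEW
      proof eventually_elim
        fix y assume y: "y \<in> list_sum_set ?Vs"
        have "(\<integral>\<^sup>+x. indicator K (x + y) * epowr (f (x + y)) r \<partial>sub_lborel V)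
          \<le> (\<integral>\<^sup>+x. indicator ?D y * (indicator ?D x * epowr (f (x + y)) r) \<partial>sub_lborel V)"
        proof (rule nn_integral_mono_AE)
          show "AE x in sub_lborel V. indicator K (x + y) * epowr (f (x + y)) r
             \<le> indicator ?D y * (indicator ?D x * epowr (f (x + y)) r)"
            using sub_lborel_AE_in[OF V(1) refl]
          proof eventually_elim
            fix x assume x: "x \<in> V"
            have "x + y \<in> K \<Longrightarrow> norm x \<le> c * R \<and> norm y \<le> c * R"
              using c(2)[OF x y] c(1) R by (meson less_imp_le mult_left_mono order_trans)
            then show "indicator K (x + y) * epowr (f (x + y)) r
             \<le> indicator ?D y * (indicator ?D x * epowr (f (x + y)) r)"
              by (auto simp: indicator_def)
          qed
        qed
        also have "\<dots> = indicator ?D y * (\<integral>\<^sup>+x. indicator ?D x * epowr (f (x + y)) r \<partial>sub_lborel V)"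
          by (rule nn_integral_cmult) measurable
        also have "\<dots> \<le> indicator ?D y * (S * epowr (?F y) r)"
          unfolding S_def using V Cons.prems b by (intro mult_left_mono Lp_local) auto
        finally show "(\<integral>\<^sup>+x. indicator K (x + y) * epowr (f (x + y)) r \<partial>sub_lborel V)
         \<le> S * (indicator ?D y * epowr (?F y) r)" by (simp add: ac_simps)
      qed
    qed
    also have "\<dots> = S * (\<integral>\<^sup>+y. indicator ?D y * epowr (?F y) r \<partial>sum_lborel ?Vs)"
      by (rule nn_integral_cmult) measurable
    also have "\<dots> \<le> S * (C * epowr (borel_mixed B ?F) r)" by (intro mult_left_mono C) auto
    finally show ?thesis by (simp add: b mult.assoc)
  qed
  then show ?case using S C(1) by (intro exI[of _ "S * C"]) (auto simp: ennreal_mult_less_top)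
qed

section \<open>Entire functions of several variables\<close>

lemma norm_vector_smult: "norm (t *s v) = norm t * norm (v :: complex ^ 'd)"
  by (simp add: norm_vec_def norm_mult L2_set_right_distrib)

lemma bounded_linear_smult_left: "bounded_linear (\<lambda>t. t *s (v :: complex ^ 'd))"
  by (rule bounded_linear_intro[of _ "norm v"])
     (auto simp: vec_eq_iff algebra_simps norm_vector_smult)

lemma bounded_linear_smult_right: "bounded_linear (\<lambda>v. t *s (v :: complex ^ 'd))"
  by (rule bounded_linear_intro[of _ "norm t"])
     (auto simp: vec_eq_iff algebra_simps norm_vector_smult)

lemma entire_has_derivative: "entire F \<Longrightarrow> (F has_derivative frechet_derivative F (at z)) (at z)"
  using frechet_derivative_works unfolding entire_def differentiable_def by blast

lemma entire_derivative_smult: "entire F \<Longrightarrow> frechet_derivative F (at z) (c *s v) = c * frechet_derivative F (at z) v"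
  using frechet_derivative_at unfolding entire_def by metis

lemma entire_differentiable: "entire F \<Longrightarrow> F differentiable (at z)"
  using entire_has_derivative differentiableI by blast

lemma entire_continuous: "entire F \<Longrightarrow> continuous_on S F"
  using entire_differentiable differentiable_imp_continuous_within continuous_at_imp_continuous_on by metis

lemma entireI: "(\<And>z. (F has_derivative D z) (at z)) \<Longrightarrow> (\<And>z c v. D z (c *s v) = c * D z v) \<Longrightarrow> entire F"
  unfolding entire_def by blast

text \<open>Complex linearity of the derivative makes the restriction to each complex line
  holomorphic; the results of one complex variable enter through this.\<close>

lemma entire_line:
  assumes "entire F"
  shows "((\<lambda>t. F (z + t *s v)) has_field_derivative frechet_derivative F (at (z + t *s v)) v) (at t)"
proof -
  have 1: "((\<lambda>t. z + t *s v) has_derivative (\<lambda>h. h *s v)) (at t)"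
    using bounded_linear_imp_has_derivative[OF bounded_linear_smult_left] by (auto intro!: derivative_eq_intros)
  have "((F \<circ> (\<lambda>t. z + t *s v)) has_derivative (frechet_derivative F (at (z + t *s v)) \<circ> (\<lambda>h. h *s v))) (at t)"
    by (rule diff_chain_at[OF 1 entire_has_derivative[OF assms]])
  then show ?thesis
    by (simp add: has_field_derivative_def comp_def entire_derivative_smult[OF assms] mult_commute_abs)
qed

lemma entire_line_holomorphic: "entire F \<Longrightarrow> (\<lambda>t. F (z + t *s v)) holomorphic_on S"
  unfolding holomorphic_on_def field_differentiable_def using has_field_derivative_at_within[OF entire_line] by blast

lemma entire_derivative_line: "entire F \<Longrightarrow> frechet_derivative F (at z) v = deriv (\<lambda>t. F (z + t *s v)) 0"
  using entire_line[of F z v 0] by (simp add: DERIV_imp_deriv)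

lemma entire_Cauchy_bound:
  assumes F: "entire F" and "0 < r" and M: "\<And>t. norm t = r \<Longrightarrow> norm (F (z + t *s v)) \<le> M"
  shows "norm (frechet_derivative F (at z) v) \<le> M / r"
proof -
  have "norm ((deriv ^^ 1) (\<lambda>t. F (z + t *s v)) 0) \<le> fact 1 * M / r ^ 1"
    using M by (intro Cauchy_inequality entire_line_holomorphic[OF F] assms holomorphic_on_imp_continuous_on) auto
  then show ?thesis by (simp add: entire_derivative_line[OF F])
qed

lemma entire_const [intro]: "entire (\<lambda>z. c)"
  by (rule entireI[where D="\<lambda>z v. 0"]) auto

lemma entire_add [intro]:
  assumes "entire F" "entire G" shows "entire (\<lambda>z. F z + G z)"
  by (rule entireI[where D="\<lambda>z v. frechet_derivative F (at z) v + frechet_derivative G (at z) v"])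
     (auto intro!: has_derivative_add entire_has_derivative assms simp: entire_derivative_smult assms algebra_simps)

lemma entire_mult [intro]:
  assumes "entire F" "entire G" shows "entire (\<lambda>z. F z * G z)"
proof (rule entireI)
  show "((\<lambda>z. F z * G z) has_derivative (\<lambda>v. F z * frechet_derivative G (at z) v + frechet_derivative F (at z) v * G z)) (at z)" for z
    by (intro has_derivative_mult entire_has_derivative assms)
qed (simp add: entire_derivative_smult assms algebra_simps)

lemma entire_cmult [intro]: "entire F \<Longrightarrow> entire (\<lambda>z. c * F z)"
  by (intro entire_mult entire_const)

lemma entire_diff [intro]:
  assumes "entire F" "entire G" shows "entire (\<lambda>z. F z - G z)"
  using entire_add[OF assms(1) entire_cmult[OF assms(2), of "-1"]] by simp

lemma entire_nth [intro]: "entire (\<lambda>z. z $ i)"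
  by (rule entireI[where D="\<lambda>z v. v $ i"]) (auto intro!: bounded_linear_imp_has_derivative bounded_linear_vec_nth)

lemma entire_sum [intro]: "(\<And>i. i \<in> I \<Longrightarrow> entire (F i)) \<Longrightarrow> entire (\<lambda>z. \<Sum>i\<in>I. F i z)"
  by (induction I rule: infinite_finite_induct) auto

lemma entire_holomorphic_compose:
  assumes F: "entire F" and h: "h holomorphic_on UNIV"
  shows "entire (\<lambda>z. h (F z))"
proof (rule entireI)
  fix z
  have "(h has_field_derivative deriv h (F z)) (at (F z))"
    using h by (auto intro: holomorphic_derivI)
  then show "((\<lambda>z. h (F z)) has_derivative (\<lambda>v. deriv h (F z) * frechet_derivative F (at z) v)) (at z)"
    using diff_chain_at[OF entire_has_derivative[OF F]] unfolding has_field_derivative_def comp_def by blast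
qed (simp add: entire_derivative_smult[OF F])

lemma entire_exp [intro]: "entire F \<Longrightarrow> entire (\<lambda>z. exp (F z))"
  by (rule entire_holomorphic_compose) (auto intro: holomorphic_intros)

lemma entire_affine:
  assumes F: "entire F" shows "entire (\<lambda>z. F (a + c *s z))"
proof (rule entireI)
  fix z
  have 1: "((\<lambda>z. a + c *s z) has_derivative (\<lambda>h. c *s h)) (at z)"
    using bounded_linear_imp_has_derivative[OF bounded_linear_smult_right] by (auto intro!: derivative_eq_intros)
  show "((\<lambda>z. F (a + c *s z)) has_derivative (\<lambda>h. frechet_derivative F (at (a + c *s z)) (c *s h))) (at z)"
    using diff_chain_at[OF 1 entire_has_derivative[OF F]] by (simp add: comp_def)
qed (simp add: entire_derivative_smult[OF F] algebra_simps)

text \<open>Cauchy's inequality on unit circles in complex lines turns uniform closeness of the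
  functions on the ball of radius R + 1 into closeness of their derivatives on the ball of radius R.
  The theorem on limits of differentiable sequences then applies, and complex linearity passes to
  the limit of the derivatives.\<close>

lemma entire_uniform_limit:
  fixes F :: "nat \<Rightarrow> complex ^ 'd \<Rightarrow> complex"
  assumes F: "\<And>n. entire (F n)" and lim: "\<And>R. uniform_limit (cball 0 R) F g sequentially"
  shows "entire g"
proof -
  define D where "D n z v = frechet_derivative (F n) (at z) v" for n z v
  have Dl: "D n z (c *s v) = c * D n z v" for n z c v
    by (simp add: D_def entire_derivative_smult[OF F])
  have DR: "D n z (r *\<^sub>R v) = r *\<^sub>R D n z v" for n z r v
    using linear_cmul[OF has_derivative_linear[OF entire_has_derivative[OF F]]] by (simp add: D_def)
  have diffD: "frechet_derivative (\<lambda>z. F m z - F n z) (at z) v = D m z v - D n z v" for m n z v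
    using frechet_derivative_at[OF has_derivative_diff[OF entire_has_derivative[OF F[of m]] entire_has_derivative[OF F[of n]]], of z]
    by (simp add: D_def fun_eq_iff)
  have ev: "\<exists>N. \<forall>m\<ge>N. \<forall>n\<ge>N. \<forall>z\<in>cball 0 R. \<forall>v. norm (D m z v - D n z v) \<le> e * norm v" if "e > 0" for e R
  proof -
    have "\<exists>N. \<forall>n\<ge>N. \<forall>z\<in>cball 0 (R+1). dist (F n z) (g z) < e/2"
      using lim[of "R+1"] \<open>e > 0\<close> unfolding uniform_limit_iff eventually_sequentially by (meson half_gt_zero)
    then obtain N where N: "\<And>n z. n \<ge> N \<Longrightarrow> z \<in> cball 0 (R+1) \<Longrightarrow> dist (F n z) (g z) < e/2" by blast
    have "norm (D m z v - D n z v) \<le> e * norm v" if mn: "m \<ge> N" "n \<ge> N" and z: "z \<in> cball 0 R" for m n z v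
    proof (cases "v = 0")
      case True then show ?thesis using DR[of _ z 0 v] by simp
    next
      case False
      \<comment> \<open>Normalizing v keeps the circle \<open>z + t *s ?u\<close> at distance 1 from
        z; real homogeneity restores v afterwards.\<close>
      let ?u = "(1 / norm v) *\<^sub>R v"
      have "norm (frechet_derivative (\<lambda>z. F m z - F n z) (at z) ?u) \<le> e / 1"
      proof (rule entire_Cauchy_bound)
        fix t :: complex assume t: "norm t = 1"
        have "norm (z + t *s ?u) \<le> norm z + norm (t *s ?u)" by (rule norm_triangle_ineq)
        also have "\<dots> \<le> R + 1" using z t False by (simp add: norm_vector_smult)
        finally have in': "z + t *s ?u \<in> cball 0 (R+1)" by simp
        have "dist (F m (z + t *s ?u)) (F n (z + t *s ?u)) < e" using N[OF mn(1) in'] N[OF mn(2) in']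
          by (rule dist_triangle_half_l)
        then show "norm (F m (z + t *s ?u) - F n (z + t *s ?u)) \<le> e" by (simp add: dist_norm)
      qed (auto intro: F)
      then have "norm (D m z ?u - D n z ?u) \<le> e" unfolding diffD by simp
      then have "norm ((1 / norm v) *\<^sub>R (D m z v - D n z v)) \<le> e" by (simp only: DR scaleR_diff_right)
      then show ?thesis using False unfolding norm_scaleR by (simp add: field_simps)
    qed
    then show ?thesis by blast
  qed
  have conv: "convergent (\<lambda>n. D n z v)" for z v
  proof -
    have "Cauchy (\<lambda>n. D n z v)"
    proof (rule CauchyI)
      fix e :: real assume e: "0 < e"
      then have "0 < e / (norm v + 1)" by (simp add: add_nonneg_pos)
      from ev[OF this, of "norm z"] obtain N where
        N: "\<forall>m\<ge>N. \<forall>n\<ge>N. \<forall>w\<in>cball 0 (norm z). \<forall>u. norm (D m w u - D n w u) \<le> e / (norm v + 1) * norm u" by blast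
      have "norm (D m z v - D n z v) \<le> e / (norm v + 1) * norm v" if "m \<ge> N" "n \<ge> N" for m n
        using N that by (metis mem_cball_0 order_refl)
      moreover have "e / (norm v + 1) * norm v < e" using e by (simp add: field_simps add_nonneg_pos add_pos_nonneg)
      ultimately show "\<exists>M. \<forall>m\<ge>M. \<forall>n\<ge>M. norm (D m z v - D n z v) < e" by (meson order_le_less_trans)
    qed
    then show ?thesis by (simp add: Cauchy_convergent_iff)
  qed
  define G where "G z v = lim (\<lambda>n. D n z v)" for z v
  have G: "(\<lambda>n. D n z v) \<longlonglongrightarrow> G z v" for z v using conv by (simp add: G_def convergent_LIMSEQ_iff)
  have pt: "(\<lambda>n. F n z) \<longlonglongrightarrow> g z" for z
    by (rule tendsto_uniform_limitI[OF lim[of "norm z"]]) simp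
  show ?thesis
  proof (rule entireI)
    fix z :: "complex ^ 'd"
    let ?S = "ball (0::complex^'d) (norm z + 1)"
    have "\<exists>h. \<forall>x\<in>?S. (\<lambda>n. F n x) \<longlonglongrightarrow> h x \<and> (h has_derivative G x) (at x within ?S)"
    proof (rule has_derivative_sequence[where f' = D and ?x0.0 = 0])
      show "(F n has_derivative D n x) (at x within ?S)" for n x
        unfolding D_def using entire_has_derivative[OF F] has_derivative_at_withinI by blast
      show "\<forall>\<^sub>F n in sequentially. \<forall>x\<in>?S. \<forall>h. norm (D n x h - G x h) \<le> e * norm h" if e: "0 < e" for e
      proof -
        obtain N where N: "\<And>m n x h. m \<ge> N \<Longrightarrow> n \<ge> N \<Longrightarrow> x \<in> cball 0 (norm z + 1) \<Longrightarrow> norm (D m x h - D n x h) \<le> e * norm h"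
          using ev[OF e, of "norm z + 1"] by blast
        have "norm (D n x h - G x h) \<le> e * norm h" if "n \<ge> N" "x \<in> ?S" for n x h
        proof (rule LIMSEQ_le_const2)
          show "(\<lambda>m. norm (D n x h - D m x h)) \<longlonglongrightarrow> norm (D n x h - G x h)" by (intro tendsto_intros G)
          show "\<exists>M. \<forall>m\<ge>M. norm (D n x h - D m x h) \<le> e * norm h" using N that by (intro exI[of _ N]) auto
        qed
        then show ?thesis unfolding eventually_sequentially by blast
      qed
      show "(\<lambda>n. F n 0) \<longlonglongrightarrow> g 0" by (rule pt)
    qed (auto simp: add_nonneg_pos)
    then obtain h where h: "\<And>x. x \<in> ?S \<Longrightarrow> (\<lambda>n. F n x) \<longlonglongrightarrow> h x" "\<And>x. x \<in> ?S \<Longrightarrow> (h has_derivative G x) (at x within ?S)" by blast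
    have "h x = g x" if "x \<in> ?S" for x using LIMSEQ_unique[OF h(1)[OF that] pt] .
    moreover have zS: "z \<in> ?S" by simp
    ultimately have "(g has_derivative G z) (at z within ?S)"
      by (intro has_derivative_transform[OF zS _ h(2)[OF zS]]) auto
    then show "(g has_derivative G z) (at z)" using zS by (simp add: at_within_open[OF _ open_ball])
  next
    fix z c v
    have "(\<lambda>n. c * D n z v) \<longlonglongrightarrow> G z (c *s v)" using G[of z "c *s v"] by (simp add: Dl)
    moreover have "(\<lambda>n. c * D n z v) \<longlonglongrightarrow> c * G z v" by (intro tendsto_intros G)
    ultimately show "G z (c *s v) = c * G z v" by (rule LIMSEQ_unique)
  qed
qed

section \<open>Coordinate derivatives and Cauchy estimates\<close>

text \<open>The factor 8 is Cauchy's bound 2! M / (1/2)^2 for the second derivative on circles of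
  radius 1/2, which stay inside the closed unit disc.\<close>

lemma holomorphic_quadratic_remainder:
  assumes f: "f holomorphic_on UNIV" and M: "\<And>s. norm s \<le> 1 \<Longrightarrow> norm (f s) \<le> M" and t: "norm t \<le> 1/2"
  shows "norm (f t - f 0 - deriv f 0 * t) \<le> 8 * M * (norm t)\<^sup>2"
proof -
  have hol: "(deriv ^^ k) f holomorphic_on UNIV" for k using f by (intro holomorphic_higher_deriv) auto
  have "norm ((deriv ^^ 0) f t - (\<Sum>i\<le>1. (deriv ^^ i) f 0 * (t - 0) ^ i / fact i)) \<le> (8 * M) * norm (t - 0) ^ (Suc 1) / fact 1"
  proof (rule complex_Taylor[where S = "cball 0 (1/2)"])
    show "((deriv ^^ i) f has_field_derivative (deriv ^^ (Suc i)) f x) (at x within cball 0 (1/2))" for i x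
      using holomorphic_derivI[OF hol[of i] open_UNIV, of x] by (auto intro: has_field_derivative_at_within)
    show "norm ((deriv ^^ (Suc 1)) f x) \<le> 8 * M" if x: "x \<in> cball 0 (1/2)" for x
    proof -
      have "norm ((deriv ^^ 2) f x) \<le> fact 2 * M / (1/2) ^ 2"
      proof (rule Cauchy_inequality)
        show "f holomorphic_on ball x (1/2)" "continuous_on (cball x (1/2)) f"
          using f holomorphic_on_subset holomorphic_on_imp_continuous_on by blast+
        fix y assume "norm (x - y) = 1/2"
        then have "norm y \<le> 1" using x norm_triangle_ineq2[of y x] by (auto simp: norm_minus_commute)
        then show "norm (f y) \<le> M" by (rule M)
      qed auto
      then show ?thesis by (simp add: power2_eq_square numeral_2_eq_2)
    qed
  qed (use t in auto)
  then show ?thesis by (simp add: power2_eq_square algebra_simps)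
qed

definition cpartial :: "'d \<Rightarrow> (complex ^ 'd \<Rightarrow> complex) \<Rightarrow> complex ^ 'd \<Rightarrow> complex" where
  "cpartial i F = (\<lambda>z. frechet_derivative F (at z) (axis i 1))"

lemma cpartial_deriv: "entire F \<Longrightarrow> cpartial i F z = deriv (\<lambda>t. F (z + t *s axis i 1)) 0"
  by (simp add: cpartial_def entire_derivative_line)

lemma entire_bounded_cball:
  fixes F :: "complex ^ 'd \<Rightarrow> complex"
  assumes "entire F" obtains M where "0 < M" "\<And>z. norm z \<le> R \<Longrightarrow> norm (F z) \<le> M"
proof -
  have "compact (F ` cball 0 R)" by (intro compact_continuous_image entire_continuous assms compact_cball)
  then have "bounded (F ` cball 0 R)" by (rule compact_imp_bounded)
  then obtain M where "0 < M" "\<forall>x\<in>F ` cball 0 R. norm x \<le> M" unfolding bounded_pos by blast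
  then show ?thesis by (intro that[of M]) auto
qed

text \<open>The partial derivative is a locally uniform limit of difference quotients, which are
  entire, so \<open>entire_uniform_limit\<close> applies. The increments 1 / (n + 2) are at most
  1/2, as the quadratic remainder estimate requires.\<close>

lemma entire_cpartial:
  fixes F :: "complex ^ 'd \<Rightarrow> complex"
  assumes F: "entire F" shows "entire (cpartial i F)"
proof (rule entire_uniform_limit)
  define e where "e = (axis i 1 :: complex ^ 'd)"
  define G where "G n z = of_nat (n + 2) * (F (z + (1 / of_nat (n + 2)) *s e) - F z)" for n z
  show "entire (G n)" for n
  proof -
    have "entire (\<lambda>z. F (z + (1 / of_nat (n + 2)) *s e))"
      using entire_affine[OF F, of "(1 / of_nat (n + 2)) *s e" 1] by (simp add: add.commute)
    then show ?thesis unfolding G_def by (intro entire_cmult entire_diff F)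
  qed
  show "uniform_limit (cball 0 R) G (cpartial i F) sequentially" for R
  proof -
    obtain M where M: "0 < M" "\<And>z. norm z \<le> R + 1 \<Longrightarrow> norm (F z) \<le> M" using entire_bounded_cball[OF F] by blast
    have ne: "norm e = 1" by (simp add: e_def norm_axis_1)
    have b: "dist (G n z) (cpartial i F z) \<le> 8 * M / real (n + 2)" if z: "z \<in> cball 0 R" for n z
    proof -
      let ?f = "\<lambda>t. F (z + t *s e)"
      define t where "t = 1 / (of_nat (n + 2) :: complex)"
      have nt: "norm t = 1 / real (n+2)" unfolding t_def norm_divide norm_of_nat by simp
      have "norm (?f t - ?f 0 - deriv ?f 0 * t) \<le> 8 * M * (norm t)\<^sup>2"
      proof (rule holomorphic_quadratic_remainder[OF entire_line_holomorphic[OF F]])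
        show "norm (F (z + s *s e)) \<le> M" if "norm s \<le> 1" for s
          using norm_triangle_ineq[of z "s *s e"] z that by (intro M(2)) (auto simp: norm_vector_smult ne)
        show "norm t \<le> 1/2" unfolding nt by simp
      qed
      moreover have "G n z - cpartial i F z = (?f t - ?f 0 - deriv ?f 0 * t) / t"
      proof -
        define N where "N = (of_nat (n + 2) :: complex)"
        have "N \<noteq> 0" unfolding N_def of_nat_eq_0_iff by simp
        then show ?thesis unfolding G_def cpartial_deriv[OF F] e_def[symmetric] t_def N_def[symmetric]
          by (simp add: field_simps)
      qed
      ultimately have "norm (G n z - cpartial i F z) \<le> 8 * M * (norm t)\<^sup>2 / norm t"
        unfolding norm_divide by (simp add: divide_right_mono norm_divide)
      also have "\<dots> = 8 * M / real (n + 2)" unfolding nt by (simp add: power2_eq_square)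
      finally show ?thesis by (simp add: dist_norm)
    qed
    have l: "(\<lambda>n. 8 * M / real (n + 2)) \<longlonglongrightarrow> 0"
      using LIMSEQ_ignore_initial_segment[OF lim_const_over_n[of "8 * M"], of 2] by simp
    show ?thesis unfolding uniform_limit_iff
    proof (intro allI impI)
      fix d :: real assume "0 < d"
      then have "\<forall>\<^sub>F n in sequentially. 8 * M / real (n + 2) < d" using l by (rule order_tendstoD(2)[rotated])
      then show "\<forall>\<^sub>F n in sequentially. \<forall>z\<in>cball 0 R. dist (G n z) (cpartial i F z) < d"
        by eventually_elim (meson b order_le_less_trans)
    qed
  qed
qed

lemma entire_cpartial_funpow: "entire F \<Longrightarrow> entire ((cpartial i ^^ k) F)"
  by (induction k) (auto intro: entire_cpartial)

lemma entire_cpartial_foldr: "entire F \<Longrightarrow> entire (foldr (\<lambda>i. cpartial i ^^ a i) L F)"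
  by (induction L) (auto intro: entire_cpartial_funpow)

lemma cpartial_funpow_deriv:
  assumes F: "entire F"
  shows "(deriv ^^ k) (\<lambda>t. F (z + t *s axis i 1)) t = (cpartial i ^^ k) F (z + t *s axis i 1)"
proof (induction k arbitrary: t)
  case (Suc k)
  have "(deriv ^^ k) (\<lambda>t. F (z + t *s axis i 1)) = (\<lambda>t. (cpartial i ^^ k) F (z + t *s axis i 1))"
    using Suc.IH by (rule ext)
  then have "(deriv ^^ (Suc k)) (\<lambda>t. F (z + t *s axis i 1)) t = deriv (\<lambda>t. (cpartial i ^^ k) F (z + t *s axis i 1)) t"
    by simp
  also have "\<dots> = (cpartial i ^^ (Suc k)) F (z + t *s axis i 1)"
    using DERIV_imp_deriv[OF entire_line[OF entire_cpartial_funpow[OF F, of k i], of z "axis i 1" t]] by (simp add: cpartial_def)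
  finally show ?case .
qed simp

text \<open>The one-variable inequality is applied to the outermost coordinate j, while the
  coordinates in the tail are covered by the induction hypothesis at the moved point
  \<open>z + t *s axis j 1\<close>. Coordinates outside the list stay fixed, which lets the two
  displacements be combined into one.\<close>

lemma polydisc_Cauchy_bound:
  fixes F :: "complex ^ 'd \<Rightarrow> complex"
  assumes F: "entire F" and "distinct L" and r: "\<And>i. 0 < r i"
    and S: "\<And>l. (\<And>i. i \<in> set L \<Longrightarrow> norm (l $ i) \<le> r i) \<Longrightarrow> (\<And>i. i \<notin> set L \<Longrightarrow> l $ i = 0) \<Longrightarrow> norm (F (z + l)) \<le> S"
  shows "norm (foldr (\<lambda>i. cpartial i ^^ a i) L F z) \<le> S * (\<Prod>i\<in>set L. fact (a i) / r i ^ a i)"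
  using assms(2,4)
proof (induction L arbitrary: z S)
  case Nil
  then show ?case using Nil.prems(2)[of 0] by simp
next
  case (Cons j L)
  define G where "G = foldr (\<lambda>i. cpartial i ^^ a i) L F"
  have G: "entire G" unfolding G_def by (rule entire_cpartial_foldr[OF F])
  define P where "P = (\<Prod>i\<in>set L. fact (a i) / r i ^ a i)"
  have P: "0 \<le> P" unfolding P_def using r by (intro prod_nonneg divide_nonneg_nonneg zero_le_power) (auto intro: less_imp_le)
  have "norm ((deriv ^^ a j) (\<lambda>t. G (z + t *s axis j 1)) 0) \<le> fact (a j) * (S * P) / r j ^ a j"
  proof (rule Cauchy_inequality)
    show "(\<lambda>t. G (z + t *s axis j 1)) holomorphic_on ball 0 (r j)" by (rule entire_line_holomorphic[OF G])
    show "continuous_on (cball 0 (r j)) (\<lambda>t. G (z + t *s axis j 1))"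
      by (rule holomorphic_on_imp_continuous_on[OF entire_line_holomorphic[OF G]])
    show "0 < r j" by (rule r)
    fix t :: complex assume t: "norm (0 - t) = r j"
    show "norm (G (z + t *s axis j 1)) \<le> S * P" unfolding G_def P_def
    proof (rule Cons.IH)
      show "distinct L" using Cons.prems by simp
      fix l :: "complex ^ 'd"
      assume l: "\<And>i. i \<in> set L \<Longrightarrow> norm (l $ i) \<le> r i" "\<And>i. i \<notin> set L \<Longrightarrow> l $ i = 0"
      have lj: "l $ j = 0" using Cons.prems(1) by (intro l) auto
      have "norm (F (z + (t *s axis j 1 + l))) \<le> S"
        using l lj t Cons.prems(1) by (intro Cons.prems(2)) (auto simp: axis_def)
      then show "norm (F (z + t *s axis j 1 + l)) \<le> S" by (simp add: add.assoc)
    qed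
  qed
  then have "norm ((cpartial j ^^ a j) G z) \<le> fact (a j) * (S * P) / r j ^ a j"
    by (simp add: cpartial_funpow_deriv[OF G])
  then show ?case using Cons.prems(1) by (simp add: G_def P_def ac_simps)
qed

section \<open>Restriction to real arguments and Gelfand-Shilov estimates\<close>

definition cvec :: "real ^ 'd \<Rightarrow> complex ^ 'd" where
  "cvec x = (\<chi> i. of_real (x $ i))"

lemma cvec_nth [simp]: "cvec x $ i = of_real (x $ i)"
  by (simp add: cvec_def)

lemma norm_cvec [simp]: "norm (cvec x) = norm x"
  by (simp add: norm_vec_def)

lemma bounded_linear_cvec: "bounded_linear cvec"
  by (rule bounded_linear_intro[of _ 1]) (auto simp: vec_eq_iff complex_eq_iff)

lemma entire_restrict_derivative:
  assumes F: "entire F"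
  shows "((\<lambda>x. F (cvec x)) has_derivative (\<lambda>h. frechet_derivative F (at (cvec x)) (cvec h))) (at x)"
  using diff_chain_at[OF bounded_linear_imp_has_derivative[OF bounded_linear_cvec] entire_has_derivative[OF F]]
  by (simp add: comp_def)

lemma cvec_axis: "cvec (axis i 1) = axis i 1"
  by (simp add: vec_eq_iff axis_def)

lemma partial_deriv_restrict:
  assumes F: "entire F"
  shows "partial_deriv i (\<lambda>x. F (cvec x)) = (\<lambda>x. cpartial i F (cvec x))"
proof
  fix x
  show "partial_deriv i (\<lambda>x. F (cvec x)) x = cpartial i F (cvec x)"
    using frechet_derivative_at[OF entire_restrict_derivative[OF F, of x], symmetric]
    by (simp add: partial_deriv_def cpartial_def cvec_axis)
qed

lemma partial_deriv_funpow_restrict: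
  assumes F: "entire F"
  shows "(partial_deriv i ^^ k) (\<lambda>x. F (cvec x)) = (\<lambda>x. (cpartial i ^^ k) F (cvec x))"
  by (induction k) (simp_all add: partial_deriv_restrict entire_cpartial_funpow[OF F])

lemma foldr_partial_deriv_restrict:
  assumes F: "entire F"
  shows "foldr (\<lambda>i. partial_deriv i ^^ a i) L (\<lambda>x. F (cvec x)) = (\<lambda>x. foldr (\<lambda>i. cpartial i ^^ a i) L F (cvec x))"
  by (induction L) (simp_all add: partial_deriv_funpow_restrict entire_cpartial_foldr[OF F])

lemma smooth_restrict: "entire F \<Longrightarrow> smooth (\<lambda>x. F (cvec x))"
  unfolding smooth_def
  using foldr_partial_deriv_restrict[of F "\<lambda>_. 1"] entire_restrict_derivative[OF entire_cpartial_foldr[of F "\<lambda>_. 1"]]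
  by (auto simp: differentiable_def)

text \<open>A single term of the series of exp(a x^2) bounds x^(2n) exp(- a x^2) by n! / a^n; the
  claim is its square root.\<close>

lemma gauss_power_bound:
  fixes x a :: real
  assumes "0 < a" shows "\<bar>x\<bar> ^ n * exp (- a * x\<^sup>2 / 2) \<le> (1 / sqrt a) ^ n * sqrt (fact n)"
proof (rule power2_le_imp_le)
  have "(a * x\<^sup>2) ^ n / fact n \<le> exp (a * x\<^sup>2)"
  proof -
    have "(\<Sum>i\<in>{n}. (a * x\<^sup>2) ^ i /\<^sub>R fact i) \<le> (\<Sum>i. (a * x\<^sup>2) ^ i /\<^sub>R fact i)"
      using assms by (intro sum_le_suminf summable_exp_generic) auto
    then show ?thesis by (simp add: exp_def divide_inverse mult.commute)
  qed
  then have "(x\<^sup>2) ^ n * exp (- (a * x\<^sup>2)) \<le> fact n / a ^ n"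
    using assms by (simp add: field_simps exp_minus power_mult_distrib)
  then have "x ^ (2*n) * exp (- (a * x\<^sup>2)) \<le> fact n / a ^ n" by (simp only: power_mult)
  moreover have "(\<bar>x\<bar> ^ n * exp (- a * x\<^sup>2 / 2))\<^sup>2 = x ^ (2*n) * exp (- (a * x\<^sup>2))"
  proof -
    have "(exp (- a * x\<^sup>2 / 2))\<^sup>2 = exp (- (a * x\<^sup>2))" by (simp add: power2_eq_square exp_add[symmetric])
    moreover have "(\<bar>x\<bar> ^ n)\<^sup>2 = (\<bar>x\<bar>\<^sup>2) ^ n" by (simp only: power_mult[symmetric] mult.commute)
    ultimately show ?thesis by (simp only: power_mult_distrib power2_abs power_mult)
  qed
  moreover have "((1 / sqrt a) ^ n * sqrt (fact n))\<^sup>2 = fact n / a ^ n"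
    using assms by (simp add: power_mult_distrib power_mult[symmetric] mult.commute[of n] power_divide)
      (simp add: power_mult)
  ultimately show "(\<bar>x\<bar> ^ n * exp (- a * x\<^sup>2 / 2))\<^sup>2 \<le> ((1 / sqrt a) ^ n * sqrt (fact n))\<^sup>2" by simp
qed (use assms in auto)

lemma fact_le_Suc_power: "fact n \<le> (real n + 1) ^ n"
proof -
  have "fact n \<le> real (n ^ n)" by (rule fact_le_power)
  also have "\<dots> = real n ^ n" by simp
  also have "\<dots> \<le> (real n + 1) ^ n" by (intro power_mono) auto
  finally show ?thesis .
qed

text \<open>With the radius sqrt(n + 1), Cauchy's bound n! / r^n is at most sqrt(n!), the growth
  that order 1/2 demands; the summand 1 keeps the radius positive for n = 0.\<close>

lemma fact_over_sqrt_power: "fact n / sqrt (real n + 1) ^ n \<le> sqrt (fact n)"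
proof -
  have "sqrt (fact n) \<le> sqrt ((real n + 1) ^ n)" using fact_le_Suc_power by simp
  then have "sqrt (fact n) * sqrt (fact n) \<le> sqrt (fact n) * sqrt (real n + 1) ^ n"
    by (intro mult_left_mono) (auto simp: real_sqrt_power)
  then show ?thesis by (simp add: divide_le_eq)
qed

definition re_sq :: "complex ^ 'd \<Rightarrow> real" where "re_sq z = (\<Sum>i\<in>UNIV. (Re (z $ i))\<^sup>2)"
definition im_sq :: "complex ^ 'd \<Rightarrow> real" where "im_sq z = (\<Sum>i\<in>UNIV. (Im (z $ i))\<^sup>2)"

lemma sqrt_prod: "sqrt (\<Prod>i\<in>A. f i) = (\<Prod>i\<in>A. sqrt (f i))"
  by (induction A rule: infinite_finite_induct) (auto simp: real_sqrt_mult)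

text \<open>Cauchy's inequality on the polydisc with radii \<open>sqrt (\<alpha> i + 1)\<close>
  costs a factor \<open>exp ((a + b) * (\<alpha> i + 1))\<close> per coordinate, which is geometric
  in \<alpha> and goes into h and K. Half of the Gaussian decay survives and absorbs the powers of
  x. As h and K depend only on a and b, Gaussian bounds control every functional that is bounded on
  the steps.\<close>

lemma GS_analytic:
  fixes a b :: real
  assumes "0 < a" "0 < b"
  shows "\<exists>h>0. \<exists>K>0. \<forall>(F :: complex ^ 'd \<Rightarrow> complex) M. entire F \<longrightarrow> 
      (\<forall>z. norm (F z) \<le> M * exp (- a * re_sq z + b * im_sq z)) \<longrightarrow>
      (\<lambda>x. F (cvec x)) \<in> GS_step (1/2) h \<and> GS_norm (1/2) h (\<lambda>x. F (cvec x)) \<le> ennreal (K * M)"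
proof -
  define h where "h = max 1 (1 / sqrt a) * exp (a + b)"
  define K where "K = exp (a + b) ^ CARD('d)"
  have h1: "exp (a + b) \<le> h" "1 / sqrt a \<le> h"
  proof -
    show "exp (a + b) \<le> h" unfolding h_def by (simp add: mult_le_cancel_right1)
    have "1 / sqrt a * 1 \<le> h" unfolding h_def using assms by (intro mult_mono) auto
    then show "1 / sqrt a \<le> h" by simp
  qed
  have h: "0 < h" using h1(1) exp_gt_zero[of "a + b"] by linarith
  have main: "(\<lambda>x. F (cvec x)) \<in> GS_step (1/2) h \<and> GS_norm (1/2) h (\<lambda>x. F (cvec x)) \<le> ennreal (K * M)"
    if F: "entire F" and bnd: "\<And>z. norm (F z) \<le> M * exp (- a * re_sq z + b * im_sq z)"
    for F :: "complex ^ 'd \<Rightarrow> complex" and M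
  proof -
    have "norm (F 0) \<le> M" using bnd[of 0] by (simp add: re_sq_def im_sq_def)
    then have M: "0 \<le> M" using norm_ge_zero order_trans by blast
    have "norm (of_real (mpower x \<beta>) * multi_deriv \<alpha> (\<lambda>x. F (cvec x)) x) /
          (h ^ (mabs \<alpha> + mabs \<beta>) * (mfact \<alpha> * mfact \<beta>) powr (1/2)) \<le> K * M" for \<alpha> \<beta> x
    proof -
      define L where "L = (SOME is. distinct is \<and> set is = (UNIV :: 'd set))"
      have L: "distinct L" "set L = UNIV"
        using someI_ex[of "\<lambda>is. distinct is \<and> set is = (UNIV :: 'd set)"] finite_distinct_list[of "UNIV :: 'd set"]
        unfolding L_def by auto
      define r where "r i = sqrt (real (\<alpha> i) + 1)" for i
      define S where "S = M * exp (\<Sum>i\<in>UNIV. - a * (x $ i)\<^sup>2 / 2 + (a + b) * (real (\<alpha> i) + 1))"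
      have md: "multi_deriv \<alpha> (\<lambda>x. F (cvec x)) x = foldr (\<lambda>i. cpartial i ^^ \<alpha> i) L F (cvec x)"
        unfolding multi_deriv_def L_def[symmetric] foldr_partial_deriv_restrict[OF F] ..
      have "norm (multi_deriv \<alpha> (\<lambda>x. F (cvec x)) x) \<le> S * (\<Prod>i\<in>set L. fact (\<alpha> i) / r i ^ \<alpha> i)"
        unfolding md
      proof (rule polydisc_Cauchy_bound[OF F L(1)])
        show "0 < r i" for i by (simp add: r_def add_nonneg_pos)
        fix l :: "complex ^ 'd" assume l: "\<And>i. i \<in> set L \<Longrightarrow> norm (l $ i) \<le> r i"
        have "- a * (Re ((cvec x + l) $ i))\<^sup>2 + b * (Im ((cvec x + l) $ i))\<^sup>2 \<le> - a * (x $ i)\<^sup>2 / 2 + (a + b) * (real (\<alpha> i) + 1)" for i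
        proof -
          have li: "(norm (l $ i))\<^sup>2 \<le> real (\<alpha> i) + 1"
          proof -
            have "(norm (l $ i))\<^sup>2 \<le> (r i)\<^sup>2" using l[of i] L(2) by (intro power_mono) auto
            then show ?thesis by (simp add: r_def)
          qed
          have n2: "(norm (l $ i))\<^sup>2 = (Re (l $ i))\<^sup>2 + (Im (l $ i))\<^sup>2" by (simp add: cmod_power2)
          \<comment> \<open>Young's inequality: a displacement by u costs half of the square of the
            coordinate, and the other half is left for the powers of x.\<close>
          have sq: "(x $ i + u)\<^sup>2 \<ge> (x $ i)\<^sup>2 / 2 - u\<^sup>2" for u
          proof -
            have "0 \<le> (x $ i + 2 * u)\<^sup>2 / 2" by simp
            then show ?thesis by (simp add: power2_eq_square algebra_simps)
          qed
          have "- a * (x $ i + Re (l $ i))\<^sup>2 \<le> - a * ((x $ i)\<^sup>2 / 2 - (Re (l $ i))\<^sup>2)"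
            using sq[of "Re (l $ i)"] assms by (simp add: mult_left_mono)
          moreover have "a * (Re (l $ i))\<^sup>2 \<le> a * (real (\<alpha> i) + 1)" "b * (Im (l $ i))\<^sup>2 \<le> b * (real (\<alpha> i) + 1)"
            using li n2 assms by (auto intro!: mult_left_mono) (smt (verit) zero_le_power2)+
          ultimately show ?thesis by (simp add: algebra_simps)
        qed
        then have "- a * re_sq (cvec x + l) + b * im_sq (cvec x + l) \<le> (\<Sum>i\<in>UNIV. - a * (x $ i)\<^sup>2 / 2 + (a + b) * (real (\<alpha> i) + 1))"
          unfolding re_sq_def im_sq_def sum_distrib_left sum.distrib[symmetric] by (intro sum_mono) 
        then show "norm (F (cvec x + l)) \<le> S" unfolding S_def using bnd[of "cvec x + l"] M
          by (meson exp_le_cancel_iff mult_left_mono order_trans)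
      qed
      then have "norm (of_real (mpower x \<beta>) * multi_deriv \<alpha> (\<lambda>x. F (cvec x)) x) \<le> 
         (\<Prod>i\<in>UNIV. \<bar>x $ i\<bar> ^ \<beta> i) * (S * (\<Prod>i\<in>UNIV. fact (\<alpha> i) / r i ^ \<alpha> i))"
        unfolding norm_mult norm_of_real mpower_def abs_prod power_abs L(2)
        by (intro mult_left_mono) (auto intro: prod_nonneg)
      also have "\<dots> = M * (\<Prod>i\<in>UNIV. (\<bar>x $ i\<bar> ^ \<beta> i * exp (- a * (x $ i)\<^sup>2 / 2)) * (exp ((a + b) * (real (\<alpha> i) + 1)) * (fact (\<alpha> i) / r i ^ \<alpha> i)))"
      proof -
        have "S = M * ((\<Prod>i\<in>UNIV. exp (- a * (x $ i)\<^sup>2 / 2)) * (\<Prod>i\<in>UNIV. exp ((a + b) * (real (\<alpha> i) + 1))))"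
          unfolding S_def by (simp only: sum.distrib exp_add exp_sum[OF finite])
        then show ?thesis by (simp only: prod.distrib ac_simps)
      qed
      also have "\<dots> \<le> M * (\<Prod>i\<in>UNIV. (h ^ \<beta> i * sqrt (fact (\<beta> i))) * (exp (a + b) * h ^ \<alpha> i * sqrt (fact (\<alpha> i))))"
      proof (rule mult_left_mono[OF prod_mono M], rule conjI)
        fix i
        show "0 \<le> (\<bar>x $ i\<bar> ^ \<beta> i * exp (- a * (x $ i)\<^sup>2 / 2)) * (exp ((a + b) * (real (\<alpha> i) + 1)) * (fact (\<alpha> i) / r i ^ \<alpha> i))"
          by (simp add: r_def)
        have 1: "\<bar>x $ i\<bar> ^ \<beta> i * exp (- a * (x $ i)\<^sup>2 / 2) \<le> h ^ \<beta> i * sqrt (fact (\<beta> i))"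
          using gauss_power_bound[OF assms(1), of "x $ i" "\<beta> i"] power_mono[OF h1(2), of "\<beta> i"] assms
          by (smt (verit) mult_right_mono real_sqrt_ge_zero fact_ge_zero divide_nonneg_nonneg real_sqrt_ge_0_iff)
        have "exp ((a + b) * (real (\<alpha> i) + 1)) = exp (a + b) * exp (a + b) ^ \<alpha> i"
          by (simp add: algebra_simps exp_add exp_of_nat_mult[symmetric])
        also have "\<dots> \<le> exp (a + b) * h ^ \<alpha> i" using h1(1) by (intro mult_left_mono power_mono) auto
        finally have 2: "exp ((a + b) * (real (\<alpha> i) + 1)) \<le> exp (a + b) * h ^ \<alpha> i" .
        have 3: "fact (\<alpha> i) / r i ^ \<alpha> i \<le> sqrt (fact (\<alpha> i))" unfolding r_def by (rule fact_over_sqrt_power)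
        have 4: "0 \<le> fact (\<alpha> i) / r i ^ \<alpha> i" by (simp add: r_def)
        show "(\<bar>x $ i\<bar> ^ \<beta> i * exp (- a * (x $ i)\<^sup>2 / 2)) * (exp ((a + b) * (real (\<alpha> i) + 1)) * (fact (\<alpha> i) / r i ^ \<alpha> i))
           \<le> (h ^ \<beta> i * sqrt (fact (\<beta> i))) * (exp (a + b) * h ^ \<alpha> i * sqrt (fact (\<alpha> i)))"
          by (rule mult_mono[OF 1 mult_mono[OF 2 3 _ 4]], use h in simp, use h in simp)
            (rule mult_nonneg_nonneg[OF exp_ge_zero 4])
      qed
      also have "\<dots> = K * M * (h ^ (mabs \<alpha> + mabs \<beta>) * (mfact \<alpha> * mfact \<beta>) powr (1/2))"
      proof -
        have "(mfact \<alpha> * mfact \<beta>) powr (1/2) = sqrt (mfact \<alpha> * mfact \<beta>)"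
          by (rule powr_half_sqrt) (auto simp: mfact_def intro!: mult_nonneg_nonneg prod_nonneg)
        also have "\<dots> = (\<Prod>i\<in>UNIV. sqrt (fact (\<alpha> i))) * (\<Prod>i\<in>UNIV. sqrt (fact (\<beta> i)))"
          by (simp add: mfact_def real_sqrt_mult sqrt_prod)
        finally show ?thesis
          by (simp add: prod.distrib K_def mabs_def power_sum power_add ac_simps)
      qed
      finally show ?thesis using h by (simp add: divide_le_eq mfact_def prod_pos)
    qed
    then have "GS_norm (1/2) h (\<lambda>x. F (cvec x)) \<le> ennreal (K * M)"
      unfolding GS_norm_def by (intro SUP_least ennreal_leI) 
    then show ?thesis using smooth_restrict[OF F] by (auto simp: GS_step_def intro: le_less_trans)
  qed
  show ?thesis by (intro exI[of _ h] conjI exI[of _ K]) (use h main in \<open>auto simp: K_def\<close>)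
qed

section \<open>Gaussian integrals and circular means\<close>

lemma integrable_gauss_real:
  fixes c :: real assumes "0 < c" shows "integrable lborel (\<lambda>x. exp (- c * x\<^sup>2))"
proof -
  define K where "K = 1 / sqrt (2 * pi * (1 / sqrt (2*c))\<^sup>2)"
  have K: "K \<noteq> 0" using assms by (simp add: K_def)
  have "normal_density 0 (1 / sqrt (2*c)) = (\<lambda>x. K * exp (- c * x\<^sup>2))"
    unfolding K_def using assms by (auto simp: normal_density_def fun_eq_iff power_divide)
  then have "integrable lborel (\<lambda>x. K * exp (- c * x\<^sup>2))"
    using integrable_normal_density[of "1 / sqrt (2*c)" 0] assms by simp
  then show ?thesis using K by auto
qed

lemma norm_sq_Basis: "(norm x)\<^sup>2 = (\<Sum>b\<in>Basis. (x \<bullet> b)\<^sup>2)"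
  unfolding power2_norm_eq_inner by (subst euclidean_inner) (simp add: power2_eq_square)

lemma integrable_gauss:
  fixes c :: real assumes "0 < c" shows "integrable lborel (\<lambda>x::'a::euclidean_space. exp (- c * (norm x)\<^sup>2))"
proof (rule integrableI_nonneg)
  have "(\<integral>\<^sup>+x. ennreal (exp (- c * (norm x)\<^sup>2)) \<partial>(lborel :: 'a measure)) = (\<integral>\<^sup>+x. (\<Prod>b\<in>Basis. ennreal (exp (- c * (x \<bullet> b)\<^sup>2))) \<partial>(lborel :: 'a measure))"
    by (intro nn_integral_cong)
       (simp add: prod_ennreal exp_sum[symmetric] norm_sq_Basis sum_distrib_left sum_negf)
  also have "\<dots> = (\<Prod>b\<in>(Basis::'a set). (\<integral>\<^sup>+x. ennreal (exp (- c * x\<^sup>2)) \<partial>lborel))"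
    by (rule nn_integral_lborel_prod) auto
  also have "\<dots> < \<infinity>"
  proof -
    have "(\<integral>\<^sup>+x. ennreal (exp (- c * x\<^sup>2)) \<partial>lborel) < \<infinity>"
      using integrable_gauss_real[OF assms] by (simp add: integrable_iff_bounded)
    then show ?thesis by (simp add: power_less_top_ennreal)
  qed
  finally show "(\<integral>\<^sup>+x. ennreal (exp (- c * (norm x)\<^sup>2)) \<partial>(lborel :: 'a measure)) < \<infinity>" .
qed auto

lemma gauss_linear_bound:
  fixes c k t :: real assumes "0 < c" shows "- c * t\<^sup>2 + k * t \<le> - (c/2) * t\<^sup>2 + k\<^sup>2 / (2 * c)"
proof -
  have "0 \<le> (c * t - k)\<^sup>2 / (2 * c)" using assms by simp
  also have "\<dots> = (c/2) * t\<^sup>2 - k * t + k\<^sup>2 / (2*c)" using assms by (simp add: power2_eq_square field_simps)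
  finally show ?thesis by (simp add: field_simps)
qed

lemma integrable_gauss_linear:
  fixes c :: real assumes "0 < c" shows "integrable lborel (\<lambda>x::'a::euclidean_space. exp (- c * (norm x)\<^sup>2 + k * norm x))"
proof (rule Bochner_Integration.integrable_bound)
  show "integrable lborel (\<lambda>x::'a. exp (k\<^sup>2 / (2 * c)) * exp (- (c/2) * (norm x)\<^sup>2))"
    using assms by (intro integrable_mult_right integrable_gauss) auto
  show "AE x in lborel. norm (exp (- c * (norm x)\<^sup>2 + k * norm (x::'a))) \<le> norm (exp (k\<^sup>2 / (2 * c)) * exp (- (c/2) * (norm x)\<^sup>2))"
    using gauss_linear_bound[OF assms] by (intro always_eventually allI) (simp add: exp_add[symmetric] add.commute)
qed measurable

text \<open>With a = p + i q the real substitution x = p/2 + y / sqrt 2 leaves the standard normal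
  density times a character, so the integral is read off the characteristic function of the normal
  distribution and no contour has to be moved.\<close>

lemma gauss_integral_complex_real_line:
  fixes a :: complex
  shows "(\<integral>x. exp (of_real (- x\<^sup>2) + a * of_real x) \<partial>lborel) = of_real (sqrt pi) * exp (a\<^sup>2 / 4)"
    and "integrable lborel (\<lambda>x. exp (of_real (- x\<^sup>2) + a * of_real x))"
proof -
  show "integrable lborel (\<lambda>x. exp (of_real (- x\<^sup>2) + a * of_real x))"
  proof (rule Bochner_Integration.integrable_bound)
    show "integrable lborel (\<lambda>x::real. exp (- 1 * (norm x)\<^sup>2 + norm a * norm x))" by (rule integrable_gauss_linear) simp
    show "AE x in lborel. norm (exp (of_real (- x\<^sup>2) + a * of_real x)) \<le> norm (exp (- 1 * (norm x)\<^sup>2 + norm a * norm x))"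
    proof (intro always_eventually allI)
      fix x :: real
      have "Re a * x \<le> \<bar>Re a\<bar> * \<bar>x\<bar>" unfolding abs_mult[symmetric] by (rule abs_ge_self)
      also have "\<dots> \<le> norm a * \<bar>x\<bar>" by (intro mult_right_mono abs_Re_le_cmod) auto
      finally have "Re a * x \<le> norm a * \<bar>x\<bar>" .
      then show "norm (exp (of_real (- x\<^sup>2) + a * of_real x)) \<le> norm (exp (- 1 * (norm x)\<^sup>2 + norm a * norm x))"
        by simp
    qed
  qed measurable
  define p q where "p = Re a" and "q = Im a"
  have a: "a = of_real p + \<i> * of_real q" by (simp add: p_def q_def complex_eq)
  have char: "(\<integral>x. std_normal_density x *\<^sub>R iexp (t * x) \<partial>lborel) = complex_of_real (exp (- (t^2) / 2))" for t
    using fun_cong[OF char_std_normal_distribution, of t] unfolding char_def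
    by (subst (asm) integral_density) auto
  have "(\<integral>x. exp (of_real (- x\<^sup>2) + a * of_real x) \<partial>lborel)
     = \<bar>1 / sqrt 2\<bar> *\<^sub>R (\<integral>x. exp (of_real (- (p/2 + (1 / sqrt 2) * x)\<^sup>2) + a * of_real (p/2 + (1 / sqrt 2) * x)) \<partial>lborel)"
    by (rule lborel_integral_real_affine) simp
  also have "(\<lambda>x. exp (of_real (- (p/2 + (1 / sqrt 2) * x)\<^sup>2) + a * of_real (p/2 + (1 / sqrt 2) * x)))
     = (\<lambda>x. (sqrt (2 * pi) * exp (of_real (p\<^sup>2 / 4) + \<i> * of_real (p * q / 2))) * (std_normal_density x *\<^sub>R iexp ((q / sqrt 2) * x)))"
  proof
    fix x
    have s: "(1 / sqrt 2 * x)\<^sup>2 = x\<^sup>2 / 2" by (simp add: power_mult_distrib power_divide)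
    have e: "of_real (- (p/2 + (1 / sqrt 2) * x)\<^sup>2) + a * of_real (p/2 + (1 / sqrt 2) * x)
      = (of_real (p\<^sup>2 / 4) + \<i> * of_real (p * q / 2)) + (of_real (- x\<^sup>2 / 2) + \<i> * of_real ((q / sqrt 2) * x))"
      unfolding a power2_sum s by (simp add: complex_eq_iff power2_eq_square field_simps)
    show "exp (of_real (- (p/2 + (1 / sqrt 2) * x)\<^sup>2) + a * of_real (p/2 + (1 / sqrt 2) * x))
     = (sqrt (2 * pi) * exp (of_real (p\<^sup>2 / 4) + \<i> * of_real (p * q / 2))) * (std_normal_density x *\<^sub>R iexp ((q / sqrt 2) * x))"
      unfolding e exp_add[of "of_real (p\<^sup>2 / 4) + \<i> * of_real (p * q / 2)"] exp_add[of "of_real (- x\<^sup>2 / 2)"]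
      by (simp add: std_normal_density_def scaleR_conv_of_real exp_of_real[symmetric])
  qed
  also have "\<bar>1 / sqrt 2\<bar> *\<^sub>R (\<integral>x. (sqrt (2 * pi) * exp (of_real (p\<^sup>2 / 4) + \<i> * of_real (p * q / 2))) * (std_normal_density x *\<^sub>R iexp ((q / sqrt 2) * x)) \<partial>lborel)
     = \<bar>1 / sqrt 2\<bar> *\<^sub>R ((sqrt (2 * pi) * exp (of_real (p\<^sup>2 / 4) + \<i> * of_real (p * q / 2))) * of_real (exp (- ((q / sqrt 2)^2) / 2)))"
    unfolding integral_mult_right_zero char ..
  also have "\<dots> = of_real (sqrt pi) * exp (a\<^sup>2 / 4)"
  proof -
    have "a\<^sup>2 / 4 = (of_real (p\<^sup>2 / 4) + \<i> * of_real (p * q / 2)) + of_real (- ((q / sqrt 2)^2) / 2)"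
      unfolding a by (simp add: complex_eq_iff power2_eq_square field_simps)
    then have "exp (a\<^sup>2 / 4) = exp (of_real (p\<^sup>2 / 4) + \<i> * of_real (p * q / 2)) * of_real (exp (- ((q / sqrt 2)^2) / 2))"
      by (simp only: exp_add exp_of_real mult.assoc)
    moreover have "of_real (sqrt (2 * pi)) / of_real (sqrt 2) = (of_real (sqrt pi) :: complex)"
      by (simp add: of_real_divide[symmetric] real_sqrt_divide[symmetric] del: of_real_divide)
    ultimately show ?thesis by (simp add: scaleR_conv_of_real field_simps)
  qed
  finally show "(\<integral>x. exp (of_real (- x\<^sup>2) + a * of_real x) \<partial>lborel) = of_real (sqrt pi) * exp (a\<^sup>2 / 4)" .
qed

text \<open>The bilinear product, without conjugation, so that expressions in it are holomorphic in
  both arguments.\<close>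

definition cdot :: "complex ^ 'd \<Rightarrow> complex ^ 'd \<Rightarrow> complex" where
  "cdot w z = (\<Sum>i\<in>UNIV. w $ i * z $ i)"

lemma cdot_commute: "cdot w z = cdot z w"
  by (simp add: cdot_def mult.commute)

lemma cdot_add_left: "cdot (w + w') z = cdot w z + cdot w' z"
  by (simp add: cdot_def algebra_simps sum.distrib)

lemma norm_cdot_le: "norm (cdot w z) \<le> norm w * norm z"
proof -
  have "norm (cdot w z) \<le> (\<Sum>i\<in>UNIV. \<bar>norm (w $ i)\<bar> * \<bar>norm (z $ i)\<bar>)"
    unfolding cdot_def by (rule order_trans[OF norm_sum]) (simp add: norm_mult)
  also have "\<dots> \<le> norm w * norm z" unfolding norm_vec_def by (rule L2_set_mult_ineq)
  finally show ?thesis .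
qed

lemma gauss_integral_complex:
  fixes w :: "complex ^ 'd"
  shows "(\<integral>x. exp (of_real (- (norm x)\<^sup>2) + cdot w (cvec x)) \<partial>lborel) = of_real (sqrt pi ^ CARD('d)) * exp (cdot w w / 4)"
proof -
  let ?f = "\<lambda>b x. exp (of_real (- x\<^sup>2) + cdot w (cvec b) * of_real x)"
  have fin: "finite (Basis :: (real ^ 'd) set)" by simp
  have "exp (of_real (- (norm x)\<^sup>2) + cdot w (cvec x)) = (\<Prod>b\<in>Basis. ?f b (x \<bullet> b))" for x :: "real ^ 'd"
  proof -
    have 1: "(norm x)\<^sup>2 = (\<Sum>b\<in>Basis. (x \<bullet> b)\<^sup>2)"
      by (rule norm_sq_Basis)
    have "cdot w (cvec x) = cdot w (cvec (\<Sum>b\<in>Basis. (x \<bullet> b) *\<^sub>R b))" by (simp add: euclidean_representation)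
    also have "\<dots> = (\<Sum>b\<in>Basis. cdot w (cvec b) * of_real (x \<bullet> b))"
      unfolding cdot_def cvec_nth sum_component scaleR_vec_def vec_lambda_beta real_scaleR_def of_real_sum of_real_mult
        sum_distrib_left sum_distrib_right
      by (subst sum.swap) (intro sum.cong refl, simp add: ac_simps)
    finally have "of_real (- (norm x)\<^sup>2) + cdot w (cvec x) = (\<Sum>b\<in>Basis. of_real (- (x \<bullet> b)\<^sup>2) + cdot w (cvec b) * of_real (x \<bullet> b))"
      unfolding 1 by (simp add: sum.distrib sum_negf sum_subtractf)
    then show ?thesis by (simp add: exp_sum)
  qed
  then have "(\<integral>x. exp (of_real (- (norm x)\<^sup>2) + cdot w (cvec x)) \<partial>lborel)
     = (\<integral>x. (\<Prod>b\<in>Basis. ?f b (x \<bullet> b)) \<partial>(lborel :: (real^'d) measure))" by simp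
  also have "\<dots> = (\<integral>t. (\<Prod>b\<in>Basis. ?f b ((\<Sum>c\<in>Basis. t c *\<^sub>R c) \<bullet> b)) \<partial>(\<Pi>\<^sub>M b\<in>(Basis::(real^'d) set). lborel))"
    by (subst lborel_eq, subst integral_distr) auto
  also have "\<dots> = (\<integral>t. (\<Prod>b\<in>Basis. ?f b (t b)) \<partial>(\<Pi>\<^sub>M b\<in>(Basis::(real^'d) set). lborel))"
    by (intro Bochner_Integration.integral_cong prod.cong refl) simp
  also have "\<dots> = (\<Prod>b\<in>Basis. of_real (sqrt pi) * exp ((cdot w (cvec b))\<^sup>2 / 4))"
    by (subst product_lborel.product_integral_prod[OF fin]) (simp_all only: gauss_integral_complex_real_line)
  also have "\<dots> = of_real (sqrt pi ^ CARD('d)) * exp (\<Sum>b\<in>(Basis::(real^'d) set). (cdot w (cvec b))\<^sup>2 / 4)"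
    by (simp add: prod.distrib exp_sum)
  also have "(\<Sum>b\<in>(Basis::(real^'d) set). (cdot w (cvec b))\<^sup>2 / 4) = cdot w w / 4"
  proof -
    have B: "(Basis :: (real^'d) set) = range (\<lambda>i. axis i 1)" by (auto simp: Basis_vec_def)
    have "cdot w (cvec (axis i 1)) = w $ i" for i by (simp add: cdot_def axis_def if_distrib cong: if_cong)
    then show ?thesis unfolding B
      by (subst sum.reindex) (auto simp: inj_on_def axis_eq_axis cdot_def power2_eq_square sum_divide_distrib)
  qed
  finally show ?thesis .
qed

section \<open>Phase space as a complex vector space, and its rotations\<close>

text \<open>The sign follows \<open>B_transform\<close>, which evaluates its argument at x - i
  \<xi>, up to the factor 1 / sqrt 2.\<close>

definition cplx :: "'d::finite phase_space \<Rightarrow> complex ^ 'd" where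
  "cplx z = (\<chi> j. Complex (fst z $ j) (- snd z $ j))"

lemma cplx_nth [simp]: "cplx z $ j = Complex (fst z $ j) (- snd z $ j)"
  by (simp add: cplx_def)

lemma cplx_add: "cplx (z + z') = cplx z + cplx z'"
  by (simp add: vec_eq_iff complex_eq_iff)

lemma cplx_0 [simp]: "cplx 0 = 0"
  by (simp add: vec_eq_iff complex_eq_iff zero_prod_def)

lemma norm_cplx [simp]: "norm (cplx z) = norm (z :: 'd::finite phase_space)"
proof -
  have "(norm (cplx z))\<^sup>2 = (norm (fst z))\<^sup>2 + (norm (snd z))\<^sup>2"
    by (simp add: norm_vec_def L2_set_def sum_nonneg cmod_power2 sum.distrib)
  then show ?thesis by (simp add: norm_prod_def real_sqrt_unique)
qed

lemma bounded_linear_cplx: "bounded_linear cplx"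
  by (rule bounded_linear_intro[of _ 1]) (auto simp: vec_eq_iff complex_eq_iff)

lemma continuous_on_cplx [continuous_intros]:
  "continuous_on S f \<Longrightarrow> continuous_on S (\<lambda>x. cplx (f x))"
  by (rule bounded_linear.continuous_on[OF bounded_linear_cplx])

lemma surj_cplx: "\<exists>z. cplx z = w"
  by (rule exI[of _ "(\<chi> j. Re (w $ j), \<chi> j. - Im (w $ j))"]) (simp add: vec_eq_iff complex_eq_iff)

text \<open>Multiplication by a number of modulus 1, written in real coordinates so that its effect
  on Lebesgue measure can be computed from shears.\<close>

definition rot :: "real \<Rightarrow> 'd::finite phase_space \<Rightarrow> 'd::finite phase_space" where
  "rot \<theta> z = (cos \<theta> *\<^sub>R fst z + sin \<theta> *\<^sub>R snd z, cos \<theta> *\<^sub>R snd z - sin \<theta> *\<^sub>R fst z)"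

lemma cplx_rot: "cplx (rot \<theta> z) = cis \<theta> *s cplx z"
  by (simp add: vec_eq_iff complex_eq_iff rot_def algebra_simps)

lemma norm_rot [simp]: "norm (rot \<theta> z) = norm z"
  using norm_cplx[of "rot \<theta> z"] by (simp add: cplx_rot norm_vector_smult del: norm_cplx) simp

lemma cplx_inj: "cplx z = cplx z' \<Longrightarrow> z = z'"
  by (auto simp: vec_eq_iff complex_eq_iff prod_eq_iff)

lemma rot_rot: "rot a (rot b z) = rot (a + b) z"
  by (rule cplx_inj) (simp add: cplx_rot cis_mult[symmetric] vec_eq_iff)

lemma borel_measurable_rot [measurable]:
  assumes "f \<in> borel_measurable M" "g \<in> borel_measurable M"
  shows "(\<lambda>x. rot (f x) (g x)) \<in> borel_measurable M"
proof -
  have "continuous_on UNIV (\<lambda>p. rot (fst p) (snd p))" unfolding rot_def by (intro continuous_intros)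
  then have "(\<lambda>p. rot (fst p) (snd p)) \<in> borel_measurable borel" by (rule borel_measurable_continuous_onI)
  from measurable_compose[OF borel_measurable_Pair[OF assms] this] show ?thesis by simp
qed

lemma borel_measurable_shear [measurable]:
  "(\<lambda>z::'d::finite phase_space. (fst z + t *\<^sub>R snd z, snd z)) \<in> borel_measurable borel"
  "(\<lambda>z::'d::finite phase_space. (fst z, snd z + t *\<^sub>R fst z)) \<in> borel_measurable borel"
  by (intro borel_measurable_continuous_onI continuous_intros)+

lemma shear_invariant:
  fixes f :: "'d::finite phase_space \<Rightarrow> ennreal"
  assumes [measurable]: "f \<in> borel_measurable borel"
  shows "(\<integral>\<^sup>+z. f (fst z + t *\<^sub>R snd z, snd z) \<partial>lborel) = (\<integral>\<^sup>+z. f z \<partial>lborel)"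
    and "(\<integral>\<^sup>+z. f (fst z, snd z + t *\<^sub>R fst z) \<partial>lborel) = (\<integral>\<^sup>+z. f z \<partial>lborel)"
proof -
  have [measurable]: "f \<in> borel_measurable (lborel \<Otimes>\<^sub>M lborel)" by (simp add: lborel_prod)
  have [measurable]: "(\<lambda>z. f (fst z + t *\<^sub>R snd z, snd z)) \<in> borel_measurable borel"
     "(\<lambda>z. f (fst z, snd z + t *\<^sub>R fst z)) \<in> borel_measurable borel"
    by (rule measurable_compose[OF borel_measurable_shear(1) assms] measurable_compose[OF borel_measurable_shear(2) assms])+
  have "(\<integral>\<^sup>+z. f (fst z + t *\<^sub>R snd z, snd z) \<partial>(lborel \<Otimes>\<^sub>M lborel)) = (\<integral>\<^sup>+y. \<integral>\<^sup>+x. f (x + t *\<^sub>R y, y) \<partial>lborel \<partial>lborel)"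
    by (subst lborel_pair.nn_integral_snd[symmetric]) (auto simp: lborel_prod)
  also have "\<dots> = (\<integral>\<^sup>+y. \<integral>\<^sup>+x. f (x, y) \<partial>lborel \<partial>lborel)"
  proof (rule nn_integral_cong)
    fix y
    show "(\<integral>\<^sup>+x. f (x + t *\<^sub>R y, y) \<partial>lborel) = (\<integral>\<^sup>+x. f (x, y) \<partial>lborel)"
      using nn_integral_lborel_translate[of "\<lambda>x. f (x, y)" "t *\<^sub>R y"] by simp
  qed
  also have "\<dots> = (\<integral>\<^sup>+z. f z \<partial>(lborel \<Otimes>\<^sub>M lborel))"
    by (rule lborel_pair.nn_integral_snd) measurable
  finally show "(\<integral>\<^sup>+z. f (fst z + t *\<^sub>R snd z, snd z) \<partial>lborel) = (\<integral>\<^sup>+z. f z \<partial>lborel)" by (simp add: lborel_prod)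
  have "(\<integral>\<^sup>+z. f (fst z, snd z + t *\<^sub>R fst z) \<partial>(lborel \<Otimes>\<^sub>M lborel)) = (\<integral>\<^sup>+x. \<integral>\<^sup>+y. f (x, y + t *\<^sub>R x) \<partial>lborel \<partial>lborel)"
    by (subst lborel.nn_integral_fst[symmetric]) (auto simp: lborel_prod)
  also have "\<dots> = (\<integral>\<^sup>+x. \<integral>\<^sup>+y. f (x, y) \<partial>lborel \<partial>lborel)"
  proof (rule nn_integral_cong)
    fix x
    show "(\<integral>\<^sup>+y. f (x, y + t *\<^sub>R x) \<partial>lborel) = (\<integral>\<^sup>+y. f (x, y) \<partial>lborel)"
      using nn_integral_lborel_translate[of "\<lambda>y. f (x, y)" "t *\<^sub>R x"] by simp
  qed
  also have "\<dots> = (\<integral>\<^sup>+z. f z \<partial>(lborel \<Otimes>\<^sub>M lborel))"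
    by (rule lborel.nn_integral_fst) measurable
  finally show "(\<integral>\<^sup>+z. f (fst z, snd z + t *\<^sub>R fst z) \<partial>lborel) = (\<integral>\<^sup>+z. f z \<partial>lborel)" by (simp add: lborel_prod)
qed

text \<open>A rotation is a product of three shears, each of which preserves Lebesgue measure by
  Fubini's theorem and translation invariance. The factorization breaks down only for the half turn,
  which is two quarter turns.\<close>

lemma rot_invariant:
  fixes f :: "'d::finite phase_space \<Rightarrow> ennreal"
  assumes f[measurable]: "f \<in> borel_measurable borel"
  shows "(\<integral>\<^sup>+z. f (rot \<theta> z) \<partial>lborel) = (\<integral>\<^sup>+z. f z \<partial>lborel)"
proof -
  have main: "(\<integral>\<^sup>+z. g (rot \<theta> z) \<partial>lborel) = (\<integral>\<^sup>+z. g z \<partial>lborel)"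
    if c: "cos \<theta> \<noteq> -1" and [measurable]: "g \<in> borel_measurable borel" for \<theta> and g :: "'d::finite phase_space \<Rightarrow> ennreal"
  proof -
    \<comment> \<open>This is tan(\<theta>/2), written so that the identities needed below are
      rational in sin and cos.\<close>
    define t where "t = sin \<theta> / (1 + cos \<theta>)"
    have c1: "1 + cos \<theta> \<noteq> 0" using c by linarith
    have t: "t * (1 + cos \<theta>) = sin \<theta>" using c1 by (simp add: t_def)
    have ts: "sin \<theta> * t = 1 - cos \<theta>"
    proof -
      have "sin \<theta> * t = (sin \<theta>)\<^sup>2 / (1 + cos \<theta>)" by (simp add: t_def power2_eq_square)
      also have "(sin \<theta>)\<^sup>2 = (1 - cos \<theta>) * (1 + cos \<theta>)" using sin_squared_eq[of \<theta>] by (simp add: power2_eq_square algebra_simps)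
      finally show ?thesis using c1 by simp
    qed
    define S1 where "S1 = (\<lambda>z::'d::finite phase_space. (fst z + t *\<^sub>R snd z, snd z))"
    define S2 where "S2 = (\<lambda>z::'d::finite phase_space. (fst z, snd z + (- sin \<theta>) *\<^sub>R fst z))"
    have [measurable]: "S1 \<in> borel_measurable borel" "S2 \<in> borel_measurable borel" unfolding S1_def S2_def by (rule borel_measurable_shear)+
    have r: "rot \<theta> z = S1 (S2 (S1 z))" for z
    proof -
      have 2: "snd (S2 (S1 z)) = snd (rot \<theta> z)"
      proof -
        have "snd z - sin \<theta> *\<^sub>R (fst z + t *\<^sub>R snd z) = (1 - sin \<theta> * t) *\<^sub>R snd z - sin \<theta> *\<^sub>R fst z"
          by (simp add: algebra_simps)
        then show ?thesis by (simp add: S1_def S2_def rot_def ts)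
      qed
      have "fst (S1 (S2 (S1 z))) = fst z + t *\<^sub>R snd z + t *\<^sub>R (cos \<theta> *\<^sub>R snd z - sin \<theta> *\<^sub>R fst z)"
        using 2 by (simp add: S1_def rot_def) (simp add: S2_def)
      also have "\<dots> = (1 - sin \<theta> * t) *\<^sub>R fst z + (t * (1 + cos \<theta>)) *\<^sub>R snd z" by (simp add: algebra_simps)
      also have "\<dots> = fst (rot \<theta> z)" by (simp add: t ts rot_def)
      finally have 1: "fst (S1 (S2 (S1 z))) = fst (rot \<theta> z)" .
      have "snd (S1 (S2 (S1 z))) = snd (rot \<theta> z)" using 2 by (simp add: S1_def)
      with 1 show ?thesis by (simp add: prod_eq_iff)
    qed
    have "(\<integral>\<^sup>+z. g (rot \<theta> z) \<partial>lborel) = (\<integral>\<^sup>+z. g (S1 (S2 z)) \<partial>lborel)"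
    proof -
      have m: "(\<lambda>z. g (S1 (S2 z))) \<in> borel_measurable borel" by measurable
      have "(fst z + t *\<^sub>R snd z, snd z) = S1 z" for z by (simp add: S1_def)
      then show ?thesis using shear_invariant(1)[OF m, of t] by (simp only: r)
    qed
    also have "\<dots> = (\<integral>\<^sup>+z. g (S1 z) \<partial>lborel)"
    proof -
      have m: "(\<lambda>z. g (S1 z)) \<in> borel_measurable borel" by measurable
      have "(fst z, snd z + (- sin \<theta>) *\<^sub>R fst z) = S2 z" for z by (simp add: S2_def)
      then show ?thesis using shear_invariant(2)[OF m, of "- sin \<theta>"] by (simp only:)
    qed
    also have "\<dots> = (\<integral>\<^sup>+z. g z \<partial>lborel)"
      using shear_invariant(1)[of g t] by (simp add: S1_def)
    finally show ?thesis .
  qed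
  show ?thesis
  proof (cases "cos \<theta> = -1")
    case False then show ?thesis using f by (intro main)
  next
    case True
    then have "sin \<theta> = 0" using sin_squared_eq[of \<theta>] by simp
    then have "rot \<theta> z = rot (pi/2) (rot (pi/2) z)" for z :: "'d::finite phase_space" using True by (simp add: rot_rot) (simp add: rot_def)
    then show ?thesis using main[of "pi/2" "\<lambda>z. f (rot (pi/2) z)"] main[of "pi/2" f] by simp
  qed
qed

section \<open>Circular means\<close>

abbreviation unit_lborel :: "real measure" where "unit_lborel \<equiv> restrict_space lborel {0..1}"

lemma prob_space_unit_lborel: "prob_space unit_lborel"
  by (rule prob_spaceI) (simp add: space_restrict_space emeasure_restrict_space)

text \<open>Cauchy's integral formula on the unit circle; the parameter runs over [0, 1] so that the
  mean is an integral over a probability space, ready for Fubini's theorem.\<close>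

lemma circle_mean:
  assumes "f holomorphic_on UNIV"
  shows "integrable unit_lborel (\<lambda>t. f (cis (2 * pi * t)))" "(\<integral>t. f (cis (2 * pi * t)) \<partial>unit_lborel) = f 0"
proof -
  let ?g = "\<lambda>t. f (cis (2 * pi * t))"
  have "((\<lambda>u. f u / (u - 0)) has_contour_integral (2 * of_real pi * \<i> * f 0)) (circlepath 0 1)"
    using assms by (intro Cauchy_integral_circlepath holomorphic_on_imp_continuous_on) (auto intro: holomorphic_on_subset)
  then have "((\<lambda>t. f (circlepath 0 1 t) / (circlepath 0 1 t) * vector_derivative (circlepath 0 1) (at t)) has_integral (2 * of_real pi * \<i> * f 0)) {0..1}"
    by (simp add: has_contour_integral)
  then have "((\<lambda>t. (2 * of_real pi * \<i>) * ?g t) has_integral ((2 * of_real pi * \<i>) * f 0)) {0..1}"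
    unfolding vector_derivative_circlepath by (simp add: circlepath cis_conv_exp mult_ac)
  then have "((\<lambda>t. (1 / (2 * of_real pi * \<i>)) * ((2 * of_real pi * \<i>) * ?g t)) has_integral ((1 / (2 * of_real pi * \<i>)) * ((2 * of_real pi * \<i>) * f 0))) {0..1}"
    by (rule has_integral_mult_right)
  then have hi: "(?g has_integral f 0) {0..1}" by simp
  have cont: "continuous_on {0..1} ?g"
  proof (rule continuous_on_compose2[OF holomorphic_on_imp_continuous_on[OF assms]])
    show "continuous_on {0..1} (\<lambda>t. cis (2 * pi * t))" unfolding cis_conv_exp by (intro continuous_intros)
  qed simp
  have si: "set_integrable lborel {0..1} ?g" by (rule borel_integrable_atLeastAtMost'[OF cont])
  then show "integrable unit_lborel ?g" by (simp add: set_integrable_def integrable_restrict_space)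
  have "(\<integral>t. ?g t \<partial>unit_lborel) = set_lebesgue_integral lborel {0..1} ?g"
    by (simp add: set_lebesgue_integral_def integral_restrict_space)
  also have "\<dots> = f 0" using set_borel_integral_eq_integral(2)[OF si] hi by (simp add: integral_unique)
  finally show "(\<integral>t. ?g t \<partial>unit_lborel) = f 0" .
qed

lemma entire_circle_mean:
  assumes "entire F"
  shows "(\<integral>t. F (a + cplx (rot (2 * pi * t) z)) \<partial>unit_lborel) = F a"
    and "ennreal (norm (F a)) \<le> (\<integral>\<^sup>+t. ennreal (norm (F (a + cplx (rot (2 * pi * t) z)))) \<partial>unit_lborel)"
proof -
  have hol: "(\<lambda>t. F (a + t *s cplx z)) holomorphic_on UNIV" by (rule entire_line_holomorphic[OF assms])
  show e: "(\<integral>t. F (a + cplx (rot (2 * pi * t) z)) \<partial>unit_lborel) = F a"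
    using circle_mean(2)[OF hol] by (simp add: cplx_rot)
  have i: "integrable unit_lborel (\<lambda>t. F (a + cplx (rot (2 * pi * t) z)))"
    using circle_mean(1)[OF hol] by (simp add: cplx_rot)
  have "ennreal (norm (F a)) \<le> ennreal (\<integral>t. norm (F (a + cplx (rot (2 * pi * t) z))) \<partial>unit_lborel)"
    using integral_norm_bound[of unit_lborel "\<lambda>t. F (a + cplx (rot (2 * pi * t) z))"] e by (intro ennreal_leI) simp
  also have "\<dots> = (\<integral>\<^sup>+t. ennreal (norm (F (a + cplx (rot (2 * pi * t) z)))) \<partial>unit_lborel)"
    using i by (intro nn_integral_eq_integral[symmetric]) auto
  finally show "ennreal (norm (F a)) \<le> (\<integral>\<^sup>+t. ennreal (norm (F (a + cplx (rot (2 * pi * t) z)))) \<partial>unit_lborel)" .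
qed

lemma borel_measurable_entire [measurable]: "entire F \<Longrightarrow> F \<in> borel_measurable borel"
  by (intro borel_measurable_continuous_onI entire_continuous)

lemma borel_measurable_cplx [measurable]: "cplx \<in> borel_measurable borel"
  by (intro borel_measurable_continuous_onI continuous_intros)

text \<open>The circular mean inequality is integrated over the ball; after the integrals are
  exchanged, each rotation disappears because it preserves the ball and Lebesgue measure.\<close>

lemma sub_mean_value:
  fixes F :: "complex ^ 'd \<Rightarrow> complex"
  assumes F: "entire F"
  shows "ennreal (norm (F a)) * emeasure lborel (ball (0::'d::finite phase_space) d)
     \<le> (\<integral>\<^sup>+z. indicator (ball 0 d) z * ennreal (norm (F (a + cplx z))) \<partial>lborel)"
proof -
  interpret U: prob_space unit_lborel by (rule prob_space_unit_lborel)
  interpret P: pair_sigma_finite unit_lborel "lborel :: 'd::finite phase_space measure" by standard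
  have [measurable]: "F \<in> borel_measurable borel" using F by (rule borel_measurable_entire)
  let ?D = "ball (0::'d::finite phase_space) d"
  have [measurable]: "?D \<in> sets borel" by simp
  let ?k = "\<lambda>z. indicator ?D z * ennreal (norm (F (a + cplx z)))"
  have "ennreal (norm (F a)) * emeasure lborel ?D = (\<integral>\<^sup>+z. ennreal (norm (F a)) * indicator ?D z \<partial>lborel)"
    by (subst nn_integral_cmult) auto
  also have "\<dots> \<le> (\<integral>\<^sup>+z. \<integral>\<^sup>+t. ?k (rot (2 * pi * t) z) \<partial>unit_lborel \<partial>lborel)"
  proof (rule nn_integral_mono)
    fix z :: "'d::finite phase_space"
    have "ennreal (norm (F a)) * indicator ?D z \<le> (\<integral>\<^sup>+t. ennreal (norm (F (a + cplx (rot (2 * pi * t) z)))) \<partial>unit_lborel) * indicator ?D z"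
      by (intro mult_right_mono entire_circle_mean[OF F]) auto
    also have "\<dots> = (\<integral>\<^sup>+t. ennreal (norm (F (a + cplx (rot (2 * pi * t) z)))) * indicator ?D z \<partial>unit_lborel)"
      by (subst nn_integral_multc) (auto simp: measurable_restrict_space1)
    also have "\<dots> = (\<integral>\<^sup>+t. ?k (rot (2 * pi * t) z) \<partial>unit_lborel)"
      by (intro nn_integral_cong) (auto simp: indicator_def)
    finally show "ennreal (norm (F a)) * indicator ?D z \<le> (\<integral>\<^sup>+t. ?k (rot (2 * pi * t) z) \<partial>unit_lborel)" .
  qed
  also have "\<dots> = (\<integral>\<^sup>+t. \<integral>\<^sup>+z. ?k (rot (2 * pi * t) z) \<partial>lborel \<partial>unit_lborel)"
  proof (rule P.Fubini')
    have "fst \<in> borel_measurable (unit_lborel \<Otimes>\<^sub>M (lborel :: 'd phase_space measure))"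
      by (rule measurable_compose[OF measurable_fst]) (simp add: measurable_restrict_space1)
    moreover have "snd \<in> borel_measurable (unit_lborel \<Otimes>\<^sub>M (lborel :: 'd phase_space measure))"
      using measurable_snd[of unit_lborel "lborel :: 'd phase_space measure"] by simp
    ultimately have "(\<lambda>p. rot (2 * pi * fst p) (snd p)) \<in> borel_measurable (unit_lborel \<Otimes>\<^sub>M (lborel :: 'd phase_space measure))"
      by (intro borel_measurable_rot) auto
    moreover have "?k \<in> borel_measurable borel" by measurable
    ultimately have "(\<lambda>p. ?k (rot (2 * pi * fst p) (snd p))) \<in> borel_measurable (unit_lborel \<Otimes>\<^sub>M (lborel :: 'd phase_space measure))"
      by (rule measurable_compose)
    then show "(\<lambda>(t, z). ?k (rot (2 * pi * t) z)) \<in> borel_measurable (unit_lborel \<Otimes>\<^sub>M (lborel :: 'd phase_space measure))"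
      by (simp add: case_prod_beta)
  qed
  also have "\<dots> = (\<integral>\<^sup>+t. \<integral>\<^sup>+z. ?k z \<partial>lborel \<partial>unit_lborel)"
    by (intro nn_integral_cong rot_invariant) measurable
  also have "\<dots> = (\<integral>\<^sup>+z. ?k z \<partial>lborel)" by (simp add: emeasure_restrict_space)
  finally show ?thesis .
qed

section \<open>Sub-mean value property and analytic functionals\<close>

text \<open>
  For \<open>r < 1\<close> maximize \<open>\<bar>F(a + z)\<bar> (1 - \<bar>z\<bar>)\<^sup>N\<close> over the unit ball: near a maximum
  point, \<open>\<bar>F\<bar>\<close> is at most a constant times \<open>\<bar>F\<bar>\<^sup>r\<close>, which reduces the claim to \<open>r = 1\<close>.
\<close>

lemma power_sub_mean_value:
  fixes r :: real
  assumes r: "0 < r" "r \<le> 1"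
  shows "\<exists>C>0. \<forall>(F :: complex ^ 'd::finite \<Rightarrow> complex) a. entire F \<longrightarrow>
     ennreal (norm (F a) powr r) \<le> ennreal C * (\<integral>\<^sup>+z. indicator (ball 0 1) z * ennreal (norm (F (a + cplx z)) powr r) \<partial>lborel)"
proof -
  define n where "n = real DIM('d phase_space)"
  \<comment> \<open>This exponent makes the powers of the distance d cancel at the end, through
    \<open>- N * (1 - r) = - N + n\<close>.\<close>
  define N where "N = n / r"
  define V where "V = measure lborel (ball (0::'d phase_space) 1)"
  have V: "0 < V" unfolding V_def by (rule content_ball_pos) simp
  have n: "0 < n" unfolding n_def by simp
  have N: "0 < N" using n r by (simp add: N_def)
  have main: "ennreal (norm (F a) powr r) \<le> ennreal (2 powr N / V) * (\<integral>\<^sup>+z. indicator (ball 0 1) z * ennreal (norm (F (a + cplx z)) powr r) \<partial>lborel)"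
    (is "_ \<le> _ * ?A") if F: "entire F" for F :: "complex ^ 'd \<Rightarrow> complex" and a
  proof -
    have [measurable]: "F \<in> borel_measurable borel" using F by (rule borel_measurable_entire)
    define f where "f z = norm (F (a + cplx z))" for z
    have f0: "0 \<le> f z" for z by (simp add: f_def)
    have [measurable]: "f \<in> borel_measurable borel" unfolding f_def by measurable
    define \<phi> where "\<phi> z = f z * (1 - norm z) powr N" for z :: "'d phase_space"
    have cF: "continuous_on (cball 0 1) (\<lambda>z::'d phase_space. F (a + cplx z))"
      by (rule continuous_on_compose2[OF entire_continuous[OF F, of UNIV]]) (auto intro!: continuous_intros)
    have "continuous_on (cball 0 1) \<phi>" unfolding \<phi>_def f_def using N
      by (intro continuous_on_mult continuous_on_norm cF continuous_on_powr' continuous_intros) auto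
    then obtain z1 where z1: "z1 \<in> cball 0 1" "\<And>z. z \<in> cball 0 1 \<Longrightarrow> \<phi> z \<le> \<phi> z1"
      using continuous_attains_sup[of "cball 0 1" \<phi>] by auto
    define S where "S = \<phi> z1"
    have fS: "f 0 \<le> S" using z1(2)[of 0] by (simp add: \<phi>_def S_def)
    \<comment> \<open>If S = 0 then F vanishes at a, and if the integral is infinite nothing is to
      be shown; in the remaining case all quantities are positive reals or finite.\<close>
    consider "S = 0" | "?A = top" | "S \<noteq> 0" "?A \<noteq> top" by blast
    then show ?thesis
    proof cases
      case 1
      then have "f 0 = 0" using fS f0[of 0] by simp
      then show ?thesis by (simp add: f_def)
    next
      case 2
      then show ?thesis using V by (simp add: ennreal_mult_top)
    next
      case 3
      then have S: "0 < S" using fS f0[of 0] by simp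
      obtain A where A: "?A = ennreal A" "0 \<le> A" using 3 by (cases ?A) auto
      have nz: "norm z1 < 1"
      proof (rule ccontr)
        assume "\<not> norm z1 < 1"
        then have "norm z1 = 1" using z1(1) by simp
        then show False using S N by (simp add: S_def \<phi>_def)
      qed
      \<comment> \<open>Half the distance of the maximum point from the sphere: on the ball of
        radius d around it, \<open>1 - norm\<close> stays at least d, so maximality bounds f there
        by \<open>S * d powr (- N)\<close>.\<close>
      define d where "d = (1 - norm z1) / 2"
      have d: "0 < d" "1 - norm z1 = 2 * d" using nz by (auto simp: d_def)
      define c where "c = (S * d powr (- N)) powr (1 - r)"
      have pt: "f (z1 + z) \<le> c * f (z1 + z) powr r" "z1 + z \<in> ball 0 1" if z: "z \<in> ball 0 d" for z
      proof -
        have le: "d \<le> 1 - norm (z1 + z)" using z d norm_triangle_ineq[of z1 z] by simp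
        then show in1: "z1 + z \<in> ball 0 1" using d by simp
        have "f (z1 + z) * d powr N \<le> \<phi> (z1 + z)" unfolding \<phi>_def
          using le d N by (intro mult_left_mono powr_mono2 f0) auto
        also have "\<dots> \<le> S" unfolding S_def using in1 by (intro z1) auto
        finally have "f (z1 + z) \<le> S * d powr (- N)" using d by (simp add: powr_minus field_simps)
        then have 1: "f (z1 + z) powr (1 - r) \<le> c" unfolding c_def using r f0 by (intro powr_mono2) auto
        have "f (z1 + z) = f (z1 + z) powr (1 - r) * f (z1 + z) powr r"
        proof (cases "f (z1 + z) = 0")
          case False
          then show ?thesis using f0[of "z1 + z"] by (simp add: powr_add[symmetric])
        qed simp
        also have "\<dots> \<le> c * f (z1 + z) powr r" using 1 by (rule mult_right_mono) simp
        finally show "f (z1 + z) \<le> c * f (z1 + z) powr r" .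
      qed
      have c0: "0 \<le> c" by (simp add: c_def)
      have "ennreal (f z1) * emeasure lborel (ball (0::'d phase_space) d) \<le>
         (\<integral>\<^sup>+z. indicator (ball 0 d) z * ennreal (f (z + z1)) \<partial>lborel)"
        using sub_mean_value[OF F, of "a + cplx z1" d] by (simp add: f_def cplx_add ac_simps)
      also have "\<dots> \<le> (\<integral>\<^sup>+z. ennreal c * (indicator (ball 0 1) (z + z1) * ennreal (f (z + z1) powr r)) \<partial>lborel)"
      proof (rule nn_integral_mono)
        fix z :: "'d phase_space"
        show "indicator (ball 0 d) z * ennreal (f (z + z1)) \<le> ennreal c * (indicator (ball 0 1) (z + z1) * ennreal (f (z + z1) powr r))"
          using pt[of z] c0 by (cases "z \<in> ball 0 d") (auto simp: add.commute ennreal_mult[symmetric] intro!: ennreal_leI)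
      qed
      also have "\<dots> = ennreal c * (\<integral>\<^sup>+z. indicator (ball 0 1) (z + z1) * ennreal (f (z + z1) powr r) \<partial>lborel)"
      proof (rule nn_integral_cmult)
        have [measurable]: "ball (0::'d phase_space) 1 \<in> sets borel" by simp
        show "(\<lambda>z. indicator (ball 0 1) (z + z1) * ennreal (f (z + z1) powr r)) \<in> borel_measurable lborel" by measurable
      qed
      also have "(\<integral>\<^sup>+z. indicator (ball 0 1) (z + z1) * ennreal (f (z + z1) powr r) \<partial>lborel) = ?A"
        unfolding f_def[symmetric]
      proof (rule nn_integral_lborel_translate)
        have [measurable]: "ball (0::'d phase_space) 1 \<in> sets borel" by simp
        show "(\<lambda>z. indicator (ball 0 1) z * ennreal (f z powr r)) \<in> borel_measurable borel" by measurable
      qed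
      also have "emeasure lborel (ball (0::'d phase_space) d) = ennreal (d powr n * V)"
      proof -
        have "emeasure lborel (ball (0::'d phase_space) d) = ennreal (measure lborel (ball (0::'d phase_space) d))"
          using emeasure_lborel_ball_finite[of "0::'d phase_space" d] by (intro emeasure_eq_ennreal_measure) auto
        also have "measure lborel (ball (0::'d phase_space) d) = d ^ DIM('d phase_space) * V"
          unfolding V_def using d by (intro content_ball_conv_unit_ball) simp
        also have "d ^ DIM('d phase_space) = d powr n" unfolding n_def using d(1) by (rule powr_realpow[symmetric])
        finally show ?thesis .
      qed
      finally have "ennreal (f z1 * (d powr n * V)) \<le> ennreal (c * A)"
        using f0[of z1] V d A c0 by (simp add: ennreal_mult[symmetric])
      then have le: "f z1 * (d powr n * V) \<le> c * A" using c0 A by (subst (asm) ennreal_le_iff) auto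
      have fz1: "f z1 = S / (2 * d) powr N" using d by (simp add: S_def \<phi>_def)
      have c: "c = S powr (1 - r) * (d powr (- N) * d powr n)"
      proof -
        have "c = S powr (1 - r) * (d powr (- N)) powr (1 - r)" unfolding c_def using S by (simp add: powr_mult)
        also have "(d powr (- N)) powr (1 - r) = d powr (- N + n)"
        proof -
          have "- N * (1 - r) = - N + n" using r by (simp add: N_def field_simps)
          then show ?thesis by (simp only: powr_powr)
        qed
        finally show ?thesis by (simp only: powr_add)
      qed
      \<comment> \<open>Both sides carry the same power of d, so the unknown position of the maximum
        drops out; what remains can be divided by \<open>S powr (1 - r)\<close> because S is
        positive.\<close>
      have "S * (d powr n * V) / (2 powr N * d powr N) \<le> S powr (1 - r) * (d powr n / d powr N) * A"
        using le d unfolding fz1 c by (simp add: powr_mult powr_minus field_simps)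
      then have "S * V \<le> S powr (1 - r) * A * 2 powr N"
        using d by (simp add: field_simps)
      moreover have eq: "S powr (1 - r) * S powr r = S" using S by (simp add: powr_add[symmetric])
      ultimately have "S powr (1 - r) * (S powr r * V) \<le> S powr (1 - r) * (A * 2 powr N)"
        by (simp only: mult.assoc[symmetric] eq)
      then have "S powr r * V \<le> A * 2 powr N" using S by (simp add: mult_le_cancel_left)
      then have "S powr r \<le> (2 powr N / V) * A" using V by (simp add: field_simps)
      moreover have "f 0 powr r \<le> S powr r" using fS f0 r by (intro powr_mono2) auto
      ultimately have "f 0 powr r \<le> (2 powr N / V) * A" by linarith
      then show ?thesis unfolding A(1) using V A(2)
        by (simp add: f_def ennreal_mult[symmetric] ennreal_leI)
    qed
  qed
  then show ?thesis using V by (intro exI[of _ "2 powr N / V"]) auto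
qed

lemma distr_rot: "distr lborel borel (rot \<theta>) = (lborel :: 'd::finite phase_space measure)"
proof (rule measure_eqI)
  fix A assume "A \<in> sets (distr lborel borel (rot \<theta>) :: 'd phase_space measure)"
  then have [measurable]: "A \<in> sets borel" by simp
  have [measurable]: "rot \<theta> \<in> borel_measurable borel" by (rule borel_measurable_rot[of "\<lambda>_. \<theta>" _ "\<lambda>z. z"]) auto
  have "emeasure (distr lborel borel (rot \<theta>)) A = (\<integral>\<^sup>+z. indicator A z \<partial>distr lborel borel (rot \<theta>))" by simp
  also have "\<dots> = (\<integral>\<^sup>+z. indicator A (rot \<theta> z) \<partial>lborel)" by (subst nn_integral_distr) auto
  also have "\<dots> = emeasure lborel A" by (subst rot_invariant) auto
  finally show "emeasure (distr lborel borel (rot \<theta>)) A = emeasure lborel A" .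
qed simp

text \<open>Averaging over rotations first replaces F by its circular means, all equal to
  \<open>F 0\<close>, while the Gaussian weight is unchanged. The integrability assumption justifies
  the exchange of the integrals.\<close>

lemma gaussian_mean_value:
  fixes F :: "complex ^ 'd::finite \<Rightarrow> complex"
  assumes F: "entire F" and int: "integrable lborel (\<lambda>z::'d phase_space. F (cplx z) * of_real (exp (- (norm z)\<^sup>2 / 2)))"
  shows "(\<integral>z. F (cplx z) * of_real (exp (- (norm z)\<^sup>2 / 2)) \<partial>lborel) = F 0 * of_real (\<integral>z. exp (- (norm z)\<^sup>2 / 2) \<partial>(lborel :: 'd phase_space measure))"
proof -
  interpret U: prob_space unit_lborel by (rule prob_space_unit_lborel)
  interpret P: pair_sigma_finite unit_lborel "lborel :: 'd phase_space measure" by standard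
  have [measurable]: "F \<in> borel_measurable borel" using F by (rule borel_measurable_entire)
  let ?k = "\<lambda>z::'d phase_space. F (cplx z) * of_real (exp (- (norm z)\<^sup>2 / 2))"
  have [measurable]: "?k \<in> borel_measurable borel" by measurable
  have mr: "rot \<theta> \<in> borel_measurable borel" for \<theta>
    by (rule borel_measurable_rot[of "\<lambda>_. \<theta>" _ "\<lambda>z. z"]) auto
  have rk: "(\<integral>z. ?k (rot \<theta> z) \<partial>lborel) = (\<integral>z. ?k z \<partial>lborel)" "integrable lborel (\<lambda>z. ?k (rot \<theta> z))"
     "(\<integral>z. norm (?k (rot \<theta> z)) \<partial>lborel) = (\<integral>z. norm (?k z) \<partial>lborel)" for \<theta>
    using integral_distr[of "rot \<theta>" lborel borel ?k] integral_distr[of "rot \<theta>" lborel borel "\<lambda>z. norm (?k z)"]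
      integrable_distr[of "rot \<theta>" lborel borel ?k] mr[of \<theta>] int
    by (simp_all add: distr_rot)
  have m: "(\<lambda>(t, z). ?k (rot (2 * pi * t) z)) \<in> borel_measurable (unit_lborel \<Otimes>\<^sub>M (lborel :: 'd phase_space measure))"
  proof -
    have "fst \<in> borel_measurable (unit_lborel \<Otimes>\<^sub>M (lborel :: 'd phase_space measure))"
      by (rule measurable_compose[OF measurable_fst]) (simp add: measurable_restrict_space1)
    moreover have "snd \<in> borel_measurable (unit_lborel \<Otimes>\<^sub>M (lborel :: 'd phase_space measure))"
      using measurable_snd[of unit_lborel "lborel :: 'd phase_space measure"] by simp
    ultimately have "(\<lambda>p. rot (2 * pi * fst p) (snd p)) \<in> borel_measurable (unit_lborel \<Otimes>\<^sub>M (lborel :: 'd phase_space measure))"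
      by (intro borel_measurable_rot) auto
    moreover have "?k \<in> borel_measurable borel" by measurable
    ultimately have "(\<lambda>p. ?k (rot (2 * pi * fst p) (snd p))) \<in> borel_measurable (unit_lborel \<Otimes>\<^sub>M (lborel :: 'd phase_space measure))"
      by (rule measurable_compose)
    then show ?thesis by (simp add: case_prod_beta)
  qed
  have "integrable (unit_lborel \<Otimes>\<^sub>M lborel) (\<lambda>(t, z). ?k (rot (2 * pi * t) z))"
  proof (rule P.Fubini_integrable[OF m])
    show "integrable unit_lborel (\<lambda>t. \<integral>z. norm (case (t, z) of (t, z) \<Rightarrow> ?k (rot (2 * pi * t) z)) \<partial>lborel)"
      unfolding prod.case rk(3) by simp
    show "AE t in unit_lborel. integrable lborel (\<lambda>z. case (t, z) of (t, z) \<Rightarrow> ?k (rot (2 * pi * t) z))"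
      unfolding prod.case using rk(2) by simp
  qed
  from P.Fubini_integral[OF this]
  have "(\<integral>z. (\<integral>t. ?k (rot (2 * pi * t) z) \<partial>unit_lborel) \<partial>lborel) = (\<integral>t. (\<integral>z. ?k (rot (2 * pi * t) z) \<partial>lborel) \<partial>unit_lborel)"
    by simp
  also have "\<dots> = (\<integral>z. ?k z \<partial>lborel)" unfolding rk(1) using U.prob_space by simp
  also have "(\<integral>z. (\<integral>t. ?k (rot (2 * pi * t) z) \<partial>unit_lborel) \<partial>lborel) = (\<integral>z. F 0 * of_real (exp (- (norm z)\<^sup>2 / 2)) \<partial>(lborel :: 'd phase_space measure))"
    using entire_circle_mean(1)[OF F, of 0] by (intro Bochner_Integration.integral_cong refl) simp
  also have "\<dots> = F 0 * of_real (\<integral>z. exp (- (norm z)\<^sup>2 / 2) \<partial>(lborel :: 'd phase_space measure))"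
    by simp
  finally show ?thesis by simp
qed

section \<open>Gaussian wave packets and functionals on them\<close>

text \<open>Continuing the packet to complex arguments makes it accessible to
  \<open>analytic_bound\<close>, which measures a function on all of complex space instead of
  through its derivatives.\<close>

definition cexpq :: "complex ^ 'd \<Rightarrow> complex ^ 'd \<Rightarrow> complex" where
  "cexpq w z = exp (- cdot z z / 2 + cdot w z)"

definition gexp :: "complex ^ 'd::finite \<Rightarrow> real ^ 'd \<Rightarrow> complex" where
  "gexp w = (\<lambda>y. cexpq w (cvec y))"

lemma entire_cdot [intro]: "entire (\<lambda>z. cdot w z)"
  unfolding cdot_def by (intro entire_sum entire_mult entire_const entire_nth)

lemma entire_cdot_self [intro]: "entire (\<lambda>z. cdot z z)"
  unfolding cdot_def by (intro entire_sum entire_mult entire_nth)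

lemma entire_cexpq [intro]: "entire (cexpq w)"
proof -
  have "entire (\<lambda>z. exp ((- 1/2) * cdot z z + cdot w z))" by (intro entire_exp entire_add entire_cmult entire_cdot entire_cdot_self)
  then show ?thesis by (simp add: cexpq_def[abs_def])
qed

lemma norm_sq_re_im: "(norm z)\<^sup>2 = re_sq z + im_sq z"
  by (simp add: norm_vec_def L2_set_def sum_nonneg cmod_power2 re_sq_def im_sq_def sum.distrib)

lemma Re_cdot_self: "Re (cdot z z) = re_sq z - im_sq z"
  by (simp add: cdot_def re_sq_def im_sq_def power2_eq_square sum_subtractf)

lemma norm_cexpq_le: "norm (cexpq w z) \<le> exp (- (re_sq z) / 2 + im_sq z / 2 + norm w * norm z)"
proof -
  have "Re (cdot w z) \<le> norm w * norm z" using complex_Re_le_cmod norm_cdot_le order_trans by blast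
  then show ?thesis by (simp add: cexpq_def Re_cdot_self diff_divide_distrib)
qed

text \<open>Decay in real and growth in imaginary directions, both Gaussian. By
  \<open>GS_analytic\<close> such bounds imply membership in a Gelfand-Shilov step of order 1/2, so
  the derivatives of packets and of their superpositions never have to be estimated.\<close>

definition analytic_bound :: "real \<Rightarrow> real \<Rightarrow> real \<Rightarrow> (complex ^ 'd::finite \<Rightarrow> complex) \<Rightarrow> bool" where
  "analytic_bound a b M F \<longleftrightarrow> entire F \<and> (\<forall>z. norm (F z) \<le> M * exp (- a * re_sq z + b * im_sq z))"

text \<open>What is asked of a functional to make \<open>w \<mapsto> L (gexp w)\<close> entire. It
  covers the elements of \<open>GS_dual (1/2)\<close> as well as integration against a bounded
  function, so the argument is made once.\<close>

definition analytic_functional :: "((real ^ 'd::finite \<Rightarrow> complex) \<Rightarrow> complex) \<Rightarrow> bool" where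
  "analytic_functional L \<longleftrightarrow>
     (\<forall>F G a b M M' \<alpha> \<beta>. 0 < a \<longrightarrow> 0 < b \<longrightarrow> analytic_bound a b M F \<longrightarrow> analytic_bound a b M' G \<longrightarrow>
        L (\<lambda>x. \<alpha> * F (cvec x) + \<beta> * G (cvec x)) = \<alpha> * L (\<lambda>x. F (cvec x)) + \<beta> * L (\<lambda>x. G (cvec x))) \<and>
     (\<forall>a>0. \<forall>b>0. \<exists>C>0. \<forall>F M. analytic_bound a b M F \<longrightarrow> norm (L (\<lambda>x. F (cvec x))) \<le> C * M)"

lemma re_im_sq_nonneg [simp]: "0 \<le> re_sq z" "0 \<le> im_sq z"
  by (simp_all add: re_sq_def im_sq_def sum_nonneg)

lemma poly_exp_bound:
  assumes "0 \<le> t" shows "(1 + t\<^sup>2) * exp (k * t) \<le> 8 * exp (2 * k\<^sup>2) * exp (t\<^sup>2 / 4 :: real)"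
proof -
  have 1: "1 + t\<^sup>2 \<le> 8 * exp (t\<^sup>2 / 8)" 
  proof -
    have "1 + t\<^sup>2/8 \<le> exp (t\<^sup>2/8)" by (rule exp_ge_add_one_self)
    then show ?thesis by linarith
  qed
  have "0 \<le> (t / 4 - k)\<^sup>2 * 2" by simp
  then have 2: "k * t \<le> 2 * k\<^sup>2 + t\<^sup>2 / 8" by (simp add: power2_eq_square algebra_simps)
  have "(1 + t\<^sup>2) * exp (k * t) \<le> (8 * exp (t\<^sup>2 / 8)) * exp (2 * k\<^sup>2 + t\<^sup>2 / 8)"
    using 1 2 by (intro mult_mono) auto
  also have "\<dots> = 8 * exp (2 * k\<^sup>2) * exp (t\<^sup>2 / 4)" by (simp add: exp_add[symmetric])
  finally show ?thesis .
qed

text \<open>The rates 1/4 and 3/4 arise as 1/2 - 1/4 and 1/2 + 1/4: a quarter of |z|^2 is given up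
  to swallow the factor p and the exponential of |w| |z|. They are the same for all w, so one
  continuity constant of a functional serves for all packets.\<close>

lemma cexpq_poly_bound:
  assumes "norm p \<le> c * (1 + (norm z)\<^sup>2) * exp (k * norm z)" "0 \<le> c"
  shows "norm (cexpq w z * p) \<le> c * (8 * exp (2 * (norm w + k)\<^sup>2)) * exp (- (1/4) * re_sq z + (3/4) * im_sq z)"
proof -
  have "norm (cexpq w z * p) \<le> exp (- (re_sq z) / 2 + im_sq z / 2 + norm w * norm z) * (c * (1 + (norm z)\<^sup>2) * exp (k * norm z))"
    unfolding norm_mult by (intro mult_mono norm_cexpq_le assms) auto
  also have "\<dots> = c * exp (- (re_sq z) / 2 + im_sq z / 2) * ((1 + (norm z)\<^sup>2) * exp ((norm w + k) * norm z))"
  proof -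
    have "exp ((norm w + k) * norm z) = exp (norm w * norm z) * exp (k * norm z)" by (simp add: distrib_right exp_add)
    then show ?thesis unfolding exp_add[of _ "norm w * norm z"] by (simp only: ac_simps)
  qed
  also have "\<dots> \<le> c * exp (- (re_sq z) / 2 + im_sq z / 2) * (8 * exp (2 * (norm w + k)\<^sup>2) * exp ((norm z)\<^sup>2 / 4))"
    using assms(2) by (intro mult_left_mono poly_exp_bound) auto
  also have "\<dots> = c * (8 * exp (2 * (norm w + k)\<^sup>2)) * exp (- (re_sq z) / 2 + im_sq z / 2 + (re_sq z + im_sq z) / 4)"
    by (simp add: exp_add norm_sq_re_im)
  also have "- (re_sq z) / 2 + im_sq z / 2 + (re_sq z + im_sq z) / 4 = - (1/4) * re_sq z + (3/4) * im_sq z" unfolding add_divide_distrib by simp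
  finally show ?thesis .
qed

lemma analytic_bound_gexp:
  "analytic_bound (1/4) (3/4) (8 * exp (2 * (norm w)\<^sup>2)) (cexpq w)"
  using cexpq_poly_bound[of 1 1 _ 0 w] by (auto simp: analytic_bound_def)

lemma exp_remainder_bound: "norm (exp s - 1 - s :: complex) \<le> (norm s)\<^sup>2 * exp (norm s)"
proof -
  have "norm (exp s - (\<Sum>k\<le>1. s ^ k / fact k)) \<le> exp (norm s) * (norm s) ^ Suc 1 / fact 1"
    by (rule Taylor_exp_field)
  then show ?thesis by (simp add: power2_eq_square algebra_simps)
qed

text \<open>Differentiation under the functional: \<open>Q\<close> is the derivative of the packet
  in direction v, and the remainder is of order |v|^2 in the weighted supremum norm with rates 1/4
  and 3/4, in which L is bounded.\<close>

lemma analytic_functional_entire: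
  fixes L :: "(real ^ 'd::finite \<Rightarrow> complex) \<Rightarrow> complex"
  assumes L: "analytic_functional L"
  shows "entire (\<lambda>w. L (gexp w))"
proof -
  define Q where "Q w v z = cexpq w z * cdot v z" for w v z :: "complex ^ 'd"
  define D where "D w v = L (\<lambda>x. Q w v (cvec x))" for w v
  have lin: "L (\<lambda>x. \<alpha> * F (cvec x) + \<beta> * G (cvec x)) = \<alpha> * L (\<lambda>x. F (cvec x)) + \<beta> * L (\<lambda>x. G (cvec x))"
    if "analytic_bound (1/4) (3/4) M F" "analytic_bound (1/4) (3/4) M' G" for F G M M' \<alpha> \<beta>
    by (rule L[unfolded analytic_functional_def, THEN conjunct1, rule_format, OF _ _ that]) simp_all
  have "\<exists>C>0. \<forall>F M. analytic_bound (1/4) (3/4) M F \<longrightarrow> norm (L (\<lambda>x. F (cvec x))) \<le> C * M"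
    by (rule L[unfolded analytic_functional_def, THEN conjunct2, rule_format]) simp_all
  then obtain C where C: "0 < C" "\<And>F M. analytic_bound (1/4) (3/4) M F \<Longrightarrow> norm (L (\<lambda>x. F (cvec x))) \<le> C * M"
    by blast
  have entQ: "entire (Q w v)" for w v
    unfolding Q_def by (intro entire_mult entire_cdot entire_cexpq)
  have Qb: "analytic_bound (1/4) (3/4) (norm v * (8 * exp (2 * (norm w)\<^sup>2))) (Q w v)" for w v
  proof -
    have "norm (cdot v z) \<le> norm v * (1 + (norm z)\<^sup>2) * exp (0 * norm z)" for z
    proof -
      have "norm z \<le> 1 + (norm z)\<^sup>2"

      proof -
        have "0 \<le> (norm z - 1/2)\<^sup>2" by simp
        then show ?thesis by (simp add: power2_eq_square algebra_simps)
      qed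
      then have "norm v * norm z \<le> norm v * (1 + (norm z)\<^sup>2)" by (intro mult_left_mono) auto
      then show ?thesis using norm_cdot_le[of v z] by simp
    qed
    from cexpq_poly_bound[OF this, of w] entQ show ?thesis unfolding analytic_bound_def Q_def by auto
  qed
  have Dadd: "D w (v + v') = D w v + D w v'" for w v v'
    using lin[OF Qb[of v w] Qb[of v' w], of 1 1] by (simp add: D_def Q_def cdot_add_left algebra_simps)
  have Dsm: "D w (c *s v) = c * D w v" for w c v
  proof -
    have "cdot (c *s v) z = c * cdot v z" for z by (simp add: cdot_def sum_distrib_left mult.assoc)
    then have "D w (c *s v) = L (\<lambda>x. c * Q w v (cvec x) + 0 * Q w v (cvec x))" by (simp add: D_def Q_def ac_simps)
    then show ?thesis using lin[OF Qb[of v w] Qb[of v w], of c 0] by (simp add: D_def)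
  qed
  have Dn: "norm (D w v) \<le> norm v * (C * (8 * exp (2 * (norm w)\<^sup>2)))" for w v
    using C(2)[OF Qb[of v w]] by (simp add: D_def ac_simps)
  have bl: "bounded_linear (D w)" for w
  proof (rule bounded_linear_intro[OF Dadd _ Dn])
    fix r and v :: "complex ^ 'd"
    have "r *\<^sub>R v = complex_of_real r *s v" by (simp add: vec_eq_iff complex_eq_iff)
    then show "D w (r *\<^sub>R v) = r *\<^sub>R D w v" by (simp only: Dsm scaleR_conv_of_real)
  qed
  have rem: "norm (L (gexp (w + v)) - L (gexp w) - D w v) \<le> (C * (8 * exp (2 * (norm w + 1)\<^sup>2))) * (norm v)\<^sup>2"
    if v: "norm v \<le> 1" for w v
  proof -
    define R where "R z = cexpq w z * (exp (cdot v z) - 1 - cdot v z)" for z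
    have eR: "entire R" unfolding R_def
      by (intro entire_mult entire_diff entire_exp entire_cdot entire_const entire_cexpq)
    have Rb: "analytic_bound (1/4) (3/4) ((norm v)\<^sup>2 * (8 * exp (2 * (norm w + 1)\<^sup>2))) R"
    proof -
      have "norm (exp (cdot v z) - 1 - cdot v z) \<le> (norm v)\<^sup>2 * (1 + (norm z)\<^sup>2) * exp (1 * norm z)" for z
      proof -
        have 1: "norm (cdot v z) \<le> norm v * norm z" by (rule norm_cdot_le)
        have 2: "norm v * norm z \<le> 1 * norm z" using v by (intro mult_right_mono) auto
        have "norm (exp (cdot v z) - 1 - cdot v z) \<le> (norm (cdot v z))\<^sup>2 * exp (norm (cdot v z))" by (rule exp_remainder_bound)
        also have "\<dots> \<le> (norm v * norm z)\<^sup>2 * exp (1 * norm z)"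
          using 1 2 by (intro mult_mono power_mono) auto
        also have "\<dots> \<le> ((norm v)\<^sup>2 * (1 + (norm z)\<^sup>2)) * exp (1 * norm z)"
          by (intro mult_right_mono) (auto simp: power_mult_distrib distrib_left)
        finally show ?thesis .
      qed
      from cexpq_poly_bound[OF this, of w] eR show ?thesis unfolding analytic_bound_def R_def by auto
    qed
    have e: "cexpq (w + v) z = cexpq w z * exp (cdot v z)" for z
      by (simp add: cexpq_def cdot_add_left exp_add[symmetric] algebra_simps)
    have "gexp (w + v) = (\<lambda>x. 1 * R (cvec x) + 1 * (cexpq w (cvec x) + Q w v (cvec x)))"
      unfolding gexp_def e R_def Q_def by (simp add: algebra_simps)
    moreover have "analytic_bound (1/4) (3/4) (8 * exp (2 * (norm w)\<^sup>2) + norm v * (8 * exp (2 * (norm w)\<^sup>2))) (\<lambda>z. cexpq w z + Q w v z)"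
      using analytic_bound_gexp[of w] Qb[of v w] unfolding analytic_bound_def
      by (auto simp: distrib_right intro!: norm_triangle_mono entire_add)
    ultimately have "L (gexp (w + v)) = L (\<lambda>x. R (cvec x)) + L (\<lambda>x. cexpq w (cvec x) + Q w v (cvec x))"
      using lin[OF Rb, of _ "\<lambda>z. cexpq w z + Q w v z" 1 1] by simp
    also have "L (\<lambda>x. cexpq w (cvec x) + Q w v (cvec x)) = L (gexp w) + D w v"
      using lin[OF analytic_bound_gexp[of w] Qb[of v w], of 1 1] by (simp add: D_def gexp_def)
    finally have "L (gexp (w + v)) - L (gexp w) - D w v = L (\<lambda>x. R (cvec x))" by simp
    then show ?thesis using C(2)[OF Rb] by (simp add: ac_simps)
  qed
  show ?thesis
  proof (rule entireI)
    fix w :: "complex ^ 'd"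
    let ?K = "C * (8 * exp (2 * (norm w + 1)\<^sup>2))"
    show "((\<lambda>w. L (gexp w)) has_derivative D w) (at w)"
    proof (rule has_derivativeI_sandwich[of 1])
      show "((\<lambda>y. ?K * norm (y - w)) \<longlongrightarrow> 0) (at w)"
        by (rule tendsto_eq_intros refl | simp)+
      fix y assume y: "y \<noteq> w" "dist y w < 1"
      have "norm (L (gexp y) - L (gexp w) - D w (y - w)) \<le> ?K * (norm (y - w))\<^sup>2"
        using rem[of "y - w" w] y by (simp add: dist_norm)
      then show "norm (L (gexp y) - L (gexp w) - D w (y - w)) / norm (y - w) \<le> ?K * norm (y - w)"
        using y by (simp add: divide_le_eq power2_eq_square mult.assoc)
    qed (use bl in auto)
  qed (rule Dsm)
qed

section \<open>Gelfand-Shilov functions and their dual\<close>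

lemma smooth_foldr: "smooth f \<Longrightarrow> foldr partial_deriv is f differentiable (at x)"
  by (simp add: smooth_def)

lemma smooth_partial_deriv: "smooth f \<Longrightarrow> smooth (partial_deriv i f)"
  unfolding smooth_def
proof (intro allI)
  fix "is" x
  assume "\<forall>is x. foldr partial_deriv is f differentiable at x"
  then have "foldr partial_deriv (is @ [i]) f differentiable at x" by blast
  then show "foldr partial_deriv is (partial_deriv i f) differentiable at x" by simp
qed

lemma smooth_funpow: "smooth f \<Longrightarrow> smooth ((partial_deriv i ^^ k) f)"
  by (induction k) (auto intro: smooth_partial_deriv)

lemma smooth_differentiable: "smooth f \<Longrightarrow> f differentiable (at x)"
  using smooth_foldr[of f "[]"] by simp

lemma partial_deriv_lincomb:
  assumes "\<And>x. f differentiable (at x)" "\<And>x. g differentiable (at x)"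
  shows "partial_deriv i (\<lambda>x. a * f x + b * g x) = (\<lambda>x. a * partial_deriv i f x + b * partial_deriv i g x)"
proof
  fix x
  have "((\<lambda>x. a * f x + b * g x) has_derivative (\<lambda>h. a * frechet_derivative f (at x) h + b * frechet_derivative g (at x) h)) (at x)"
    using assms by (intro has_derivative_add has_derivative_mult_right) (auto simp: frechet_derivative_works)
  from frechet_derivative_at[OF this, symmetric]
  show "partial_deriv i (\<lambda>x. a * f x + b * g x) x = a * partial_deriv i f x + b * partial_deriv i g x"
    by (simp add: partial_deriv_def)
qed

lemma foldr_partial_deriv_lincomb:
  assumes "smooth f" "smooth g"
  shows "foldr partial_deriv is (\<lambda>x. a * f x + b * g x) = (\<lambda>x. a * foldr partial_deriv is f x + b * foldr partial_deriv is g x)"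
proof (induction "is")
  case (Cons i "is")
  show ?case using partial_deriv_lincomb[OF smooth_foldr[OF assms(1), of "is"] smooth_foldr[OF assms(2), of "is"]]
    by (simp add: Cons.IH)
qed simp

lemma smooth_lincomb: "smooth f \<Longrightarrow> smooth g \<Longrightarrow> smooth (\<lambda>x. a * f x + b * g x)"
  unfolding smooth_def[of "\<lambda>x. a * f x + b * g x"]
  by (simp add: foldr_partial_deriv_lincomb) (intro allI derivative_intros smooth_foldr)

text \<open>Rewriting iterated powers as one list of single derivatives brings
  \<open>multi_deriv\<close> into the form in which \<open>smooth\<close> is stated.\<close>

lemma foldr_funpow_concat:
  "foldr (\<lambda>i. F i ^^ a i) L f = foldr F (concat (map (\<lambda>i. replicate (a i) i) L)) f"
proof (induction L)
  case (Cons i L)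
  have "foldr F (replicate n i) g = (F i ^^ n) g" for n g by (induction n) auto
  then show ?case using Cons by simp
qed simp

lemma multi_deriv_lincomb:
  "smooth f \<Longrightarrow> smooth g \<Longrightarrow> multi_deriv \<alpha> (\<lambda>x. a * f x + b * g x) x = a * multi_deriv \<alpha> f x + b * multi_deriv \<alpha> g x"
  unfolding multi_deriv_def foldr_funpow_concat by (simp add: foldr_partial_deriv_lincomb)

lemma GS_norm_upper:
  "ennreal (norm (of_real (mpower x \<beta>) * multi_deriv \<alpha> f x) / (h ^ (mabs \<alpha> + mabs \<beta>) * (mfact \<alpha> * mfact \<beta>) powr s)) \<le> GS_norm s h f"
  unfolding GS_norm_def by (rule SUP_upper2[of \<alpha>], simp, rule SUP_upper2[of \<beta>], simp, rule SUP_upper2[of x]) auto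

lemma GS_norm_least:
  assumes "\<And>\<alpha> \<beta> x. ennreal (norm (of_real (mpower x \<beta>) * multi_deriv \<alpha> f x) / (h ^ (mabs \<alpha> + mabs \<beta>) * (mfact \<alpha> * mfact \<beta>) powr s)) \<le> B"
  shows "GS_norm s h f \<le> B"
  unfolding GS_norm_def by (intro SUP_least assms)

lemma mfact_pos: "0 < mfact \<alpha>"
  by (simp add: mfact_def prod_pos)

lemma GS_norm_lincomb:
  fixes h s :: real and f g :: "real ^ 'd::finite \<Rightarrow> complex"
  assumes h: "0 < h" and f: "smooth f" "smooth g"
  shows "GS_norm s h (\<lambda>x. a * f x + b * g x) \<le> ennreal (norm a) * GS_norm s h f + ennreal (norm b) * GS_norm s h g"
proof (rule GS_norm_least)
  fix \<alpha> \<beta> :: "'d \<Rightarrow> nat" and x :: "real ^ 'd"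
  let ?d = "h ^ (mabs \<alpha> + mabs \<beta>) * (mfact \<alpha> * mfact \<beta>) powr s"
  let ?q = "\<lambda>f. norm (of_real (mpower x \<beta>) * multi_deriv \<alpha> f x)"
  have d: "0 < ?d" using h mfact_pos[of \<alpha>] mfact_pos[of \<beta>] by simp
  have "?q (\<lambda>x. a * f x + b * g x) \<le> norm a * ?q f + norm b * ?q g"
  proof -
    have "of_real (mpower x \<beta>) * multi_deriv \<alpha> (\<lambda>x. a * f x + b * g x) x
        = a * (of_real (mpower x \<beta>) * multi_deriv \<alpha> f x) + b * (of_real (mpower x \<beta>) * multi_deriv \<alpha> g x)"
      by (simp add: multi_deriv_lincomb[OF f] algebra_simps)
    then show ?thesis by (simp only:) (rule order_trans[OF norm_triangle_ineq], simp only: norm_mult order_refl)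
  qed
  then have "?q (\<lambda>x. a * f x + b * g x) / ?d \<le> (norm a * ?q f + norm b * ?q g) / ?d"
    by (rule divide_right_mono) (use d in simp)
  then have "?q (\<lambda>x. a * f x + b * g x) / ?d \<le> norm a * (?q f / ?d) + norm b * (?q g / ?d)"
    by (simp only: add_divide_distrib times_divide_eq_right)
  then have "ennreal (?q (\<lambda>x. a * f x + b * g x) / ?d) \<le> ennreal (norm a * (?q f / ?d) + norm b * (?q g / ?d))"
    by (rule ennreal_leI)
  also have "\<dots> = ennreal (norm a) * ennreal (?q f / ?d) + ennreal (norm b) * ennreal (?q g / ?d)"
    using d by (simp only: ennreal_plus[OF mult_nonneg_nonneg mult_nonneg_nonneg] ennreal_mult norm_ge_zero divide_nonneg_pos)
  also have "\<dots> \<le> ennreal (norm a) * GS_norm s h f + ennreal (norm b) * GS_norm s h g"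
    by (intro add_mono mult_left_mono GS_norm_upper) auto
  finally show "ennreal (?q (\<lambda>x. a * f x + b * g x) / ?d) \<le> ennreal (norm a) * GS_norm s h f + ennreal (norm b) * GS_norm s h g" .
qed

lemma GS_norm_antimono:
  fixes f :: "real ^ 'd::finite \<Rightarrow> complex"
  assumes "0 < h" "h \<le> h'" shows "GS_norm s h' f \<le> GS_norm s h f"
proof (rule GS_norm_least)
  fix \<alpha> \<beta> :: "'d \<Rightarrow> nat" and x :: "real ^ 'd"
  have "0 < (mfact \<alpha> * mfact \<beta>) powr s" using mfact_pos[of \<alpha>] mfact_pos[of \<beta>] by simp
  then have "ennreal (norm (of_real (mpower x \<beta>) * multi_deriv \<alpha> f x) / (h' ^ (mabs \<alpha> + mabs \<beta>) * (mfact \<alpha> * mfact \<beta>) powr s))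
     \<le> ennreal (norm (of_real (mpower x \<beta>) * multi_deriv \<alpha> f x) / (h ^ (mabs \<alpha> + mabs \<beta>) * (mfact \<alpha> * mfact \<beta>) powr s))"
    using assms by (intro ennreal_leI divide_left_mono mult_right_mono power_mono mult_pos_pos zero_less_power) auto
  then show "ennreal (norm (of_real (mpower x \<beta>) * multi_deriv \<alpha> f x) / (h' ^ (mabs \<alpha> + mabs \<beta>) * (mfact \<alpha> * mfact \<beta>) powr s)) \<le> GS_norm s h f"
    using GS_norm_upper order_trans by blast
qed

lemma GS_step_mono: "0 < h \<Longrightarrow> h \<le> h' \<Longrightarrow> GS_step s h \<subseteq> GS_step s h'"
  using GS_norm_antimono[of h h' s] unfolding GS_step_def by (auto intro: le_less_trans)

lemma GS_step_lincomb:
  assumes "0 < h" "f \<in> GS_step s h" "g \<in> GS_step s h" shows "(\<lambda>x. a * f x + b * g x) \<in> GS_step s h"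
  using assms GS_norm_lincomb[of h f g s a b] unfolding GS_step_def
  by (auto intro!: smooth_lincomb elim!: le_less_trans simp: ennreal_mult_less_top)

lemma GS_stepI: "0 < h \<Longrightarrow> f \<in> GS_step s h \<Longrightarrow> f \<in> GS s"
  by (auto simp: GS_def)

lemma GS_lincomb:
  assumes "f \<in> GS s" "g \<in> GS s" shows "(\<lambda>x. a * f x + b * g x) \<in> GS s"
proof -
  obtain h h' where h: "0 < h" "f \<in> GS_step s h" "0 < h'" "g \<in> GS_step s h'" using assms by (auto simp: GS_def)
  then have "f \<in> GS_step s (max h h')" "g \<in> GS_step s (max h h')"
    using GS_step_mono[of h "max h h'"] GS_step_mono[of h' "max h h'"] by auto
  moreover have m: "0 < max h h'" using h(1) by (simp add: less_max_iff_disj)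
  ultimately show ?thesis using GS_stepI[OF m GS_step_lincomb[OF m]] by blast
qed

lemma smooth_zero: "smooth (\<lambda>x. 0)"
  using smooth_restrict[OF entire_const[of 0]] by simp

lemma zero_in_GS: "(\<lambda>x :: real ^ 'd::finite. 0) \<in> GS s"
proof -
  have "foldr partial_deriv is (\<lambda>x. 0) = (\<lambda>x :: real ^ 'd. 0)" for "is" :: "'d list"
    using foldr_partial_deriv_lincomb[OF smooth_zero smooth_zero, of "is" 0 0] by simp
  then have "multi_deriv \<alpha> (\<lambda>x. 0) = (\<lambda>x :: real ^ 'd. 0)" for \<alpha>
    unfolding multi_deriv_def foldr_funpow_concat by blast
  then have "GS_norm s 1 (\<lambda>x :: real ^ 'd. 0) = 0" by (simp add: GS_norm_def)
  then show ?thesis using smooth_zero by (intro GS_stepI[of 1]) (auto simp: GS_step_def)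
qed

section \<open>Continuous functionals as functionals bounded on the steps\<close>

text \<open>Continuity on the inductive limit, expressed step by step; real bounds M > 0 on the
  seminorm avoid arithmetic with \<open>top\<close>.\<close>

definition GS_bounded :: "real \<Rightarrow> ((real ^ 'd::finite \<Rightarrow> complex) \<Rightarrow> complex) \<Rightarrow> bool" where
  "GS_bounded s u \<longleftrightarrow> (\<forall>h>0. \<exists>C>0. \<forall>f\<in>GS_step s h. \<forall>M>0. GS_norm s h f \<le> ennreal M \<longrightarrow> norm (u f) \<le> C * M)"

definition GS_linear :: "real \<Rightarrow> ((real ^ 'd::finite \<Rightarrow> complex) \<Rightarrow> complex) \<Rightarrow> bool" where
  "GS_linear s u \<longleftrightarrow> (\<forall>f\<in>GS s. \<forall>g\<in>GS s. \<forall>a b. u (\<lambda>x. a * f x + b * g x) = a * u f + b * u g)"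

lemma GS_linearD:
  "GS_linear s u \<Longrightarrow> f \<in> GS s \<Longrightarrow> g \<in> GS s \<Longrightarrow> u (\<lambda>x. a * f x + b * g x) = a * u f + b * u g"
  by (simp add: GS_linear_def)

lemma topspace_GS: "topspace (GS_topology s) = GS s"
proof
  show "topspace (GS_topology s) \<subseteq> GS s"
    using openin_topspace[of "GS_topology s"] unfolding openin_GS_topology GS_open_def by blast
  have "GS_zero_nbhd s (GS s)" unfolding GS_zero_nbhd_def
    by (auto intro: GS_lincomb GS_stepI intro!: exI[of _ 1])
  moreover have "(\<lambda>x. f x + g x) \<in> GS s" if "f \<in> GS s" "g \<in> GS s" for f g using GS_lincomb[OF that, of 1 1] by simp
  ultimately have "openin (GS_topology s) (GS s)" unfolding openin_GS_topology GS_open_def by blast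
  then show "GS s \<subseteq> topspace (GS_topology s)" by (rule openin_subset)
qed

text \<open>Continuity at 0 gives an admissible neighbourhood of zero on which u is smaller than 1
  in modulus. Its trace on the step h contains all functions of norm at most some d > 0, and a
  function of norm at most M is scaled into it by d / M.\<close>

lemma GS_dualD:
  assumes u: "u \<in> GS_dual s"
  shows "GS_linear s u" "GS_bounded s u" "f \<notin> GS s \<Longrightarrow> u f = 0"
proof -
  show lin: "GS_linear s u" and "f \<notin> GS s \<Longrightarrow> u f = 0" using u unfolding GS_dual_def GS_linear_def by blast+
  have u0: "u (\<lambda>x. 0) = 0" using GS_linearD[OF lin zero_in_GS zero_in_GS, of 0 0] by simp
  have "continuous_map (GS_topology s) euclidean u" using u by (simp add: GS_dual_def)
  then have "openin (GS_topology s) {f \<in> topspace (GS_topology s). u f \<in> ball 0 1}"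
    by (rule openin_continuous_map_preimage) simp
  then have "GS_open s {f \<in> GS s. u f \<in> ball 0 1}" unfolding openin_GS_topology topspace_GS .
  then obtain W where W: "GS_zero_nbhd s W" "\<forall>g\<in>W. (\<lambda>x. 0 + g x) \<in> {f \<in> GS s. u f \<in> ball 0 1}"
    unfolding GS_open_def using u0 zero_in_GS[of s] by fastforce
  show "GS_bounded s u" unfolding GS_bounded_def
  proof (intro allI impI)
    fix h :: real assume h: "0 < h"
    obtain e where e: "e > 0" "\<forall>f\<in>GS_step s h. GS_norm s h f < e \<longrightarrow> f \<in> W"
      using W(1) h unfolding GS_zero_nbhd_def by blast
    obtain d where d: "0 < d" "ennreal d < e"
    proof (cases e)
      case (real r)
      then show ?thesis using e(1) that[of "r / 2"] by (auto simp: ennreal_less_iff)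
    next
      case top
      then show ?thesis using that[of 1] by simp
    qed
    have "norm (u f) \<le> (1 / d) * M" if f: "f \<in> GS_step s h" and M: "0 < M" "GS_norm s h f \<le> ennreal M" for f M
    proof -
      let ?c = "complex_of_real (d / M)"
      have fG: "f \<in> GS s" using f h by (rule GS_stepI[rotated])
      have "(\<lambda>x. ?c * f x + 0 * f x) \<in> GS_step s h" by (rule GS_step_lincomb[OF h f f])
      moreover have "GS_norm s h (\<lambda>x. ?c * f x + 0 * f x) < e"
      proof -
        have "GS_norm s h (\<lambda>x. ?c * f x + 0 * f x) \<le> ennreal (norm ?c) * GS_norm s h f + ennreal (norm (0::complex)) * GS_norm s h f"
          using f by (intro GS_norm_lincomb[OF h]) (auto simp: GS_step_def)
        also have "\<dots> = ennreal (d / M) * GS_norm s h f" using d M by (simp add: norm_divide)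
        also have "\<dots> \<le> ennreal (d / M) * ennreal M" using M by (intro mult_left_mono) auto
        also have "\<dots> = ennreal d" using d M by (simp add: ennreal_mult[symmetric])
        finally show ?thesis using d(2) by (rule le_less_trans)
      qed
      ultimately have "(\<lambda>x. ?c * f x + 0 * f x) \<in> W" using e(2) by blast
      then have "norm (u (\<lambda>x. ?c * f x + 0 * f x)) < 1" using W(2) by simp
      moreover have "u (\<lambda>x. ?c * f x + 0 * f x) = ?c * u f" using GS_linearD[OF lin fG fG, of ?c 0] by simp
      ultimately have "(d / M) * norm (u f) < 1" using d M by (simp add: norm_mult norm_divide)
      then show ?thesis using d M by (simp add: field_simps)
    qed
    then show "\<exists>C>0. \<forall>f\<in>GS_step s h. \<forall>M>0. GS_norm s h f \<le> ennreal M \<longrightarrow> norm (u f) \<le> C * M"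
      using d by (intro exI[of _ "1/d"]) auto
  qed
qed

text \<open>The set where \<open>norm (u g) < r\<close> is itself an admissible neighbourhood of
  zero: absolutely convex by linearity, and containing a ball of every step by boundedness. Its
  translates show that preimages of open sets are open.\<close>

lemma GS_dualI:
  assumes lin: "GS_linear s u" and bnd: "GS_bounded s u" and out: "\<And>f. f \<notin> GS s \<Longrightarrow> u f = 0"
  shows "u \<in> GS_dual s"
proof -
  have "continuous_map (GS_topology s) euclidean u"
    unfolding continuous_map_def topspace_GS
  proof (intro conjI allI impI)
    fix U :: "complex set" assume "openin euclidean U"
    then have U: "open U" by simp
    show "openin (GS_topology s) {f \<in> GS s. u f \<in> U}" unfolding openin_GS_topology GS_open_def
    proof (intro conjI ballI)
      fix f assume f: "f \<in> {f \<in> GS s. u f \<in> U}"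
      then obtain r where r: "0 < r" "ball (u f) r \<subseteq> U" using U open_contains_ball by blast
      define W where "W = {g \<in> GS s. norm (u g) < r}"
      have "GS_zero_nbhd s W" unfolding GS_zero_nbhd_def
      proof (intro conjI ballI allI impI)
        fix g k and a b :: complex assume gk: "g \<in> W" "k \<in> W" and ab: "norm a + norm b \<le> 1"
        have "norm (u (\<lambda>x. a * g x + b * k x)) \<le> norm a * norm (u g) + norm b * norm (u k)"
          using lin gk unfolding GS_linear_def W_def by (auto intro: order_trans[OF norm_triangle_ineq] simp: norm_mult)
        also have "\<dots> \<le> norm a * max (norm (u g)) (norm (u k)) + norm b * max (norm (u g)) (norm (u k))"
          by (intro add_mono mult_left_mono) auto
        also have "\<dots> = (norm a + norm b) * max (norm (u g)) (norm (u k))" by (simp add: distrib_right)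
        also have "\<dots> \<le> 1 * max (norm (u g)) (norm (u k))" using ab by (intro mult_right_mono) (auto simp: le_max_iff_disj)
        also have "\<dots> < r" using gk by (simp add: W_def)
        finally show "(\<lambda>x. a * g x + b * k x) \<in> W" using gk GS_lincomb by (auto simp: W_def)
      next
        fix h :: real assume h: "0 < h"
        obtain C where C: "C > 0" "\<And>f M. f\<in>GS_step s h \<Longrightarrow> M > 0 \<Longrightarrow> GS_norm s h f \<le> ennreal M \<Longrightarrow> norm (u f) \<le> C * M"
          using bnd h unfolding GS_bounded_def by metis
        have "f \<in> W" if "f \<in> GS_step s h" "GS_norm s h f < ennreal (r / (2 * C))" for f
        proof -
          have "norm (u f) \<le> C * (r / (2 * C))" using that r C(1) by (intro C(2)) auto
          also have "\<dots> < r" using r C(1) by (simp add: field_simps)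
          finally show ?thesis using that GS_stepI[OF h] by (auto simp: W_def)
        qed
        then show "\<exists>e>0. \<forall>f\<in>GS_step s h. GS_norm s h f < e \<longrightarrow> f \<in> W"
          using r C(1) by (intro exI[of _ "ennreal (r / (2 * C))"]) auto
      qed (auto simp: W_def)
      moreover have "(\<lambda>x. f x + g x) \<in> {f \<in> GS s. u f \<in> U}" if g: "g \<in> W" for g
      proof -
        have "u (\<lambda>x. 1 * f x + 1 * g x) = 1 * u f + 1 * u g" using lin f g unfolding GS_linear_def W_def by blast
        then have e: "u (\<lambda>x. f x + g x) = u f + u g" by simp
        have "u f + u g \<in> ball (u f) r" using g by (simp add: W_def dist_norm)
        then show ?thesis using r e f g GS_lincomb[of f s g 1 1] by (auto simp: W_def)
      qed
      ultimately show "\<exists>W. GS_zero_nbhd s W \<and> (\<forall>g\<in>W. (\<lambda>x. f x + g x) \<in> {f \<in> GS s. u f \<in> U})" by blast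
    qed auto
  qed auto
  then show ?thesis using lin out by (auto simp: GS_dual_def GS_linear_def)
qed

lemma analytic_bound_GS:
  assumes "0 < a" "0 < b" "analytic_bound a b M F" shows "(\<lambda>x. F (cvec x)) \<in> GS (1/2)"
proof -
  obtain h K where "h > 0" "\<forall>(F :: complex ^ 'a \<Rightarrow> complex) M. entire F \<longrightarrow>
      (\<forall>z. norm (F z) \<le> M * exp (- a * re_sq z + b * im_sq z)) \<longrightarrow>
      (\<lambda>x. F (cvec x)) \<in> GS_step (1/2) h \<and> GS_norm (1/2) h (\<lambda>x. F (cvec x)) \<le> ennreal (K * M)"
    using GS_analytic[OF assms(1,2)] by blast
  then show ?thesis using assms(3) unfolding analytic_bound_def by (meson GS_stepI)
qed

lemma analytic_bound_mono: "analytic_bound a b M F \<Longrightarrow> M \<le> M' \<Longrightarrow> analytic_bound a b M' F"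
  unfolding analytic_bound_def using order_trans[OF _ mult_right_mono[OF _ exp_ge_zero]] by blast

lemma analytic_bound_nonneg:
  fixes F :: "complex ^ 'd::finite \<Rightarrow> complex"
  assumes "analytic_bound a b M F" shows "0 \<le> M"
proof -
  have "norm (F 0) \<le> M * exp (- a * re_sq (0 :: complex ^ 'd) + b * im_sq (0 :: complex ^ 'd))" using assms unfolding analytic_bound_def by blast
  then have "0 \<le> M * exp (- a * re_sq (0 :: complex ^ 'd) + b * im_sq (0 :: complex ^ 'd))"
    using norm_ge_zero order_trans by blast
  then show ?thesis by (simp add: zero_le_mult_iff not_le)
qed

text \<open>Bounds with M > 0 suffice; the general case follows by raising M by e / C and letting e
  tend to 0.\<close>

lemma analytic_functionalI:
  assumes "\<And>F G a b M M' \<alpha> \<beta>. 0 < a \<Longrightarrow> 0 < b \<Longrightarrow> analytic_bound a b M F \<Longrightarrow> analytic_bound a b M' G \<Longrightarrow>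
        L (\<lambda>x. \<alpha> * F (cvec x) + \<beta> * G (cvec x)) = \<alpha> * L (\<lambda>x. F (cvec x)) + \<beta> * L (\<lambda>x. G (cvec x))"
    and "\<And>a b. 0 < a \<Longrightarrow> 0 < b \<Longrightarrow> \<exists>C>0. \<forall>F M. 0 < M \<longrightarrow> analytic_bound a b M F \<longrightarrow> norm (L (\<lambda>x. F (cvec x))) \<le> C * M"
  shows "analytic_functional L"
  unfolding analytic_functional_def
proof (intro conjI allI impI)
  fix a b :: real assume "0 < a" "0 < b"
  then obtain C where C: "C > 0" "\<And>F M. 0 < M \<Longrightarrow> analytic_bound a b M F \<Longrightarrow> norm (L (\<lambda>x. F (cvec x))) \<le> C * M"
    using assms(2) by blast
  have "norm (L (\<lambda>x. F (cvec x))) \<le> C * M" if F: "analytic_bound a b M F" for F M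
  proof (rule field_le_epsilon)
    fix e :: real assume e: "0 < e"
    have "norm (L (\<lambda>x. F (cvec x))) \<le> C * (M + e / C)"
      using e C(1) analytic_bound_nonneg[OF F] F by (intro C(2)) (auto intro!: add_nonneg_pos elim: analytic_bound_mono)
    then show "norm (L (\<lambda>x. F (cvec x))) \<le> C * M + e" using C(1) by (simp add: distrib_left)
  qed
  then show "\<exists>C>0. \<forall>F M. analytic_bound a b M F \<longrightarrow> norm (L (\<lambda>x. F (cvec x))) \<le> C * M" using C(1) by blast
qed (rule assms(1))

lemma GS_dual_analytic_functional:
  assumes u: "u \<in> GS_dual (1/2)" shows "analytic_functional u"
proof (rule analytic_functionalI)
  fix F G :: "complex ^ 'a \<Rightarrow> complex" and a b M M' :: real and \<alpha> \<beta>
  assume "0 < a" "0 < b" "analytic_bound a b M F" "analytic_bound a b M' G"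
  then have "(\<lambda>x. F (cvec x)) \<in> GS (1/2)" "(\<lambda>x. G (cvec x)) \<in> GS (1/2)" using analytic_bound_GS by blast+
  then show "u (\<lambda>x. \<alpha> * F (cvec x) + \<beta> * G (cvec x)) = \<alpha> * u (\<lambda>x. F (cvec x)) + \<beta> * u (\<lambda>x. G (cvec x))"
    by (rule GS_linearD[OF GS_dualD(1)[OF u]])
next
  fix a b :: real assume "0 < a" "0 < b"
  then obtain h K where hK: "h > 0" "K > 0" "\<And>(F :: complex ^ 'a \<Rightarrow> complex) M. entire F \<Longrightarrow>
      (\<forall>z. norm (F z) \<le> M * exp (- a * re_sq z + b * im_sq z)) \<Longrightarrow>
      (\<lambda>x. F (cvec x)) \<in> GS_step (1/2) h \<and> GS_norm (1/2) h (\<lambda>x. F (cvec x)) \<le> ennreal (K * M)"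
    using GS_analytic by metis
  obtain C where C: "C > 0" "\<And>f M. f\<in>GS_step (1/2) h \<Longrightarrow> M > 0 \<Longrightarrow> GS_norm (1/2) h f \<le> ennreal M \<Longrightarrow> norm (u f) \<le> C * M"
    using GS_dualD(2)[OF u] hK(1) unfolding GS_bounded_def by metis
  have "norm (u (\<lambda>x. F (cvec x))) \<le> C * (K * M)" if "0 < M" "analytic_bound a b M F" for F M
    using that hK(2) hK(3)[of F M] by (intro C(2)) (auto simp: analytic_bound_def)
  then show "\<exists>C>0. \<forall>F M. 0 < M \<longrightarrow> analytic_bound a b M F \<longrightarrow> norm (u (\<lambda>x. F (cvec x))) \<le> C * M"
    using C(1) hK(2) by (intro exI[of _ "C * K"]) (auto simp: mult.assoc)
qed

lemma re_sq_cvec [simp]: "re_sq (cvec y) = (norm y)\<^sup>2"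
  by (simp add: re_sq_def norm_vec_def L2_set_def sum_nonneg)

lemma im_sq_cvec [simp]: "im_sq (cvec y) = 0"
  by (simp add: im_sq_def)

lemma norm_gexp_le: "norm (gexp w y) \<le> exp (- (1/2) * (norm y)\<^sup>2 + norm w * norm y)"
  using norm_cexpq_le[of w "cvec y"] by (simp add: gexp_def)

lemma gexp_measurable [measurable]: "gexp w \<in> borel_measurable borel"
proof -
  have "continuous_on UNIV (\<lambda>y. cexpq w (cvec y))"
    by (rule continuous_on_compose2[OF entire_continuous[OF entire_cexpq, of UNIV]])
       (auto intro: bounded_linear.continuous_on[OF bounded_linear_cvec])
  then show ?thesis unfolding gexp_def by (rule borel_measurable_continuous_onI)
qed

lemma integrable_bounded_gexp:
  assumes [measurable]: "f \<in> borel_measurable borel" and B: "\<And>y. norm (f y) \<le> B"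
  shows "integrable lborel (\<lambda>y. f y * gexp w y)"
proof (rule Bochner_Integration.integrable_bound)
  show "integrable lborel (\<lambda>y::real^'a. B * exp (- (1/2) * (norm y)\<^sup>2 + norm w * norm y))"
    by (intro integrable_mult_right integrable_gauss_linear) simp
  show "AE y in lborel. norm (f y * gexp w y) \<le> norm (B * exp (- (1/2) * (norm y)\<^sup>2 + norm w * norm y))"
  proof (intro always_eventually allI)
    fix y
    have B0: "0 \<le> B" using norm_ge_zero B order_trans by blast
    have "norm (f y) * norm (gexp w y) \<le> B * exp (- (1/2) * (norm y)\<^sup>2 + norm w * norm y)"
      by (intro mult_mono B norm_gexp_le) (auto simp: B0)
    then show "norm (f y * gexp w y) \<le> norm (B * exp (- (1/2) * (norm y)\<^sup>2 + norm w * norm y))"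
      using B0 by (simp add: norm_mult)
  qed
qed measurable

section \<open>The Gaussian transform of functions and its decay\<close>

text \<open>Up to rescaling and a Gaussian factor this is the Bargmann transform of f. Left
  unnormalized, it is \<open>w \<mapsto> L (gexp w)\<close> for the functional L of integration
  against f.\<close>

definition Wtrans :: "(real ^ 'd::finite \<Rightarrow> complex) \<Rightarrow> complex ^ 'd \<Rightarrow> complex" where
  "Wtrans f w = (\<integral>y. f y * gexp w y \<partial>lborel)"

definition gauss_const :: "'d::finite itself \<Rightarrow> real" where
  "gauss_const _ = (\<integral>y. exp (- (1/2) * (norm y)\<^sup>2) \<partial>(lborel :: (real ^ 'd) measure))"

text \<open>Completing the square shows that \<open>norm (gexp w y)\<close> is
  \<open>exp (re_sq w / 2)\<close> times a Gaussian centred at the real part of w. The first factor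
  is the critical growth of transforms.\<close>

lemma integral_norm_gexp:
  fixes w :: "complex ^ 'd::finite"
  shows "integrable lborel (\<lambda>y. norm (gexp w y))" "(\<integral>y. norm (gexp w y) \<partial>lborel) = gauss_const TYPE('d) * exp (re_sq w / 2)"
proof -
  define x :: "real ^ 'd" where "x = (\<chi> i. Re (w $ i))"
  have nx: "(norm x)\<^sup>2 = re_sq w" by (simp add: x_def re_sq_def norm_vec_def L2_set_def sum_nonneg)
  have ng: "norm (gexp w y) = exp (re_sq w / 2) * exp (- (1/2) * (norm (- x + y))\<^sup>2)" for y
  proof -
    have "Re (cdot w (cvec y)) = x \<bullet> y" by (simp add: cdot_def x_def inner_vec_def)
    then have 1: "norm (gexp w y) = exp (- (norm y)\<^sup>2 / 2 + x \<bullet> y)" by (simp add: gexp_def cexpq_def Re_cdot_self)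
    have "(norm (- x + y))\<^sup>2 = (norm x)\<^sup>2 - 2 * (x \<bullet> y) + (norm y)\<^sup>2"
      by (simp add: power2_norm_eq_inner inner_diff_left inner_diff_right inner_commute[of y x])
    then show ?thesis unfolding 1 exp_add[symmetric] nx[symmetric] by (simp add: algebra_simps)
  qed
  show "integrable lborel (\<lambda>y. norm (gexp w y))"
    using integrable_bounded_gexp[of "\<lambda>_. 1" 1 w] by (simp add: integrable_norm)
  have "(\<integral>y. norm (gexp w y) \<partial>lborel) = exp (re_sq w / 2) * (\<integral>y. exp (- (1/2) * (norm (- x + y))\<^sup>2) \<partial>lborel)"
    unfolding ng by simp
  also have "(\<integral>y. exp (- (1/2) * (norm (- x + y))\<^sup>2) \<partial>lborel) = (\<integral>y. exp (- (1/2) * (norm y)\<^sup>2) \<partial>distr lborel borel ((+) (- x)))"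
    by (subst integral_distr) auto
  also have "\<dots> = gauss_const TYPE('d)" by (simp add: lborel_distr_plus gauss_const_def)
  finally show "(\<integral>y. norm (gexp w y) \<partial>lborel) = gauss_const TYPE('d) * exp (re_sq w / 2)" by simp
qed

lemma gauss_const_nonneg: "0 \<le> gauss_const TYPE('d::finite)"
  by (simp add: gauss_const_def)

lemma norm_Wtrans_le:
  fixes f :: "real ^ 'd::finite \<Rightarrow> complex"
  assumes [measurable]: "f \<in> borel_measurable borel" and B: "\<And>y. norm (f y) \<le> B"
  shows "norm (Wtrans f w) \<le> B * gauss_const TYPE('d) * exp (re_sq w / 2)"
proof -
  have "norm (Wtrans f w) \<le> (\<integral>y. norm (f y * gexp w y) \<partial>lborel)"
    unfolding Wtrans_def by (rule integral_norm_bound)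
  also have "\<dots> \<le> (\<integral>y. B * norm (gexp w y) \<partial>lborel)"
  proof (rule integral_mono)
    show "integrable lborel (\<lambda>y. norm (f y * gexp w y))" using integrable_bounded_gexp[OF assms] by (rule integrable_norm)
    show "integrable lborel (\<lambda>y. B * norm (gexp w y))" using integral_norm_gexp(1) by (rule integrable_mult_right)
    show "norm (f y * gexp w y) \<le> B * norm (gexp w y)" for y
      unfolding norm_mult by (intro mult_right_mono B) auto
  qed
  also have "\<dots> = B * gauss_const TYPE('d) * exp (re_sq w / 2)" using integral_norm_gexp(2)[of w] by simp
  finally show ?thesis .
qed

lemma integration_analytic_functional:
  fixes f :: "real ^ 'd::finite \<Rightarrow> complex"
  assumes f[measurable]: "f \<in> borel_measurable borel" and B: "\<And>y. norm (f y) \<le> B"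
  shows "analytic_functional (\<lambda>g. \<integral>y. f y * g y \<partial>lborel)"
proof (rule analytic_functionalI)
  have B0: "0 \<le> B" using norm_ge_zero B order_trans by blast
  have bd: "norm (f y * F (cvec y)) \<le> B * M * exp (- a * (norm y)\<^sup>2)"
    if "analytic_bound a b M F" for F :: "complex ^ 'd \<Rightarrow> complex" and a b M y
  proof -
    have "norm (F (cvec y)) \<le> M * exp (- a * (norm y)\<^sup>2)" using that unfolding analytic_bound_def by (metis re_sq_cvec im_sq_cvec mult_zero_right add.right_neutral)
    then show ?thesis unfolding norm_mult mult.assoc using B B0 by (intro mult_mono) auto
  qed
  have int: "integrable lborel (\<lambda>y. f y * F (cvec y))" if "0 < a" "analytic_bound a b M F" for F :: "complex ^ 'd \<Rightarrow> complex" and a b M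
  proof (rule Bochner_Integration.integrable_bound)
    show "integrable lborel (\<lambda>y::real^'d. B * M * exp (- a * (norm y)\<^sup>2))"
      using that by (intro integrable_mult_right integrable_gauss)
    have "continuous_on UNIV (\<lambda>y. F (cvec y))"
      using that(2) unfolding analytic_bound_def
      by (intro continuous_on_compose2[OF entire_continuous[of F UNIV]])
       (auto intro: bounded_linear.continuous_on[OF bounded_linear_cvec])
    then have [measurable]: "(\<lambda>y. F (cvec y)) \<in> borel_measurable borel" by (rule borel_measurable_continuous_onI)
    show "(\<lambda>y. f y * F (cvec y)) \<in> borel_measurable lborel" by measurable
    show "AE y in lborel. norm (f y * F (cvec y)) \<le> norm (B * M * exp (- a * (norm y)\<^sup>2))"
      using bd[OF that(2)] by (intro always_eventually allI) (smt (verit) real_norm_def)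
  qed
  show "(\<integral>y. f y * (\<alpha> * F (cvec y) + \<beta> * G (cvec y)) \<partial>lborel) = \<alpha> * (\<integral>y. f y * F (cvec y) \<partial>lborel) + \<beta> * (\<integral>y. f y * G (cvec y) \<partial>lborel)"
    if "0 < a" "0 < b" "analytic_bound a b M F" "analytic_bound a b M' G" for F G :: "complex ^ 'd \<Rightarrow> complex" and a b M M' \<alpha> \<beta>
  proof -
    have "(\<integral>y. f y * (\<alpha> * F (cvec y) + \<beta> * G (cvec y)) \<partial>lborel) = (\<integral>y. \<alpha> * (f y * F (cvec y)) + \<beta> * (f y * G (cvec y)) \<partial>lborel)"
      by (simp add: algebra_simps)
    also have "\<dots> = \<alpha> * (\<integral>y. f y * F (cvec y) \<partial>lborel) + \<beta> * (\<integral>y. f y * G (cvec y) \<partial>lborel)"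
      using int[OF that(1,3)] int[OF that(1,4)] by (subst Bochner_Integration.integral_add) auto
    finally show ?thesis .
  qed
  show "\<exists>C>0. \<forall>F M. 0 < M \<longrightarrow> analytic_bound a b M F \<longrightarrow> norm (\<integral>y. f y * F (cvec y) \<partial>lborel) \<le> C * M"
    if "0 < a" "0 < b" for a b
  proof (intro exI conjI allI impI)
    let ?I = "\<integral>y. exp (- a * (norm y)\<^sup>2) \<partial>(lborel :: (real ^ 'd) measure)"
    show "0 < B * ?I + 1" using B0 by (intro add_nonneg_pos mult_nonneg_nonneg) auto
    fix F :: "complex ^ 'd \<Rightarrow> complex" and M assume M: "0 < M" "analytic_bound a b M F"
    have "norm (\<integral>y. f y * F (cvec y) \<partial>lborel) \<le> (\<integral>y. norm (f y * F (cvec y)) \<partial>lborel)" by (rule integral_norm_bound)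
    also have "\<dots> \<le> (\<integral>y. B * M * exp (- a * (norm y)\<^sup>2) \<partial>(lborel :: (real ^ 'd) measure))"
      using int[OF that(1) M(2)] bd[OF M(2)] that by (intro integral_mono integrable_norm integrable_mult_right integrable_gauss) auto
    also have "\<dots> = B * ?I * M" by simp
    also have "\<dots> \<le> (B * ?I + 1) * M" using M by (intro mult_right_mono) auto
    finally show "norm (\<integral>y. f y * F (cvec y) \<partial>lborel) \<le> (B * ?I + 1) * M" .
  qed
qed

lemma entire_Wtrans:
  assumes "f \<in> borel_measurable borel" "\<And>y. norm (f y) \<le> B"
  shows "entire (Wtrans f)"
  using analytic_functional_entire[OF integration_analytic_functional[OF assms]] by (simp add: Wtrans_def[abs_def])

lemma partial_derivI: "(f has_derivative D) (at y) \<Longrightarrow> partial_deriv j f y = D (axis j 1)"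
  using frechet_derivative_at[of f D y] by (simp add: partial_deriv_def)

lemma norm_add_axis_sq: "(norm y)\<^sup>2 - 2 * \<bar>s\<bar> * norm y \<le> (norm (y + s *\<^sub>R axis j (1::real)))\<^sup>2"
proof -
  have "\<bar>y $ j\<bar> \<le> norm y" by (rule component_le_norm_cart)
  then have "\<bar>s * y $ j\<bar> \<le> \<bar>s\<bar> * norm y" by (simp add: abs_mult mult_left_mono)
  moreover have "(norm (y + s *\<^sub>R axis j 1))\<^sup>2 = (norm y)\<^sup>2 + 2 * (s * y $ j) + s\<^sup>2"
    unfolding power2_norm_eq_inner
    by (simp add: inner_add_left inner_add_right inner_axis inner_axis' axis_nth power2_eq_square algebra_simps)
  moreover have "- (s * y $ j) \<le> \<bar>s * y $ j\<bar>" "0 \<le> s\<^sup>2" by (rule abs_ge_minus_self, simp)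
  ultimately show ?thesis by (simp add: algebra_simps)
qed

text \<open>The derivative is the limit of difference quotients whose integrals vanish by
  translation invariance, and the Gaussian bound provides a common majorant.\<close>

lemma integral_partial_deriv_zero:
  fixes \<Phi> :: "real ^ 'd::finite \<Rightarrow> complex"
  assumes diff: "\<And>y. \<Phi> differentiable (at y)" and int: "integrable lborel \<Phi>"
    and bnd: "\<And>y. norm (partial_deriv j \<Phi> y) \<le> C * exp (- (1/2) * (norm y)\<^sup>2 + k * norm y)" and "0 \<le> C" "0 \<le> k"
  shows "(\<integral>y. partial_deriv j \<Phi> y \<partial>lborel) = 0"
proof -
  let ?e = "axis j 1 :: real ^ 'd"
  have ne: "norm ?e = 1" by (simp add: norm_axis_1)
  define t where "t n = inverse (real (Suc n))" for n
  have t: "0 < t n" "t n \<le> 1" for n unfolding t_def by (auto simp: inverse_le_1_iff)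
  define q where "q n y = (1 / t n) *\<^sub>R (\<Phi> (t n *\<^sub>R ?e + y) - \<Phi> y)" for n y
  have [measurable]: "\<Phi> \<in> borel_measurable borel" using int by auto
  have lim: "(\<lambda>n. q n y) \<longlonglongrightarrow> partial_deriv j \<Phi> y" for y
  proof -
    define D where "D = frechet_derivative \<Phi> (at y)"
    have D: "(\<Phi> has_derivative D) (at y)" using diff[of y] by (simp add: D_def frechet_derivative_works)
    then have l: "linear D" by (rule has_derivative_linear)
    have "((\<lambda>h. norm (\<Phi> (y + h) - \<Phi> y - D h) / norm h) \<longlongrightarrow> 0) (at 0)" using D by (simp add: has_derivative_at)
    moreover have "filterlim (\<lambda>n. t n *\<^sub>R ?e) (at 0) sequentially"
    proof (rule filterlim_atI)
      have "t \<longlonglongrightarrow> 0" unfolding t_def by (rule LIMSEQ_inverse_real_of_nat)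
      then have "(\<lambda>n. t n *\<^sub>R ?e) \<longlonglongrightarrow> 0 *\<^sub>R ?e" by (intro tendsto_intros)
      then show "(\<lambda>n. t n *\<^sub>R ?e) \<longlonglongrightarrow> 0" by simp
      show "\<forall>\<^sub>F n in sequentially. t n *\<^sub>R ?e \<noteq> 0" using t by (intro always_eventually allI) (simp add: less_imp_neq[symmetric] axis_eq_0_iff)
    qed
    ultimately have "(\<lambda>n. norm (\<Phi> (y + t n *\<^sub>R ?e) - \<Phi> y - D (t n *\<^sub>R ?e)) / norm (t n *\<^sub>R ?e)) \<longlonglongrightarrow> 0"
      by (rule filterlim_compose)
    moreover have "norm (\<Phi> (y + t n *\<^sub>R ?e) - \<Phi> y - D (t n *\<^sub>R ?e)) / norm (t n *\<^sub>R ?e) = norm (q n y - D ?e)" for n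
    proof -
      have "q n y - D ?e = (1 / t n) *\<^sub>R (\<Phi> (y + t n *\<^sub>R ?e) - \<Phi> y - D (t n *\<^sub>R ?e))"
        using t[of n] linear_cmul[OF l] by (simp add: q_def scaleR_diff_right add.commute)
      then show ?thesis using t[of n] ne by simp
    qed
    ultimately have "(\<lambda>n. norm (q n y - D ?e)) \<longlonglongrightarrow> 0" by simp
    then have "(\<lambda>n. q n y) \<longlonglongrightarrow> D ?e" by (simp add: tendsto_norm_zero_iff LIM_zero_iff)
    then show ?thesis using partial_derivI[OF D] by simp
  qed
  \<comment> \<open>Mean value inequality along a segment of length at most 1: moving the argument
    raises the exponent by at most \<open>k + norm y\<close>, whence the factor \<open>exp k\<close>
    and the rate \<open>k + 1\<close>.\<close>
  have dom: "norm (q n y) \<le> C * exp k * exp (- (1/2) * (norm y)\<^sup>2 + (k + 1) * norm y)" for n y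
  proof -
    let ?S = "C * exp k * exp (- (1/2) * (norm y)\<^sup>2 + (k + 1) * norm y)"
    let ?f = "\<lambda>s. \<Phi> (s *\<^sub>R ?e + y)"
    have "norm (?f (t n) - ?f 0) \<le> ?S * norm (t n - 0)"
    proof (rule differentiable_bound[where S = "{0..t n}"])
      fix s assume s: "s \<in> {0..t n}"
      have "((\<lambda>s. s *\<^sub>R ?e + y) has_derivative (\<lambda>h. h *\<^sub>R ?e)) (at s)" by (auto intro!: derivative_eq_intros)
      moreover have "(\<Phi> has_derivative frechet_derivative \<Phi> (at (s *\<^sub>R ?e + y))) (at (s *\<^sub>R ?e + y))"
        using diff by (simp add: frechet_derivative_works)
      ultimately have "((\<lambda>s. \<Phi> (s *\<^sub>R ?e + y)) has_derivative (\<lambda>h. frechet_derivative \<Phi> (at (s *\<^sub>R ?e + y)) (h *\<^sub>R ?e))) (at s)"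
        by (rule has_derivative_compose)
      moreover have "frechet_derivative \<Phi> (at (s *\<^sub>R ?e + y)) (h *\<^sub>R ?e) = h *\<^sub>R partial_deriv j \<Phi> (s *\<^sub>R ?e + y)" for h
        using linear_cmul[OF has_derivative_linear] diff[of "s *\<^sub>R ?e + y"] by (simp add: partial_deriv_def frechet_derivative_works)
      ultimately show "(?f has_derivative (\<lambda>h. h *\<^sub>R partial_deriv j \<Phi> (s *\<^sub>R ?e + y))) (at s within {0..t n})"
        by (simp add: has_derivative_at_withinI)
      have s1: "\<bar>s\<bar> \<le> 1" using s t(2)[of n] by auto
      have "norm (s *\<^sub>R ?e + y) \<le> norm (s *\<^sub>R ?e) + norm y" by (rule norm_triangle_ineq)
      also have "\<dots> \<le> 1 + norm y" using s1 ne by simp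
      finally have n1: "k * norm (s *\<^sub>R ?e + y) \<le> k * (1 + norm y)" using \<open>0 \<le> k\<close> by (rule mult_left_mono)
      have "2 * \<bar>s\<bar> * norm y \<le> 2 * 1 * norm y" using s1 by (intro mult_right_mono) auto
      then have n2: "(norm y)\<^sup>2 - 2 * norm y \<le> (norm (s *\<^sub>R ?e + y))\<^sup>2"
        using norm_add_axis_sq[of y s j] by (simp add: add.commute)
      have "onorm (\<lambda>h::real. h *\<^sub>R partial_deriv j \<Phi> (s *\<^sub>R ?e + y)) \<le> norm (partial_deriv j \<Phi> (s *\<^sub>R ?e + y))"
        by (rule onorm_le) simp
      also have "\<dots> \<le> C * exp (- (1/2) * (norm (s *\<^sub>R ?e + y))\<^sup>2 + k * norm (s *\<^sub>R ?e + y))" by (rule bnd)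
      also have "\<dots> \<le> C * exp (k + (- (1/2) * (norm y)\<^sup>2 + (k + 1) * norm y))"
        using n1 n2 \<open>0 \<le> C\<close> by (intro mult_left_mono) (auto simp: algebra_simps)
      also have "\<dots> = ?S" by (simp add: exp_add)
      finally show "onorm (\<lambda>h::real. h *\<^sub>R partial_deriv j \<Phi> (s *\<^sub>R ?e + y)) \<le> ?S" .
    qed (use t(1)[of n] in auto)
    then have "norm (\<Phi> (t n *\<^sub>R ?e + y) - \<Phi> y) \<le> ?S * t n" using t(1)[of n] by simp
    then show ?thesis using t(1)[of n] unfolding q_def norm_scaleR by (simp add: pos_divide_le_eq mult.commute)
  qed
  have "(\<lambda>n. \<integral>y. q n y \<partial>lborel) \<longlonglongrightarrow> (\<integral>y. partial_deriv j \<Phi> y \<partial>lborel)"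
  proof (rule integral_dominated_convergence)
    show "integrable lborel (\<lambda>y::real^'d. C * exp k * exp (- (1/2) * (norm y)\<^sup>2 + (k + 1) * norm y))"
      by (intro integrable_mult_right integrable_gauss_linear) simp
    show qm: "q n \<in> borel_measurable lborel" for n unfolding q_def by measurable
    show "partial_deriv j \<Phi> \<in> borel_measurable lborel"
      by (rule borel_measurable_LIMSEQ_metric[OF qm lim])
  qed (use lim dom in auto)
  moreover have "(\<integral>y. q n y \<partial>lborel) = 0" for n
  proof -
    have 1: "integrable lborel (\<lambda>y. \<Phi> (t n *\<^sub>R ?e + y))" "(\<integral>y. \<Phi> (t n *\<^sub>R ?e + y) \<partial>lborel) = (\<integral>y. \<Phi> y \<partial>lborel)"
      using integrable_distr[of "(+) (t n *\<^sub>R ?e)" lborel borel \<Phi>] integral_distr[of "(+) (t n *\<^sub>R ?e)" lborel borel \<Phi>] int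
      by (simp_all add: lborel_distr_plus)
    then show ?thesis unfolding q_def using int by (simp add: Bochner_Integration.integral_diff)
  qed
  ultimately show ?thesis by (simp add: LIMSEQ_const_iff)
qed

lemma gexp_has_derivative:
  "(gexp w has_derivative (\<lambda>h. (cdot w (cvec h) - cdot (cvec y) (cvec h)) * gexp w y)) (at y)"
proof -
  have bl: "bounded_linear (\<lambda>h. cdot v (cvec h))" for v :: "complex ^ 'a"
  proof -
    have "bounded_linear (\<lambda>z. cdot v z)" unfolding cdot_def
      by (intro bounded_linear_sum bounded_linear_mult_right[THEN bounded_linear_compose] bounded_linear_vec_nth)
    then show ?thesis using bounded_linear_compose bounded_linear_cvec by blast
  qed
  have 1: "((\<lambda>y. cdot w (cvec y)) has_derivative (\<lambda>h. cdot w (cvec h))) (at y)"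
    by (rule bounded_linear_imp_has_derivative[OF bl])
  have 2: "((\<lambda>y. cdot (cvec y) (cvec y)) has_derivative (\<lambda>h. 2 * cdot (cvec y) (cvec h))) (at y)"
  proof -
    have b: "bounded_linear (\<lambda>y. complex_of_real (y $ i))" for i :: 'a
      by (rule bounded_linear_compose[OF bounded_linear_of_real bounded_linear_vec_nth])
    have "((\<lambda>y. \<Sum>i\<in>UNIV. complex_of_real (y $ i) * complex_of_real (y $ i)) has_derivative
        (\<lambda>h. \<Sum>i\<in>UNIV. complex_of_real (y $ i) * complex_of_real (h $ i) + complex_of_real (h $ i) * complex_of_real (y $ i))) (at y)"
      by (intro has_derivative_sum has_derivative_mult bounded_linear_imp_has_derivative[OF b])
    then show ?thesis unfolding cdot_def by (simp add: sum_distrib_left mult.commute)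
  qed
  have "((\<lambda>y. exp (- cdot (cvec y) (cvec y) / 2 + cdot w (cvec y))) has_derivative
     (\<lambda>h. exp (- cdot (cvec y) (cvec y) / 2 + cdot w (cvec y)) * (- (2 * cdot (cvec y) (cvec h)) / 2 + cdot w (cvec h)))) (at y)"
  proof -
    have "((\<lambda>y. - cdot (cvec y) (cvec y) / 2 + cdot w (cvec y)) has_derivative (\<lambda>h. - (2 * cdot (cvec y) (cvec h)) / 2 + cdot w (cvec h))) (at y)"
      using has_derivative_add[OF has_derivative_mult_right[OF 2, of "- 1/2"] 1] by simp
    moreover have "(exp has_derivative (\<lambda>h. exp x * h)) (at x)" for x :: complex
      using DERIV_exp[of x] by (simp add: has_field_derivative_def)
    ultimately show ?thesis by (rule has_derivative_compose)
  qed
  then show ?thesis unfolding gexp_def cexpq_def by (simp add: algebra_simps)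
qed

lemma fact_double_le: "(fact (2 * m) :: real) \<le> (2 ^ m * fact m)\<^sup>2"
proof (induction m)
  case (Suc m)
  have "fact (2 * Suc m) = real (2*m+2) * real (2*m+1) * fact (2 * m)" by (simp add: algebra_simps)
  also have "\<dots> \<le> real (2*m+2) * real (2*m+2) * (2 ^ m * fact m)\<^sup>2"
    by (intro mult_mono Suc.IH) auto
  also have "\<dots> = (2 ^ Suc m * fact (Suc m))\<^sup>2" by (simp add: power2_eq_square algebra_simps)
  finally show ?case .
qed simp

text \<open>Only the even exponents a = 2 m enter. Since sqrt((2 m)!) \<le> 2^m m!, the m-th term of
  the exponential series is at most B / 2^m; the 4 in the denominator is chosen for this geometric
  series, whose sum is 2 B.\<close>

lemma power_fact_exp_decay:
  fixes A B X x :: real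
  assumes le: "\<And>a. x ^ a * X \<le> B * A ^ a * sqrt (fact a)" and A: "0 < A" and X: "0 \<le> X"
  shows "X * exp (x\<^sup>2 / (4 * A\<^sup>2)) \<le> 2 * B"
proof -
  have t: "((x\<^sup>2 / (4 * A\<^sup>2)) ^ m / fact m) * X \<le> B * (1/2) ^ m" for m
  proof -
    have "(x\<^sup>2) ^ m * X \<le> B * (A\<^sup>2) ^ m * sqrt (fact (2*m))" using le[of "2*m"] by (simp add: power_mult)
    also have "\<dots> \<le> B * (A\<^sup>2) ^ m * (2 ^ m * fact m)"
    proof (intro mult_left_mono mult_nonneg_nonneg)
      show "sqrt (fact (2 * m)) \<le> 2 ^ m * fact m" using fact_double_le[of m] by (intro real_le_lsqrt) auto
      show "0 \<le> B" using le[of 0] X by simp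
    qed auto
    finally have *: "(x\<^sup>2) ^ m * X \<le> B * (A\<^sup>2) ^ m * (2 ^ m * fact m)" .
    have "((x\<^sup>2 / (4 * A\<^sup>2)) ^ m / fact m) * X = ((x\<^sup>2) ^ m * X) / (4 ^ m * (A\<^sup>2) ^ m * fact m)"
      by (simp add: power_divide power_mult_distrib)
    also have "\<dots> \<le> (B * (A\<^sup>2) ^ m * (2 ^ m * fact m)) / (4 ^ m * (A\<^sup>2) ^ m * fact m)"
      using * by (rule divide_right_mono) simp
    also have "\<dots> = B * (2 ^ m / 4 ^ m)" using A by simp
    also have "2 ^ m / 4 ^ m = (1/2 :: real) ^ m" by (simp add: power_divide[symmetric])
    finally show ?thesis .
  qed
  have s1: "(\<lambda>m. ((x\<^sup>2 / (4 * A\<^sup>2)) ^ m / fact m) * X) sums (exp (x\<^sup>2 / (4 * A\<^sup>2)) * X)"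
  proof (rule sums_mult2)
    have "(\<lambda>m. y ^ m / fact m) sums exp y" for y :: real
      using exp_converges[of y] by (simp add: divide_inverse_commute)
    then show "(\<lambda>m. (x\<^sup>2 / (4 * A\<^sup>2)) ^ m / fact m) sums exp (x\<^sup>2 / (4 * A\<^sup>2))" .
  qed
  have s2: "(\<lambda>m. B * (1/2) ^ m) sums (B * (1 / (1 - 1/2)))"
    by (intro sums_mult geometric_sums) simp
  have "exp (x\<^sup>2 / (4 * A\<^sup>2)) * X \<le> B * (1 / (1 - 1/2))"
    by (rule sums_le[OF t s1 s2])
  then show ?thesis by (simp add: mult.commute)
qed

lemma multi_deriv_single:
  "multi_deriv (\<lambda>i. if i = j then k else 0) f = (partial_deriv j ^^ k) f"
proof -
  define L where "L = (SOME is. distinct is \<and> set is = (UNIV :: 'a set))"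
  have L: "distinct L" "set L = UNIV"
    using someI_ex[of "\<lambda>is. distinct is \<and> set is = (UNIV :: 'a set)"] finite_distinct_list[of "UNIV :: 'a set"]
    unfolding L_def by auto
  have "distinct M \<Longrightarrow> foldr (\<lambda>i. partial_deriv i ^^ (if i = j then k else 0)) M f = (if j \<in> set M then (partial_deriv j ^^ k) f else f)" for M
    by (induction M) auto
  then show ?thesis using L unfolding multi_deriv_def L_def[symmetric] by simp
qed

lemma mabs_single: "mabs (\<lambda>i. if i = j then k else 0) = k"
  by (simp add: mabs_def)

lemma mfact_single: "mfact (\<lambda>i. if i = j then k else 0) = fact k"
proof -
  have "(\<Prod>i\<in>UNIV. fact (if i = j then k else 0)) = (\<Prod>i\<in>UNIV. if i = j then fact k else (1::real))"
    by (intro prod.cong) auto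
  then show ?thesis by (simp add: mfact_def)
qed

lemma mpower_single: "mpower x (\<lambda>i. if i = j then k else 0) = (x $ j) ^ k"
proof -
  have "(\<Prod>i\<in>UNIV. (x $ i) ^ (if i = j then k else 0)) = (\<Prod>i\<in>UNIV. if i = j then (x $ j) ^ k else 1)"
    by (intro prod.cong) auto
  then show ?thesis by (simp add: mpower_def)
qed

lemma GS_norm_single:
  fixes f :: "real ^ 'd::finite \<Rightarrow> complex"
  assumes h: "0 < h" and N: "GS_norm (1/2) h f \<le> ennreal D" and D: "0 \<le> D"
  shows "norm (of_real ((y $ j) ^ b) * (partial_deriv j ^^ k) f y) \<le> D * (h ^ (b + k) * sqrt (fact b * fact k))"
proof -
  let ?d = "h ^ (k + b) * (fact k * fact b) powr (1/2)"
  have d: "0 < ?d" using h by simp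
  have "ennreal (norm (of_real ((y $ j) ^ b) * (partial_deriv j ^^ k) f y) / ?d) \<le> ennreal D"
    using GS_norm_upper[of y "\<lambda>i. if i = j then b else 0" "\<lambda>i. if i = j then k else 0" f h "1/2"] N
    by (simp add: multi_deriv_single mabs_single mfact_single mpower_single)
  then have "norm (of_real ((y $ j) ^ b) * (partial_deriv j ^^ k) f y) / ?d \<le> D" using D by (simp add: ennreal_le_iff)
  then have "norm (of_real ((y $ j) ^ b) * (partial_deriv j ^^ k) f y) \<le> D * ?d" using d by (simp add: pos_divide_le_eq)
  also have "?d = h ^ (b + k) * sqrt (fact b * fact k)" by (simp add: powr_half_sqrt ac_simps)
  finally show ?thesis .
qed

lemma sqrt_fact_mult_le: "sqrt (fact b * fact k) \<le> sqrt (fact (b + k))"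
proof -
  have "fact b * fact k dvd (fact (b + k) :: nat)" by (rule fact_fact_dvd_fact)
  then have "fact b * fact k \<le> (fact (b + k) :: nat)" by (rule dvd_imp_le) simp
  then have "real (fact b * fact k) \<le> real (fact (b + k))" by (rule of_nat_mono)
  then show ?thesis by simp
qed

text \<open>The product rule on a monomial produces a factor b and lowers the degree by one; this
  shows that the resulting term still fits under the bound for degree n + 1.\<close>

lemma sqrt_fact_step: "b \<le> n \<Longrightarrow> real b * sqrt (fact (n - 1)) \<le> sqrt (fact (Suc n))"
proof (cases n)
  case (Suc m)
  assume b: "b \<le> n"
  have "(real b)\<^sup>2 * fact m \<le> (real (Suc (Suc m)) * real (Suc m)) * fact m"
    unfolding power2_eq_square using b Suc by (intro mult_right_mono mult_mono) auto
  also have "\<dots> = fact (Suc n)" by (simp add: Suc algebra_simps)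
  finally have "sqrt ((real b)\<^sup>2 * fact m) \<le> sqrt (fact (Suc n))" by (rule real_sqrt_le_mono)
  then show ?thesis by (simp add: real_sqrt_mult Suc)
qed simp

text \<open>
  Integration by parts shows that multiplying the transform by \<open>w\<^sub>j\<close> amounts to applying
  \<open>y\<^sub>j - \<partial>\<^sub>j\<close> to \<open>f\<close>; iterating this bounds the transform times any power of \<open>w\<^sub>j\<close>.
\<close>

lemma Wtrans_decay_coord:
  fixes f :: "real ^ 'd::finite \<Rightarrow> complex"
  assumes h: "0 < h" and f: "f \<in> GS_step (1/2) h" and N: "GS_norm (1/2) h f \<le> ennreal D" and D: "0 \<le> D"
  shows "norm (Wtrans f w) * exp ((norm (w $ j))\<^sup>2 / (4 * (3 * max 1 h)\<^sup>2)) \<le> 2 * (D * gauss_const TYPE('d) * exp (re_sq w / 2))"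
proof -
  \<comment> \<open>A family closed under multiplication by the coordinate and, up to a term with
    smaller b, under differentiation in direction j; f is its member with b = k = 0.\<close>
  define g where "g b k y = of_real ((y $ j) ^ b) * (partial_deriv j ^^ k) f y" for b k and y :: "real ^ 'd"
  \<comment> \<open>At least 1, so that powers of H increase and the lower-order term of the
    recursion fits under the common bound.\<close>
  define H where "H = max 1 h"
  have H: "1 \<le> H" "0 < H" "h \<le> H" by (auto simp: H_def)
  have sm: "smooth f" using f by (simp add: GS_step_def)
  have gb: "norm (g b k y) \<le> D * (H ^ (b + k) * sqrt (fact (b + k)))" for b k y
  proof -
    have "norm (g b k y) \<le> D * (h ^ (b + k) * sqrt (fact b * fact k))" unfolding g_def by (rule GS_norm_single[OF h N D])
    also have "\<dots> \<le> D * (H ^ (b + k) * sqrt (fact (b + k)))"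
      using h H D by (intro mult_left_mono mult_mono power_mono sqrt_fact_mult_le) auto
    finally show ?thesis .
  qed
  have gd: "(g b k has_derivative (\<lambda>h. of_real ((y $ j) ^ b) * frechet_derivative ((partial_deriv j ^^ k) f) (at y) h
      + of_real (real b * (y $ j) ^ (b - 1) * h $ j) * (partial_deriv j ^^ k) f y)) (at y)" for b k y
  proof -
    have "((partial_deriv j ^^ k) f has_derivative frechet_derivative ((partial_deriv j ^^ k) f) (at y)) (at y)"
      using smooth_differentiable[OF smooth_funpow[OF sm]] by (simp add: frechet_derivative_works)
    moreover have "((\<lambda>y. complex_of_real ((y $ j) ^ b)) has_derivative (\<lambda>h. of_real (real b * (y $ j) ^ (b - 1) * h $ j))) (at y)"
    proof -
      have "((\<lambda>y. (y $ j) ^ b) has_derivative (\<lambda>h. real b * (h $ j) * (y $ j) ^ (b - 1))) (at y)"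
        by (rule has_derivative_power) (rule bounded_linear_imp_has_derivative[OF bounded_linear_vec_nth])
      from bounded_linear.has_derivative[OF bounded_linear_of_real this] show ?thesis by (simp add: ac_simps)
    qed
    ultimately show ?thesis unfolding g_def by (rule has_derivative_mult[rotated])
  qed
  have gcont: "continuous_on UNIV (g b k)" for b k
    using gd has_derivative_continuous by (intro continuous_at_imp_continuous_on) blast
  then have gm[measurable]: "g b k \<in> borel_measurable borel" for b k by (rule borel_measurable_continuous_onI)
  have gi: "integrable lborel (\<lambda>y. g b k y * gexp w y)" for b k
    using gm gb by (rule integrable_bounded_gexp)
  \<comment> \<open>The integral of the derivative of \<open>g b k y * gexp w y\<close> vanishes.
    The derivative falls on the packet, giving \<open>w $ j - y $ j\<close>, on f, raising k, or on
    the monomial, giving the factor b; for b = 0 this factor makes the truncated index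
    \<open>b - 1\<close> harmless.\<close>
  have recur: "(w $ j) * Wtrans (g b k) w = Wtrans (g (Suc b) k) w - of_nat b * Wtrans (g (b - 1) k) w - Wtrans (g b (Suc k)) w" for b k
  proof -
    define \<Phi> where "\<Phi> y = g b k y * gexp w y" for y
    have \<Phi>d: "(\<Phi> has_derivative (\<lambda>h. g b k y * ((cdot w (cvec h) - cdot (cvec y) (cvec h)) * gexp w y) + 
      (of_real ((y $ j) ^ b) * frechet_derivative ((partial_deriv j ^^ k) f) (at y) h
      + of_real (real b * (y $ j) ^ (b - 1) * h $ j) * (partial_deriv j ^^ k) f y) * gexp w y)) (at y)" for y
      unfolding \<Phi>_def by (rule has_derivative_mult[OF gd gexp_has_derivative])
    have p: "partial_deriv j \<Phi> y = ((w $ j) * (g b k y * gexp w y) - g (Suc b) k y * gexp w y)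
       + (g b (Suc k) y * gexp w y + of_nat b * (g (b - 1) k y * gexp w y))" for y
    proof -
      have c: "cdot v (cvec (axis j 1)) = v $ j" for v :: "complex ^ 'd"
        by (simp add: cvec_axis) (simp add: cdot_def axis_def if_distrib cong: if_cong)
      have pd: "frechet_derivative ((partial_deriv j ^^ k) f) (at y) (axis j 1) = (partial_deriv j ^^ Suc k) f y"
        by (simp add: partial_deriv_def)
      have "partial_deriv j \<Phi> y = g b k y * ((w $ j - of_real (y $ j)) * gexp w y) + 
        (of_real ((y $ j) ^ b) * (partial_deriv j ^^ Suc k) f y + of_real (real b * (y $ j) ^ (b - 1)) * (partial_deriv j ^^ k) f y) * gexp w y"
        unfolding partial_derivI[OF \<Phi>d] c pd by (simp add: axis_def)
      then show ?thesis unfolding g_def by (simp add: algebra_simps)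
    qed
    define M where "M = D * (H ^ (b + k) * sqrt (fact (b + k))) * norm w + D * (H ^ (Suc b + k) * sqrt (fact (Suc b + k)))
       + D * (H ^ (b + Suc k) * sqrt (fact (b + Suc k))) + real b * (D * (H ^ (b - 1 + k) * sqrt (fact (b - 1 + k))))"
    have M0: "0 \<le> M" using D H(2) unfolding M_def by (intro add_nonneg_nonneg mult_nonneg_nonneg) auto
    have tri: "norm (p - q + r + s) \<le> norm p + norm q + norm r + norm s" for p q r s :: complex
      using norm_triangle_ineq[of "p - q + r" s] norm_triangle_ineq[of "p - q" r] norm_triangle_ineq4[of p q] by linarith
    have "0 = (\<integral>y. partial_deriv j \<Phi> y \<partial>lborel)"
    proof (rule integral_partial_deriv_zero[symmetric])
      show "\<Phi> differentiable at y" for y using \<Phi>d[of y] by (rule differentiableI)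
      show "integrable lborel \<Phi>" unfolding \<Phi>_def by (rule gi)
      show "norm (partial_deriv j \<Phi> y) \<le> M * exp (- (1/2) * (norm y)\<^sup>2 + norm w * norm y)" for y
      proof -
        have "partial_deriv j \<Phi> y = (w $ j * g b k y - g (Suc b) k y + g b (Suc k) y + of_nat b * g (b - 1) k y) * gexp w y"
          unfolding p by (simp add: algebra_simps)
        moreover have "norm (w $ j * g b k y - g (Suc b) k y + g b (Suc k) y + of_nat b * g (b - 1) k y) \<le> M"
        proof -
          have 1: "norm (w $ j * g b k y) \<le> D * (H ^ (b + k) * sqrt (fact (b + k))) * norm w"
          proof -
            have "norm (w $ j) * norm (g b k y) \<le> norm w * (D * (H ^ (b + k) * sqrt (fact (b + k))))"
              by (intro mult_mono Finite_Cartesian_Product.norm_nth_le gb) auto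
            then show ?thesis by (simp only: norm_mult mult.commute)
          qed
          have 2: "norm (of_nat b * g (b - 1) k y) \<le> real b * (D * (H ^ (b - 1 + k) * sqrt (fact (b - 1 + k))))"
            unfolding norm_mult norm_of_nat by (intro mult_left_mono gb) auto
          show ?thesis unfolding M_def
            using 1 2 gb[of "Suc b" k y] gb[of b "Suc k" y]
              tri[of "w $ j * g b k y" "g (Suc b) k y" "g b (Suc k) y" "of_nat b * g (b - 1) k y"] by linarith
        qed
        ultimately show ?thesis using M0 norm_gexp_le[of w y] by (simp only: norm_mult mult_mono norm_ge_zero)
      qed
      show "0 \<le> M" by (rule M0)
    qed simp
    also have "\<dots> = ((w $ j) * Wtrans (g b k) w - Wtrans (g (Suc b) k) w) + (Wtrans (g b (Suc k)) w + of_nat b * Wtrans (g (b - 1) k) w)"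
      unfolding p Wtrans_def using gi by simp
    finally show ?thesis by (simp add: algebra_simps)
  qed
  let ?I = "gauss_const TYPE('d) * exp (re_sq w / 2)"
  have I: "0 \<le> ?I" by (simp add: gauss_const_nonneg)
  \<comment> \<open>Each use of the recursion yields three terms with the same bound
    \<open>E\<close>, which accounts for the 3 in the base.\<close>
  have ind: "(norm (w $ j)) ^ a * norm (Wtrans (g b k) w) \<le> D * (3 * H) ^ a * H ^ (b + k) * sqrt (fact (a + b + k)) * ?I" for a b k
  proof (induction a arbitrary: b k)
    case 0
    then show ?case using norm_Wtrans_le[OF gm gb, of b k w] by (simp add: mult.assoc)
  next
    case (Suc a)
    let ?n = "a + b + k"
    define E where "E = D * (3 * H) ^ a * H ^ (Suc (b + k)) * sqrt (fact (Suc ?n)) * ?I"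
    have base: "0 \<le> D * (3 * H) ^ a" using D H by simp
    have "norm (w $ j) * norm (Wtrans (g b k) w) = norm (Wtrans (g (Suc b) k) w - of_nat b * Wtrans (g (b - 1) k) w - Wtrans (g b (Suc k)) w)"
      unfolding recur[symmetric] by (simp add: norm_mult)
    also have "\<dots> \<le> norm (Wtrans (g (Suc b) k) w) + real b * norm (Wtrans (g (b - 1) k) w) + norm (Wtrans (g b (Suc k)) w)"
      by (intro order_trans[OF norm_triangle_ineq4 add_mono]) (auto simp: norm_mult intro: order_trans[OF norm_triangle_ineq4])
    finally have st: "norm (w $ j) * norm (Wtrans (g b k) w)
       \<le> norm (Wtrans (g (Suc b) k) w) + real b * norm (Wtrans (g (b - 1) k) w) + norm (Wtrans (g b (Suc k)) w)" .
    have "(norm (w $ j)) ^ Suc a * norm (Wtrans (g b k) w) = (norm (w $ j)) ^ a * (norm (w $ j) * norm (Wtrans (g b k) w))"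
      by (simp add: ac_simps)
    also have "\<dots> \<le>
       (norm (w $ j)) ^ a * (norm (Wtrans (g (Suc b) k) w) + real b * norm (Wtrans (g (b - 1) k) w) + norm (Wtrans (g b (Suc k)) w))"
      by (rule mult_left_mono[OF st]) simp
    also have "\<dots> = (norm (w $ j)) ^ a * norm (Wtrans (g (Suc b) k) w) + real b * ((norm (w $ j)) ^ a * norm (Wtrans (g (b - 1) k) w))
      + (norm (w $ j)) ^ a * norm (Wtrans (g b (Suc k)) w)" by (simp add: algebra_simps)
    also have "\<dots> \<le> E + E + E"
    proof (intro add_mono)
      show "(norm (w $ j)) ^ a * norm (Wtrans (g (Suc b) k) w) \<le> E" using Suc.IH[of "Suc b" k] by (simp add: E_def)
      show "(norm (w $ j)) ^ a * norm (Wtrans (g b (Suc k)) w) \<le> E" using Suc.IH[of b "Suc k"] by (simp add: E_def)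
      show "real b * ((norm (w $ j)) ^ a * norm (Wtrans (g (b - 1) k) w)) \<le> E"
      proof (cases b)
        case 0
        then show ?thesis using base H I by (simp add: E_def)
      next
        case (Suc c)
        have "real b * ((norm (w $ j)) ^ a * norm (Wtrans (g (b - 1) k) w))
            \<le> real b * (D * (3 * H) ^ a * H ^ (b - 1 + k) * sqrt (fact (a + (b - 1) + k)) * ?I)"
          by (intro mult_left_mono Suc.IH) auto
        also have "\<dots> = D * (3 * H) ^ a * H ^ (b - 1 + k) * (real b * sqrt (fact (?n - 1))) * ?I"
          using Suc by simp
        also have "\<dots> \<le> E" unfolding E_def
        proof (intro mult_right_mono[OF mult_mono] mult_left_mono base I)
          show "H ^ (b - 1 + k) \<le> H ^ Suc (b + k)" using H by (intro power_increasing) auto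
          show "real b * sqrt (fact (?n - 1)) \<le> sqrt (fact (Suc ?n))" by (rule sqrt_fact_step) simp
        qed (use base H in auto)
        finally show ?thesis .
      qed
    qed
    also have "E + E + E = D * (3 * H) ^ Suc a * H ^ (b + k) * sqrt (fact (Suc a + b + k)) * ?I"
      by (simp add: E_def algebra_simps)
    finally show ?case .
  qed
  have g0: "g 0 0 = f" by (simp add: g_def fun_eq_iff)
  have "(norm (w $ j)) ^ a * norm (Wtrans f w) \<le> (D * ?I) * (3 * H) ^ a * sqrt (fact a)" for a
    using ind[of a 0 0] by (simp add: g0 ac_simps)
  from power_fact_exp_decay[OF this] show ?thesis using H by (simp add: H_def[symmetric] mult.assoc)
qed

section \<open>The reproducing formula\<close>

text \<open>Some coordinate carries at least the share 1 / d of |w|^2, so decay in a single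
  coordinate is decay in |w|^2, at a rate that depends only on h and the dimension.\<close>

lemma Wtrans_decay:
  fixes h :: real
  assumes h: "0 < h"
  shows "\<exists>\<delta>>0. \<exists>C>0. \<forall>f\<in>GS_step (1/2) h. \<forall>D\<ge>0. GS_norm (1/2) h f \<le> ennreal D \<longrightarrow>
     (\<forall>w::complex ^ 'd::finite. norm (Wtrans f w) \<le> C * D * exp (re_sq w / 2 - \<delta> * (norm w)\<^sup>2))"
proof -
  define A where "A = 4 * (3 * max 1 h)\<^sup>2"
  have A: "0 < A" unfolding A_def by (intro mult_pos_pos zero_less_power) auto
  define d where "d = real CARD('d)"
  have d: "0 < d" by (simp add: d_def)
  have main: "norm (Wtrans f w) \<le> (2 * gauss_const TYPE('d) + 1) * D * exp (re_sq w / 2 - 1 / (A * d) * (norm w)\<^sup>2)"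
    if f: "f \<in> GS_step (1/2) h" "GS_norm (1/2) h f \<le> ennreal D" "0 \<le> D" for f D and w :: "complex ^ 'd"
  proof -
    have "\<exists>j. (norm w)\<^sup>2 / d \<le> (norm (w $ j))\<^sup>2"
    proof (rule ccontr)
      assume "\<not> ?thesis"
      then have "(\<Sum>j\<in>UNIV. (norm (w $ j))\<^sup>2) < (\<Sum>j\<in>(UNIV::'d set). (norm w)\<^sup>2 / d)"
        by (intro sum_strict_mono) (auto simp: not_le)
      then show False using d by (simp add: norm_vec_def L2_set_def sum_nonneg d_def)
    qed
    then obtain j where j: "(norm w)\<^sup>2 / d \<le> (norm (w $ j))\<^sup>2" by blast
    have "1 / (A * d) * (norm w)\<^sup>2 \<le> (norm (w $ j))\<^sup>2 / A"
      using divide_right_mono[OF j, of A] A by (simp add: mult.commute)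
    then have "norm (Wtrans f w) * exp (1 / (A * d) * (norm w)\<^sup>2) \<le> norm (Wtrans f w) * exp ((norm (w $ j))\<^sup>2 / A)"
      by (intro mult_left_mono) auto
    also have "\<dots> \<le> 2 * (D * gauss_const TYPE('d) * exp (re_sq w / 2))"
      unfolding A_def by (rule Wtrans_decay_coord[OF h f])
    also have "\<dots> \<le> (2 * gauss_const TYPE('d) + 1) * D * exp (re_sq w / 2)"
      using f(3) by (simp add: algebra_simps)
    finally have le: "norm (Wtrans f w) * exp (1 / (A * d) * (norm w)\<^sup>2) \<le> (2 * gauss_const TYPE('d) + 1) * D * exp (re_sq w / 2)" .
    have "norm (Wtrans f w) = (norm (Wtrans f w) * exp (1 / (A * d) * (norm w)\<^sup>2)) * exp (- (1 / (A * d) * (norm w)\<^sup>2))"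
      unfolding mult.assoc exp_add[symmetric] by simp
    also have "\<dots> \<le> ((2 * gauss_const TYPE('d) + 1) * D * exp (re_sq w / 2)) * exp (- (1 / (A * d) * (norm w)\<^sup>2))"
      using le by (rule mult_right_mono) simp
    also have "\<dots> = (2 * gauss_const TYPE('d) + 1) * D * exp (re_sq w / 2 - 1 / (A * d) * (norm w)\<^sup>2)"
      unfolding mult.assoc exp_add[symmetric] by simp
    finally show ?thesis .
  qed
  have "0 < 1 / (A * d)" "0 < 2 * gauss_const TYPE('d) + 1"
    using A d gauss_const_nonneg[where 'd='d] by (simp, linarith)
  then show ?thesis using main by blast
qed

section \<open>Reproducing kernel and representation of entire functions by functionals\<close>

definition cbar :: "'d::finite phase_space \<Rightarrow> complex ^ 'd" where
  "cbar z = cplx (fst z, - snd z)"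

lemma cbar_nth [simp]: "cbar z $ j = Complex (fst z $ j) (snd z $ j)"
  by (simp add: cbar_def)

lemma norm_cbar [simp]: "norm (cbar z) = norm z"
  by (simp add: cbar_def norm_prod_def)

lemma re_sq_cplx [simp]: "re_sq (cplx z) = (norm (fst z))\<^sup>2" "im_sq (cplx z) = (norm (snd z))\<^sup>2"
  by (simp_all add: re_sq_def im_sq_def norm_vec_def L2_set_def sum_nonneg)

lemma re_sq_cbar [simp]: "re_sq (cbar z) = (norm (fst z))\<^sup>2"
  by (simp add: cbar_def)

lemma continuous_on_cbar [continuous_intros]: "continuous_on S f \<Longrightarrow> continuous_on S (\<lambda>x. cbar (f x))"
  unfolding cbar_def by (intro continuous_intros)

lemma borel_measurable_cbar [measurable]: "cbar \<in> borel_measurable borel"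
  by (intro borel_measurable_continuous_onI continuous_intros)

lemma norm_sq_phase: "(norm z)\<^sup>2 = (norm (fst z))\<^sup>2 + (norm (snd z))\<^sup>2"
  by (simp add: norm_prod_def)

lemma Wtrans_gexp: 
  "Wtrans (gexp w0) w = of_real (sqrt pi ^ CARD('d)) * exp (cdot (w0 + w) (w0 + w) / 4)" for w :: "complex ^ 'd::finite"
proof -
  have c: "cdot (cvec y) (cvec y) = of_real ((norm y)\<^sup>2)" for y :: "real ^ 'd"
    by (simp add: cdot_def norm_vec_def L2_set_def sum_nonneg power2_eq_square)
  have "gexp w0 y * gexp w y = exp (of_real (- (norm y)\<^sup>2) + cdot (w0 + w) (cvec y))" for y
  proof -
    have "(- cdot (cvec y) (cvec y) / 2 + cdot w0 (cvec y)) + (- cdot (cvec y) (cvec y) / 2 + cdot w (cvec y))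
       = of_real (- (norm y)\<^sup>2) + cdot (w0 + w) (cvec y)"
      unfolding c cdot_add_left by simp
    then show ?thesis unfolding gexp_def cexpq_def exp_add[symmetric] by (simp only:)
  qed
  then show ?thesis unfolding Wtrans_def by (simp only: gauss_integral_complex)
qed

definition phase_const :: "'d::finite itself \<Rightarrow> real" where
  "phase_const _ = (\<integral>z. exp (- (norm z)\<^sup>2 / 2) \<partial>(lborel :: 'd phase_space measure))"

definition repr_const :: "'d::finite itself \<Rightarrow> real" where
  "repr_const _ = sqrt pi ^ CARD('d) * phase_const TYPE('d)"

lemma integrable_exp_pos:
  assumes "integrable lborel (\<lambda>z::'a::euclidean_space. exp (f z :: real))"
  shows "0 < (\<integral>z. exp (f z) \<partial>lborel)"
proof -
  have "(\<integral>z. exp (f z) \<partial>lborel) \<noteq> 0"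
  proof
    assume "(\<integral>z. exp (f z) \<partial>lborel) = 0"
    then have "AE z in lborel. exp (f z) = 0" using integral_nonneg_eq_0_iff_AE[OF assms] by simp
    then have "AE z in (lborel :: 'a measure). False" by simp
    then have "emeasure lborel (UNIV :: 'a set) = 0" using AE_iff_measurable[of UNIV "lborel :: 'a measure" "\<lambda>_. False"] by simp
    then show False by simp
  qed
  moreover have "0 \<le> (\<integral>z. exp (f z) \<partial>lborel)" by simp
  ultimately show ?thesis by linarith
qed

lemma repr_const_pos: "0 < repr_const TYPE('d::finite)"
proof -
  have "0 < phase_const TYPE('d)" unfolding phase_const_def
    using integrable_gauss[of "1/2", where 'a = "'d phase_space"] by (intro integrable_exp_pos) simp
  then show ?thesis by (simp add: repr_const_def)
qed

lemma lborel_integral_translate: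
  fixes f :: "'a::euclidean_space \<Rightarrow> 'b::{banach, second_countable_topology}"
  assumes [measurable]: "f \<in> borel_measurable borel" and i: "integrable lborel (\<lambda>z. f (a + z))"
  shows "integrable lborel f" "(\<integral>z. f z \<partial>lborel) = (\<integral>z. f (a + z) \<partial>lborel)"
  using integrable_distr_eq[of "(+) a" lborel borel f] integral_distr[of "(+) a" lborel borel f] i
  by (simp_all add: lborel_distr_plus)

text \<open>After translation by the point z0 that corresponds to w0, the quadratic exponents of the
  kernel combine to a linear holomorphic term and the real Gaussian exp(- |z|^2 / 2), so the
  integral is a Gaussian mean of the entire function \<open>G\<close> and is given by its value at
  0. The bound on \<epsilon> secures integrability: the quadratic growth rate of \<open>G\<close> is
  1/4 + \<epsilon>, which has to stay below 1/2.\<close>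

lemma reproducing:
  fixes H :: "complex ^ 'd::finite \<Rightarrow> complex"
  assumes H: "entire H" and e: "0 \<le> \<epsilon>" "\<epsilon> < 1/4" and C: "0 \<le> C"
    and bnd: "\<And>z. norm (H (cplx z)) \<le> C * exp ((norm (fst z))\<^sup>2 / 2 + \<epsilon> * (norm z)\<^sup>2)"
  shows "integrable lborel (\<lambda>z. H (cplx z) * of_real (exp (- (norm (fst z))\<^sup>2)) * Wtrans (gexp w0) (cbar z))"
    and "(\<integral>z. H (cplx z) * of_real (exp (- (norm (fst z))\<^sup>2)) * Wtrans (gexp w0) (cbar z) \<partial>lborel) = of_real (repr_const TYPE('d)) * H w0"
proof -
  obtain z0 where z0: "cplx z0 = w0" using surj_cplx by blast
  \<comment> \<open>Removing the factor exp(w^2 / 4), with the bilinear square, makes the growth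
    bound rotation invariant, with rate 1/4 + \<epsilon> in |w|^2.\<close>
  define P where "P w = H w * exp ((-1/4) * cdot w w)" for w
  define G where "G \<zeta> = P (w0 + 1 *s \<zeta>) * exp ((-1/2) * cdot (cbar z0) \<zeta>)" for \<zeta>
  have P: "entire P" unfolding P_def by (intro entire_mult H entire_exp entire_cmult entire_cdot_self)
  have "entire (\<lambda>\<zeta>. exp ((-1/2) * cdot (cbar z0) \<zeta>))" by (intro entire_exp entire_cmult entire_cdot)
  then have G: "entire G" unfolding G_def by (rule entire_mult[OF entire_affine[OF P]])
  let ?k = "\<lambda>z. H (cplx z) * of_real (exp (- (norm (fst z))\<^sup>2)) * Wtrans (gexp w0) (cbar z)"
  let ?g = "\<lambda>z::'d phase_space. G (cplx z) * of_real (exp (- (norm z)\<^sup>2 / 2))"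
  define c where "c = of_real (sqrt pi ^ CARD('d)) * exp (cdot w0 w0 / 4)"
  have kg: "?k (z0 + z) = c * ?g z" for z
  proof -
    \<comment> \<open>Checked coordinate by coordinate, where it is a polynomial identity between
      real and imaginary parts.\<close>
    have ex: "cdot (cplx (z0 + z)) (cplx (z0 + z)) / 4 + of_real (- (norm (fst (z0 + z)))\<^sup>2) + cdot (w0 + cbar (z0 + z)) (w0 + cbar (z0 + z)) / 4
      = cdot w0 w0 / 4 + (-1/2) * cdot (cbar z0) (cplx z) + of_real (- (norm z)\<^sup>2 / 2)"
    proof -
      have n1: "of_real ((norm (fst (z0 + z)))\<^sup>2) = (\<Sum>i\<in>UNIV. complex_of_real ((fst z0 $ i + fst z $ i)\<^sup>2))"
        by (simp add: norm_vec_def L2_set_def sum_nonneg)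
      have n2: "of_real ((norm z)\<^sup>2) = (\<Sum>i\<in>UNIV. complex_of_real ((fst z $ i)\<^sup>2 + (snd z $ i)\<^sup>2))"
        unfolding norm_sq_phase by (simp add: norm_vec_def L2_set_def sum_nonneg sum.distrib)
      have "cdot (cplx (z0 + z)) (cplx (z0 + z)) / 4 + of_real (- (norm (fst (z0 + z)))\<^sup>2) + cdot (w0 + cbar (z0 + z)) (w0 + cbar (z0 + z)) / 4
        = (\<Sum>i\<in>UNIV. cplx (z0 + z) $ i * cplx (z0 + z) $ i / 4 - complex_of_real ((fst z0 $ i + fst z $ i)\<^sup>2)
            + (w0 + cbar (z0 + z)) $ i * (w0 + cbar (z0 + z)) $ i / 4)"
        unfolding cdot_def of_real_minus n1 by (simp add: sum.distrib sum_subtractf sum_divide_distrib)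
      also have "\<dots> = (\<Sum>i\<in>UNIV. w0 $ i * w0 $ i / 4 + (-1/2) * (cbar z0 $ i * cplx z $ i) - complex_of_real ((fst z $ i)\<^sup>2 + (snd z $ i)\<^sup>2) / 2)"
        by (intro sum.cong refl) (simp add: z0[symmetric] complex_eq_iff power2_eq_square field_simps)
      also have "\<dots> = cdot w0 w0 / 4 + (-1/2) * cdot (cbar z0) (cplx z) - of_real ((norm z)\<^sup>2) / 2"
        unfolding cdot_def n2 sum.distrib sum_subtractf sum_divide_distrib sum_distrib_left by simp
      finally show ?thesis by simp
    qed
    have Hp: "H (cplx (z0 + z)) = P (w0 + cplx z) * exp (cdot (cplx (z0 + z)) (cplx (z0 + z)) / 4)"
    proof -
      have "exp ((-1/4) * cdot (cplx (z0 + z)) (cplx (z0 + z))) * exp (cdot (cplx (z0 + z)) (cplx (z0 + z)) / 4) = 1"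
        by (simp add: exp_add[symmetric])
      then show ?thesis unfolding P_def z0[symmetric] cplx_add[symmetric] by (simp only: mult.assoc mult_1_right)
    qed
    have "?k (z0 + z) = of_real (sqrt pi ^ CARD('d)) * P (w0 + cplx z) * exp (cdot (cplx (z0 + z)) (cplx (z0 + z)) / 4 + of_real (- (norm (fst (z0 + z)))\<^sup>2) + cdot (w0 + cbar (z0 + z)) (w0 + cbar (z0 + z)) / 4)"
      unfolding Hp Wtrans_gexp exp_add exp_of_real by (simp only: ac_simps)
    also have "\<dots> = c * ?g z" unfolding ex exp_add exp_of_real c_def G_def by (simp only: ac_simps vector_smult_lid)
    finally show ?thesis .
  qed
  have Pb: "norm (P w) \<le> C * exp ((1/4 + \<epsilon>) * (norm w)\<^sup>2)" for w
  proof -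
    obtain z where z: "cplx z = w" using surj_cplx by blast
    have "norm (P w) = norm (H w) * exp (- (re_sq w - im_sq w) / 4)"
      unfolding P_def norm_mult norm_exp_eq_Re by (simp add: Re_cdot_self field_simps)
    also have "\<dots> \<le> (C * exp ((norm (fst z))\<^sup>2 / 2 + \<epsilon> * (norm z)\<^sup>2)) * exp (- (re_sq w - im_sq w) / 4)"
      using bnd[of z] z by (intro mult_right_mono) auto
    also have "\<dots> = C * exp ((1/4 + \<epsilon>) * (norm w)\<^sup>2)"
    proof -
      have "(norm (fst z))\<^sup>2 / 2 + \<epsilon> * (norm z)\<^sup>2 + - (re_sq w - im_sq w) / 4 = (1/4 + \<epsilon>) * (norm w)\<^sup>2"
        unfolding z[symmetric] norm_cplx norm_sq_phase re_sq_cplx by (simp add: field_simps)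
      then show ?thesis by (simp only: mult.assoc exp_add[symmetric])
    qed
    finally show ?thesis .
  qed
  define r where "r = norm w0"
  have r: "0 \<le> r" by (simp add: r_def)
  have ig: "integrable lborel ?g"
  proof (rule Bochner_Integration.integrable_bound)
    show "integrable lborel (\<lambda>z::'d phase_space. (C * exp ((1/4 + \<epsilon>) * r\<^sup>2)) * exp (- (1/4 - \<epsilon>) * (norm z)\<^sup>2 + ((1/4 + \<epsilon>) * (2 * r) + r / 2) * norm z))"
      using e by (intro integrable_mult_right integrable_gauss_linear) simp
    have [measurable]: "G \<in> borel_measurable borel" using G by (rule borel_measurable_entire)
    show "?g \<in> borel_measurable lborel" by measurable
    show "AE z in lborel. norm (?g z) \<le> norm ((C * exp ((1/4 + \<epsilon>) * r\<^sup>2)) * exp (- (1/4 - \<epsilon>) * (norm z)\<^sup>2 + ((1/4 + \<epsilon>) * (2 * r) + r / 2) * norm z))"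
    proof (intro always_eventually allI)
      fix z :: "'d phase_space"
      have "norm (w0 + cplx z) \<le> r + norm z" unfolding r_def using norm_triangle_ineq[of w0 "cplx z"] by simp
      then have "(norm (w0 + cplx z))\<^sup>2 \<le> (r + norm z)\<^sup>2" by (intro power_mono) auto
      then have 1: "(1/4 + \<epsilon>) * (norm (w0 + cplx z))\<^sup>2 \<le> (1/4 + \<epsilon>) * (r + norm z)\<^sup>2" using e by (intro mult_left_mono) auto
      have "norm (cdot (cbar z0) (cplx z)) \<le> r * norm z" using norm_cdot_le[of "cbar z0" "cplx z"] z0 by (simp add: r_def flip: norm_cplx[of z0]) 
      then have 2: "Re ((-1/2) * cdot (cbar z0) (cplx z)) \<le> r * norm z / 2"
        using abs_Re_le_cmod[of "cdot (cbar z0) (cplx z)"] by simp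
      have "norm (?g z) \<le> (C * exp ((1/4 + \<epsilon>) * (r + norm z)\<^sup>2)) * exp (r * norm z / 2) * exp (- (norm z)\<^sup>2 / 2)"
        unfolding G_def norm_mult norm_exp_eq_Re vector_smult_lid norm_of_real abs_exp_cancel
        using Pb[of "w0 + cplx z"] 1 2 C by (intro mult_mono) (auto intro: order_trans mult_left_mono)
      also have "\<dots> = (C * exp ((1/4 + \<epsilon>) * r\<^sup>2)) * exp (- (1/4 - \<epsilon>) * (norm z)\<^sup>2 + ((1/4 + \<epsilon>) * (2 * r) + r / 2) * norm z)"
      proof -
        have "(1/4 + \<epsilon>) * (r + norm z)\<^sup>2 + r * norm z / 2 + - (norm z)\<^sup>2 / 2
           = (1/4 + \<epsilon>) * r\<^sup>2 + (- (1/4 - \<epsilon>) * (norm z)\<^sup>2 + ((1/4 + \<epsilon>) * (2 * r) + r / 2) * norm z)"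
          by (simp add: power2_eq_square algebra_simps)
        then show ?thesis by (simp only: mult.assoc exp_add[symmetric] add.assoc)
      qed
      finally show "norm (?g z) \<le> norm ((C * exp ((1/4 + \<epsilon>) * r\<^sup>2)) * exp (- (1/4 - \<epsilon>) * (norm z)\<^sup>2 + ((1/4 + \<epsilon>) * (2 * r) + r / 2) * norm z))"
        using C by simp
    qed
  qed
  have km: "?k \<in> borel_measurable borel"
  proof -
    have [measurable]: "H \<in> borel_measurable borel" using H by (rule borel_measurable_entire)
    have "continuous_on UNIV (\<lambda>z::'d phase_space. norm (fst z))" by (intro continuous_intros)
    then have [measurable]: "(\<lambda>z::'d phase_space. norm (fst z)) \<in> borel_measurable borel" by (rule borel_measurable_continuous_onI)
    have "entire (\<lambda>w. exp ((1/4) * cdot w w))" by (intro entire_exp entire_cmult entire_cdot_self)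
    then have "entire (\<lambda>w. exp ((1/4) * cdot (w0 + 1 *s w) (w0 + 1 *s w)))" by (rule entire_affine)
    then have [measurable]: "(\<lambda>w. exp (cdot (w0 + w) (w0 + w) / 4)) \<in> borel_measurable borel" by (simp add: borel_measurable_entire)
    show ?thesis unfolding Wtrans_gexp by measurable
  qed
  have i: "integrable lborel (\<lambda>z. ?k (z0 + z))" unfolding kg using ig by (rule integrable_mult_right)
  show "integrable lborel ?k" by (rule lborel_integral_translate(1)[OF km i])
  have "(\<integral>z. ?k z \<partial>lborel) = (\<integral>z. ?k (z0 + z) \<partial>lborel)" by (rule lborel_integral_translate(2)[OF km i])
  also have "\<dots> = c * (\<integral>z. ?g z \<partial>lborel)" unfolding kg by simp
  also have "\<dots> = c * (G 0 * of_real (phase_const TYPE('d)))" unfolding phase_const_def by (subst gaussian_mean_value[OF G ig]) simp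
  also have "G 0 = P w0" by (simp add: G_def cdot_def)
  also have "c * (P w0 * of_real (phase_const TYPE('d))) = of_real (repr_const TYPE('d)) * (P w0 * exp (cdot w0 w0 / 4))"
    by (simp add: c_def repr_const_def)
  also have "P w0 * exp (cdot w0 w0 / 4) = H w0"
    unfolding P_def by (simp add: exp_add[symmetric] mult.assoc)
  finally show "(\<integral>z. ?k z \<partial>lborel) = of_real (repr_const TYPE('d)) * H w0" .
qed

lemma smooth_measurable: "smooth f \<Longrightarrow> f \<in> borel_measurable borel"
  by (intro borel_measurable_continuous_onI continuous_at_imp_continuous_on)
     (auto dest: smooth_differentiable intro: differentiable_imp_continuous_within)

lemma GS_step_bounded:
  assumes "0 < h" "f \<in> GS_step (1/2) h" "GS_norm (1/2) h f \<le> ennreal D" "0 \<le> D"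
  shows "norm (f y) \<le> D" "f \<in> borel_measurable borel"
  using GS_norm_single[OF assms(1,3,4), of y undefined 0 0] assms smooth_measurable by (auto simp: GS_step_def)

lemma GS_obtain:
  assumes "f \<in> GS s" obtains h D where "0 < h" "f \<in> GS_step s h" "0 < D" "GS_norm s h f \<le> ennreal D"
proof -
  obtain h where h: "0 < h" "f \<in> GS_step s h" using assms by (auto simp: GS_def)
  then have "GS_norm s h f < top" by (simp add: GS_step_def)
  then obtain D where "GS_norm s h f = ennreal D" "0 \<le> D" by (cases "GS_norm s h f") auto
  then show ?thesis using h that[of h "D + 1"] by (auto intro: ennreal_leI)
qed

lemma GS_bounded_measurable:
  assumes "f \<in> GS (1/2)" obtains B where "f \<in> borel_measurable borel" "\<And>y. norm (f y) \<le> B"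
proof -
  obtain h D where hD: "0 < h" "f \<in> GS_step (1/2) h" "0 < D" "GS_norm (1/2) h f \<le> ennreal D" using GS_obtain[OF assms] by blast
  then show ?thesis using that[of D] GS_step_bounded[OF hD(1,2,4)] by auto
qed

text \<open>The functional that is meant to take the values of H on the packets; the division
  normalizes the reproducing formula, and the value 0 off the test functions is the convention of
  \<open>GS_dual\<close>.\<close>

definition repr_functional :: "(complex ^ 'd \<Rightarrow> complex) \<Rightarrow> (real ^ 'd::finite \<Rightarrow> complex) \<Rightarrow> complex" where
  "repr_functional H f = (if f \<in> GS (1/2) then
     (\<integral>z. H (cplx z) * of_real (exp (- (norm (fst z))\<^sup>2)) * Wtrans f (cbar z) \<partial>lborel) / of_real (repr_const TYPE('d)) else 0)"

text \<open>The integrand of \<open>repr_functional\<close> contains H, the factor exp(- |x|^2) and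
  a transform of size exp(|x|^2 / 2 - \<delta> |z|^2). The growth allowed here is critical up to
  \<epsilon>, and every \<epsilon> > 0 is asked for because the available \<delta> shrinks as h
  grows.\<close>

definition gelfand_shilov_growth :: "(complex ^ 'd::finite \<Rightarrow> complex) \<Rightarrow> bool" where
  "gelfand_shilov_growth H \<longleftrightarrow> entire H \<and>
    (\<forall>\<epsilon>>0. \<exists>C\<ge>0. \<forall>z. norm (H (cplx z)) \<le> C * exp ((norm (fst z))\<^sup>2 / 2 + \<epsilon> * (norm z)\<^sup>2))"

lemma gexp_in_GS: "gexp w \<in> GS (1/2)"
  unfolding gexp_def using analytic_bound_GS[OF _ _ analytic_bound_gexp[of w]] by simp

lemma repr_functional:
  fixes H :: "complex ^ 'd::finite \<Rightarrow> complex"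
  assumes "gelfand_shilov_growth H"
  shows "repr_functional H \<in> GS_dual (1/2)" "repr_functional H (gexp w) = H w"
proof -
  have H: "entire H" and gr: "\<And>\<epsilon>. \<epsilon> > 0 \<Longrightarrow> \<exists>C\<ge>0. \<forall>z. norm (H (cplx z)) \<le> C * exp ((norm (fst z))\<^sup>2 / 2 + \<epsilon> * (norm z)\<^sup>2)"
    using assms by (auto simp: gelfand_shilov_growth_def)
  let ?i = "\<lambda>f z. H (cplx z) * of_real (exp (- (norm (fst z))\<^sup>2)) * Wtrans f (cbar z)"
  have kappa: "0 < repr_const TYPE('d)" by (rule repr_const_pos)
  have key: "\<exists>\<delta>>0. \<exists>C\<ge>0. \<forall>f\<in>GS_step (1/2) h. \<forall>D\<ge>0. GS_norm (1/2) h f \<le> ennreal D \<longrightarrow>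
     (\<forall>z. norm (?i f z) \<le> C * D * exp (- \<delta> * (norm z)\<^sup>2)) \<and> integrable lborel (?i f)" if h: "0 < h" for h
  proof -
    obtain \<delta> C where dC: "\<delta> > 0" "C > 0" "\<And>f D w. f\<in>GS_step (1/2) h \<Longrightarrow> D\<ge>0 \<Longrightarrow> GS_norm (1/2) h f \<le> ennreal D \<Longrightarrow>
     norm (Wtrans f (w::complex ^ 'd)) \<le> C * D * exp (re_sq w / 2 - \<delta> * (norm w)\<^sup>2)"
      using Wtrans_decay[OF h] by metis
    \<comment> \<open>With \<epsilon> = \<delta>/2, half of the decay of the transform is left over
      after the growth of H, which gives integrability and a bound linear in D.\<close>
    obtain C' where C': "C' \<ge> 0" "\<And>z. norm (H (cplx z)) \<le> C' * exp ((norm (fst z))\<^sup>2 / 2 + (\<delta>/2) * (norm z)\<^sup>2)"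
      using gr[of "\<delta>/2"] dC(1) by auto
    have b: "norm (?i f z) \<le> (C' * C) * D * exp (- (\<delta>/2) * (norm z)\<^sup>2)"
      if "f\<in>GS_step (1/2) h" "D\<ge>0" "GS_norm (1/2) h f \<le> ennreal D" for f D z
    proof -
      have "norm (?i f z) \<le> (C' * exp ((norm (fst z))\<^sup>2 / 2 + (\<delta>/2) * (norm z)\<^sup>2)) * exp (- (norm (fst z))\<^sup>2) *
          (C * D * exp ((norm (fst z))\<^sup>2 / 2 - \<delta> * (norm z)\<^sup>2))"
        unfolding norm_mult using C'(2)[of z] dC(3)[OF that, of "cbar z"] C'(1) by (intro mult_mono) auto
      also have "\<dots> = (C' * C) * D * exp ((norm (fst z))\<^sup>2 / 2 + (\<delta>/2) * (norm z)\<^sup>2 + (- (norm (fst z))\<^sup>2) + ((norm (fst z))\<^sup>2 / 2 - \<delta> * (norm z)\<^sup>2))"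
        unfolding exp_add by (simp only: ac_simps)
      also have "(norm (fst z))\<^sup>2 / 2 + (\<delta>/2) * (norm z)\<^sup>2 + (- (norm (fst z))\<^sup>2) + ((norm (fst z))\<^sup>2 / 2 - \<delta> * (norm z)\<^sup>2) = - (\<delta>/2) * (norm z)\<^sup>2"
        by (simp add: field_simps)
      finally show ?thesis .
    qed
    have "integrable lborel (?i f)" if f: "f\<in>GS_step (1/2) h" "D\<ge>0" "GS_norm (1/2) h f \<le> ennreal D" for f D
    proof (rule Bochner_Integration.integrable_bound)
      show "integrable lborel (\<lambda>z::'d phase_space. (C' * C) * D * exp (- (\<delta>/2) * (norm z)\<^sup>2))"
        using dC(1) by (intro integrable_mult_right integrable_gauss) simp
      have [measurable]: "H \<in> borel_measurable borel" using H by (rule borel_measurable_entire)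
      have "entire (Wtrans f)" using GS_step_bounded[OF h f(1,3,2)] by (intro entire_Wtrans)
      then have [measurable]: "Wtrans f \<in> borel_measurable borel" by (rule borel_measurable_entire)
      have "continuous_on UNIV (\<lambda>z::'d phase_space. norm (fst z))" by (intro continuous_intros)
      then have [measurable]: "(\<lambda>z::'d phase_space. norm (fst z)) \<in> borel_measurable borel" by (rule borel_measurable_continuous_onI)
      show "?i f \<in> borel_measurable lborel" by measurable
      show "AE z in lborel. norm (?i f z) \<le> norm ((C' * C) * D * exp (- (\<delta>/2) * (norm z)\<^sup>2))"
        using b[OF f] by (intro always_eventually allI) (smt (verit) real_norm_def)
    qed
    then show ?thesis using b dC(1,2) C'(1) by (intro exI[of _ "\<delta>/2"] conjI exI[of _ "C' * C"]) auto
  qed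
  have int: "integrable lborel (?i f)" if f: "f \<in> GS (1/2)" for f
  proof -
    obtain h D where hD: "0 < h" "f \<in> GS_step (1/2) h" "0 < D" "GS_norm (1/2) h f \<le> ennreal D"
      by (rule GS_obtain[OF f])
    from key[OF hD(1)] obtain \<delta> C where "\<forall>f\<in>GS_step (1/2) h. \<forall>D\<ge>0. GS_norm (1/2) h f \<le> ennreal D \<longrightarrow>
      (\<forall>z. norm (?i f z) \<le> C * D * exp (- \<delta> * (norm z)\<^sup>2)) \<and> integrable lborel (?i f)" by (elim exE conjE)
    from this[rule_format, OF hD(2) _ hD(4)] hD(3) show ?thesis by simp
  qed
  show "repr_functional H \<in> GS_dual (1/2)"
  proof (rule GS_dualI)
    show "GS_linear (1/2) (repr_functional H)" unfolding GS_linear_def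
    proof (intro ballI allI)
      fix f g :: "real ^ 'd \<Rightarrow> complex" and a b assume fg: "f \<in> GS (1/2)" "g \<in> GS (1/2)"
      obtain B where B: "f \<in> borel_measurable borel" "\<And>y. norm (f y) \<le> B" using GS_bounded_measurable[OF fg(1)] by blast
      obtain B' where B': "g \<in> borel_measurable borel" "\<And>y. norm (g y) \<le> B'" using GS_bounded_measurable[OF fg(2)] by blast
      have W: "Wtrans (\<lambda>x. a * f x + b * g x) w = a * Wtrans f w + b * Wtrans g w" for w
      proof -
        have "Wtrans (\<lambda>x. a * f x + b * g x) w = (\<integral>y. a * (f y * gexp w y) + b * (g y * gexp w y) \<partial>lborel)"
          unfolding Wtrans_def by (simp add: algebra_simps)
        then show ?thesis unfolding Wtrans_def using integrable_bounded_gexp[OF B] integrable_bounded_gexp[OF B'] by simp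
      qed
      have "(\<integral>z. ?i (\<lambda>x. a * f x + b * g x) z \<partial>lborel) = (\<integral>z. a * ?i f z + b * ?i g z \<partial>lborel)"
        unfolding W by (simp add: algebra_simps)
      also have "\<dots> = a * (\<integral>z. ?i f z \<partial>lborel) + b * (\<integral>z. ?i g z \<partial>lborel)"
        using int fg by simp
      finally show "repr_functional H (\<lambda>x. a * f x + b * g x) = a * repr_functional H f + b * repr_functional H g"
        using fg GS_lincomb[OF fg] by (simp add: repr_functional_def add_divide_distrib)
    qed
    show "GS_bounded (1/2) (repr_functional H)" unfolding GS_bounded_def
    proof (intro allI impI)
      fix h :: real assume h: "0 < h"
      from key[OF h] obtain \<delta> C where dC0: "\<delta> > 0" "C \<ge> 0" "\<forall>f\<in>GS_step (1/2) h. \<forall>D\<ge>0. GS_norm (1/2) h f \<le> ennreal D \<longrightarrow>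
         (\<forall>z. norm (?i f z) \<le> C * D * exp (- \<delta> * (norm z)\<^sup>2)) \<and> integrable lborel (?i f)"
        by (elim exE conjE)
      note dC = dC0(1,2) dC0(3)[rule_format]
      let ?I = "\<integral>z. exp (- \<delta> * (norm z)\<^sup>2) \<partial>(lborel :: 'd phase_space measure)"
      have "norm (repr_functional H f) \<le> (C * ?I / repr_const TYPE('d) + 1) * M"
        if f: "f \<in> GS_step (1/2) h" and M: "0 < M" "GS_norm (1/2) h f \<le> ennreal M" for f M
      proof -
        have "norm (\<integral>z. ?i f z \<partial>lborel) \<le> (\<integral>z. norm (?i f z) \<partial>lborel)" by (rule integral_norm_bound)
        also have "\<dots> \<le> (\<integral>z. C * M * exp (- \<delta> * (norm z)\<^sup>2) \<partial>(lborel :: 'd phase_space measure))"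
          using dC0(3)[rule_format, OF f _ M(2)] M(1) dC(1) by (intro integral_mono integrable_norm integrable_mult_right integrable_gauss) auto
        also have "\<dots> = C * ?I * M" by simp
        finally have "norm (repr_functional H f) \<le> C * ?I * M / repr_const TYPE('d)"
          using GS_stepI[OF h f] kappa by (simp add: repr_functional_def norm_divide divide_right_mono)
        also have "\<dots> \<le> (C * ?I / repr_const TYPE('d) + 1) * M" using M(1) by (simp add: distrib_right)
        finally show ?thesis .
      qed
      moreover have "0 < C * ?I / repr_const TYPE('d) + 1" using dC kappa by (intro add_nonneg_pos divide_nonneg_pos mult_nonneg_nonneg) auto
      ultimately show "\<exists>C>0. \<forall>f\<in>GS_step (1/2) h. \<forall>M>0. GS_norm (1/2) h f \<le> ennreal M \<longrightarrow> norm (repr_functional H f) \<le> C * M"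
        by blast
    qed
  qed (simp add: repr_functional_def)
  \<comment> \<open>Any \<epsilon> below 1/4 is admissible in the reproducing formula.\<close>
  obtain C where "C \<ge> 0" "\<And>z. norm (H (cplx z)) \<le> C * exp ((norm (fst z))\<^sup>2 / 2 + (1/8) * (norm z)\<^sup>2)"
    using gr[of "1/8"] by auto
  from reproducing(2)[OF H _ _ this, of w] show "repr_functional H (gexp w) = H w"
    using kappa by (simp add: repr_functional_def gexp_in_GS)
qed

text \<open>
  Integrating the transform against Gaussians over imaginary directions produces the averages of \<open>f\<close>
  against narrow Gaussians centred at \<open>y0\<close>.
\<close>

lemma Wtrans_injective:
  fixes f :: "real ^ 'd::finite \<Rightarrow> complex"
  assumes cont: "continuous_on UNIV f" and B: "\<And>y. norm (f y) \<le> B" and W: "\<And>w. Wtrans f w = 0"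
  shows "f y0 = 0"
proof -
  have [measurable]: "f \<in> borel_measurable borel" using cont by (rule borel_measurable_continuous_onI)
  have B0: "0 \<le> B" using norm_ge_zero B order_trans by blast
  define g where "g y = f y * of_real (exp (- (norm y)\<^sup>2 / 2))" for y
  have gm[measurable]: "g \<in> borel_measurable borel" unfolding g_def by measurable
  have gb: "norm (g y) \<le> B * exp (- (1/2) * (norm y)\<^sup>2)" for y
    using mult_right_mono[OF B, of "exp (- (norm y)\<^sup>2 / 2)" y] by (simp add: g_def norm_mult)
  have gB: "norm (g y) \<le> B" for y using gb[of y] B0 mult_left_le[of "exp (- (1/2) * (norm y)\<^sup>2)" B] by (auto intro: order_trans)
  \<comment> \<open>The kernel \<open>K\<close> is integrated in both orders. Over y it gives a
    multiple of a value of \<open>Wtrans f\<close> at an imaginary point, hence 0; over \<xi> it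
    gives a Gaussian about y0 whose width is of order 1 / r.\<close>
  have z: "(\<integral>y. g y * of_real (exp (- (r * norm (y - y0))\<^sup>2 / 4)) \<partial>lborel) = 0" for r :: real
  proof -
    define K where "K \<xi> y = g y * exp (of_real (- (norm \<xi>)\<^sup>2) + cdot ((\<i> * of_real r) *s cvec (y - y0)) (cvec \<xi>))" for \<xi> y :: "real ^ 'd"
    have Kc: "K \<xi> y = exp (of_real (- (norm \<xi>)\<^sup>2)) * exp (- (\<i> * of_real (r * (y0 \<bullet> \<xi>)))) * (f y * gexp ((\<i> * of_real r) *s cvec \<xi>) y)" for \<xi> y
    proof -
      have "cdot (c *s cvec a) (cvec b) = c * of_real (a \<bullet> b)" for c and a b :: "real ^ 'd"
        by (simp add: cdot_def inner_vec_def sum_distrib_left mult.assoc)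
      moreover have "cdot (cvec y) (cvec y) = of_real ((norm y)\<^sup>2)"
        by (simp add: cdot_def norm_vec_def L2_set_def sum_nonneg power2_eq_square)
      ultimately show ?thesis unfolding K_def g_def gexp_def cexpq_def
        by (simp add: exp_add[symmetric] exp_of_real[symmetric] inner_diff_left inner_commute[of \<xi> y] algebra_simps)
    qed
    have nK: "norm (K \<xi> y) = norm (g y) * exp (- 1 * (norm \<xi>)\<^sup>2)" for \<xi> y
    proof -
      have "Re (cdot ((\<i> * of_real r) *s cvec (y - y0)) (cvec \<xi>)) = 0" by (simp add: cdot_def)
      then show ?thesis unfolding K_def norm_mult norm_exp_eq_Re by simp
    qed
    have gi: "integrable lborel (\<lambda>y. norm (g y))"
    proof (rule Bochner_Integration.integrable_bound)
      show "integrable lborel (\<lambda>y::real^'d. B * exp (- (1/2) * (norm y)\<^sup>2))" by (intro integrable_mult_right integrable_gauss) simp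
      show "AE y in lborel. norm (norm (g y)) \<le> norm (B * exp (- (1/2) * (norm y)\<^sup>2))"
        using gb by (intro always_eventually allI) (smt (verit) real_norm_def norm_ge_zero)
    qed measurable
    have Km: "(\<lambda>(\<xi>, y). K \<xi> y) \<in> borel_measurable (lborel \<Otimes>\<^sub>M lborel)"
    proof -
      have "continuous_on UNIV (\<lambda>p::(real^'d) \<times> (real^'d). exp (of_real (- (norm (fst p))\<^sup>2) + (\<Sum>i\<in>UNIV. ((\<i> * of_real r) * of_real (snd p $ i - y0 $ i)) * of_real (fst p $ i)))  :: complex)"
        by (intro continuous_intros)
      then have "(\<lambda>p::(real^'d) \<times> (real^'d). exp (of_real (- (norm (fst p))\<^sup>2) + (\<Sum>i\<in>UNIV. ((\<i> * of_real r) * of_real (snd p $ i - y0 $ i)) * of_real (fst p $ i)))  :: complex) \<in> borel_measurable borel"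
        by (rule borel_measurable_continuous_onI)
      then have [measurable]: "(\<lambda>p::(real^'d) \<times> (real^'d). exp (of_real (- (norm (fst p))\<^sup>2) + (\<Sum>i\<in>UNIV. ((\<i> * of_real r) * of_real (snd p $ i - y0 $ i)) * of_real (fst p $ i)))  :: complex) \<in> borel_measurable (borel \<Otimes>\<^sub>M borel)"
        by (simp add: borel_prod)
      have "(\<lambda>p. g (snd p) * (exp (of_real (- (norm (fst p))\<^sup>2) + (\<Sum>i\<in>UNIV. ((\<i> * of_real r) * of_real (snd p $ i - y0 $ i)) * of_real (fst p $ i)))  :: complex)) \<in> borel_measurable (borel \<Otimes>\<^sub>M borel)"
        by measurable
      then show ?thesis by (simp add: case_prod_beta K_def cdot_def cong: measurable_cong_sets)
    qed
    have "integrable (lborel \<Otimes>\<^sub>M lborel) (\<lambda>(\<xi>, y). K \<xi> y)"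
    proof (rule lborel_pair.Fubini_integrable[OF Km])
      show "integrable lborel (\<lambda>\<xi>. \<integral>y. norm (case (\<xi>, y) of (\<xi>, y) \<Rightarrow> K \<xi> y) \<partial>lborel)"
        unfolding prod.case nK by (simp add: integrable_gauss[of 1, simplified])
      show "AE \<xi> in lborel. integrable lborel (\<lambda>y. case (\<xi>, y) of (\<xi>, y) \<Rightarrow> K \<xi> y)"
      proof (intro always_eventually allI)
        fix \<xi> :: "real ^ 'd"
        show "integrable lborel (\<lambda>y. case (\<xi>, y) of (\<xi>, y) \<Rightarrow> K \<xi> y)" unfolding prod.case Kc
          by (intro integrable_mult_right integrable_bounded_gexp[OF _ B]) measurable
      qed
    qed
    note Kint = this
    have inner: "(\<integral>\<xi>. K \<xi> y \<partial>lborel) = of_real (sqrt pi ^ CARD('d)) * (g y * of_real (exp (- (r * norm (y - y0))\<^sup>2 / 4)))" for y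
    proof -
      have "cdot ((\<i> * of_real r) *s cvec (y - y0)) ((\<i> * of_real r) *s cvec (y - y0)) = - (\<Sum>i\<in>UNIV. (of_real r)\<^sup>2 * of_real (((y - y0) $ i)\<^sup>2))"
        by (simp add: cdot_def power2_eq_square sum_negf[symmetric] algebra_simps)
      also have "\<dots> = of_real (- (r * norm (y - y0))\<^sup>2)"
        by (simp add: power_mult_distrib norm_vec_def L2_set_def sum_nonneg sum_distrib_left)
      finally have c: "cdot ((\<i> * of_real r) *s cvec (y - y0)) ((\<i> * of_real r) *s cvec (y - y0)) = of_real (- (r * norm (y - y0))\<^sup>2)" .
      have "(\<integral>\<xi>. K \<xi> y \<partial>lborel) = g y * (of_real (sqrt pi ^ CARD('d)) * exp (of_real (- (r * norm (y - y0))\<^sup>2) / 4))"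
        unfolding K_def by (simp only: integral_mult_right_zero gauss_integral_complex c)
      then show ?thesis by (simp add: exp_of_real[symmetric])
    qed
    have "(\<integral>y. \<integral>\<xi>. K \<xi> y \<partial>lborel \<partial>lborel) = (\<integral>\<xi>. \<integral>y. K \<xi> y \<partial>lborel \<partial>lborel)"
      using lborel_pair.Fubini_integral[OF Kint] by simp
    also have "\<dots> = 0"
    proof -
      have "(\<integral>y. K \<xi> y \<partial>lborel) = 0" for \<xi>
        unfolding Kc integral_mult_right_zero using W by (simp add: Wtrans_def)
      then show ?thesis by simp
    qed
    finally have "of_real (sqrt pi ^ CARD('d)) * (\<integral>y. g y * of_real (exp (- (r * norm (y - y0))\<^sup>2 / 4)) \<partial>lborel) = 0"
      by (simp only: inner integral_mult_right_zero)
    then show ?thesis by simp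
  qed
  define t where "t n = inverse (real (Suc n))" for n
  have t: "0 < t n" for n unfolding t_def by auto
  have tl: "t \<longlonglongrightarrow> 0" unfolding t_def by (rule LIMSEQ_inverse_real_of_nat)
  \<comment> \<open>The choice r = 2 / t and the substitution y = y0 + t v turn the narrow Gaussian
    into the fixed weight exp(- |v|^2), so that dominated convergence applies as t tends to
    0.\<close>
  have z2: "(\<integral>v. g (y0 + t n *\<^sub>R v) * of_real (exp (- (norm v)\<^sup>2)) \<partial>lborel) = 0" for n
  proof -
    let ?q = "\<lambda>y. g y * of_real (exp (- ((2 / t n) * norm (y - y0))\<^sup>2 / 4))"
    have qm: "?q \<in> borel_measurable borel" by measurable
    have "0 = (\<integral>y. ?q y \<partial>lborel)" by (rule z[symmetric])
    also have "\<dots> = (\<integral>y. ?q y \<partial>density (distr lborel borel (\<lambda>x. y0 + t n *\<^sub>R x)) (\<lambda>_. ennreal (\<bar>t n\<bar>^DIM(real^'d))))"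
      using lborel_affine[of "t n" y0] t[of n] by simp
    also have "\<dots> = (\<bar>t n\<bar>^DIM(real^'d)) *\<^sub>R (\<integral>v. ?q (y0 + t n *\<^sub>R v) \<partial>lborel)"
      by (subst integral_density) (auto simp: integral_distr)
    also have "(\<lambda>v. ?q (y0 + t n *\<^sub>R v)) = (\<lambda>v. g (y0 + t n *\<^sub>R v) * of_real (exp (- (norm v)\<^sup>2)))"
      using t[of n] by (simp add: fun_eq_iff power_mult_distrib)
    finally show ?thesis using t[of n] by simp
  qed
  have gc: "continuous_on UNIV g" unfolding g_def using cont by (intro continuous_intros) auto
  have "(\<lambda>n. \<integral>v. g (y0 + t n *\<^sub>R v) * of_real (exp (- (norm v)\<^sup>2)) \<partial>(lborel :: (real ^ 'd) measure)) \<longlonglongrightarrow> (\<integral>v. g y0 * of_real (exp (- (norm v)\<^sup>2)) \<partial>(lborel :: (real ^ 'd) measure))"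
  proof (rule integral_dominated_convergence)
    show "integrable lborel (\<lambda>v::real^'d. B * exp (- 1 * (norm v)\<^sup>2))" by (intro integrable_mult_right integrable_gauss) simp
    show "AE v in lborel. (\<lambda>n. g (y0 + t n *\<^sub>R v) * of_real (exp (- (norm (v :: real ^ 'd))\<^sup>2))) \<longlonglongrightarrow> g y0 * of_real (exp (- (norm v)\<^sup>2))"
    proof (intro always_eventually allI tendsto_mult tendsto_const)
      fix v :: "real ^ 'd"
      have "(\<lambda>n. y0 + t n *\<^sub>R v) \<longlonglongrightarrow> y0 + 0 *\<^sub>R v" by (intro tendsto_intros tl)
      then have l: "(\<lambda>n. y0 + t n *\<^sub>R v) \<longlonglongrightarrow> y0" by simp
      have "isCont g y0" using gc by (simp add: continuous_on_eq_continuous_at)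
      then show "(\<lambda>n. g (y0 + t n *\<^sub>R v)) \<longlonglongrightarrow> g y0" using l by (rule isCont_tendsto_compose)
    qed
    show "AE v in lborel. norm (g (y0 + t n *\<^sub>R v) * of_real (exp (- (norm (v :: real ^ 'd))\<^sup>2))) \<le> B * exp (- 1 * (norm v)\<^sup>2)" for n
      using gB by (intro always_eventually allI) (simp add: norm_mult mult_right_mono)
  qed measurable
  then have "(\<integral>v. g y0 * of_real (exp (- (norm v)\<^sup>2)) \<partial>(lborel :: (real ^ 'd) measure)) = 0"
    unfolding z2 by (simp add: LIMSEQ_const_iff)
  then have "g y0 * of_real (\<integral>v. exp (- (norm v)\<^sup>2) \<partial>(lborel :: (real ^ 'd) measure)) = 0" by simp
  moreover have "0 < (\<integral>v. exp (- (norm v)\<^sup>2) \<partial>(lborel :: (real ^ 'd) measure))"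
    using integrable_gauss[of 1, where 'a = "real ^ 'd"] by (intro integrable_exp_pos) simp
  ultimately show ?thesis by (simp add: g_def)
qed

section \<open>Functionals vanishing on Gaussian wave packets\<close>

text \<open>Riemann sums for an integral with parameter \<zeta>, with an error that is uniform in
  \<zeta> relative to the weight W. K is covered by finitely many small balls, made disjoint; on
  each piece G is frozen at the centre, which need not lie in K, and the coefficient is the integral
  of c over the piece.\<close>

lemma integral_finite_combination_approx:
  fixes c :: "'z::euclidean_space \<Rightarrow> complex" and G :: "'z \<Rightarrow> 'b \<Rightarrow> complex"
  assumes c: "integrable lborel c" and K: "compact K" and \<eta>: "0 < \<eta>" and e: "0 \<le> e"
    and Gm: "\<And>\<zeta>. (\<lambda>z. G z \<zeta>) \<in> borel_measurable borel"
    and cG: "\<And>\<zeta>. integrable lborel (\<lambda>z. indicator K z * (c z * G z \<zeta>))"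
    and eq: "\<And>z v \<zeta>. z \<in> K \<Longrightarrow> dist v z < \<eta> \<Longrightarrow> norm (G z \<zeta> - G v \<zeta>) \<le> e * W \<zeta>"
    and W: "\<And>\<zeta>. 0 \<le> W \<zeta>"
  shows "\<exists>(n::nat) v \<alpha>. \<forall>\<zeta>. norm ((\<integral>z. indicator K z * (c z * G z \<zeta>) \<partial>lborel) - (\<Sum>i<n. \<alpha> i * G (v i) \<zeta>))
    \<le> e * W \<zeta> * (\<integral>z. norm (c z) \<partial>lborel)"
proof -
  obtain k where k: "finite k" "K \<subseteq> (\<Union>x\<in>k. ball x \<eta>)" using K \<eta> unfolding compact_eq_totally_bounded by blast
  obtain n :: nat and v where v: "k = v ` {i. i < n}" using k(1) unfolding finite_conv_nat_seg_image by blast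
  define A where "A i = disjointed (\<lambda>i. ball (v i) \<eta>) i \<inter> K" for i
  have Km[measurable]: "K \<in> sets borel" using K by (intro borel_closed compact_imp_closed)
  have Am[measurable]: "A i \<in> sets borel" for i unfolding A_def disjointed_def by measurable
  have Ab: "z \<in> K" "dist (v i) z < \<eta>" if "z \<in> A i" for z i
    using that disjointed_subset[of "\<lambda>i. ball (v i) \<eta>" i] by (auto simp: A_def)
  have cover: "K = (\<Union>i<n. A i)"
  proof -
    have "(\<Union>i<n. disjointed (\<lambda>i. ball (v i) \<eta>) i) = (\<Union>i<n. ball (v i) \<eta>)"
      using finite_UN_disjointed_eq[of "\<lambda>i. ball (v i) \<eta>" n] by (simp add: atLeast0LessThan)
    then show ?thesis using k(2) unfolding A_def v by auto
  qed
  have disj: "disjoint_family_on A {..<n}"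
    using disjoint_family_disjointed[of "\<lambda>i. ball (v i) \<eta>"] by (auto simp: disjoint_family_on_def A_def)
  have ind: "(\<Sum>i<n. indicator (A i) z) = (indicator K z :: complex)" for z
    unfolding cover by (rule indicator_UN_disjoint[symmetric]) (use disj in auto)
  have indr: "(\<Sum>i<n. indicator (A i) z) = (indicator K z :: real)" for z
    unfolding cover by (rule indicator_UN_disjoint[symmetric]) (use disj in auto)
  have sub: "A i \<subseteq> K" for i using Ab by auto
  have i1: "integrable lborel (\<lambda>z. indicator (A i) z * (c z * G z \<zeta>))" for i \<zeta>
  proof -
    have "integrable lborel (\<lambda>z. indicator (A i) z *\<^sub>R (indicator K z * (c z * G z \<zeta>)))"
      by (intro integrable_mult_indicator cG) measurable
    moreover have "indicator (A i) z *\<^sub>R (indicator K z * (c z * G z \<zeta>)) = indicator (A i) z * (c z * G z \<zeta>)" for z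
      using sub[of i] by (auto split: split_indicator)
    ultimately show ?thesis by simp
  qed
  have i2: "integrable lborel (\<lambda>z. indicator (A i) z * c z)" for i
  proof -
    have "integrable lborel (\<lambda>z. indicator (A i) z *\<^sub>R c z)" by (intro integrable_mult_indicator c) measurable
    moreover have "indicator (A i) z *\<^sub>R c z = indicator (A i) z * c z" for z by (auto split: split_indicator)
    ultimately show ?thesis by simp
  qed
  have i3: "integrable lborel (\<lambda>z. indicator (A i) z * norm (c z))" for i
    using integrable_mult_indicator[of "A i" lborel "\<lambda>z. norm (c z)"] c by auto
  show ?thesis
  proof (intro exI[of _ n] exI[of _ v] exI[of _ "\<lambda>i. \<integral>z. indicator (A i) z * c z \<partial>lborel"] allI)
    fix \<zeta>
    let ?d = "\<lambda>i z. indicator (A i) z * (c z * G z \<zeta>) - (indicator (A i) z * c z) * G (v i) \<zeta>"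
    have "(\<integral>z. indicator K z * (c z * G z \<zeta>) \<partial>lborel) = (\<integral>z. (\<Sum>i<n. indicator (A i) z * (c z * G z \<zeta>)) \<partial>lborel)"
      unfolding ind[symmetric] by (simp add: sum_distrib_right)
    also have "\<dots> = (\<Sum>i<n. \<integral>z. indicator (A i) z * (c z * G z \<zeta>) \<partial>lborel)" by (intro Bochner_Integration.integral_sum i1)
    finally have "(\<integral>z. indicator K z * (c z * G z \<zeta>) \<partial>lborel) - (\<Sum>i<n. (\<integral>z. indicator (A i) z * c z \<partial>lborel) * G (v i) \<zeta>)
        = (\<Sum>i<n. \<integral>z. ?d i z \<partial>lborel)"
      using i1 i2 by (simp add: sum_subtractf)
    also have "norm \<dots> \<le> (\<Sum>i<n. \<integral>z. e * W \<zeta> * (indicator (A i) z * norm (c z)) \<partial>lborel)"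
    proof (rule sum_norm_le, rule Bochner_Integration.integral_norm_bound_integral)
      fix i assume "i \<in> {..<n}"
      show "integrable lborel (?d i)" using i1 i2 by auto
      show "integrable lborel (\<lambda>z. e * W \<zeta> * (indicator (A i) z * norm (c z)))" by (intro integrable_mult_right i3)
      show "norm (?d i z) \<le> e * W \<zeta> * (indicator (A i) z * norm (c z))" for z
      proof (cases "z \<in> A i")
        case True
        have "norm (c z) * norm (G z \<zeta> - G (v i) \<zeta>) \<le> norm (c z) * (e * W \<zeta>)" using eq[OF Ab[OF True]] by (intro mult_left_mono) auto
        with True show ?thesis by (simp add: norm_mult[symmetric] algebra_simps)
      qed simp
    qed
    also have "\<dots> = e * W \<zeta> * (\<integral>z. (\<Sum>i<n. indicator (A i) z * norm (c z)) \<partial>lborel)"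
      using i3 by (simp add: Bochner_Integration.integral_sum[of "{..<n}"] sum_distrib_left del: sum_mult_indicator sum_indicator_mult)
    also have "(\<lambda>z. \<Sum>i<n. indicator (A i) z * norm (c z)) = (\<lambda>z. indicator K z * norm (c z))"
      unfolding indr[symmetric] by (simp add: sum_distrib_right)
    also have "e * W \<zeta> * (\<integral>z. indicator K z * norm (c z) \<partial>lborel) \<le> e * W \<zeta> * (\<integral>z. norm (c z) \<partial>lborel)"
    proof (rule mult_left_mono)
      have "integrable lborel (\<lambda>z. indicator K z * norm (c z))"
        using integrable_mult_indicator[of K lborel "\<lambda>z. norm (c z)"] c by auto
      then show "(\<integral>z. indicator K z * norm (c z) \<partial>lborel) \<le> (\<integral>z. norm (c z) \<partial>lborel)"
        by (rule integral_mono) (use c in \<open>auto split: split_indicator\<close>)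
    qed (use e W in simp)
    finally show "norm ((\<integral>z. indicator K z * (c z * G z \<zeta>) \<partial>lborel) - (\<Sum>i<n. (\<integral>z. indicator (A i) z * c z \<partial>lborel) * G (v i) \<zeta>))
      \<le> e * W \<zeta> * (\<integral>z. norm (c z) \<partial>lborel)" .
  qed
qed

lemma cexpq_diff_bound:
  fixes w v \<zeta> :: "complex ^ 'd::finite"
  assumes "norm (v - w) \<le> 1"
  shows "norm (cexpq w \<zeta> - cexpq v \<zeta>) \<le> norm (v - w) * (8 * exp (2 * (norm w + 1)\<^sup>2)) * exp (- (1/4) * re_sq \<zeta> + (3/4) * im_sq \<zeta>)"
proof -
  let ?s = "cdot (v - w) \<zeta>" and ?n = "norm (v - w)"
  have s: "norm ?s \<le> ?n * norm \<zeta>" by (rule norm_cdot_le)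
  have s1: "norm ?s \<le> norm \<zeta>" using s mult_right_mono[OF assms, of "norm \<zeta>"] by simp
  have "norm (exp ?s - 1) \<le> norm ?s * exp (norm ?s)"
    using Taylor_exp_field[of ?s 0] by (simp add: mult.commute)
  also have "\<dots> \<le> (?n * norm \<zeta>) * exp (norm \<zeta>)" using s s1 by (intro mult_mono) auto
  also have "\<dots> \<le> (?n * (1 + (norm \<zeta>)\<^sup>2)) * exp (1 * norm \<zeta>)"
  proof -
    have "2 * norm \<zeta> \<le> 1 + (norm \<zeta>)\<^sup>2" using sum_squares_bound[of 1 "norm \<zeta>"] by simp
    then have "norm \<zeta> \<le> 1 + (norm \<zeta>)\<^sup>2" using norm_ge_zero[of \<zeta>] by linarith
    then show ?thesis by (intro mult_mono mult_left_mono) auto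
  qed
  finally have "norm (1 - exp ?s) \<le> ?n * (1 + (norm \<zeta>)\<^sup>2) * exp (1 * norm \<zeta>)" by (simp add: norm_minus_commute)
  from cexpq_poly_bound[OF this, of w] have "norm (cexpq w \<zeta> * (1 - exp ?s)) \<le> ?n * (8 * exp (2 * (norm w + 1)\<^sup>2)) * exp (- (1/4) * re_sq \<zeta> + (3/4) * im_sq \<zeta>)" by simp
  moreover have "cexpq v \<zeta> = cexpq w \<zeta> * exp ?s"
  proof -
    have "cdot v \<zeta> = cdot w \<zeta> + cdot (v - w) \<zeta>" by (simp add: cdot_add_left[symmetric])
    then show ?thesis by (simp add: cexpq_def exp_add[symmetric] algebra_simps)
  qed
  ultimately show ?thesis by (simp add: right_diff_distrib)
qed

text \<open>Young's inequality with parameter 1 + \<delta> for the real parts and \<delta> for the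
  imaginary parts. Because 1 / (2 (1 + \<delta>)) \<le> 1/2 - \<delta>/4 for \<delta> \<le> 1, decay
  at rate \<delta>/4 in the real part of \<zeta> survives, besides half of the decay in z.\<close>

lemma cexpq_cbar_weighted_bound:
  fixes z :: "'d::finite phase_space"
  assumes d: "0 < \<delta>" "\<delta> \<le> 1"
  shows "exp (- (norm (fst z))\<^sup>2 / 2 - \<delta> * (norm z)\<^sup>2) * norm (cexpq (cbar z) \<zeta>)
    \<le> exp (- (\<delta>/4) * re_sq \<zeta> + (1/2 + 1/(2*\<delta>)) * im_sq \<zeta> - (\<delta>/2) * (norm z)\<^sup>2)"
proof -
  have r: "x * p - s * q \<le> (1/2 + \<delta>/2) * x\<^sup>2 + (\<delta>/2) * s\<^sup>2 + (1/2 - \<delta>/4) * p\<^sup>2 + (1/(2*\<delta>)) * q\<^sup>2" for x p s q :: real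
  proof -
    have "0 \<le> (\<delta> * s + q)\<^sup>2 / (2 * \<delta>)" using d by simp
    also have "(\<delta> * s + q)\<^sup>2 / (2 * \<delta>) = (\<delta>/2) * s\<^sup>2 + (1/(2*\<delta>)) * q\<^sup>2 + s * q"
      using d by (simp add: power2_eq_square field_simps)
    finally have 1: "- s * q \<le> (\<delta>/2) * s\<^sup>2 + (1/(2*\<delta>)) * q\<^sup>2" by simp
    define m where "m = 1 + \<delta>"
    have m: "m > 0" using d by (simp add: m_def)
    have "x * p \<le> (m/2) * x\<^sup>2 + (1/(2*m)) * p\<^sup>2"
    proof -
      have "0 \<le> (m * x - p)\<^sup>2 / (2 * m)" using m by simp
      also have "(m * x - p)\<^sup>2 / (2 * m) = (m/2) * x\<^sup>2 + (1/(2*m)) * p\<^sup>2 - x * p"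
        using m by (simp add: power2_eq_square field_simps)
      finally show ?thesis by simp
    qed
    moreover have "1/(2*m) \<le> 1/2 - \<delta>/4"
    proof -
      have "\<delta> * \<delta> \<le> 1 * \<delta>" using d by (intro mult_right_mono) auto
      then have "1 \<le> (1/2 - \<delta>/4) * (2 * m)" by (simp add: m_def field_simps)
      then show ?thesis using m by (simp add: divide_le_eq)
    qed
    then have "(1/(2*m)) * p\<^sup>2 \<le> (1/2 - \<delta>/4) * p\<^sup>2" by (rule mult_right_mono) simp
    ultimately show ?thesis using 1 by (simp add: m_def add_divide_distrib)
  qed
  have N: "(norm y)\<^sup>2 = (\<Sum>j\<in>UNIV. (y $ j)\<^sup>2)" for y :: "real ^ 'd" by (simp add: norm_vec_def L2_set_def sum_nonneg)
  have "Re (cdot (cbar z) \<zeta>) = (\<Sum>j\<in>UNIV. fst z $ j * Re (\<zeta> $ j) - snd z $ j * Im (\<zeta> $ j))"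
    by (simp add: cdot_def)
  also have "\<dots> \<le> (\<Sum>j\<in>UNIV. (1/2 + \<delta>/2) * (fst z $ j)\<^sup>2 + (\<delta>/2) * (snd z $ j)\<^sup>2 + (1/2 - \<delta>/4) * (Re (\<zeta> $ j))\<^sup>2 + (1/(2*\<delta>)) * (Im (\<zeta> $ j))\<^sup>2)"
    by (intro sum_mono r)
  also have "\<dots> = (1/2 + \<delta>/2) * (norm (fst z))\<^sup>2 + (\<delta>/2) * (norm (snd z))\<^sup>2 + (1/2 - \<delta>/4) * re_sq \<zeta> + (1/(2*\<delta>)) * im_sq \<zeta>"
    by (simp only: sum.distrib sum_distrib_left[symmetric] N re_sq_def im_sq_def)
  finally have R: "Re (cdot (cbar z) \<zeta>) \<le> (1/2 + \<delta>/2) * (norm (fst z))\<^sup>2 + (\<delta>/2) * (norm (snd z))\<^sup>2 + (1/2 - \<delta>/4) * re_sq \<zeta> + (1/(2*\<delta>)) * im_sq \<zeta>" .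
  have "exp (- (norm (fst z))\<^sup>2 / 2 - \<delta> * (norm z)\<^sup>2) * norm (cexpq (cbar z) \<zeta>)
     = exp (- (norm (fst z))\<^sup>2 / 2 - \<delta> * (norm z)\<^sup>2 + (- (re_sq \<zeta> - im_sq \<zeta>) / 2 + Re (cdot (cbar z) \<zeta>)))"
  proof -
    have "norm (cexpq (cbar z) \<zeta>) = exp (- (re_sq \<zeta> - im_sq \<zeta>) / 2 + Re (cdot (cbar z) \<zeta>))"
      unfolding cexpq_def norm_exp_eq_Re by (simp add: Re_cdot_self[of \<zeta>] divide_simps)
    then show ?thesis by (simp only: exp_add)
  qed
  also have "\<dots> \<le> exp (- (\<delta>/4) * re_sq \<zeta> + (1/2 + 1/(2*\<delta>)) * im_sq \<zeta> - (\<delta>/2) * (norm z)\<^sup>2)"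
    using R unfolding norm_sq_phase[of z] exp_le_cancel_iff by (simp add: algebra_simps diff_divide_distrib)
  finally show ?thesis .
qed

lemma exp_neg_small:
  fixes M e \<delta> :: real
  assumes "0 < e" "0 \<le> M" "0 < \<delta>"
  obtains R where "0 < R" "M * exp (- \<delta> * R\<^sup>2) \<le> e"
proof -
  define R where "R = sqrt ((M / e + 1) / \<delta>)"
  have R: "R > 0" "\<delta> * R\<^sup>2 = M / e + 1" using assms unfolding R_def by (auto simp: add_nonneg_pos)
  have "M / e \<le> exp (\<delta> * R\<^sup>2)" using exp_ge_add_one_self[of "\<delta> * R\<^sup>2"] R(2) by simp
  then have "M * exp (- \<delta> * R\<^sup>2) \<le> e" using assms by (simp add: exp_minus field_simps)
  with R(1) show ?thesis by (rule that)
qed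

text \<open>The coefficients decay just enough to keep all packets in one weighted space with rates
  \<delta>/4 and 1/2 + 1/(2 \<delta>). The approximation is uniform relative to this weight, hence
  in a norm for which elements of the dual are continuous. The tail outside a large ball and the
  Riemann sum inside it each take half of the error.\<close>

lemma superposition_approx:
  fixes c :: "'d::finite phase_space \<Rightarrow> complex"
  assumes d: "0 < \<delta>" "\<delta> \<le> 1" and C: "0 \<le> C" and cm[measurable]: "c \<in> borel_measurable borel"
    and cb: "\<And>z. norm (c z) \<le> C * exp (- (norm (fst z))\<^sup>2 / 2 - \<delta> * (norm z)\<^sup>2)"
  shows "norm (c z * cexpq (cbar z) \<zeta>) \<le> C * exp (- (\<delta>/4) * re_sq \<zeta> + (1/2 + 1/(2*\<delta>)) * im_sq \<zeta>) * exp (- (\<delta>/2) * (norm z)\<^sup>2)"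
    and "integrable lborel (\<lambda>z. c z * cexpq (cbar z) \<zeta>)"
    and "0 < e \<Longrightarrow> \<exists>(n::nat) v \<alpha>. \<forall>\<zeta>. norm ((\<integral>z. c z * cexpq (cbar z) \<zeta> \<partial>lborel) - (\<Sum>i<n. \<alpha> i * cexpq (v i) \<zeta>))
      \<le> e * exp (- (\<delta>/4) * re_sq \<zeta> + (1/2 + 1/(2*\<delta>)) * im_sq \<zeta>)"
proof -
  let ?W = "\<lambda>\<zeta> :: complex ^ 'd. exp (- (\<delta>/4) * re_sq \<zeta> + (1/2 + 1/(2*\<delta>)) * im_sq \<zeta>)"
  show b: "norm (c z * cexpq (cbar z) \<zeta>) \<le> C * ?W \<zeta> * exp (- (\<delta>/2) * (norm z)\<^sup>2)" for z \<zeta>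
  proof -
    have "norm (c z * cexpq (cbar z) \<zeta>) \<le> C * exp (- (norm (fst z))\<^sup>2 / 2 - \<delta> * (norm z)\<^sup>2) * norm (cexpq (cbar z) \<zeta>)"
      unfolding norm_mult by (intro mult_right_mono cb) simp
    also have "\<dots> \<le> C * exp (- (\<delta>/4) * re_sq \<zeta> + (1/2 + 1/(2*\<delta>)) * im_sq \<zeta> - (\<delta>/2) * (norm z)\<^sup>2)"
      using mult_left_mono[OF cexpq_cbar_weighted_bound[OF d, of z \<zeta>] C] by (simp only: mult.assoc)
    also have "\<dots> = C * ?W \<zeta> * exp (- (\<delta>/2) * (norm z)\<^sup>2)"
      by (simp only: diff_conv_add_uminus exp_add mult.assoc mult_minus_left)
    finally show ?thesis .
  qed
  have gm[measurable]: "(\<lambda>z :: 'd phase_space. cexpq (cbar z) \<zeta>) \<in> borel_measurable borel" for \<zeta>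
  proof -
    have e: "(\<lambda>w. cexpq w \<zeta>) = (\<lambda>w. exp (- cdot \<zeta> \<zeta> / 2 + cdot \<zeta> w))" by (rule ext) (simp only: cexpq_def cdot_commute)
    have "entire (\<lambda>w. exp (- cdot \<zeta> \<zeta> / 2 + cdot \<zeta> w))" by (intro entire_exp entire_add entire_const entire_cdot)
    then have [measurable]: "(\<lambda>w. cexpq w \<zeta>) \<in> borel_measurable borel" unfolding e by (rule borel_measurable_entire)
    show ?thesis by measurable
  qed
  have gi: "integrable lborel (\<lambda>z::'d phase_space. k * exp (- s * (norm z)\<^sup>2))" if "0 < s" for k s
    using that by (intro integrable_mult_right integrable_gauss)
  show i: "integrable lborel (\<lambda>z. c z * cexpq (cbar z) \<zeta>)" for \<zeta>
  proof (rule Bochner_Integration.integrable_bound[OF gi])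
    show "AE z in lborel. norm (c z * cexpq (cbar z) \<zeta>) \<le> norm (C * ?W \<zeta> * exp (- (\<delta>/2) * (norm z)\<^sup>2))"
      using b[of _ \<zeta>] by (intro always_eventually allI) (smt (verit) real_norm_def)
  qed (use d in \<open>simp_all, measurable\<close>)
  have ci: "integrable lborel c"
  proof (rule Bochner_Integration.integrable_bound[OF gi])
    show "0 < \<delta>" by (rule d)
    show "AE z in lborel. norm (c z) \<le> norm (C * exp (- \<delta> * (norm z)\<^sup>2))"
    proof (intro always_eventually allI)
      fix z
      have "norm (c z) \<le> C * exp (- \<delta> * (norm z)\<^sup>2)" using cb[of z] by (rule order_trans) (intro mult_left_mono C, simp)
      then show "norm (c z) \<le> norm (C * exp (- \<delta> * (norm z)\<^sup>2))" using C by simp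
    qed
  qed measurable
  assume e: "0 < e"
  define I where "I = (\<integral>z. exp (- (\<delta>/4) * (norm z)\<^sup>2) \<partial>(lborel :: 'd phase_space measure))"
  have I: "0 \<le> I" unfolding I_def by simp
  obtain R where R: "0 < R" "(C * I) * exp (- (\<delta>/4) * R\<^sup>2) \<le> e / 2"
    using exp_neg_small[of "e/2" "C * I" "\<delta>/4"] d e C I by auto
  define K where "K = cball (0 :: 'd phase_space) R"
  have Km[measurable]: "K \<in> sets borel" by (simp add: K_def)
  define J where "J = (\<integral>z. norm (c z) \<partial>lborel)"
  have J: "0 \<le> J" by (simp add: J_def)
  define E where "E = e / (2 * (J + 1))"
  have E: "0 < E" "E * J \<le> e / 2" using e J by (auto simp: E_def field_simps)
  define D where "D = 8 * exp (2 * (R + 1)\<^sup>2)"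
  have D: "0 < D" by (simp add: D_def)
  \<comment> \<open>The mesh is adapted to \<open>D\<close>, which bounds the Lipschitz factor of
    \<open>cexpq_diff_bound\<close> on the ball K; the cap at 1 meets the hypothesis of that
    lemma.\<close>
  define \<eta> where "\<eta> = min 1 (E / D)"
  have \<eta>: "0 < \<eta>" "\<eta> \<le> 1" "\<eta> * D \<le> E" using E D by (auto simp: \<eta>_def min_def field_simps)
  have iK: "integrable lborel (\<lambda>z. indicator K z * (c z * cexpq (cbar z) \<zeta>))" for \<zeta>
  proof -
    have "integrable lborel (\<lambda>z. indicator K z *\<^sub>R (c z * cexpq (cbar z) \<zeta>))" by (intro integrable_mult_indicator i) measurable
    moreover have "indicator K z *\<^sub>R (c z * cexpq (cbar z) \<zeta>) = indicator K z * (c z * cexpq (cbar z) \<zeta>)" for z by (auto split: split_indicator)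
    ultimately show ?thesis by simp
  qed
  have eq: "norm (cexpq (cbar z) \<zeta> - cexpq (cbar v) \<zeta>) \<le> E * ?W \<zeta>" if z: "z \<in> K" "dist v z < \<eta>" for z v \<zeta>
  proof -
    have n: "norm (cbar v - cbar z) = dist v z"
    proof -
      have "cbar v - cbar z = cbar (v - z)" by (simp add: vec_eq_iff complex_eq_iff)
      then show ?thesis by (simp add: dist_norm)
    qed
    have "norm (cexpq (cbar z) \<zeta> - cexpq (cbar v) \<zeta>) \<le> norm (cbar v - cbar z) * (8 * exp (2 * (norm (cbar z) + 1)\<^sup>2)) * exp (- (1/4) * re_sq \<zeta> + (3/4) * im_sq \<zeta>)"
      by (rule cexpq_diff_bound) (use z \<eta> n in auto)
    also have "\<dots> \<le> (\<eta> * D) * ?W \<zeta>"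
    proof (intro mult_mono)
      show "8 * exp (2 * (norm (cbar z) + 1)\<^sup>2) \<le> D" using z(1) by (auto simp: D_def K_def intro!: power_mono)
      have "3/4 \<le> 1/2 + 1/(2*\<delta>)" using d by (simp add: field_simps)
      then show "exp (- (1/4) * re_sq \<zeta> + (3/4) * im_sq \<zeta>) \<le> ?W \<zeta>"
        using d unfolding exp_le_cancel_iff by (intro add_mono mult_right_mono) auto
    qed (use n z D \<eta> in auto)
    also have "\<dots> \<le> E * ?W \<zeta>" using \<eta> by (intro mult_right_mono) auto
    finally show ?thesis .
  qed
  have "compact K" by (simp add: K_def)
  have "\<exists>(n::nat) v \<alpha>. \<forall>\<zeta>. norm ((\<integral>z. indicator K z * (c z * cexpq (cbar z) \<zeta>) \<partial>lborel) - (\<Sum>i<n. \<alpha> i * cexpq (cbar (v i)) \<zeta>)) \<le> E * ?W \<zeta> * J"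
    unfolding J_def
    by (rule integral_finite_combination_approx[where W="?W" and G="\<lambda>z. cexpq (cbar z)", OF ci \<open>compact K\<close> \<eta>(1) less_imp_le[OF E(1)] gm iK _ exp_ge_zero]) (rule eq)
  then obtain n :: nat and v \<alpha> where
    nv: "\<forall>\<zeta>. norm ((\<integral>z. indicator K z * (c z * cexpq (cbar z) \<zeta>) \<partial>lborel) - (\<Sum>i<n. \<alpha> i * cexpq (cbar (v i)) \<zeta>)) \<le> E * ?W \<zeta> * J"
    by (elim exE)
  have "norm ((\<integral>z. c z * cexpq (cbar z) \<zeta> \<partial>lborel) - (\<Sum>i<n. \<alpha> i * cexpq (cbar (v i)) \<zeta>)) \<le> e * ?W \<zeta>" for \<zeta>
  proof -
    let ?f = "\<lambda>z. c z * cexpq (cbar z) \<zeta>"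
    have "norm ((\<integral>z. ?f z \<partial>lborel) - (\<integral>z. indicator K z * ?f z \<partial>lborel)) = norm (\<integral>z. ?f z - indicator K z * ?f z \<partial>lborel)"
      using i iK by simp
    also have "\<dots> \<le> (\<integral>z. (C * ?W \<zeta> * exp (- (\<delta>/4) * R\<^sup>2)) * exp (- (\<delta>/4) * (norm z)\<^sup>2) \<partial>(lborel :: 'd phase_space measure))"
    proof (rule Bochner_Integration.integral_norm_bound_integral)
      show "integrable lborel (\<lambda>z. ?f z - indicator K z * ?f z)" using i iK by auto
      show "integrable lborel (\<lambda>z::'d phase_space. (C * ?W \<zeta> * exp (- (\<delta>/4) * R\<^sup>2)) * exp (- (\<delta>/4) * (norm z)\<^sup>2))" using d by (intro gi) auto
      fix z :: "'d phase_space"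
      show "norm (?f z - indicator K z * ?f z) \<le> (C * ?W \<zeta> * exp (- (\<delta>/4) * R\<^sup>2)) * exp (- (\<delta>/4) * (norm z)\<^sup>2)"
      proof (cases "z \<in> K")
        case True then show ?thesis using C by simp
      next
        case False
        then have "R\<^sup>2 \<le> (norm z)\<^sup>2" using R(1) by (intro power_mono) (auto simp: K_def)
        then have "exp (- (\<delta>/2) * (norm z)\<^sup>2) \<le> exp (- (\<delta>/4) * R\<^sup>2 + - (\<delta>/4) * (norm z)\<^sup>2)"
        proof -
          have "(\<delta>/4) * R\<^sup>2 \<le> (\<delta>/4) * (norm z)\<^sup>2" using d \<open>R\<^sup>2 \<le> (norm z)\<^sup>2\<close> by (intro mult_left_mono) auto
          then show ?thesis unfolding exp_le_cancel_iff by (simp add: field_simps)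
        qed
        then have "C * ?W \<zeta> * exp (- (\<delta>/2) * (norm z)\<^sup>2) \<le> C * ?W \<zeta> * (exp (- (\<delta>/4) * R\<^sup>2) * exp (- (\<delta>/4) * (norm z)\<^sup>2))"
          unfolding exp_add using C by (intro mult_left_mono) auto
        with b[of z \<zeta>] False show ?thesis by (simp add: mult.assoc)
      qed
    qed
    also have "\<dots> = ?W \<zeta> * ((C * I) * exp (- (\<delta>/4) * R\<^sup>2))" by (simp add: I_def)
    also have "\<dots> \<le> ?W \<zeta> * (e / 2)" by (intro mult_left_mono R) simp
    also have "\<dots> = e / 2 * ?W \<zeta>" by (rule mult.commute)
    finally have 1: "norm ((\<integral>z. ?f z \<partial>lborel) - (\<integral>z. indicator K z * ?f z \<partial>lborel)) \<le> e / 2 * ?W \<zeta>" .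
    have "E * ?W \<zeta> * J \<le> e / 2 * ?W \<zeta>" using mult_right_mono[OF E(2), of "?W \<zeta>"] by (simp add: mult_ac)
    with nv[rule_format, of \<zeta>] have 2: "norm ((\<integral>z. indicator K z * ?f z \<partial>lborel) - (\<Sum>i<n. \<alpha> i * cexpq (cbar (v i)) \<zeta>)) \<le> e / 2 * ?W \<zeta>" by linarith
    have "norm ((\<integral>z. ?f z \<partial>lborel) - (\<Sum>i<n. \<alpha> i * cexpq (cbar (v i)) \<zeta>)) \<le> e / 2 * ?W \<zeta> + e / 2 * ?W \<zeta>"
      using norm_triangle_le[OF add_mono[OF 1 2]] by simp
    then show ?thesis by simp
  qed
  then show "\<exists>(n::nat) v \<alpha>. \<forall>\<zeta>. norm ((\<integral>z. c z * cexpq (cbar z) \<zeta> \<partial>lborel) - (\<Sum>i<n. \<alpha> i * cexpq (v i) \<zeta>)) \<le> e * ?W \<zeta>"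
    by (intro exI[of _ n] exI[of _ "\<lambda>i. cbar (v i)"] exI[of _ \<alpha>] allI)
qed

lemma finite_combination_gexp:
  assumes u: "u \<in> GS_dual (1/2)" and u0: "\<And>w. u (gexp w) = 0"
  shows "(\<lambda>y. \<Sum>i<(n::nat). \<alpha> i * gexp (v i) y) \<in> GS (1/2) \<and> u (\<lambda>y. \<Sum>i<n. \<alpha> i * gexp (v i) y) = 0"
proof (induction n)
  case 0
  have "u (\<lambda>x. 0 * gexp (v 0) x + 0 * gexp (v 0) x) = 0 * u (gexp (v 0)) + 0 * u (gexp (v 0))"
    by (intro GS_linearD[OF GS_dualD(1)[OF u]] gexp_in_GS)
  then show ?case by (simp add: zero_in_GS)
next
  case (Suc n)
  have "(\<lambda>y. \<Sum>i<Suc n. \<alpha> i * gexp (v i) y) = (\<lambda>y. 1 * (\<Sum>i<n. \<alpha> i * gexp (v i) y) + \<alpha> n * gexp (v n) y)" by simp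
  with Suc GS_lincomb[of "\<lambda>y. \<Sum>i<n. \<alpha> i * gexp (v i) y" "1/2" "gexp (v n)" 1 "\<alpha> n"]
    GS_linearD[OF GS_dualD(1)[OF u], of "\<lambda>y. \<Sum>i<n. \<alpha> i * gexp (v i) y" "gexp (v n)" 1 "\<alpha> n"] u0[of "v n"]
  show ?case by (simp only: gexp_in_GS simp_thms mult_zero_right add_0_right)
qed

text \<open>The superposition \<open>T\<close> of packets with coefficients from the transform of
  \<psi> is a limit of finite combinations, on which u vanishes, in a norm for which u is
  continuous; so u vanishes on \<open>T\<close>. By the reproducing formula for
  \<open>Wtrans \<psi>\<close>, the transform of \<open>T\<close> is \<kappa> times that of \<psi>,
  and injectivity of the transform identifies \<open>T\<close> with \<kappa> \<psi> on real
  arguments.\<close>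

lemma GS_dual_eq_zero:
  fixes u :: "(real ^ 'd::finite \<Rightarrow> complex) \<Rightarrow> complex"
  assumes u: "u \<in> GS_dual (1/2)" and u0: "\<And>w. u (gexp w) = 0"
  shows "u \<psi> = 0"
proof (cases "\<psi> \<in> GS (1/2)")
  case False then show ?thesis using GS_dualD(3)[OF u] by blast
next
  case psi: True
  obtain h D where hD: "0 < h" "\<psi> \<in> GS_step (1/2) h" "0 < D" "GS_norm (1/2) h \<psi> \<le> ennreal D" by (rule GS_obtain[OF psi])
  obtain Bd where Bd: "\<psi> \<in> borel_measurable borel" "\<And>y. norm (\<psi> y) \<le> Bd" using GS_bounded_measurable[OF psi] by blast
  obtain \<delta>0 C0 where dC: "0 < \<delta>0" "0 < C0" "\<And>w :: complex ^ 'd. norm (Wtrans \<psi> w) \<le> C0 * D * exp (re_sq w / 2 - \<delta>0 * (norm w)\<^sup>2)"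
    using Wtrans_decay[OF hD(1)] hD(2,3,4) by (metis less_imp_le)
  \<comment> \<open>The weighted packet estimate assumes a rate of at most 1.\<close>
  define \<delta> where "\<delta> = min 1 \<delta>0"
  have \<delta>: "0 < \<delta>" "\<delta> \<le> 1" "\<delta> \<le> \<delta>0" using dC by (auto simp: \<delta>_def)
  define C where "C = C0 * D"
  have C: "0 \<le> C" using dC hD by (simp add: C_def)
  define \<kappa> where "\<kappa> = repr_const TYPE('d)"
  have \<kappa>: "0 < \<kappa>" unfolding \<kappa>_def by (rule repr_const_pos)
  have eW: "entire (Wtrans \<psi>)" by (rule entire_Wtrans[OF Bd])
  have [measurable]: "Wtrans \<psi> \<in> borel_measurable borel" "\<psi> \<in> borel_measurable borel" using eW Bd(1) by (auto intro: borel_measurable_entire)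
  define c where "c z = Wtrans \<psi> (cplx z) * of_real (exp (- (norm (fst z))\<^sup>2))" for z
  have [measurable]: "(\<lambda>z::'d phase_space. norm (fst z)) \<in> borel_measurable borel" by (intro borel_measurable_continuous_onI continuous_intros)
  have cm[measurable]: "c \<in> borel_measurable borel" unfolding c_def by measurable
  have cb: "norm (c z) \<le> C * exp (- (norm (fst z))\<^sup>2 / 2 - \<delta> * (norm z)\<^sup>2)" for z
  proof -
    have "norm (c z) \<le> (C * exp ((norm (fst z))\<^sup>2 / 2 - \<delta>0 * (norm z)\<^sup>2)) * exp (- (norm (fst z))\<^sup>2)"
      unfolding c_def norm_mult using dC(3)[of "cplx z"] by (simp add: C_def)
    also have "\<dots> = C * exp (((norm (fst z))\<^sup>2 / 2 - \<delta>0 * (norm z)\<^sup>2) + (- (norm (fst z))\<^sup>2))" by (simp only: exp_add mult.assoc)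
    also have "\<dots> \<le> C * exp (- (norm (fst z))\<^sup>2 / 2 - \<delta> * (norm z)\<^sup>2)"
      using mult_right_mono[OF \<delta>(3), of "(norm z)\<^sup>2"] by (intro mult_left_mono C) simp
    finally show ?thesis .
  qed
  note SA = superposition_approx[OF \<delta>(1,2) C cm cb]
  define T where "T \<zeta> = (\<integral>z. c z * cexpq (cbar z) \<zeta> \<partial>lborel)" for \<zeta>
  let ?W = "\<lambda>\<zeta> :: complex ^ 'd. exp (- (\<delta>/4) * re_sq \<zeta> + (1/2 + 1/(2*\<delta>)) * im_sq \<zeta>)"
  have ab: "0 < \<delta>/4" "0 < 1/2 + 1/(2*\<delta>)" using \<delta> by (auto intro: add_pos_pos)
  have approx: "\<exists>S. entire S \<and> (\<forall>\<zeta>. norm (T \<zeta> - S \<zeta>) \<le> e * ?W \<zeta>) \<and> (\<lambda>y. S (cvec y)) \<in> GS (1/2) \<and> u (\<lambda>y. S (cvec y)) = 0" if e: "0 < e" for e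
  proof -
    obtain n :: nat and v \<alpha> where "\<forall>\<zeta>. norm (T \<zeta> - (\<Sum>i<n. \<alpha> i * cexpq (v i) \<zeta>)) \<le> e * ?W \<zeta>"
      using SA(3)[OF e] unfolding T_def by (elim exE)
    moreover have "entire (\<lambda>\<zeta>. \<Sum>i<n. \<alpha> i * cexpq (v i) \<zeta>)" by (intro entire_sum entire_cmult entire_cexpq)
    ultimately show ?thesis using finite_combination_gexp[OF u u0, of \<alpha> v n] unfolding gexp_def
      by (intro exI[of _ "\<lambda>\<zeta>. \<Sum>i<n. \<alpha> i * cexpq (v i) \<zeta>"] conjI) auto
  qed
  \<comment> \<open>This sequence serves to show that \<open>T\<close> is entire, as a locally
    uniform limit.\<close>
  have "\<forall>n. \<exists>S. entire S \<and> (\<forall>\<zeta>. norm (T \<zeta> - S \<zeta>) \<le> inverse (real (Suc n)) * ?W \<zeta>)"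
  proof
    fix n :: nat
    have "0 < inverse (real (Suc n))" by simp
    from approx[OF this] show "\<exists>S. entire S \<and> (\<forall>\<zeta>. norm (T \<zeta> - S \<zeta>) \<le> inverse (real (Suc n)) * ?W \<zeta>)"
      by (elim exE conjE) (intro exI conjI)
  qed
  from choice[OF this] obtain S where "\<forall>n. entire (S n) \<and> (\<forall>\<zeta>. norm (T \<zeta> - S n \<zeta>) \<le> inverse (real (Suc n)) * ?W \<zeta>)" by (elim exE)
  then have S: "\<And>n. entire (S n)" "\<And>n \<zeta>. norm (T \<zeta> - S n \<zeta>) \<le> inverse (real (Suc n)) * ?W \<zeta>" by simp_all
  have eT: "entire T"
  proof (rule entire_uniform_limit[OF S(1)])
    fix R
    define L where "L = exp ((1/2 + 1/(2*\<delta>)) * R\<^sup>2)"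
    have "(\<lambda>n. inverse (real (Suc n)) * L) \<longlonglongrightarrow> 0 * L" by (intro tendsto_mult tendsto_const LIMSEQ_inverse_real_of_nat)
    then have l: "(\<lambda>n. inverse (real (Suc n)) * L) \<longlonglongrightarrow> 0" by simp
    show "uniform_limit (cball 0 R) S T sequentially"
    proof (rule uniform_limitI)
      fix e :: real assume "0 < e"
      with l have "\<forall>\<^sub>F n in sequentially. inverse (real (Suc n)) * L < e" by (rule order_tendstoD)
      then show "\<forall>\<^sub>F n in sequentially. \<forall>\<zeta>\<in>cball 0 R. dist (S n \<zeta>) (T \<zeta>) < e"
      proof (eventually_elim, intro ballI)
        fix n \<zeta> assume n: "inverse (real (Suc n)) * L < e" and z: "\<zeta> \<in> cball (0 :: complex ^ 'd) R"
        have "im_sq \<zeta> \<le> R\<^sup>2" using norm_sq_re_im[of \<zeta>] z power_mono[of "norm \<zeta>" R 2] re_im_sq_nonneg(1)[of \<zeta>] unfolding mem_cball_0 by (smt (verit) norm_ge_zero)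
        then have "(1/2 + 1/(2*\<delta>)) * im_sq \<zeta> \<le> (1/2 + 1/(2*\<delta>)) * R\<^sup>2" using ab(2) by (intro mult_left_mono) auto
        moreover have "0 \<le> (\<delta>/4) * re_sq \<zeta>" using ab(1) by (intro mult_nonneg_nonneg) auto
        ultimately have "?W \<zeta> \<le> L" unfolding L_def exp_le_cancel_iff by linarith
        then have "inverse (real (Suc n)) * ?W \<zeta> \<le> inverse (real (Suc n)) * L" by (intro mult_left_mono) auto
        with S(2)[of \<zeta> n] n show "dist (S n \<zeta>) (T \<zeta>) < e" unfolding dist_norm norm_minus_commute[of "S n \<zeta>"] by linarith
      qed
    qed
  qed
  define I where "I = (\<integral>z. exp (- (\<delta>/2) * (norm z)\<^sup>2) \<partial>(lborel :: 'd phase_space measure))"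
  have gi: "integrable lborel (\<lambda>z::'d phase_space. k * exp (- (\<delta>/2) * (norm z)\<^sup>2))" for k
    using \<delta> by (intro integrable_mult_right integrable_gauss) simp
  have Tb: "norm (T \<zeta>) \<le> (C * I) * ?W \<zeta>" for \<zeta>
  proof -
    have "norm (T \<zeta>) \<le> (\<integral>z. C * ?W \<zeta> * exp (- (\<delta>/2) * (norm z)\<^sup>2) \<partial>(lborel :: 'd phase_space measure))"
      unfolding T_def by (rule Bochner_Integration.integral_norm_bound_integral[OF SA(2) gi SA(1)])
    then show ?thesis by (simp add: I_def mult_ac)
  qed
  have Ta: "analytic_bound (\<delta>/4) (1/2 + 1/(2*\<delta>)) (C * I) T" using eT Tb by (simp add: analytic_bound_def)
  have TG: "(\<lambda>y. T (cvec y)) \<in> GS (1/2)" by (rule analytic_bound_GS[OF ab Ta])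
  have "\<forall>a>0. \<forall>b>0. \<exists>C>0. \<forall>F M. analytic_bound a b M F \<longrightarrow> norm (u (\<lambda>x. F (cvec x))) \<le> C * M"
    using GS_dual_analytic_functional[OF u] unfolding analytic_functional_def by (rule conjunct2)
  from this[rule_format, OF ab]
  obtain Cu where "0 < Cu" "\<forall>F M. analytic_bound (\<delta>/4) (1/2 + 1/(2*\<delta>)) M F \<longrightarrow> norm (u (\<lambda>x. F (cvec x))) \<le> Cu * M" by (elim exE conjE)
  then have Cu: "0 < Cu" "\<And>F M. analytic_bound (\<delta>/4) (1/2 + 1/(2*\<delta>)) M F \<Longrightarrow> norm (u (\<lambda>x. F (cvec x))) \<le> Cu * M" by auto
  have "norm (u (\<lambda>y. T (cvec y))) \<le> e" if e: "0 < e" for e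
  proof -
    obtain S where S: "entire S" "\<forall>\<zeta>. norm (T \<zeta> - S \<zeta>) \<le> (e / Cu) * ?W \<zeta>" "(\<lambda>y. S (cvec y)) \<in> GS (1/2)" "u (\<lambda>y. S (cvec y)) = 0"
      using approx[of "e / Cu"] e Cu(1) by auto
    have "analytic_bound (\<delta>/4) (1/2 + 1/(2*\<delta>)) (e / Cu) (\<lambda>\<zeta>. T \<zeta> - S \<zeta>)"
      using S(2) entire_diff[OF eT S(1)] by (simp add: analytic_bound_def)
    from Cu(2)[OF this] have "norm (u (\<lambda>y. T (cvec y) - S (cvec y))) \<le> e" using Cu(1) by simp
    moreover have "u (\<lambda>y. 1 * T (cvec y) + (-1) * S (cvec y)) = 1 * u (\<lambda>y. T (cvec y)) + (-1) * u (\<lambda>y. S (cvec y))"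
      by (rule GS_linearD[OF GS_dualD(1)[OF u] TG S(3)])
    ultimately show ?thesis using S(4) by simp
  qed
  then have uT: "u (\<lambda>y. T (cvec y)) = 0" using field_le_epsilon[of "norm (u (\<lambda>y. T (cvec y)))" 0] by simp
  have WT: "Wtrans (\<lambda>y. T (cvec y)) w = of_real \<kappa> * Wtrans \<psi> w" for w
  proof -
    let ?K = "\<lambda>z y. c z * gexp (cbar z) y * gexp w y"
    have Kb: "norm (?K z y) \<le> C * exp (- (\<delta>/2) * (norm z)\<^sup>2) * norm (gexp w y)" for z y
    proof -
      have "exp (- (\<delta>/4) * (norm y)\<^sup>2) \<le> 1" using \<delta> by simp
      then have "C * exp (- (\<delta>/4) * (norm y)\<^sup>2) * exp (- (\<delta>/2) * (norm z)\<^sup>2) \<le> C * 1 * exp (- (\<delta>/2) * (norm z)\<^sup>2)"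
        using C by (intro mult_right_mono mult_left_mono) auto
      with SA(1)[of z "cvec y"] have "norm (c z * gexp (cbar z) y) \<le> C * exp (- (\<delta>/2) * (norm z)\<^sup>2)"
        by (simp add: gexp_def)
      then show ?thesis unfolding norm_mult[of _ "gexp w y"] by (rule mult_right_mono) simp
    qed
    have Km: "(\<lambda>(z, y). ?K z y) \<in> borel_measurable (lborel \<Otimes>\<^sub>M lborel)"
    proof -
      have "continuous_on UNIV (\<lambda>p::'d phase_space \<times> (real^'d). exp (- (\<Sum>i\<in>UNIV. of_real (snd p $ i) * of_real (snd p $ i)) / 2 + (\<Sum>i\<in>UNIV. (cbar (fst p) $ i) * of_real (snd p $ i))) :: complex)"
        by (intro continuous_intros) auto
      then have "(\<lambda>p::'d phase_space \<times> (real^'d). exp (- (\<Sum>i\<in>UNIV. of_real (snd p $ i) * of_real (snd p $ i)) / 2 + (\<Sum>i\<in>UNIV. (cbar (fst p) $ i) * of_real (snd p $ i))) :: complex) \<in> borel_measurable borel"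
        by (rule borel_measurable_continuous_onI)
      moreover have "gexp (cbar (fst p)) (snd p) = exp (- (\<Sum>i\<in>UNIV. of_real (snd p $ i) * of_real (snd p $ i)) / 2 + (\<Sum>i\<in>UNIV. (cbar (fst p) $ i) * of_real (snd p $ i)))" for p :: "'d phase_space \<times> (real^'d)"
        by (simp only: gexp_def cexpq_def cdot_def cvec_nth)
      ultimately have [measurable]: "(\<lambda>p::'d phase_space \<times> (real^'d). gexp (cbar (fst p)) (snd p)) \<in> borel_measurable (borel \<Otimes>\<^sub>M borel)"
        by (simp only: borel_prod)
      have "(\<lambda>p. c (fst p) * gexp (cbar (fst p)) (snd p) * gexp w (snd p)) \<in> borel_measurable (borel \<Otimes>\<^sub>M borel)" by measurable
      then show ?thesis by (simp add: case_prod_beta cong: measurable_cong_sets)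
    qed
    have Ki: "integrable lborel (\<lambda>y. ?K z y)" for z
    proof (rule Bochner_Integration.integrable_bound)
      show "integrable lborel (\<lambda>y. C * exp (- (\<delta>/2) * (norm z)\<^sup>2) * norm (gexp w y))" by (intro integrable_mult_right integral_norm_gexp)
      show "AE y in lborel. norm (?K z y) \<le> norm (C * exp (- (\<delta>/2) * (norm z)\<^sup>2) * norm (gexp w y))"
        using Kb C by (intro always_eventually allI) (simp add: abs_mult)
    qed measurable
    have "integrable (lborel \<Otimes>\<^sub>M lborel) (\<lambda>(z, y). ?K z y)"
    proof (rule lborel_pair.Fubini_integrable[OF Km])
      show "integrable lborel (\<lambda>z. \<integral>y. norm (case (z, y) of (z, y) \<Rightarrow> ?K z y) \<partial>lborel)" unfolding prod.case
      proof (rule Bochner_Integration.integrable_bound[OF gi])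
        have "(\<lambda>(z, y). norm (?K z y)) \<in> borel_measurable (lborel \<Otimes>\<^sub>M lborel)" using Km by (simp add: case_prod_beta)
        then show "(\<lambda>z. \<integral>y. norm (?K z y) \<partial>lborel) \<in> borel_measurable lborel" by (rule lborel.borel_measurable_lebesgue_integral)
        show "AE z in lborel. norm (\<integral>y. norm (?K z y) \<partial>lborel) \<le> norm ((C * (\<integral>y. norm (gexp w y) \<partial>lborel)) * exp (- (\<delta>/2) * (norm z)\<^sup>2))"
        proof (intro always_eventually allI)
          fix z :: "'d phase_space"
          have "(\<integral>y. norm (?K z y) \<partial>lborel) \<le> (\<integral>y. C * exp (- (\<delta>/2) * (norm z)\<^sup>2) * norm (gexp w y) \<partial>lborel)"
            using Kb Ki by (intro integral_mono integrable_mult_right integral_norm_gexp integrable_norm) auto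
          then show "norm (\<integral>y. norm (?K z y) \<partial>lborel) \<le> norm ((C * (\<integral>y. norm (gexp w y) \<partial>lborel)) * exp (- (\<delta>/2) * (norm z)\<^sup>2))"
            using C by (simp add: abs_mult mult_ac)
        qed
      qed
      show "AE z in lborel. integrable lborel (\<lambda>y. case (z, y) of (z, y) \<Rightarrow> ?K z y)" using Ki by simp
    qed
    note F = lborel_pair.Fubini_integral[OF this]
    \<comment> \<open>The kernel is symmetric, so the reproducing formula can be read with the roles
      of w and of the parameter of the packet exchanged.\<close>
    have sym: "Wtrans (gexp (cbar z)) w = Wtrans (gexp w) (cbar z)" for z by (simp add: Wtrans_gexp add.commute)
    have "Wtrans (\<lambda>y. T (cvec y)) w = (\<integral>y. \<integral>z. ?K z y \<partial>lborel \<partial>lborel)"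
      unfolding Wtrans_def T_def gexp_def[of "cbar _"] by simp
    also have "\<dots> = (\<integral>z. \<integral>y. ?K z y \<partial>lborel \<partial>lborel)" by (rule F)
    also have "\<dots> = (\<integral>z. c z * Wtrans (gexp w) (cbar z) \<partial>lborel)"
      unfolding sym[symmetric] by (simp add: Wtrans_def mult.assoc)
    also have "\<dots> = of_real \<kappa> * Wtrans \<psi> w"
    proof -
      \<comment> \<open>The critical bound for transforms of bounded functions is the growth
        hypothesis of the reproducing formula with \<epsilon> = 0.\<close>
      have 0: "0 \<le> Bd" using norm_ge_zero Bd(2) order_trans by blast
      show ?thesis unfolding c_def \<kappa>_def
      proof (rule reproducing(2)[OF eW order_refl])
        show "0 \<le> Bd * gauss_const TYPE('d)" using 0 gauss_const_nonneg by (rule mult_nonneg_nonneg)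
        show "norm (Wtrans \<psi> (cplx z)) \<le> Bd * gauss_const TYPE('d) * exp ((norm (fst z))\<^sup>2 / 2 + 0 * (norm z)\<^sup>2)" for z
          using norm_Wtrans_le[OF Bd, of "cplx z"] by simp
      qed simp
    qed
    finally show ?thesis .
  qed
  obtain BT where BT: "(\<lambda>y. T (cvec y)) \<in> borel_measurable borel" "\<And>y. norm (T (cvec y)) \<le> BT" using GS_bounded_measurable[OF TG] by blast
  have "T (cvec y) - of_real \<kappa> * \<psi> y = 0" for y
  proof (rule Wtrans_injective[where f="\<lambda>y. T (cvec y) - of_real \<kappa> * \<psi> y"])
    have "smooth \<psi>" using hD(2) by (simp add: GS_step_def)
    then have "continuous_on UNIV \<psi>" by (auto dest: smooth_differentiable intro: differentiable_imp_continuous_within continuous_at_imp_continuous_on)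
    moreover have "continuous_on UNIV (\<lambda>y. T (cvec y))"
      using smooth_restrict[OF eT] by (auto dest: smooth_differentiable intro: differentiable_imp_continuous_within continuous_at_imp_continuous_on)
    ultimately show "continuous_on UNIV (\<lambda>y. T (cvec y) - of_real \<kappa> * \<psi> y)" by (intro continuous_intros)
    show "norm (T (cvec y) - of_real \<kappa> * \<psi> y) \<le> BT + \<kappa> * Bd" for y
    proof -
      have "norm (of_real \<kappa> * \<psi> y) \<le> \<kappa> * Bd" unfolding norm_mult using Bd(2)[of y] \<kappa> by simp
      then show ?thesis using norm_triangle_ineq4[of "T (cvec y)" "of_real \<kappa> * \<psi> y"] BT(2)[of y] by linarith
    qed
    show "Wtrans (\<lambda>y. T (cvec y) - of_real \<kappa> * \<psi> y) w = 0" for w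
    proof -
      have "Wtrans (\<lambda>y. T (cvec y) - of_real \<kappa> * \<psi> y) w = (\<integral>y. T (cvec y) * gexp w y - of_real \<kappa> * (\<psi> y * gexp w y) \<partial>lborel)"
        unfolding Wtrans_def by (simp add: algebra_simps)
      also have "\<dots> = Wtrans (\<lambda>y. T (cvec y)) w - of_real \<kappa> * Wtrans \<psi> w"
        unfolding Wtrans_def using integrable_bounded_gexp[OF Bd] integrable_bounded_gexp[OF BT] by simp
      finally show ?thesis by (simp add: WT)
    qed
  qed
  then have "(\<lambda>y. T (cvec y)) = (\<lambda>y. of_real \<kappa> * \<psi> y + 0 * \<psi> y)" by (simp add: fun_eq_iff)
  with uT have "u (\<lambda>y. of_real \<kappa> * \<psi> y + 0 * \<psi> y) = 0" by simp
  then show ?thesis using GS_linearD[OF GS_dualD(1)[OF u] psi psi, of "of_real \<kappa>" 0] \<kappa> by simp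
qed

section \<open>Weighted norms of entire functions\<close>

lemma mixed_quasi_norm_space_valid:
  assumes "mixed_quasi_norm_space B"
  shows "valid_mixed B" "list_sum_set (map fst B) = UNIV" "indep_list (map fst B)"
  using assms direct_sum_decomposition_indep[of "map fst B"]
  by (auto simp: mixed_quasi_norm_space_def valid_mixed_def)

text \<open>A Borel representative agrees with the weight only almost everywhere, but the pointwise
  estimates use a lower bound at every point; the maximum with l restores it without changing the
  almost everywhere class.\<close>

lemma weighted_mixed_norm:
  fixes \<omega> l :: "'a::euclidean_space \<Rightarrow> real"
  assumes B: "mixed_quasi_norm_space B" and \<omega>: "\<omega> \<in> borel_measurable lebesgue"
    and l: "l \<in> borel_measurable borel" "\<And>z. 0 \<le> l z" "\<And>z. l z \<le> \<omega> z"
  obtains \<omega>' where "\<omega>' \<in> borel_measurable borel" "\<And>z. l z \<le> \<omega>' z"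
    "\<And>G. G \<in> borel_measurable borel \<Longrightarrow> mixed_norm B (\<lambda>z. G z * of_real (\<omega> z)) = borel_mixed B (\<lambda>z. ennreal (norm (G z)) * ennreal (\<omega>' z))"
proof -
  note V = mixed_quasi_norm_space_valid[OF B]
  obtain g where g: "g \<in> borel_measurable lborel" "AE x in lborel. \<omega> x = g x"
    using completion_ex_borel_measurable_real[OF \<omega>] by blast
  define \<omega>' where "\<omega>' z = max (l z) (g z)" for z
  have m[measurable]: "\<omega>' \<in> borel_measurable borel" unfolding \<omega>'_def using g(1) l(1) by simp
  obtain c where c: "0 < c" "c < \<infinity>" "lborel = density (sum_lborel (map fst B)) (\<lambda>_. c)"
    using lborel_eq_sum_lborel[OF V(3,2)] by blast
  have "AE x in lborel. \<omega> x = \<omega>' x" using g(2)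
  proof eventually_elim
    case (elim x) then show ?case using l(3)[of x] by (simp add: \<omega>'_def)
  qed
  then have ae: "AE x in sum_lborel (map fst B). \<omega> x = \<omega>' x" unfolding c(3) using c(1) by (subst (asm) AE_density) auto
  show ?thesis
  proof (rule that[OF m])
    show "l z \<le> \<omega>' z" for z by (simp add: \<omega>'_def)
    fix G :: "'a \<Rightarrow> complex" assume [measurable]: "G \<in> borel_measurable borel"
    show "mixed_norm B (\<lambda>z. G z * of_real (\<omega> z)) = borel_mixed B (\<lambda>z. ennreal (norm (G z)) * ennreal (\<omega>' z))"
      unfolding mixed_norm_def
    proof (rule mixed_ennnorm_eq_borel_mixed[OF V(3)])
      show "AE x in sum_lborel (map fst B). ennreal (norm (G x * of_real (\<omega> x))) = ennreal (norm (G x)) * ennreal (\<omega>' x)"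
        using ae
      proof eventually_elim
        case (elim x)
        have "0 \<le> \<omega>' x" using l(2)[of x] by (simp add: \<omega>'_def)
        then show ?case unfolding elim by (simp add: norm_mult ennreal_mult)
      qed
    qed measurable
  qed
qed

lemma weighted_mixed_norm_properties:
  fixes \<omega> :: "'a::euclidean_space \<Rightarrow> real"
  assumes B: "mixed_quasi_norm_space B" and \<omega>: "weight \<omega>"
  shows "G \<in> borel_measurable borel \<Longrightarrow> mixed_norm B (\<lambda>z. (c * G z) * of_real (\<omega> z)) = ennreal (norm c) * mixed_norm B (\<lambda>z. G z * of_real (\<omega> z))"
    and "G \<in> borel_measurable borel \<Longrightarrow> H \<in> borel_measurable borel \<Longrightarrow>
      mixed_norm B (\<lambda>z. (G z + H z) * of_real (\<omega> z)) \<le> ennreal (mixed_const B) * (mixed_norm B (\<lambda>z. G z * of_real (\<omega> z)) + mixed_norm B (\<lambda>z. H z * of_real (\<omega> z)))"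
    and "(\<And>n. S n \<in> borel_measurable borel) \<Longrightarrow> G \<in> borel_measurable borel \<Longrightarrow> (\<And>z. (\<lambda>n. S n z) \<longlonglongrightarrow> G z) \<Longrightarrow>
      mixed_norm B (\<lambda>z. G z * of_real (\<omega> z)) \<le> liminf (\<lambda>n. mixed_norm B (\<lambda>z. S n z * of_real (\<omega> z)))"
proof -
  note V = mixed_quasi_norm_space_valid[OF B]
  have om: "\<omega> \<in> borel_measurable lebesgue" "\<And>z. 0 \<le> \<omega> z" using \<omega> by (auto simp: weight_def intro: less_imp_le)
  \<comment> \<open>The lower bound 0 secures that the Borel representative is nonnegative.\<close>
  from weighted_mixed_norm[where l="\<lambda>_. 0", OF B om(1) borel_measurable_const order_refl om(2)]
  obtain w where w[measurable]: "w \<in> borel_measurable borel" and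
    eq: "\<And>G. G \<in> borel_measurable borel \<Longrightarrow> mixed_norm B (\<lambda>z. G z * of_real (\<omega> z)) = borel_mixed B (\<lambda>z. ennreal (norm (G z)) * ennreal (w z))"
    by blast
  show "mixed_norm B (\<lambda>z. (c * G z) * of_real (\<omega> z)) = ennreal (norm c) * mixed_norm B (\<lambda>z. G z * of_real (\<omega> z))"
    if [measurable]: "G \<in> borel_measurable borel"
  proof -
    have "mixed_norm B (\<lambda>z. (c * G z) * of_real (\<omega> z)) = borel_mixed B (\<lambda>z. ennreal (norm c) * (ennreal (norm (G z)) * ennreal (w z)))"
      by (subst eq) (auto simp: norm_mult ennreal_mult mult.assoc)
    also have "\<dots> = ennreal (norm c) * borel_mixed B (\<lambda>z. ennreal (norm (G z)) * ennreal (w z))"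
      by (rule borel_mixed_cmult[OF V(1)]) auto
    finally show ?thesis by (simp only: eq[OF that])
  qed
  show "mixed_norm B (\<lambda>z. (G z + H z) * of_real (\<omega> z)) \<le> ennreal (mixed_const B) * (mixed_norm B (\<lambda>z. G z * of_real (\<omega> z)) + mixed_norm B (\<lambda>z. H z * of_real (\<omega> z)))"
    if G[measurable]: "G \<in> borel_measurable borel" and H[measurable]: "H \<in> borel_measurable borel"
  proof -
    have "mixed_norm B (\<lambda>z. (G z + H z) * of_real (\<omega> z)) = borel_mixed B (\<lambda>z. ennreal (norm (G z + H z)) * ennreal (w z))"
      by (subst eq) auto
    also have "\<dots> \<le> borel_mixed B (\<lambda>z. ennreal (norm (G z)) * ennreal (w z) + ennreal (norm (H z)) * ennreal (w z))"
      unfolding distrib_right[symmetric]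
      by (intro borel_mixed_mono[OF V(1)] mult_right_mono) (auto simp: ennreal_plus[symmetric] norm_triangle_ineq simp del: ennreal_plus)
    also have "\<dots> \<le> ennreal (mixed_const B) * (borel_mixed B (\<lambda>z. ennreal (norm (G z)) * ennreal (w z)) + borel_mixed B (\<lambda>z. ennreal (norm (H z)) * ennreal (w z)))"
      by (rule borel_mixed_triangle[OF V(1)]) auto
    finally show ?thesis by (simp only: eq[OF G] eq[OF H])
  qed
  show "mixed_norm B (\<lambda>z. G z * of_real (\<omega> z)) \<le> liminf (\<lambda>n. mixed_norm B (\<lambda>z. S n z * of_real (\<omega> z)))"
    if S[measurable]: "\<And>n. S n \<in> borel_measurable borel" and G[measurable]: "G \<in> borel_measurable borel" and lim: "\<And>z. (\<lambda>n. S n z) \<longlonglongrightarrow> G z"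
  proof -
    have "ennreal (norm (G z)) * ennreal (w z) = liminf (\<lambda>n. ennreal (norm (S n z)) * ennreal (w z))" for z
    proof (rule lim_imp_Liminf[symmetric])
      have "(\<lambda>n. ennreal (norm (S n z))) \<longlonglongrightarrow> ennreal (norm (G z))" by (intro tendsto_ennrealI tendsto_norm lim)
      then show "(\<lambda>n. ennreal (norm (S n z)) * ennreal (w z)) \<longlonglongrightarrow> ennreal (norm (G z)) * ennreal (w z)"
        by (rule tendsto_mult_ennreal) (auto simp: zero_less_iff_neq_zero)
    qed simp
    then have "mixed_norm B (\<lambda>z. G z * of_real (\<omega> z)) = borel_mixed B (\<lambda>z. liminf (\<lambda>n. ennreal (norm (S n z)) * ennreal (w z)))"
      by (simp only: eq[OF G])
    also have "\<dots> \<le> liminf (\<lambda>n. borel_mixed B (\<lambda>z. ennreal (norm (S n z)) * ennreal (w z)))"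
      by (rule borel_mixed_Fatou[OF V(1)]) measurable
    finally show ?thesis by (simp only: eq[OF S])
  qed
qed

section \<open>From norms to pointwise bounds\<close>

lemma B_transform_eq:
  "B_transform F z = of_real ((2 * pi) powr (- real CARD('d) / 2)) *
     of_real (exp (- (norm z)\<^sup>2 / 4)) * exp (- (\<i> * of_real (fst z \<bullet> snd z) / 2)) *
     F (of_real (1 / sqrt 2) *s cplx z)" for F :: "complex ^ 'd::finite \<Rightarrow> complex"
proof -
  have "(\<chi> j. Complex (fst z $ j / sqrt 2) (- (snd z $ j) / sqrt 2)) = of_real (1 / sqrt 2) *s cplx z"
    by (simp add: vec_eq_iff complex_eq_iff)
  then show ?thesis by (simp add: B_transform_def case_prod_beta norm_sq_phase)
qed

lemma norm_B_transform:
  "norm (B_transform F z) = (2 * pi) powr (- real CARD('d) / 2) * exp (- (norm z)\<^sup>2 / 4) * norm (F (of_real (1 / sqrt 2) *s cplx z))"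
  for F :: "complex ^ 'd::finite \<Rightarrow> complex"
proof -
  have "norm (exp (- (\<i> * of_real (fst z \<bullet> snd z) / 2))) = 1" by (simp add: norm_exp_eq_Re)
  then show ?thesis unfolding B_transform_eq norm_mult by simp
qed

lemma B_transform_add: "B_transform (\<lambda>w. F w + G w) z = B_transform F z + B_transform G z"
  and B_transform_cmult: "B_transform (\<lambda>w. c * F w) z = c * B_transform F z"
  and B_transform_diff: "B_transform (\<lambda>w. F w - G w) z = B_transform F z - B_transform G z"
  by (simp_all add: B_transform_eq algebra_simps)

lemma B_transform_measurable [measurable]:
  fixes F :: "complex ^ 'd::finite \<Rightarrow> complex"
  assumes "entire F" shows "B_transform F \<in> borel_measurable borel"
proof (rule borel_measurable_continuous_onI)
  have e: "entire (\<lambda>z. F (0 + of_real (1 / sqrt 2) *s z))" by (rule entire_affine[OF assms])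
  have "continuous_on UNIV (\<lambda>z::'d phase_space. F (0 + of_real (1 / sqrt 2) *s cplx z))"
    by (rule continuous_on_compose2[OF entire_continuous[OF e, of UNIV]]) (auto intro: continuous_intros)
  then show "continuous_on UNIV (B_transform F)" unfolding B_transform_eq[abs_def]
    by (intro continuous_intros) auto
qed

text \<open>The sub-mean value property bounds a value of F by a local integral of |F|^r, the local
  embedding bounds this by the quasi-norm of a translate, and translation invariance removes the
  dependence on the point. Gaussian factors are paid only at distance at most 1, which gives the
  explicit exponential; its dependence on c matters for the surjectivity of the Bargmann
  transform.\<close>

lemma B_transform_pointwise_bound:
  fixes B :: "'d::finite phase_space mixed_space" and \<omega> :: "'d phase_space \<Rightarrow> real"
  assumes B: "mixed_quasi_norm_space B" and \<omega>: "weight \<omega>" and c: "0 < c" "0 < C0" "gaussian_bounds c C0 \<omega>"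
  shows "\<exists>C>0. \<forall>F z0. entire F \<longrightarrow> ennreal (norm (B_transform F z0)) \<le>
     ennreal (C * exp (- (norm z0)\<^sup>2 / 4 + (1/4 + c) * (norm z0 + 1)\<^sup>2)) * B_norm \<omega> B F"
proof -
  note V = mixed_quasi_norm_space_valid[OF B]
  \<comment> \<open>Inserting 1 gives a nonempty set and r \<le> 1, as the sub-mean value property
    requires.\<close>
  define P where "P = insert 1 (set (map snd B))"
  have P: "finite P" "P \<noteq> {}" "\<forall>p\<in>P. 0 < p" using B by (auto simp: P_def mixed_quasi_norm_space_def)
  define r where "r = enn2real (Min P)"
  have M1: "Min P \<le> 1" using P by (intro Min_le) (auto simp: P_def)
  have M0: "0 < Min P" using P by simp
  have er: "ennreal r = Min P" using M1 unfolding r_def by (intro ennreal_enn2real) (auto simp: less_top[symmetric] top_unique)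
  have r0: "0 < r" using M0 unfolding er[symmetric] by simp
  have r1: "r \<le> 1" using M1 unfolding er[symmetric] by simp
  have rp: "\<forall>p\<in>set (map snd B). ennreal r \<le> p" unfolding er using P by (auto simp: P_def)
  define l where "l z = inverse C0 * exp (- c * (norm z)\<^sup>2)" for z :: "'d phase_space"
  have lm: "l \<in> borel_measurable borel" unfolding l_def by measurable
  have l0: "0 \<le> l z" for z using c by (simp add: l_def)
  have lw: "l z \<le> \<omega> z" for z unfolding l_def using c(3) unfolding gaussian_bounds_def by blast
  have "\<omega> \<in> borel_measurable lebesgue" using \<omega> by (simp add: weight_def)
  from weighted_mixed_norm[OF B this lm l0 lw]
  obtain w where w[measurable]: "w \<in> borel_measurable borel" and wl: "\<And>z. l z \<le> w z" and
    eq: "\<And>G. G \<in> borel_measurable borel \<Longrightarrow> mixed_norm B (\<lambda>z. G z * of_real (\<omega> z)) = borel_mixed B (\<lambda>z. ennreal (norm (G z)) * ennreal (w z))"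
    by blast
  define k where "k = (2 * pi) powr (- real CARD('d) / 2)"
  have k: "0 < k" by (simp add: k_def)
  obtain C1 where C1: "0 < C1" "\<And>(F :: complex ^ 'd \<Rightarrow> complex) a. entire F \<Longrightarrow>
     ennreal (norm (F a) powr r) \<le> ennreal C1 * (\<integral>\<^sup>+ z. indicator (ball 0 1) z * ennreal (norm (F (a + cplx z)) powr r) \<partial>lborel)"
    using power_sub_mean_value[OF r0 r1, where 'd = 'd] by blast
  obtain cs where cs: "0 < cs" "cs < \<infinity>" "lborel = density (sum_lborel (map fst B)) (\<lambda>_. cs)"
    using lborel_eq_sum_lborel[OF V(3,2)] by blast
  obtain C2 where C2: "C2 < \<infinity>" "\<And>f. f\<in>borel_measurable borel \<Longrightarrow>
    (\<integral>\<^sup>+x. indicator (ball 0 1) x * epowr (f x) r \<partial>sum_lborel (map fst B)) \<le> C2 * epowr (borel_mixed B f) r"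
    using borel_mixed_local[OF V(1) r0 rp bounded_ball, of 0 1] by auto
  define Q where "Q = ennreal C1 * (cs * C2)"
  have Q: "Q < top" using cs(2) C2(1) by (simp add: Q_def ennreal_mult_less_top)
  \<comment> \<open>The constant is written as an r-th power, so that the root can be taken at the
    end by monotonicity of \<open>epowr\<close>.\<close>
  define Q' where "Q' = enn2real (epowr Q (1 / r))"
  have Q': "epowr (ennreal Q') r = Q"
  proof -
    have "epowr Q (1 / r) < top" using Q by (simp add: less_top[symmetric])
    then have "ennreal Q' = epowr Q (1 / r)" by (simp add: Q'_def)
    then show ?thesis using r0 by (simp add: epowr_inverse)
  qed
  have Q'0: "0 \<le> Q'" by (simp add: Q'_def)
  show ?thesis
  proof (intro exI[of _ "Q' * C0 + 1"] conjI allI impI)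
    show "0 < Q' * C0 + 1" using Q'0 c by (simp add: add_nonneg_pos)
    fix F :: "complex ^ 'd \<Rightarrow> complex" and z0 :: "'d phase_space" assume F: "entire F"
    define F1 where "F1 w = F (0 + of_real (1 / sqrt 2) *s w)" for w
    have F1: "entire F1" unfolding F1_def[abs_def] by (rule entire_affine[OF F])
    have nB: "norm (B_transform F z) = k * exp (- (norm z)\<^sup>2 / 4) * norm (F1 (cplx z))" for z
      by (simp add: norm_B_transform F1_def k_def)
    have [measurable]: "B_transform F \<in> borel_measurable borel" by (rule B_transform_measurable[OF F])
    define f where "f z = ennreal (norm (B_transform F z)) * ennreal (w z)" for z
    have fm[measurable]: "f \<in> borel_measurable borel" unfolding f_def by measurable
    have N: "B_norm \<omega> B F = borel_mixed B f" unfolding B_norm_def f_def by (rule eq) measurable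
    \<comment> \<open>\<open>A\<close> collects the largest loss over the unit ball about z0: the
      inverse Gaussian of \<open>B_transform\<close> and the inverse of the lower bound l.\<close>
    define A where "A = C0 * exp ((1/4 + c) * (norm z0 + 1)\<^sup>2) / k"
    have A0: "0 \<le> A" using c k by (simp add: A_def)
    have loc: "ennreal (norm (F1 (cplx (z + z0)))) \<le> ennreal A * f (z + z0)" if z: "z \<in> ball 0 1" for z
    proof -
      let ?y = "z + z0"
      have ny: "norm ?y \<le> norm z0 + 1" using norm_triangle_ineq[of z z0] z by simp
      have "norm (F1 (cplx ?y)) = norm (B_transform F ?y) * (exp ((norm ?y)\<^sup>2 / 4) / k)"
        using k by (simp add: nB exp_minus field_simps)
      also have "exp ((norm ?y)\<^sup>2 / 4) / k = (C0 * exp ((1/4 + c) * (norm ?y)\<^sup>2) / k) * l ?y"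
      proof -
        have "exp ((1/4 + c) * (norm ?y)\<^sup>2) = exp ((norm ?y)\<^sup>2 / 4) * exp (c * (norm ?y)\<^sup>2)"
          by (simp add: exp_add[symmetric] distrib_right)
        then show ?thesis using c k by (simp add: l_def exp_minus field_simps)
      qed
      also have "\<dots> \<le> A * w ?y"
        unfolding A_def
      proof (intro mult_mono wl divide_right_mono mult_left_mono)
        show "exp ((1/4 + c) * (norm ?y)\<^sup>2) \<le> exp ((1/4 + c) * (norm z0 + 1)\<^sup>2)"
          using ny c by (simp add: power_mono mult_left_mono)
      qed (use c k l0 in auto)
      finally have "norm (F1 (cplx ?y)) \<le> norm (B_transform F ?y) * (A * w ?y)" by (simp add: mult_left_mono)
      then have "ennreal (norm (F1 (cplx ?y))) \<le> ennreal (norm (B_transform F ?y) * (A * w ?y))" by (rule ennreal_leI)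
      also have "\<dots> = ennreal A * f ?y"
        using A0 order_trans[OF l0 wl] by (simp add: f_def ennreal_mult mult_ac)
      finally show ?thesis .
    qed
    have "(\<lambda>z. z + z0) \<in> borel_measurable borel" by (intro borel_measurable_continuous_onI continuous_intros)
    then have fz: "(\<lambda>z. f (z + z0)) \<in> borel_measurable borel" using fm by (rule measurable_compose)
    have gm: "(\<lambda>z. indicator (ball 0 1) z * epowr (ennreal A * f (z + z0)) r) \<in> borel_measurable borel"
      by (intro borel_measurable_times_ennreal borel_measurable_epowr borel_measurable_indicator borel_measurable_const fz) simp
    have "epowr (ennreal (norm (F1 (cplx z0)))) r = ennreal (norm (F1 (cplx z0)) powr r)" by (simp add: epowr_ennreal)
    also have "\<dots> \<le> ennreal C1 * (\<integral>\<^sup>+ z. indicator (ball 0 1) z * ennreal (norm (F1 (cplx z0 + cplx z)) powr r) \<partial>lborel)"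
      by (rule C1(2)[OF F1])
    also have "\<dots> \<le> ennreal C1 * (\<integral>\<^sup>+ z. indicator (ball 0 1) z * epowr (ennreal A * f (z + z0)) r \<partial>lborel)"
    proof (rule mult_left_mono, rule nn_integral_mono)
      fix z :: "'d phase_space"
      show "indicator (ball 0 1) z * ennreal (norm (F1 (cplx z0 + cplx z)) powr r) \<le> indicator (ball 0 1) z * epowr (ennreal A * f (z + z0)) r"
      proof (cases "z \<in> ball 0 1")
        case True
        have "ennreal (norm (F1 (cplx z0 + cplx z)) powr r) = epowr (ennreal (norm (F1 (cplx (z + z0))))) r"
          by (simp add: epowr_ennreal cplx_add add.commute)
        also have "\<dots> \<le> epowr (ennreal A * f (z + z0)) r" by (intro epowr_mono r0 loc True)
        finally show ?thesis by (intro mult_left_mono) auto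
      qed simp
    qed simp
    also have "(\<integral>\<^sup>+ z. indicator (ball 0 1) z * epowr (ennreal A * f (z + z0)) r \<partial>lborel)
       = cs * (\<integral>\<^sup>+ z. indicator (ball 0 1) z * epowr (ennreal A * f (z + z0)) r \<partial>sum_lborel (map fst B))"
      unfolding cs(3) using gm by (simp add: nn_integral_density nn_integral_cmult)
    also have "ennreal C1 * \<dots> \<le> ennreal C1 * (cs * (C2 * epowr (borel_mixed B (\<lambda>z. ennreal A * f (z + z0))) r))"
      by (intro mult_left_mono C2(2) borel_measurable_times_ennreal borel_measurable_const fz) auto
    also have "borel_mixed B (\<lambda>z. ennreal A * f (z + z0)) = ennreal A * borel_mixed B f"
      using fz by (simp add: borel_mixed_cmult[OF V(1)] borel_mixed_translate[OF V(1) fm] V(2))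
    also have "ennreal C1 * (cs * (C2 * epowr (ennreal A * borel_mixed B f) r)) = epowr (ennreal Q' * (ennreal A * borel_mixed B f)) r"
      unfolding epowr_mult[OF r0, of "ennreal Q'"] Q' by (simp add: Q_def mult.assoc)
    finally have key: "ennreal (norm (F1 (cplx z0))) \<le> ennreal Q' * (ennreal A * borel_mixed B f)"
      by (simp add: epowr_mono_iff[OF r0])
    have "ennreal (norm (B_transform F z0)) = ennreal (k * exp (- (norm z0)\<^sup>2 / 4)) * ennreal (norm (F1 (cplx z0)))"
      using k by (simp add: nB ennreal_mult)
    also have "\<dots> \<le> ennreal (k * exp (- (norm z0)\<^sup>2 / 4)) * (ennreal Q' * (ennreal A * borel_mixed B f))"
      by (intro mult_left_mono key) simp
    also have "\<dots> = ennreal (k * exp (- (norm z0)\<^sup>2 / 4) * Q' * A) * borel_mixed B f"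
      using k Q'0 A0 by (simp add: ennreal_mult mult.assoc)
    also have "k * exp (- (norm z0)\<^sup>2 / 4) * Q' * A = Q' * C0 * exp (- (norm z0)\<^sup>2 / 4 + (1/4 + c) * (norm z0 + 1)\<^sup>2)"
      unfolding exp_add A_def using k by simp
    also have "ennreal \<dots> * borel_mixed B f \<le> ennreal ((Q' * C0 + 1) * exp (- (norm z0)\<^sup>2 / 4 + (1/4 + c) * (norm z0 + 1)\<^sup>2)) * borel_mixed B f"
      by (intro mult_right_mono ennreal_leI) (auto simp: distrib_right)
    finally show "ennreal (norm (B_transform F z0)) \<le> ennreal ((Q' * C0 + 1) * exp (- (norm z0)\<^sup>2 / 4 + (1/4 + c) * (norm z0 + 1)\<^sup>2)) * B_norm \<omega> B F"
      unfolding N .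
  qed
qed

lemma entire_local_bound:
  fixes B :: "'d::finite phase_space mixed_space" and \<omega> :: "'d phase_space \<Rightarrow> real"
  assumes B: "mixed_quasi_norm_space B" and \<omega>: "weight \<omega>" and c: "0 < c" "0 < C0" "gaussian_bounds c C0 \<omega>"
  shows "\<exists>M\<ge>0. \<forall>F \<zeta>. entire F \<longrightarrow> norm \<zeta> \<le> R \<longrightarrow> ennreal (norm (F \<zeta>)) \<le> ennreal M * B_norm \<omega> B F"
proof -
  obtain C where C: "0 < C" "\<And>F z0. entire F \<Longrightarrow> ennreal (norm (B_transform F z0)) \<le>
     ennreal (C * exp (- (norm z0)\<^sup>2 / 4 + (1/4 + c) * (norm z0 + 1)\<^sup>2)) * B_norm \<omega> B F"
    using B_transform_pointwise_bound[OF assms] by blast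
  define k where "k = (2 * pi) powr (- real CARD('d) / 2)"
  have k: "0 < k" by (simp add: k_def)
  define M where "M = C / k * exp ((1/4 + c) * (sqrt 2 * R + 1)\<^sup>2)"
  have "ennreal (norm (F \<zeta>)) \<le> ennreal M * B_norm \<omega> B F" if F: "entire F" and z: "norm \<zeta> \<le> R" for F \<zeta>
  proof -
    obtain z0 where z0: "cplx z0 = of_real (sqrt 2) *s \<zeta>" using surj_cplx by blast
    have n: "norm z0 = sqrt 2 * norm \<zeta>" using arg_cong[OF z0, of norm] by (simp add: norm_vector_smult)
    have F1: "of_real (1 / sqrt 2) *s cplx z0 = \<zeta>" unfolding z0 by (simp add: vec_eq_iff)
    have nF: "norm (F \<zeta>) = exp ((norm z0)\<^sup>2 / 4) / k * norm (B_transform F z0)"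
      using k unfolding norm_B_transform F1 k_def[symmetric] by (simp add: exp_minus field_simps)
    have "ennreal (norm (F \<zeta>)) = ennreal (exp ((norm z0)\<^sup>2 / 4) / k) * ennreal (norm (B_transform F z0))"
      using k unfolding nF by (intro ennreal_mult) auto
    also have "\<dots> \<le> ennreal (exp ((norm z0)\<^sup>2 / 4) / k) *
      (ennreal (C * exp (- (norm z0)\<^sup>2 / 4 + (1/4 + c) * (norm z0 + 1)\<^sup>2)) * B_norm \<omega> B F)"
      by (intro mult_left_mono C(2) F) simp
    also have "\<dots> = ennreal (exp ((norm z0)\<^sup>2 / 4) / k * (C * exp (- (norm z0)\<^sup>2 / 4 + (1/4 + c) * (norm z0 + 1)\<^sup>2))) * B_norm \<omega> B F"
      by (subst mult.assoc[symmetric], subst ennreal_mult[symmetric]) (use k C(1) in auto)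
    also have "exp ((norm z0)\<^sup>2 / 4) / k * (C * exp (- (norm z0)\<^sup>2 / 4 + (1/4 + c) * (norm z0 + 1)\<^sup>2))
       = C / k * (exp ((norm z0)\<^sup>2 / 4) * exp (- (norm z0)\<^sup>2 / 4)) * exp ((1/4 + c) * (norm z0 + 1)\<^sup>2)"
      by (simp only: exp_add times_divide_eq_left times_divide_eq_right mult_ac)
    also have "exp ((norm z0)\<^sup>2 / 4) * exp (- (norm z0)\<^sup>2 / 4) = 1" by (simp add: exp_add[symmetric])
    also have "ennreal (C / k * 1 * exp ((1/4 + c) * (norm z0 + 1)\<^sup>2)) * B_norm \<omega> B F \<le> ennreal M * B_norm \<omega> B F"
    proof (intro mult_right_mono ennreal_leI)
      have "norm z0 + 1 \<le> sqrt 2 * R + 1" using n z by simp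
      then have "(1/4 + c) * (norm z0 + 1)\<^sup>2 \<le> (1/4 + c) * (sqrt 2 * R + 1)\<^sup>2"
        using c by (intro mult_left_mono power_mono) auto
      then show "C / k * 1 * exp ((1/4 + c) * (norm z0 + 1)\<^sup>2) \<le> M"
        unfolding M_def using C(1) k by (simp add: divide_right_mono)
    qed simp
    finally show ?thesis .
  qed
  moreover have "0 \<le> M" using C(1) k by (simp add: M_def)
  ultimately show ?thesis by blast
qed

lemma B_norm_complete:
  fixes B :: "'d::finite phase_space mixed_space" and \<omega> :: "'d phase_space \<Rightarrow> real"
  assumes B: "mixed_quasi_norm_space B" and \<omega>: "weight \<omega>" and c: "0 < c" "0 < C0" "gaussian_bounds c C0 \<omega>"
    and S: "\<And>n. entire (S n)"
    and Cauchy: "\<And>e. 0 < e \<Longrightarrow> \<exists>n0::nat. \<forall>m\<ge>n0. \<forall>n\<ge>n0. B_norm \<omega> B (\<lambda>w. S m w - S n w) < e"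
  shows "\<exists>F. entire F \<and> (\<lambda>n. B_norm \<omega> B (\<lambda>w. S n w - F w)) \<longlonglongrightarrow> 0"
proof -
  define F where "F \<zeta> = lim (\<lambda>n. S n \<zeta>)" for \<zeta>
  have ul: "uniform_limit (cball 0 R) S F sequentially" for R
  proof -
    obtain M where M: "0 \<le> M" "\<And>F \<zeta>. entire F \<Longrightarrow> norm \<zeta> \<le> R \<Longrightarrow> ennreal (norm (F \<zeta>)) \<le> ennreal M * B_norm \<omega> B F"
      using entire_local_bound[OF B \<omega> c, of R] by blast
    have "uniformly_convergent_on (cball 0 R) S"
    proof (rule Cauchy_uniformly_convergent)
      show "uniformly_Cauchy_on (cball 0 R) S" unfolding uniformly_Cauchy_on_def
      proof (intro allI impI)
        fix e :: real assume e: "0 < e"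
        have "0 < ennreal (e / (M + 1))" using e M(1) by simp
        from Cauchy[OF this] obtain n0 where n0: "\<forall>m\<ge>n0. \<forall>n\<ge>n0. B_norm \<omega> B (\<lambda>w. S m w - S n w) < ennreal (e / (M + 1))" by blast
        have "dist (S m \<zeta>) (S n \<zeta>) < e" if "\<zeta> \<in> cball 0 R" "m \<ge> n0" "n \<ge> n0" for \<zeta> m n
        proof -
          have "ennreal (norm (S m \<zeta> - S n \<zeta>)) \<le> ennreal M * B_norm \<omega> B (\<lambda>w. S m w - S n w)"
            using that(1) by (intro M(2) entire_diff S) simp
          also have "\<dots> \<le> ennreal M * ennreal (e / (M + 1))" using n0 that(2,3) by (intro mult_left_mono[OF less_imp_le]) auto
          also have "\<dots> = ennreal (M * (e / (M + 1)))" using M(1) e by (intro ennreal_mult[symmetric]) auto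
          finally have "norm (S m \<zeta> - S n \<zeta>) \<le> M * (e / (M + 1))" using M(1) e by (simp add: ennreal_le_iff)
          also have "\<dots> < e" using M(1) e by (simp add: field_simps)
          finally show ?thesis by (simp add: dist_norm)
        qed
        then show "\<exists>N. \<forall>x\<in>cball 0 R. \<forall>m\<ge>N. \<forall>n\<ge>N. dist (S m x) (S n x) < e" by blast
      qed
    qed
    then show ?thesis unfolding uniformly_convergent_uniform_limit_iff F_def .
  qed
  have F: "entire F" by (rule entire_uniform_limit[OF S ul])
  have lim: "(\<lambda>n. S n \<zeta>) \<longlonglongrightarrow> F \<zeta>" for \<zeta>
    using tendsto_uniform_limitI[OF ul[of "norm \<zeta>"], of \<zeta>] by simp
  have le: "\<forall>\<^sub>F n in sequentially. B_norm \<omega> B (\<lambda>w. S n w - F w) \<le> e" if e: "0 < e" for e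
  proof -
    obtain n0 where n0: "\<forall>m\<ge>n0. \<forall>n\<ge>n0. B_norm \<omega> B (\<lambda>w. S m w - S n w) < e" using Cauchy[OF e] by blast
    have "B_norm \<omega> B (\<lambda>w. S n w - F w) \<le> e" if n: "n \<ge> n0" for n
    proof -
      \<comment> \<open>For fixed n the limit is taken in m, where the Cauchy bound holds for all
        large m.\<close>
      have "B_norm \<omega> B (\<lambda>w. S n w - F w) \<le> liminf (\<lambda>m. B_norm \<omega> B (\<lambda>w. S n w - S m w))"
        unfolding B_norm_def
      proof (rule weighted_mixed_norm_properties(3)[OF B \<omega>])
        show "B_transform (\<lambda>w. S n w - S m w) \<in> borel_measurable borel" for m by (intro B_transform_measurable entire_diff S)
        show "B_transform (\<lambda>w. S n w - F w) \<in> borel_measurable borel" by (intro B_transform_measurable entire_diff S F)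
        show "(\<lambda>m. B_transform (\<lambda>w. S n w - S m w) z) \<longlonglongrightarrow> B_transform (\<lambda>w. S n w - F w) z" for z
          unfolding B_transform_eq by (intro tendsto_intros lim)
      qed
      also have "\<dots> \<le> e"
      proof (rule Liminf_le)
        show "\<forall>\<^sub>F m in sequentially. B_norm \<omega> B (\<lambda>w. S n w - S m w) \<le> e"
          using n0 n by (intro eventually_sequentiallyI[of n0] less_imp_le) auto
      qed simp
      finally show ?thesis .
    qed
    then show ?thesis by (rule eventually_sequentiallyI)
  qed
  have "(\<lambda>n. B_norm \<omega> B (\<lambda>w. S n w - F w)) \<longlonglongrightarrow> 0"
  proof (rule order_tendstoI)
    fix a :: ennreal assume "0 < a"
    then obtain e where e: "0 < e" "e < a" using dense by blast
    show "\<forall>\<^sub>F n in sequentially. B_norm \<omega> B (\<lambda>w. S n w - F w) < a"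
      using le[OF e(1)] by eventually_elim (rule le_less_trans[OF _ e(2)])
  qed simp
  with F show ?thesis by blast
qed

lemma B_norm_entire:
  fixes B :: "'d::finite phase_space mixed_space" and \<omega> :: "'d phase_space \<Rightarrow> real"
  assumes B: "mixed_quasi_norm_space B" and \<omega>: "weight \<omega>" and c: "0 < c" "0 < C0" "gaussian_bounds c C0 \<omega>"
    and F: "entire F"
  shows "B_norm \<omega> B (\<lambda>w. a * F w) = ennreal (norm a) * B_norm \<omega> B F"
    and "entire G \<Longrightarrow> B_norm \<omega> B (\<lambda>w. F w + G w) \<le> ennreal (mixed_const B) * (B_norm \<omega> B F + B_norm \<omega> B G)"
    and "B_norm \<omega> B F = 0 \<longleftrightarrow> F = (\<lambda>w. 0)"
proof -
  show sc: "B_norm \<omega> B (\<lambda>w. a * F w) = ennreal (norm a) * B_norm \<omega> B F" for a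
    unfolding B_norm_def B_transform_cmult by (rule weighted_mixed_norm_properties(1)[OF B \<omega> B_transform_measurable[OF F]])
  show "B_norm \<omega> B (\<lambda>w. F w + G w) \<le> ennreal (mixed_const B) * (B_norm \<omega> B F + B_norm \<omega> B G)" if G: "entire G"
    unfolding B_norm_def B_transform_add by (rule weighted_mixed_norm_properties(2)[OF B \<omega> B_transform_measurable[OF F] B_transform_measurable[OF G]])
  show "B_norm \<omega> B F = 0 \<longleftrightarrow> F = (\<lambda>w. 0)"
  proof
    assume N: "B_norm \<omega> B F = 0"
    have "F \<zeta> = 0" for \<zeta>
    proof -
      obtain M where "ennreal (norm (F \<zeta>)) \<le> ennreal M * B_norm \<omega> B F"
        using entire_local_bound[OF B \<omega> c, of "norm \<zeta>"] F by blast
      then show ?thesis by (simp add: N)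
    qed
    then show "F = (\<lambda>w. 0)" by (simp add: fun_eq_iff)
  next
    assume "F = (\<lambda>w. 0)"
    then have "(\<lambda>w. 0 * F w) = F" by (simp add: fun_eq_iff)
    with sc[of 0] show "B_norm \<omega> B F = 0" by simp
  qed
qed

section \<open>Completeness transported from entire functions\<close>

text \<open>A common frame for the two kinds of spaces: \<Phi> is the identity for the entire
  functions and the Bargmann transform for the modulation spaces. Surjectivity is asked only onto
  functions of finite norm, because the limit of a Cauchy sequence is of this kind.\<close>

lemma entire_isometry_space:
  fixes B :: "'d::finite phase_space mixed_space" and \<omega> :: "'d phase_space \<Rightarrow> real"
    and D :: "('x \<Rightarrow> complex) set" and \<Phi> :: "('x \<Rightarrow> complex) \<Rightarrow> complex ^ 'd \<Rightarrow> complex"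
  assumes B: "mixed_quasi_norm_space B" and \<omega>: "weight \<omega>" and c: "0 < c" "0 < C0" "gaussian_bounds c C0 \<omega>"
    and D: "complex_function_space D"
    and add: "\<And>u v. u \<in> D \<Longrightarrow> v \<in> D \<Longrightarrow> \<Phi> (\<lambda>x. u x + v x) = (\<lambda>w. \<Phi> u w + \<Phi> v w)"
    and cmult: "\<And>a u. u \<in> D \<Longrightarrow> \<Phi> (\<lambda>x. a * u x) = (\<lambda>w. a * \<Phi> u w)"
    and ent: "\<And>u. u \<in> D \<Longrightarrow> entire (\<Phi> u)"
    and inj: "\<And>u. u \<in> D \<Longrightarrow> \<Phi> u = (\<lambda>w. 0) \<Longrightarrow> u = (\<lambda>x. 0)"
    and surj: "\<And>F. entire F \<Longrightarrow> B_norm \<omega> B F < top \<Longrightarrow> \<exists>u\<in>D. \<Phi> u = F"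
    and N: "\<And>u. u \<in> D \<Longrightarrow> N u = B_norm \<omega> B (\<Phi> u)"
  shows "complex_function_space {u \<in> D. N u < top}"
    and "quasi_norm_on (mixed_const B) {u \<in> D. N u < top} N"
    and "complete_wrt {u \<in> D. N u < top} N"
proof -
  have D0: "(\<lambda>x. 0) \<in> D" and Dadd: "\<And>f g. f \<in> D \<Longrightarrow> g \<in> D \<Longrightarrow> (\<lambda>x. f x + g x) \<in> D" and Dc: "\<And>a f. f \<in> D \<Longrightarrow> (\<lambda>x. a * f x) \<in> D"
    using D by (auto simp: complex_function_space_def)
  have Dd: "(\<lambda>x. f x - g x) \<in> D \<and> \<Phi> (\<lambda>x. f x - g x) = (\<lambda>w. \<Phi> f w - \<Phi> g w)" if "f \<in> D" "g \<in> D" for f g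
    using Dadd[OF that(1) Dc[OF that(2), of "-1"]] add[OF that(1) Dc[OF that(2), of "-1"]] cmult[OF that(2), of "-1"] by simp
  note BN = B_norm_entire[OF B \<omega> c]
  have \<Phi>0: "\<Phi> (\<lambda>x. 0) = (\<lambda>w. 0)" using cmult[OF D0, of 0] by simp
  have N0: "N (\<lambda>x. 0) = 0" unfolding N[OF D0] using BN(3)[OF ent[OF D0]] \<Phi>0 by blast
  have Nc: "N (\<lambda>x. a * f x) = ennreal (norm a) * N f" if f: "f \<in> D" for a f
    unfolding N[OF f] N[OF Dc[OF f]] cmult[OF f] by (rule BN(1)[OF ent[OF f]])
  have Na: "N (\<lambda>x. f x + g x) \<le> ennreal (mixed_const B) * (N f + N g)" if f: "f \<in> D" and g: "g \<in> D" for f g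
    unfolding N[OF f] N[OF g] N[OF Dadd[OF f g]] add[OF f g] by (rule BN(2)[OF ent[OF f] ent[OF g]])
  show "complex_function_space {u \<in> D. N u < top}" unfolding complex_function_space_def
  proof (intro conjI ballI allI)
    show "(\<lambda>x. 0) \<in> {u \<in> D. N u < top}" using D0 N0 by simp
    fix f assume f: "f \<in> {u \<in> D. N u < top}"
    { fix g assume g: "g \<in> {u \<in> D. N u < top}"
      then have "N (\<lambda>x. f x + g x) < top" using f
        by (intro le_less_trans[OF Na]) (auto simp: ennreal_mult_less_top)
      then show "(\<lambda>x. f x + g x) \<in> {u \<in> D. N u < top}" using f g Dadd by auto }
    show "(\<lambda>x. a * f x) \<in> {u \<in> D. N u < top}" for a using f Dc by (auto simp: Nc ennreal_mult_less_top)
  qed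
  show "quasi_norm_on (mixed_const B) {u \<in> D. N u < top} N" unfolding quasi_norm_on_def
  proof (intro conjI ballI allI)
    fix f assume f: "f \<in> {u \<in> D. N u < top}"
    show "N f < top" using f by simp
    show "N f = 0 \<longleftrightarrow> f = (\<lambda>x. 0)"
      using f N[of f] BN(3)[of "\<Phi> f"] ent[of f] inj[of f] N0 by auto
  qed (use Nc Na in auto)
  show "complete_wrt {u \<in> D. N u < top} N" unfolding complete_wrt_def
  proof (intro allI impI, elim conjE)
    fix u :: "nat \<Rightarrow> 'x \<Rightarrow> complex"
    assume u: "\<forall>n. u n \<in> {u \<in> D. N u < top}" and C: "\<forall>e>0. \<exists>n0. \<forall>m\<ge>n0. \<forall>n\<ge>n0. N (\<lambda>x. u m x - u n x) < e"
    have uD: "u n \<in> D" and uN: "N (u n) < top" for n using u by auto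
    have Nd: "N (\<lambda>x. f x - g x) = B_norm \<omega> B (\<lambda>w. \<Phi> f w - \<Phi> g w)" if "f \<in> D" "g \<in> D" for f g
      using Dd[OF that] N by metis
    have "\<exists>F. entire F \<and> (\<lambda>n. B_norm \<omega> B (\<lambda>w. \<Phi> (u n) w - F w)) \<longlonglongrightarrow> 0"
      by (rule B_norm_complete[OF B \<omega> c ent[OF uD]]) (use C Nd[OF uD uD] in simp)
    then obtain F where F: "entire F" and lim: "(\<lambda>n. B_norm \<omega> B (\<lambda>w. \<Phi> (u n) w - F w)) \<longlonglongrightarrow> 0" by blast
    have "\<forall>\<^sub>F n in sequentially. B_norm \<omega> B (\<lambda>w. \<Phi> (u n) w - F w) < 1" using lim by (rule order_tendstoD) simp
    \<comment> \<open>The limit has finite norm because it is at distance less than 1 from one of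
      the terms; surjectivity then provides its preimage.\<close>
    then obtain n where n: "B_norm \<omega> B (\<lambda>w. \<Phi> (u n) w - F w) < 1" by (auto simp: eventually_sequentially)
    have d: "entire (\<lambda>w. \<Phi> (u n) w - F w)" by (intro entire_diff ent uD F)
    have d': "entire (\<lambda>w. (-1) * (\<Phi> (u n) w - F w))" by (intro entire_cmult d)
    have "B_norm \<omega> B F = B_norm \<omega> B (\<lambda>w. \<Phi> (u n) w + (-1) * (\<Phi> (u n) w - F w))" by simp
    also have "\<dots> \<le> ennreal (mixed_const B) * (B_norm \<omega> B (\<Phi> (u n)) + B_norm \<omega> B (\<lambda>w. (-1) * (\<Phi> (u n) w - F w)))"
      by (rule BN(2)[OF ent[OF uD] d'])
    also have "B_norm \<omega> B (\<lambda>w. (-1) * (\<Phi> (u n) w - F w)) = B_norm \<omega> B (\<lambda>w. \<Phi> (u n) w - F w)"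
      unfolding BN(1)[OF d, of "-1"] by simp
    also have "ennreal (mixed_const B) * (B_norm \<omega> B (\<Phi> (u n)) + B_norm \<omega> B (\<lambda>w. \<Phi> (u n) w - F w)) < top"
      using uN[of n] order_less_trans[OF n, of top] by (simp add: N[OF uD] ennreal_mult_less_top)
    finally have "B_norm \<omega> B F < top" .
    then obtain v where v: "v \<in> D" "\<Phi> v = F" using surj[OF F] by blast
    with \<open>B_norm \<omega> B F < top\<close> have "v \<in> {u \<in> D. N u < top}" by (simp add: N)
    moreover have "(\<lambda>n. N (\<lambda>x. u n x - v x)) \<longlonglongrightarrow> 0" using lim by (simp add: Nd[OF uD v(1)] v(2))
    ultimately show "\<exists>f\<in>{u \<in> D. N u < top}. (\<lambda>n. N (\<lambda>x. u n x - f x)) \<longlonglongrightarrow> 0" by blast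
  qed
qed

section \<open>The Bargmann transform\<close>

text \<open>The constant and the Gaussian factor are those of the classical Bargmann transform; with
  them \<open>B_transform (Bargmann u)\<close> is the short-time Fourier transform itself, phase
  factor included.\<close>

definition Bargmann :: "((real ^ 'd::finite \<Rightarrow> complex) \<Rightarrow> complex) \<Rightarrow> complex ^ 'd \<Rightarrow> complex" where
  "Bargmann u \<zeta> = of_real (pi powr (- real CARD('d) / 4)) * exp (- cdot \<zeta> \<zeta> / 2) * u (gexp (of_real (sqrt 2) *s \<zeta>))"

lemma entire_Bargmann:
  fixes u :: "(real ^ 'd::finite \<Rightarrow> complex) \<Rightarrow> complex"
  assumes "u \<in> GS_dual (1/2)" shows "entire (Bargmann u)"
proof -
  have "entire (\<lambda>w. u (gexp w))" by (rule analytic_functional_entire[OF GS_dual_analytic_functional[OF assms]])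
  from entire_affine[OF this, of 0 "of_real (sqrt 2)"] have "entire (\<lambda>\<zeta>. u (gexp (of_real (sqrt 2) *s \<zeta>)))" by simp
  then have "entire (\<lambda>\<zeta>. (of_real (pi powr (- real CARD('d) / 4)) * exp ((- (1/2)) * cdot \<zeta> \<zeta>)) * u (gexp (of_real (sqrt 2) *s \<zeta>)))"
    by (intro entire_mult entire_cmult entire_exp entire_cdot_self entire_const)
  then show ?thesis unfolding Bargmann_def[abs_def] by simp
qed

lemma cdot_smult: "cdot (a *s w) (b *s z) = a * b * cdot w z"
  by (simp add: cdot_def sum_distrib_left mult_ac)

lemma cdot_cplx: "cdot (cplx z) (cplx z) = of_real ((norm (fst z))\<^sup>2 - (norm (snd z))\<^sup>2) - 2 * \<i> * of_real (fst z \<bullet> snd z)"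
proof -
  have "cdot (cplx z) (cplx z) = (\<Sum>j\<in>UNIV. of_real ((fst z $ j)\<^sup>2 - (snd z $ j)\<^sup>2) - 2 * \<i> * of_real (fst z $ j * snd z $ j))"
    unfolding cdot_def by (intro sum.cong refl) (simp add: complex_eq_iff power2_eq_square)
  also have "\<dots> = of_real (\<Sum>j\<in>UNIV. (fst z $ j)\<^sup>2 - (snd z $ j)\<^sup>2) - 2 * \<i> * of_real (\<Sum>j\<in>UNIV. fst z $ j * snd z $ j)"
    by (simp only: sum_subtractf of_real_sum of_real_diff sum_distrib_left)
  finally show ?thesis by (simp add: norm_vec_def L2_set_def sum_nonneg sum_subtractf inner_vec_def)
qed

lemma stft_eq_gexp:
  fixes u :: "(real ^ 'd::finite \<Rightarrow> complex) \<Rightarrow> complex"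
  assumes u: "u \<in> GS_dual (1/2)"
  shows "stft u z = of_real ((2 * pi) powr (- real CARD('d) / 2)) * of_real (pi powr (- real CARD('d) / 4) * exp (- (norm (fst z))\<^sup>2 / 2)) * u (gexp (cplx z))"
proof -
  let ?c = "of_real (pi powr (- real CARD('d) / 4) * exp (- (norm (fst z))\<^sup>2 / 2)) :: complex"
  have "of_real (gauss (y - fst z)) * exp (- (\<i> * of_real (y \<bullet> snd z))) = ?c * gexp (cplx z) y + 0 * gexp (cplx z) y" for y
  proof -
    have c1: "cdot (cplx z) (cvec y) = of_real (fst z \<bullet> y) - \<i> * of_real (y \<bullet> snd z)"
    proof -
      have "cdot (cplx z) (cvec y) = (\<Sum>j\<in>UNIV. of_real (fst z $ j * y $ j) - \<i> * of_real (y $ j * snd z $ j))"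
        unfolding cdot_def by (intro sum.cong refl) (simp add: complex_eq_iff)
      also have "\<dots> = of_real (\<Sum>j\<in>UNIV. fst z $ j * y $ j) - \<i> * of_real (\<Sum>j\<in>UNIV. y $ j * snd z $ j)"
        by (simp only: sum_subtractf of_real_sum sum_distrib_left)
      finally show ?thesis by (simp add: inner_vec_def)
    qed
    have c2: "cdot (cvec y) (cvec y) = of_real ((norm y)\<^sup>2)"
      by (simp add: cdot_def norm_vec_def L2_set_def sum_nonneg power2_eq_square)
    have n: "(norm (y - fst z))\<^sup>2 = (norm y)\<^sup>2 + (norm (fst z))\<^sup>2 - 2 * (fst z \<bullet> y)"
      by (simp add: power2_norm_eq_inner inner_diff inner_commute algebra_simps)
    have "of_real (exp (- (norm (y - fst z))\<^sup>2 / 2)) * exp (- (\<i> * of_real (y \<bullet> snd z)))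
        = exp (of_real (- (norm (fst z))\<^sup>2 / 2) + (of_real (- (norm y)\<^sup>2 / 2) + (of_real (fst z \<bullet> y) - \<i> * of_real (y \<bullet> snd z))))"
    proof -
      have "of_real (- ((norm y)\<^sup>2 + (norm (fst z))\<^sup>2 - 2 * (fst z \<bullet> y)) / 2) + - (\<i> * of_real (y \<bullet> snd z))
          = of_real (- (norm (fst z))\<^sup>2 / 2) + (of_real (- (norm y)\<^sup>2 / 2) + (of_real (fst z \<bullet> y) - \<i> * of_real (y \<bullet> snd z)))"
        by (simp add: complex_eq_iff field_simps)
      then show ?thesis unfolding n exp_of_real[symmetric] exp_add[symmetric] by (rule arg_cong)
    qed
    also have "\<dots> = of_real (exp (- (norm (fst z))\<^sup>2 / 2)) * gexp (cplx z) y"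
      unfolding exp_add[of "of_real (- (norm (fst z))\<^sup>2 / 2)"] gexp_def cexpq_def c1 c2 by (simp add: exp_of_real[symmetric] del: exp_of_real)
    finally show ?thesis by (simp add: gauss_def mult.assoc)
  qed
  then have "stft u z = of_real ((2 * pi) powr (- real CARD('d) / 2)) * u (\<lambda>y. ?c * gexp (cplx z) y + 0 * gexp (cplx z) y)"
    by (simp only: stft_def case_prod_beta)
  also have "u (\<lambda>y. ?c * gexp (cplx z) y + 0 * gexp (cplx z) y) = ?c * u (gexp (cplx z)) + 0 * u (gexp (cplx z))"
    by (rule GS_linearD[OF GS_dualD(1)[OF u] gexp_in_GS gexp_in_GS])
  finally show ?thesis by (simp add: mult.assoc)
qed

text \<open>The exponents of \<open>B_transform\<close> and of the Gaussian factor add up to - |x|^2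
  / 2, and the phases cancel. Stated for an arbitrary H, it serves both the short-time Fourier
  transform and the construction in \<open>Bargmann_surj\<close>.\<close>

lemma B_transform_gaussian:
  fixes H :: "complex ^ 'd::finite \<Rightarrow> complex"
  assumes "F (of_real (1 / sqrt 2) *s cplx z) = of_real (pi powr (- real CARD('d) / 4)) * exp (- cdot (cplx z) (cplx z) / 4) * H (cplx z)"
  shows "B_transform F z = of_real ((2 * pi) powr (- real CARD('d) / 2)) * of_real (pi powr (- real CARD('d) / 4) * exp (- (norm (fst z))\<^sup>2 / 2)) * H (cplx z)"
proof -
  have "of_real (exp (- (norm z)\<^sup>2 / 4)) * exp (- (\<i> * of_real (fst z \<bullet> snd z) / 2)) * exp (- cdot (cplx z) (cplx z) / 4)
      = of_real (exp (- (norm (fst z))\<^sup>2 / 2))"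
  proof -
    have "of_real (- (norm z)\<^sup>2 / 4) + (- (\<i> * of_real (fst z \<bullet> snd z) / 2)) + (- cdot (cplx z) (cplx z) / 4) = of_real (- (norm (fst z))\<^sup>2 / 2)"
      unfolding norm_sq_phase[of z] cdot_cplx by (simp add: field_simps)
    then show ?thesis unfolding exp_of_real[symmetric] exp_add[symmetric] by (simp only:)
  qed
  then show ?thesis unfolding B_transform_eq assms by (simp add: mult_ac)
qed

lemma stft_eq_B_transform:
  fixes u :: "(real ^ 'd::finite \<Rightarrow> complex) \<Rightarrow> complex"
  assumes u: "u \<in> GS_dual (1/2)" shows "stft u = B_transform (Bargmann u)"
proof
  fix z :: "'d phase_space"
  have s: "of_real (sqrt 2) *s (of_real (1 / sqrt 2) *s w) = w" for w :: "complex ^ 'd" by (simp add: vec_eq_iff)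
  show "stft u z = B_transform (Bargmann u) z" unfolding stft_eq_gexp[OF u]
  proof (rule B_transform_gaussian[symmetric])
    have "of_real (1 / sqrt 2) * of_real (1 / sqrt 2) = (1 / 2 :: complex)"
      by (simp only: of_real_mult[symmetric]) (simp add: complex_eq_iff)
    then show "Bargmann u (of_real (1 / sqrt 2) *s cplx z) = of_real (pi powr (- real CARD('d) / 4)) * exp (- cdot (cplx z) (cplx z) / 4) * u (gexp (cplx z))"
      unfolding Bargmann_def s cdot_smult by simp
  qed
qed

text \<open>Solving the definition of the Bargmann transform for \<open>u (gexp w)\<close> forces
  the function \<open>H\<close>; the Gaussian bounds on the weight with c = \<epsilon>/2, for every
  \<epsilon>, give \<open>H\<close> the growth for which \<open>repr_functional\<close> is
  continuous.\<close>

lemma Bargmann_surj: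
  fixes B :: "'d::finite phase_space mixed_space" and \<omega> :: "'d phase_space \<Rightarrow> real"
  assumes B: "mixed_quasi_norm_space B" and \<omega>: "\<omega> \<in> P_Q0" and F: "entire F" and N: "B_norm \<omega> B F < top"
  shows "\<exists>u\<in>GS_dual (1/2). Bargmann u = F"
proof -
  define p where "p = pi powr (- real CARD('d) / 4)"
  have p: "0 < p" by (simp add: p_def)
  define H where "H w = of_real (1 / p) * exp (cdot w w / 4) * F (of_real (1 / sqrt 2) *s w)" for w
  have eH: "entire H"
  proof -
    have "entire (\<lambda>w. of_real (1 / p) * exp ((1/4) * cdot w w) * F (0 + of_real (1 / sqrt 2) *s w))"
      by (intro entire_mult entire_exp entire_cmult entire_cdot_self entire_const entire_affine F)
    then show ?thesis unfolding H_def[abs_def] by simp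
  qed
  have BH: "B_transform F z = of_real ((2 * pi) powr (- real CARD('d) / 2)) * of_real (p * exp (- (norm (fst z))\<^sup>2 / 2)) * H (cplx z)" for z
  proof -
    have "F (of_real (1 / sqrt 2) *s cplx z) = of_real p * exp (- cdot (cplx z) (cplx z) / 4) * H (cplx z)"
      using p by (simp add: H_def exp_minus field_simps)
    then show ?thesis unfolding p_def by (rule B_transform_gaussian)
  qed
  define k where "k = (2 * pi) powr (- real CARD('d) / 2) * p"
  have k: "0 < k" using p by (simp add: k_def)
  have nH: "norm (H (cplx z)) = norm (B_transform F z) / k * exp ((norm (fst z))\<^sup>2 / 2)" for z
  proof -
    have "norm (B_transform F z) = k * exp (- (norm (fst z))\<^sup>2 / 2) * norm (H (cplx z))"
      unfolding BH norm_mult norm_of_real k_def using p by (simp only: abs_mult abs_exp_cancel abs_of_pos powr_ge_zero abs_of_nonneg mult.assoc)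
    then show ?thesis using k by (simp add: exp_minus field_simps)
  qed
  obtain n where n: "B_norm \<omega> B F = ennreal n" "0 \<le> n" using N by (cases "B_norm \<omega> B F") auto
  have gr: "gelfand_shilov_growth H" unfolding gelfand_shilov_growth_def
  proof (intro conjI allI impI eH)
    fix \<epsilon> :: real assume e: "0 < \<epsilon>"
    define c where "c = \<epsilon> / 2"
    have c: "0 < c" using e by (simp add: c_def)
    obtain C0 where C0: "0 < C0" "gaussian_bounds c C0 \<omega>" using \<omega> c by (auto simp: P_Q0_def)
    have w: "weight \<omega>" using \<omega> by (simp add: P_Q0_def P_Q_def)
    obtain C where C: "0 < C" "\<And>z0. ennreal (norm (B_transform F z0)) \<le>
       ennreal (C * exp (- (norm z0)\<^sup>2 / 4 + (1/4 + c) * (norm z0 + 1)\<^sup>2)) * B_norm \<omega> B F"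
      using B_transform_pointwise_bound[OF B w c C0] F by blast
    \<comment> \<open>The unit shift in the pointwise bound creates a linear term 2 b t; it is
      absorbed by a further c t^2, so the final rate is 2 c = \<epsilon>.\<close>
    define b where "b = 1/4 + c"
    have "- t\<^sup>2 / 4 + (1/4 + c) * (t + 1)\<^sup>2 \<le> \<epsilon> * t\<^sup>2 + (b + b\<^sup>2 / c)" for t :: real
    proof -
      have "0 \<le> (c * t - b)\<^sup>2 / c" using c by simp
      also have "(c * t - b)\<^sup>2 / c = c * t\<^sup>2 - 2 * b * t + b\<^sup>2 / c" using c by (simp add: power2_eq_square field_simps)
      finally show ?thesis by (simp add: b_def[symmetric] power2_sum) (simp add: b_def c_def algebra_simps)
    qed
    note ex = this
    have "norm (H (cplx z)) \<le> (C * n / k * exp (b + b\<^sup>2 / c)) * exp ((norm (fst z))\<^sup>2 / 2 + \<epsilon> * (norm z)\<^sup>2)" for z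
    proof -
      have "ennreal (norm (B_transform F z)) \<le> ennreal (C * exp (- (norm z)\<^sup>2 / 4 + (1/4 + c) * (norm z + 1)\<^sup>2) * n)"
        using C(2)[of z] C(1) n by (simp add: ennreal_mult)
      then have "norm (B_transform F z) \<le> C * exp (- (norm z)\<^sup>2 / 4 + (1/4 + c) * (norm z + 1)\<^sup>2) * n"
        using C(1) n by (simp add: ennreal_le_iff)
      also have "\<dots> \<le> C * exp (\<epsilon> * (norm z)\<^sup>2 + (b + b\<^sup>2 / c)) * n"
        using ex[of "norm z"] C(1) n by (intro mult_right_mono mult_left_mono) auto
      finally have "norm (H (cplx z)) \<le> C * exp (\<epsilon> * (norm z)\<^sup>2 + (b + b\<^sup>2 / c)) * n / k * exp ((norm (fst z))\<^sup>2 / 2)"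
        unfolding nH using k by (intro mult_right_mono divide_right_mono) auto
      also have "\<dots> = (C * n / k * exp (b + b\<^sup>2 / c)) * exp ((norm (fst z))\<^sup>2 / 2 + \<epsilon> * (norm z)\<^sup>2)"
        unfolding exp_add by simp
      finally show ?thesis .
    qed
    moreover have "0 \<le> C * n / k * exp (b + b\<^sup>2 / c)" using C(1) n k by simp
    ultimately show "\<exists>C\<ge>0. \<forall>z. norm (H (cplx z)) \<le> C * exp ((norm (fst z))\<^sup>2 / 2 + \<epsilon> * (norm z)\<^sup>2)" by blast
  qed
  have s: "of_real (1 / sqrt 2) *s (of_real (sqrt 2) *s w) = w" for w :: "complex ^ 'd" by (simp add: vec_eq_iff)
  have s2: "of_real (sqrt 2) * of_real (sqrt 2) = (2 :: complex)" by (simp only: of_real_mult[symmetric]) simp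
  have "Bargmann (repr_functional H) = F"
  proof
    fix \<zeta>
    have "Bargmann (repr_functional H) \<zeta> = of_real p * exp (- cdot \<zeta> \<zeta> / 2) * (of_real (1 / p) * exp (cdot \<zeta> \<zeta> / 2) * F \<zeta>)"
      unfolding Bargmann_def repr_functional(2)[OF gr] H_def s cdot_smult s2 p_def[symmetric] by simp
    also have "\<dots> = F \<zeta>" using p by (simp add: exp_minus field_simps)
    finally show "Bargmann (repr_functional H) \<zeta> = F \<zeta>" .
  qed
  then show ?thesis using repr_functional(1)[OF gr] by blast
qed

section \<open>Assembling the two kinds of spaces\<close>

lemma zero_in_GS_dual: "(\<lambda>f :: real ^ 'd::finite \<Rightarrow> complex. 0) \<in> GS_dual s"
  by (rule GS_dualI) (auto simp: GS_linear_def GS_bounded_def intro: exI[of _ 1])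

lemma complex_function_space_GS_dual: "complex_function_space (GS_dual s :: ((real ^ 'd::finite \<Rightarrow> complex) \<Rightarrow> complex) set)"
  unfolding complex_function_space_def
proof (intro conjI ballI allI)
  show "(\<lambda>f :: real ^ 'd \<Rightarrow> complex. 0) \<in> GS_dual s" by (rule zero_in_GS_dual)
  fix u :: "(real ^ 'd \<Rightarrow> complex) \<Rightarrow> complex" assume u: "u \<in> GS_dual s"
  { fix v :: "(real ^ 'd \<Rightarrow> complex) \<Rightarrow> complex" assume v: "v \<in> GS_dual s"
    show "(\<lambda>f. u f + v f) \<in> GS_dual s" using u v unfolding GS_dual_def
      by (auto intro!: continuous_map_add simp: algebra_simps) }
  fix c
  have "continuous_map euclidean euclidean (\<lambda>t::complex. c * t)" by (simp add: continuous_intros)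
  then have "continuous_map (GS_topology s) euclidean (\<lambda>f. c * u f)"
    using u continuous_map_compose[of "GS_topology s" euclidean u euclidean "\<lambda>t. c * t"] by (simp add: GS_dual_def o_def)
  then show "(\<lambda>f. c * u f) \<in> GS_dual s" using u unfolding GS_dual_def by (auto simp: algebra_simps)
qed

lemma mixed_const_eq_1:
  assumes "1 \<le> nu1 B" shows "mixed_const B = 1"
proof -
  have "Lp_const p = 1" if "p \<in> set (map snd B)" for p
  proof -
    have "nu1 B \<le> p" using that unfolding nu1_def by (intro Min_le) auto
    then show ?thesis using assms order_trans by (auto simp: Lp_const_def)
  qed
  then have "map (Lp_const \<circ> snd) B = replicate (length B) 1" by (intro nth_equalityI) auto
  then show ?thesis by (simp add: mixed_const_def prod_list_replicate)
qed

lemma A_space_complete: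
  fixes B :: "'d::finite phase_space mixed_space"
  assumes B: "mixed_quasi_norm_space B" and \<omega>: "\<omega> \<in> P_Q"
  shows "complex_function_space (A_space \<omega> B)" "quasi_norm_on (mixed_const B) (A_space \<omega> B) (B_norm \<omega> B)"
    "complete_wrt (A_space \<omega> B) (B_norm \<omega> B)"
proof -
  have w: "weight \<omega>" using \<omega> by (simp add: P_Q_def)
  obtain c C where c: "0 < c" "0 < C" "gaussian_bounds c C \<omega>" using \<omega> unfolding P_Q_def by blast
  have D: "complex_function_space {F :: complex ^ 'd \<Rightarrow> complex. entire F}" unfolding complex_function_space_def by auto
  have A: "A_space \<omega> B = {F \<in> {F. entire F}. B_norm \<omega> B F < top}" by (auto simp: A_space_def)
  show "complex_function_space (A_space \<omega> B)" unfolding A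
    by (rule entire_isometry_space(1)[OF B w c D, where \<Phi>="\<lambda>F. F"]) auto
  show "quasi_norm_on (mixed_const B) (A_space \<omega> B) (B_norm \<omega> B)" unfolding A
    by (rule entire_isometry_space(2)[OF B w c D, where \<Phi>="\<lambda>F. F"]) auto
  show "complete_wrt (A_space \<omega> B) (B_norm \<omega> B)" unfolding A
    by (rule entire_isometry_space(3)[OF B w c D, where \<Phi>="\<lambda>F. F"]) auto
qed

lemma M_space_complete:
  fixes B :: "'d::finite phase_space mixed_space"
  assumes B: "mixed_quasi_norm_space B" and \<omega>: "\<omega> \<in> P_Q0"
  shows "complex_function_space (M_space \<omega> B)" "quasi_norm_on (mixed_const B) (M_space \<omega> B) (M_norm \<omega> B)"
    "complete_wrt (M_space \<omega> B) (M_norm \<omega> B)"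
proof -
  have w: "weight \<omega>" using \<omega> by (simp add: P_Q0_def P_Q_def)
  \<comment> \<open>For the local estimates any one rate will do; the freedom of the rate in
    \<open>P_Q0\<close> is used in \<open>Bargmann_surj\<close>.\<close>
  have "(0::real) < 1" by simp
  then obtain C where C: "0 < C" "gaussian_bounds 1 C \<omega>" using \<omega> unfolding P_Q0_def by blast
  have add: "Bargmann (\<lambda>f. u f + v f) = (\<lambda>\<zeta>. Bargmann u \<zeta> + Bargmann v \<zeta>)" for u v :: "(real ^ 'd \<Rightarrow> complex) \<Rightarrow> complex"
    by (simp add: Bargmann_def fun_eq_iff algebra_simps)
  have cmult: "Bargmann (\<lambda>f. a * u f) = (\<lambda>\<zeta>. a * Bargmann u \<zeta>)" for a and u :: "(real ^ 'd \<Rightarrow> complex) \<Rightarrow> complex"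
    by (simp add: Bargmann_def fun_eq_iff)
  have inj: "u = (\<lambda>f. 0)" if u: "u \<in> GS_dual (1/2)" and z: "Bargmann u = (\<lambda>\<zeta>. 0)" for u :: "(real ^ 'd \<Rightarrow> complex) \<Rightarrow> complex"
  proof -
    have "u (gexp w) = 0" for w
    proof -
      have "of_real (sqrt 2) *s (of_real (1 / sqrt 2) *s w) = w" by (simp add: vec_eq_iff)
      then show ?thesis using fun_cong[OF z, of "of_real (1 / sqrt 2) *s w"] by (simp add: Bargmann_def)
    qed
    then show ?thesis using GS_dual_eq_zero[OF u] by (simp add: fun_eq_iff)
  qed
  have N: "M_norm \<omega> B u = B_norm \<omega> B (Bargmann u)" if "u \<in> GS_dual (1/2)" for u
    by (simp add: M_norm_def B_norm_def stft_eq_B_transform[OF that])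
  note I = entire_isometry_space[OF B w zero_less_one C complex_function_space_GS_dual add cmult entire_Bargmann inj Bargmann_surj[OF B \<omega>] N]
  show "complex_function_space (M_space \<omega> B)" unfolding M_space_def by (rule I(1))
  show "quasi_norm_on (mixed_const B) (M_space \<omega> B) (M_norm \<omega> B)" unfolding M_space_def by (rule I(2))
  show "complete_wrt (M_space \<omega> B) (M_norm \<omega> B)" unfolding M_space_def by (rule I(3))
qed

theorem theorem5p4:
  fixes \<omega>1 \<omega>2 :: "'d::finite phase_space \<Rightarrow> real"
    and B :: "'d phase_space mixed_space"
  assumes "\<omega>1 \<in> P_Q0" and "\<omega>2 \<in> P_Q" and "mixed_quasi_norm_space B"
  shows "(quasi_Banach_space (M_space \<omega>1 B) (M_norm \<omega>1 B) \<and>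
          quasi_Banach_space (A_space \<omega>2 B) (B_norm \<omega>2 B)) \<and>
         (nu1 B \<ge> 1 \<longrightarrow>
          Banach_space (M_space \<omega>1 B) (M_norm \<omega>1 B) \<and>
          Banach_space (A_space \<omega>2 B) (B_norm \<omega>2 B))"
  unfolding quasi_Banach_space_def Banach_space_def
  using A_space_complete[OF assms(3,2)] M_space_complete[OF assms(3,1)] mixed_const_ge_1[of B] mixed_const_eq_1[of B]
  by auto

end
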